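(* Let $V$ be an irreducible Harish-Chandra module over the loop-Virasoro algebra $\mathcal{L}=\mathrm{Vir}\otimes\mathbb{C}[t^{\pm1}]$. Then $V$ is either a highest weight module, a lowest weight module, or a module of the intermediate series.
   Context: The Virasoro algebra $\mathrm{Vir}$ is the complex Lie algebra with basis $\{c,d_i : i\in\mathbb{Z}\}$ and brackets $[d_m,d_n]=(n-m)d_{m+n}+\delta_{m,-n}\frac{m^3-m}{12}c$, $[d_m,c]=0$. The loop-Virasoro algebra is $\mathcal{L}=\mathrm{Vir}\otimes\mathbb{C}[t^{\pm1}]$ with brackets $[d_i\otimes t^j,d_k\otimes t^l]=(k-i)\,d_{i+k}\otimes t^{j+l}+\delta_{i+k,0}\frac{i^3-i}{12}\,c\otimes t^{j+l}$, and with $c\otimes t^l$ central. Write $d_i=d_i\otimes 1$. Let $\mathcal{L}_i=(\mathbb{C}d_i\oplus\delta_{i,0}\mathbb{C}c)\otimes\mathbb{C}[t^{\pm1}]$, $\mathcal{L}_+=\bigoplus_{i>0}\mathcal{L}_i$, $\mathcal{L}_-=\bigoplus_{i<0}\mathcal{L}_i$; then $\mathcal{L}=\mathcal{L}_-\oplus\mathcal{L}_0\oplus\mathcal{L}_+$. For a module $V$ and $\lambda\in\mathbb{C}$, the weight space is $V_\lambda=\{v\in V: d_0v=\lambda v\}$. $V$ is a weight module if it is the sum of its weight spaces; a Harish-Chandra module is a weight module all of whose weight spaces are finite-dimensional. A module of the intermediate series is an indecomposable weight module all of whose (nonzero) weight spaces are $1$-dimensional. For a linear map $\varphi:\mathcal{L}_0\to\mathbb{C}$,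 let $\mathbb{C}v_0$ be the one-dimensional $(\mathcal{L}_0+\mathcal{L}_+)$-module with $\mathcal{L}_+v_0=0$ and $xv_0=\varphi(x)v_0$ for $x\in\mathcal{L}_0$; let $\bar V(\varphi)=U(\mathcal{L})\otimes_{U(\mathcal{L}_0+\mathcal{L}_+)}\mathbb{C}v_0$ and let $V(\varphi)$ be the quotient of $\bar V(\varphi)$ by its unique maximal proper submodule. An irreducible module is a highest weight module if it is isomorphic to some $V(\varphi)$; lowest weight modules are defined analogously, with $\mathcal{L}_-$ in place of $\mathcal{L}_+$. *)

theory Defs
  imports Complex_Main "HOL-Library.Poly_Mapping"
begin

text \<open>
  The complex vector space with basis \<open>'a\<close> is \<^typ>\<open>'a \<Rightarrow>\<^sub>0 complex\<close>; a basis vector is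
  \<^term>\<open>Poly_Mapping.single a (1::complex)\<close>.
\<close>

definition cscale :: "complex \<Rightarrow> ('a \<Rightarrow>\<^sub>0 complex) \<Rightarrow> ('a \<Rightarrow>\<^sub>0 complex)" where
  "cscale c p = Poly_Mapping.map ((*) c) p"

lemma lookup_cscale: "Poly_Mapping.lookup (cscale c p) a = c * Poly_Mapping.lookup p a"
  by (simp add: cscale_def Poly_Mapping.map.rep_eq when_def)

global_interpretation free_vs: vector_space cscale
  defines free_span = free_vs.span
  by unfold_locales
    (rule poly_mapping_eqI, simp add: lookup_cscale lookup_add algebra_simps)+

lemma cscale_single: "cscale c (Poly_Mapping.single a d) = Poly_Mapping.single a (c * d)"
  by (rule poly_mapping_eqI) (simp add: lookup_cscale lookup_single when_def)

definition lin_ext :: "('a \<Rightarrow> 'b \<Rightarrow>\<^sub>0 complex) \<Rightarrow> ('a \<Rightarrow>\<^sub>0 complex) \<Rightarrow> ('b \<Rightarrow>\<^sub>0 complex)" where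
  "lin_ext g p = (\<Sum>a\<in>Poly_Mapping.keys p. cscale (Poly_Mapping.lookup p a) (g a))"

lemma lin_ext_superset:
  assumes "finite A" "Poly_Mapping.keys p \<subseteq> A"
  shows "lin_ext g p = (\<Sum>a\<in>A. cscale (Poly_Mapping.lookup p a) (g a))"
  unfolding lin_ext_def using assms
  by (intro sum.mono_neutral_left) (auto simp: in_keys_iff)

lemma lin_ext_add: "lin_ext g (p + q) = lin_ext g p + lin_ext g q"
proof -
  let ?A = "Poly_Mapping.keys p \<union> Poly_Mapping.keys q"
  have "lin_ext g (p + q) = (\<Sum>a\<in>?A. cscale (Poly_Mapping.lookup (p + q) a) (g a))"
    by (rule lin_ext_superset) (auto simp: keys_add)
  also have "\<dots> = (\<Sum>a\<in>?A. cscale (Poly_Mapping.lookup p a) (g a)) +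
      (\<Sum>a\<in>?A. cscale (Poly_Mapping.lookup q a) (g a))"
    by (simp add: lookup_add free_vs.scale_left_distrib sum.distrib)
  also have "\<dots> = lin_ext g p + lin_ext g q"
    by (simp add: lin_ext_superset[symmetric])
  finally show ?thesis .
qed

lemma lin_ext_cscale: "lin_ext g (cscale c p) = cscale c (lin_ext g p)"
proof -
  have "lin_ext g (cscale c p) =
      (\<Sum>a\<in>Poly_Mapping.keys p. cscale (Poly_Mapping.lookup (cscale c p) a) (g a))"
    by (rule lin_ext_superset) (auto simp: in_keys_iff lookup_cscale)
  then show ?thesis
    by (simp add: lin_ext_def lookup_cscale free_vs.scale_sum_right)
qed

lemma lin_ext_single: "lin_ext g (Poly_Mapping.single a c) = cscale c (g a)"
  by (subst lin_ext_superset[of "{a}"]) auto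

datatype vir_basis = Vir_d int | Vir_c

text \<open>
  The basis index \<open>(Vir_d i, j)\<close> stands for \<open>d\<^sub>i \<otimes> t\<^sup>j\<close>, and \<open>(Vir_c, j)\<close> for \<open>c \<otimes> t\<^sup>j\<close>.
\<close>

type_synonym loop_vir = "(vir_basis \<times> int) \<Rightarrow>\<^sub>0 complex"

definition dt :: "int \<Rightarrow> int \<Rightarrow> loop_vir" where
  "dt i j = Poly_Mapping.single (Vir_d i, j) 1"

definition ct :: "int \<Rightarrow> loop_vir" where
  "ct j = Poly_Mapping.single (Vir_c, j) 1"

fun basis_bracket :: "vir_basis \<times> int \<Rightarrow> vir_basis \<times> int \<Rightarrow> loop_vir" where
  "basis_bracket (Vir_d i, j) (Vir_d k, l) =
     cscale (of_int (k - i)) (dt (i + k) (j + l)) +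
     (if i + k = 0 then cscale (of_int (i ^ 3 - i) / 12) (ct (j + l)) else 0)"
| "basis_bracket (Vir_c, j) b = 0"
| "basis_bracket a (Vir_c, l) = 0"

definition lbracket :: "loop_vir \<Rightarrow> loop_vir \<Rightarrow> loop_vir" where
  "lbracket x y = lin_ext (\<lambda>a. lin_ext (basis_bracket a) y) x"

definition graded_part :: "int \<Rightarrow> loop_vir set" where
  "graded_part i = free_span (range (dt i) \<union> (if i = 0 then range ct else {}))"

definition loop_vir_pos :: "loop_vir set" where
  "loop_vir_pos = free_span (\<Union>i\<in>{0<..}. graded_part i)"

definition loop_vir_neg :: "loop_vir set" where
  "loop_vir_neg = free_span (\<Union>i\<in>{..<0}. graded_part i)"

lemma lbracket_basis:
  "lbracket (Poly_Mapping.single a 1) (Poly_Mapping.single b 1) = basis_bracket a b"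
  by (simp add: lbracket_def lin_ext_single)

lemma lbracket_linear:
  "lbracket (x + x') y = lbracket x y + lbracket x' y"
  "lbracket x (y + y') = lbracket x y + lbracket x y'"
  "lbracket (cscale c x) y = cscale c (lbracket x y)"
  "lbracket x (cscale c y) = cscale c (lbracket x y)"
  by (simp_all add: lbracket_def lin_ext_add lin_ext_cscale)
     (simp_all add: lin_ext_def free_vs.scale_right_distrib sum.distrib free_vs.scale_sum_right
        mult.commute mult.left_commute)

text \<open>
  Concatenation of words is written additively, so that the multiplication of
  \<^theory>\<open>HOL-Library.Poly_Mapping\<close> on \<open>'a word \<Rightarrow>\<^sub>0 complex\<close> is that of the tensor algebra of the
  vector space with basis \<open>'a\<close>.
\<close>

datatype 'a word = Word (letters: "'a list")

instantiation word :: (type) monoid_add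
begin

definition "0 = Word []"

definition "u + v = Word (letters u @ letters v)"

instance
  by standard (simp_all add: zero_word_def plus_word_def)

end

type_synonym loop_vir_tensor = "(vir_basis \<times> int) word \<Rightarrow>\<^sub>0 complex"

definition tensor_of :: "loop_vir \<Rightarrow> loop_vir_tensor" where
  "tensor_of = lin_ext (\<lambda>b. Poly_Mapping.single (Word [b]) 1)"

definition env_ideal :: "loop_vir_tensor set" where
  "env_ideal = free_span
     {a * (tensor_of x * tensor_of y - tensor_of y * tensor_of x - tensor_of (lbracket x y)) * b
       | a b x y. True}"

lemma sum_single_keys: "p = (\<Sum>a\<in>Poly_Mapping.keys p. Poly_Mapping.single a (Poly_Mapping.lookup p a))"
proof (rule poly_mapping_eqI)
  fix k
  show "Poly_Mapping.lookup p k = Poly_Mapping.lookup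
      (\<Sum>a\<in>Poly_Mapping.keys p. Poly_Mapping.single a (Poly_Mapping.lookup p a)) k"
    by (simp add: lookup_sum lookup_single when_def in_keys_iff)
qed

lemma cscale_conv_mult:
  fixes p :: "'a::monoid_add \<Rightarrow>\<^sub>0 complex"
  shows "cscale c p = Poly_Mapping.single 0 c * p"
    and "cscale c p = p * Poly_Mapping.single 0 c"
proof -
  let ?s = "\<lambda>a. Poly_Mapping.single a (Poly_Mapping.lookup p a)"
  have "cscale c (\<Sum>a\<in>Poly_Mapping.keys p. ?s a) =
      Poly_Mapping.single 0 c * (\<Sum>a\<in>Poly_Mapping.keys p. ?s a)"
    by (simp add: free_vs.scale_sum_right sum_distrib_left cscale_single mult_single)
  then show "cscale c p = Poly_Mapping.single 0 c * p"
    by (simp only: sum_single_keys[of p, symmetric])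
  have "cscale c (\<Sum>a\<in>Poly_Mapping.keys p. ?s a) =
      (\<Sum>a\<in>Poly_Mapping.keys p. ?s a) * Poly_Mapping.single 0 c"
    by (simp add: free_vs.scale_sum_right sum_distrib_right cscale_single mult_single mult.commute)
  then show "cscale c p = p * Poly_Mapping.single 0 c"
    by (simp only: sum_single_keys[of p, symmetric])
qed

lemma cscale_mult_left:
  fixes p q :: "'a::monoid_add \<Rightarrow>\<^sub>0 complex"
  shows "cscale c p * q = cscale c (p * q)"
  by (simp add: cscale_conv_mult(1) mult.assoc)

lemma cscale_mult_right:
  fixes p q :: "'a::monoid_add \<Rightarrow>\<^sub>0 complex"
  shows "p * cscale c q = cscale c (p * q)"
  by (simp add: cscale_conv_mult(2) mult.assoc)

lemma env_ideal_mult_left: "p * z \<in> env_ideal" if "z \<in> env_ideal"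
  using that unfolding env_ideal_def
proof (induction z rule: free_vs.span_induct_alt)
  case base
  then show ?case by (simp add: free_vs.span_zero)
next
  case (step c z z')
  then obtain a b x y where z: "z = a * (tensor_of x * tensor_of y - tensor_of y * tensor_of x
      - tensor_of (lbracket x y)) * b" by blast
  have "p * z = (p * a) * (tensor_of x * tensor_of y - tensor_of y * tensor_of x
      - tensor_of (lbracket x y)) * b"
    by (simp add: z mult.assoc)
  then have "p * z \<in> {a * (tensor_of x * tensor_of y - tensor_of y * tensor_of x
      - tensor_of (lbracket x y)) * b | a b x y. True}" by blast
  then show ?case
    using step(2)
    by (simp add: distrib_left cscale_mult_right free_vs.span_add free_vs.span_scale
        free_vs.span_base)
qed

lemma env_ideal_mult_right: "z * p \<in> env_ideal" if "z \<in> env_ideal"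
  using that unfolding env_ideal_def
proof (induction z rule: free_vs.span_induct_alt)
  case base
  then show ?case by (simp add: free_vs.span_zero)
next
  case (step c z z')
  then obtain a b x y where z: "z = a * (tensor_of x * tensor_of y - tensor_of y * tensor_of x
      - tensor_of (lbracket x y)) * b" by blast
  have "z * p = a * (tensor_of x * tensor_of y - tensor_of y * tensor_of x
      - tensor_of (lbracket x y)) * (b * p)"
    by (simp add: z mult.assoc)
  then have "z * p \<in> {a * (tensor_of x * tensor_of y - tensor_of y * tensor_of x
      - tensor_of (lbracket x y)) * b | a b x y. True}" by blast
  then show ?case
    using step(2)
    by (simp add: distrib_right cscale_mult_left free_vs.span_add free_vs.span_scale
        free_vs.span_base)
qed

lemma env_ideal_closed:
  "0 \<in> env_ideal"
  "p \<in> env_ideal \<Longrightarrow> q \<in> env_ideal \<Longrightarrow> p + q \<in> env_ideal"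
  "p \<in> env_ideal \<Longrightarrow> q \<in> env_ideal \<Longrightarrow> p - q \<in> env_ideal"
  "p \<in> env_ideal \<Longrightarrow> - p \<in> env_ideal"
  "p \<in> env_ideal \<Longrightarrow> cscale c p \<in> env_ideal"
  unfolding env_ideal_def
  by (simp_all add: free_vs.span_zero free_vs.span_add free_vs.span_diff free_vs.span_neg
      free_vs.span_scale)

lemma lookup_zero_word_mult:
  fixes p q :: "'a word \<Rightarrow>\<^sub>0 complex"
  shows "Poly_Mapping.lookup (p * q) 0 = Poly_Mapping.lookup p 0 * Poly_Mapping.lookup q 0"
proof -
  let ?s = "\<lambda>p a. Poly_Mapping.single a (Poly_Mapping.lookup p a)"
  let ?p = "\<Sum>a\<in>Poly_Mapping.keys p. ?s p a" and ?q = "\<Sum>b\<in>Poly_Mapping.keys q. ?s q b"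
  have zero: "a + b = 0 \<longleftrightarrow> a = 0 \<and> b = 0" for a b :: "'a word"
    by (cases a; cases b) (simp add: zero_word_def plus_word_def)
  have "Poly_Mapping.lookup (?p * ?q) 0 =
      (\<Sum>a\<in>Poly_Mapping.keys p. \<Sum>b\<in>Poly_Mapping.keys q.
        Poly_Mapping.lookup (?s p a) 0 * Poly_Mapping.lookup (?s q b) 0)"
    by (simp add: sum_product lookup_sum mult_single lookup_single when_def zero)
       (intro sum.cong refl, auto)
  also have "\<dots> = Poly_Mapping.lookup ?p 0 * Poly_Mapping.lookup ?q 0"
    by (simp only: lookup_sum sum_product)
  finally show ?thesis
    by (simp only: sum_single_keys[symmetric])
qed

lemma lookup_zero_env_ideal:
  assumes "z \<in> env_ideal"
  shows "Poly_Mapping.lookup z 0 = 0"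
proof -
  have *: "Poly_Mapping.lookup (tensor_of x) 0 = 0" for x
    by (simp add: tensor_of_def lin_ext_def lookup_sum lookup_cscale lookup_single zero_word_def)
  show ?thesis
    using assms unfolding env_ideal_def
    by (induction z rule: free_vs.span_induct_alt)
       (auto simp: lookup_add lookup_cscale lookup_minus lookup_zero_word_mult *)
qed

quotient_type env_alg = loop_vir_tensor / "\<lambda>p q. p - q \<in> env_ideal"
proof (rule equivpI)
  show "reflp (\<lambda>p q. p - q \<in> env_ideal)"
    by (simp add: reflp_def env_ideal_closed(1))
  show "symp (\<lambda>p q. p - q \<in> env_ideal)"
  proof (rule sympI)
    fix p q assume "p - q \<in> env_ideal"
    then have "- (p - q) \<in> env_ideal" by (rule env_ideal_closed(4))
    then show "q - p \<in> env_ideal" by simp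
  qed
  show "transp (\<lambda>p q. p - q \<in> env_ideal)"
  proof (rule transpI)
    fix p q r assume "p - q \<in> env_ideal" "q - r \<in> env_ideal"
    then have "(p - q) + (q - r) \<in> env_ideal" by (rule env_ideal_closed(2))
    then show "p - r \<in> env_ideal" by simp
  qed
qed

instantiation env_alg :: ring_1
begin

lift_definition zero_env_alg :: env_alg is 0 .

lift_definition one_env_alg :: env_alg is 1 .

lift_definition plus_env_alg :: "env_alg \<Rightarrow> env_alg \<Rightarrow> env_alg" is "(+)"
proof -
  fix p p' q q' :: loop_vir_tensor
  assume "p - p' \<in> env_ideal" "q - q' \<in> env_ideal"
  then have "(p - p') + (q - q') \<in> env_ideal" by (rule env_ideal_closed(2))
  then show "(p + q) - (p' + q') \<in> env_ideal" by (simp add: algebra_simps)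
qed

lift_definition minus_env_alg :: "env_alg \<Rightarrow> env_alg \<Rightarrow> env_alg" is "(-)"
proof -
  fix p p' q q' :: loop_vir_tensor
  assume "p - p' \<in> env_ideal" "q - q' \<in> env_ideal"
  then have "(p - p') - (q - q') \<in> env_ideal" by (rule env_ideal_closed(3))
  then show "(p - q) - (p' - q') \<in> env_ideal" by (simp add: algebra_simps)
qed

lift_definition uminus_env_alg :: "env_alg \<Rightarrow> env_alg" is uminus
proof -
  fix p p' :: loop_vir_tensor
  assume "p - p' \<in> env_ideal"
  then have "- (p - p') \<in> env_ideal" by (rule env_ideal_closed(4))
  then show "- p - - p' \<in> env_ideal" by simp
qed

lift_definition times_env_alg :: "env_alg \<Rightarrow> env_alg \<Rightarrow> env_alg" is "(*)"
proof -
  fix p p' q q' :: loop_vir_tensor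
  assume "p - p' \<in> env_ideal" "q - q' \<in> env_ideal"
  then have "(p - p') * q + p' * (q - q') \<in> env_ideal"
    by (intro env_ideal_closed(2) env_ideal_mult_left env_ideal_mult_right)
  then show "p * q - p' * q' \<in> env_ideal" by (simp add: algebra_simps)
qed

instance
proof
  fix a b c :: env_alg
  show "a * b * c = a * (b * c)" by transfer (simp add: mult.assoc env_ideal_closed)
  show "a + b + c = a + (b + c)" by transfer (simp add: add.assoc env_ideal_closed)
  show "a + b = b + a" by transfer (simp add: add.commute env_ideal_closed)
  show "0 + a = a" by transfer (simp add: env_ideal_closed)
  show "- a + a = 0" by transfer (simp add: env_ideal_closed)
  show "a - b = a + - b" by transfer (simp add: env_ideal_closed)
  show "(a + b) * c = a * c + b * c" by transfer (simp add: distrib_right env_ideal_closed)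
  show "a * (b + c) = a * b + a * c" by transfer (simp add: distrib_left env_ideal_closed)
  show "1 * a = a" by transfer (simp add: env_ideal_closed)
  show "a * 1 = a" by transfer (simp add: env_ideal_closed)
  show "(0::env_alg) \<noteq> 1"
    by transfer (use lookup_zero_env_ideal[of "0 - 1"] in \<open>auto simp: lookup_one\<close>)
qed

end

lift_definition env_scale :: "complex \<Rightarrow> env_alg \<Rightarrow> env_alg" is cscale
  by (simp add: env_ideal_closed(5) flip: free_vs.scale_right_diff_distrib)

lift_definition env_of :: "loop_vir \<Rightarrow> env_alg" is tensor_of .

record 'v lmod =
  carrier :: "'v set"
  add :: "'v \<Rightarrow> 'v \<Rightarrow> 'v"
  zero :: 'v
  smult :: "complex \<Rightarrow> 'v \<Rightarrow> 'v"
  act :: "loop_vir \<Rightarrow> 'v \<Rightarrow> 'v"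

definition is_submodule :: "'v lmod \<Rightarrow> 'v set \<Rightarrow> bool" where
  "is_submodule M N \<longleftrightarrow> N \<subseteq> carrier M \<and> zero M \<in> N \<and>
     (\<forall>u\<in>N. \<forall>v\<in>N. add M u v \<in> N) \<and>
     (\<forall>a. \<forall>v\<in>N. smult M a v \<in> N) \<and>
     (\<forall>x. \<forall>v\<in>N. act M x v \<in> N)"

definition irreducible_module :: "'v lmod \<Rightarrow> bool" where
  "irreducible_module M \<longleftrightarrow> carrier M \<noteq> {zero M} \<and>
     (\<forall>N. is_submodule M N \<longrightarrow> N = {zero M} \<or> N = carrier M)"

definition indecomposable_module :: "'v lmod \<Rightarrow> bool" where
  "indecomposable_module M \<longleftrightarrow> carrier M \<noteq> {zero M} \<and>
     (\<forall>N N'. is_submodule M N \<and> is_submodule M N' \<and> N \<inter> N' = {zero M} \<and>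
        {add M u v | u v. u \<in> N \<and> v \<in> N'} = carrier M \<longrightarrow> N = {zero M} \<or> N' = {zero M})"

definition maximal_proper_submodule :: "'v lmod \<Rightarrow> 'v set \<Rightarrow> bool" where
  "maximal_proper_submodule M N \<longleftrightarrow> is_submodule M N \<and> N \<noteq> carrier M \<and>
     (\<forall>N'. is_submodule M N' \<and> N \<subseteq> N' \<longrightarrow> N' = N \<or> N' = carrier M)"

text \<open>
  The operations on cosets are taken elementwise; adding \<open>N\<close> once more makes the result a full
  coset, for instance in \<open>0 \<cdot> (v + N)\<close>.
\<close>

definition coset :: "'v lmod \<Rightarrow> 'v set \<Rightarrow> 'v \<Rightarrow> 'v set" where
  "coset M N v = {add M v n | n. n \<in> N}"

definition quotient_module :: "'v lmod \<Rightarrow> 'v set \<Rightarrow> 'v set lmod" where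
  "quotient_module M N =
     \<lparr>carrier = coset M N ` carrier M,
      add = (\<lambda>A B. {add M a b | a b. a \<in> A \<and> b \<in> B}),
      zero = N,
      smult = (\<lambda>c A. \<Union>a\<in>A. coset M N (smult M c a)),
      act = (\<lambda>x A. \<Union>a\<in>A. coset M N (act M x a))\<rparr>"

definition isomorphic :: "'v lmod \<Rightarrow> 'w lmod \<Rightarrow> bool" where
  "isomorphic M M' \<longleftrightarrow> (\<exists>f. bij_betw f (carrier M) (carrier M') \<and>
     (\<forall>u\<in>carrier M. \<forall>v\<in>carrier M. f (add M u v) = add M' (f u) (f v)) \<and>
     (\<forall>a. \<forall>v\<in>carrier M. f (smult M a v) = smult M' a (f v)) \<and>
     (\<forall>x. \<forall>v\<in>carrier M. f (act M x v) = act M' x (f v)))"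

locale loop_vir_module = vector_space scale
  for scale :: "complex \<Rightarrow> 'v::ab_group_add \<Rightarrow> 'v" +
  fixes action :: "loop_vir \<Rightarrow> 'v \<Rightarrow> 'v"
  assumes action_add_left: "action (x + y) v = action x v + action y v"
    and action_scale_left: "action (cscale a x) v = scale a (action x v)"
    and action_add_right: "action x (v + w) = action x v + action x w"
    and action_scale_right: "action x (scale a v) = scale a (action x v)"
    and action_lbracket: "action (lbracket x y) v = action x (action y v) - action y (action x v)"
begin

definition as_lmod :: "'v lmod" where
  "as_lmod = \<lparr>carrier = UNIV, add = (+), zero = 0, smult = scale, act = action\<rparr>"

definition weight_space :: "complex \<Rightarrow> 'v set" where
  "weight_space \<mu> = {v. action (dt 0 0) v = scale \<mu> v}"

definition weight_module :: bool where
  "weight_module \<longleftrightarrow> span (\<Union>\<mu>. weight_space \<mu>) = UNIV"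

definition Harish_Chandra :: bool where
  "Harish_Chandra \<longleftrightarrow> weight_module \<and>
     (\<forall>\<mu>. \<exists>B. finite B \<and> span B = weight_space \<mu>)"

definition intermediate_series :: bool where
  "intermediate_series \<longleftrightarrow> indecomposable_module as_lmod \<and> weight_module \<and>
     (\<forall>\<mu>. weight_space \<mu> \<noteq> {0} \<longrightarrow> dim (weight_space \<mu>) = 1)"

end

text \<open>
  Let \<open>P\<close> be \<^const>\<open>loop_vir_pos\<close> (or \<^const>\<open>loop_vir_neg\<close>) and \<open>B = \<L>\<^sub>0 + P\<close>.  The balanced
  tensor product \<open>U(\<L>) \<otimes>\<^bsub>U(B)\<^esub> \<complex>v\<^sub>0\<close> is the free vector space on the pairs \<open>(u, z)\<close>, standing for
  \<open>u \<otimes> z v\<^sub>0\<close>, modulo \<open>tensor_relations P \<phi>\<close>.  As \<open>B\<close> generates \<open>U(B)\<close>, it is enough to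
  impose \<open>u b \<otimes> v = u \<otimes> b v\<close> for \<open>b \<in> B\<close>; here \<open>(h + n) v\<^sub>0 = \<phi>(h) v\<^sub>0\<close> for \<open>h \<in> \<L>\<^sub>0\<close>
  and \<open>n \<in> P\<close>.
\<close>

definition pure_tensor :: "env_alg \<Rightarrow> complex \<Rightarrow> (env_alg \<times> complex) \<Rightarrow>\<^sub>0 complex" where
  "pure_tensor u z = Poly_Mapping.single (u, z) 1"

definition tensor_relations ::
    "loop_vir set \<Rightarrow> (loop_vir \<Rightarrow> complex) \<Rightarrow> ((env_alg \<times> complex) \<Rightarrow>\<^sub>0 complex) set" where
  "tensor_relations P \<phi> = free_span
     ({pure_tensor (u + u') z - pure_tensor u z - pure_tensor u' z | u u' z. True} \<union>
      {pure_tensor u (z + z') - pure_tensor u z - pure_tensor u z' | u z z'. True} \<union>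
      {pure_tensor (env_scale a u) z - cscale a (pure_tensor u z) | a u z. True} \<union>
      {pure_tensor u (a * z) - cscale a (pure_tensor u z) | a u z. True} \<union>
      {pure_tensor (u * env_of (h + n)) z - pure_tensor u (\<phi> h * z)
        | u h n z. h \<in> graded_part 0 \<and> n \<in> P})"

text \<open>
  This is not itself an \<open>\<L>\<close>-module: \<open>act\<close> becomes linear in \<open>x\<close>, and compatible with the
  bracket, only modulo the tensor relations.
\<close>

definition free_tensor_module :: "((env_alg \<times> complex) \<Rightarrow>\<^sub>0 complex) lmod" where
  "free_tensor_module =
     \<lparr>carrier = UNIV, add = (+), zero = 0, smult = cscale,
      act = (\<lambda>x. lin_ext (\<lambda>(u, z). pure_tensor (env_of x * u) z))\<rparr>"

definition Verma :: "loop_vir set \<Rightarrow> (loop_vir \<Rightarrow> complex)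
    \<Rightarrow> ((env_alg \<times> complex) \<Rightarrow>\<^sub>0 complex) set lmod" where
  "Verma P \<phi> = quotient_module free_tensor_module (tensor_relations P \<phi>)"

definition Verma_simple_quotient :: "loop_vir set \<Rightarrow> (loop_vir \<Rightarrow> complex)
    \<Rightarrow> ((env_alg \<times> complex) \<Rightarrow>\<^sub>0 complex) set set lmod" where
  "Verma_simple_quotient P \<phi> =
     quotient_module (Verma P \<phi>) (THE N. maximal_proper_submodule (Verma P \<phi>) N)"

definition linear_on_degree_zero :: "(loop_vir \<Rightarrow> complex) \<Rightarrow> bool" where
  "linear_on_degree_zero \<phi> \<longleftrightarrow>
     (\<forall>x\<in>graded_part 0. \<forall>y\<in>graded_part 0. \<phi> (x + y) = \<phi> x + \<phi> y) \<and>
     (\<forall>a. \<forall>x\<in>graded_part 0. \<phi> (cscale a x) = a * \<phi> x)"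

definition highest_weight_module :: "'v lmod \<Rightarrow> bool" where
  "highest_weight_module M \<longleftrightarrow> irreducible_module M \<and>
     (\<exists>\<phi>. linear_on_degree_zero \<phi> \<and> isomorphic M (Verma_simple_quotient loop_vir_pos \<phi>))"

definition lowest_weight_module :: "'v lmod \<Rightarrow> bool" where
  "lowest_weight_module M \<longleftrightarrow> irreducible_module M \<and>
     (\<exists>\<phi>. linear_on_degree_zero \<phi> \<and> isomorphic M (Verma_simple_quotient loop_vir_neg \<phi>))"

end

theory Submission
  imports Defs "HOL-Computational_Algebra.Fundamental_Theorem_Algebra"
begin

text \<open>
  Choose \<open>\<lambda>\<close> with \<open>V\<^bsub>\<lambda>\<^esub> \<noteq> 0\<close>; by irreducibility all weights lie in \<open>\<lambda> + \<int>\<close>.  If the weights are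
  bounded above or below, then \<open>\<L>\<^sub>0\<close> acts on the extreme weight space by commuting operators, and
  a common eigenvector identifies \<open>V\<close> with \<open>V(\<phi>)\<close>.

  Otherwise no nonzero vector is killed by all \<open>d\<^sub>n \<otimes> f\<close> with \<open>n\<close> large.  This forces the set
  \<open>I\<close> of all \<open>f\<close> with \<open>d\<^sub>n \<otimes> f\<close> acting as 0 for every \<open>n\<close> to be a nonzero ideal of
  \<open>\<complex>[t\<^sup>\<plusminus>]\<close>, whence the weight multiplicities are bounded.  The ideal \<open>I\<close> contains \<open>f\<close> once it
  contains \<open>f\<^sup>2\<close>, and one of two complementary idempotents modulo \<open>I\<close>, so it is maximal: \<open>V\<close> is
  a module over the Virasoro algebra on which \<open>t\<close> acts by a scalar.  For large weights \<open>\<kappa>\<close> the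
  operator \<open>d\<^sub>1\<close> is bijective; using it to identify the weight spaces, \<open>d\<^bsub>-1\<^esub>\<close> and \<open>d\<^bsub>-2\<^esub>\<close> become
  polynomials in \<open>\<kappa>\<close> with matrix coefficients, and \<open>d\<^sub>2\<close> is a solution of a linear system over the
  polynomials, hence a rational function of \<open>\<kappa>\<close>.  The leftmost root of its minimal denominator
  yields a common eigenvector of the coefficient matrices, which spans a string of vectors \<open>w\<^sub>k\<close> with
  \<open>d\<^sub>n w\<^sub>k = (\<lambda> + k + n b) w\<^bsub>k+n\<^esub>\<close> for \<open>k\<close> large.  The vectors \<open>d\<^bsub>-m\<^esub> w\<^bsub>k+m\<^esub>\<close> with \<open>m\<close> varying are
  proportional for fixed \<open>k\<close>, and they span \<open>V\<close>.
\<close>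

section \<open>Linear algebra over the complex numbers\<close>

text \<open>The obstacle is that V is not known to be irreducible over Vir until t acts by a scalar.
  The common engine before that point is the factor j - i in [d_i \<otimes> f, d_j \<otimes> g]: a
  vector killed in two consecutive positive degrees (by d_m alone, or by all d_m \<otimes> f) is
  killed in all large ones. Afterwards V is governed by d_1, d_2, d_(-1), d_(-2), which generate
  Vir. In coordinates where d_1 is the identity matrix, [d_1, d_(-1)] = -2 d_0 is a difference
  equation in the weight with quadratic solutions, and d_(-2) follows as a cubic. For d_2 only the
  relations with d_(-1) and d_(-2) remain; one of them at two consecutive weights and the other at
  one weight determine it, since polynomial solutions of the homogeneous system fail already in
  their two leading coefficients. At a leftmost pole of d_2 the terms with shifted argument are
  regular, so the leading polar coefficient is killed by d_(-1) and d_(-2). This happens at the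
  weight 1 - b, which is how the parameter b appears.\<close>

locale complex_vs = vector_space scale
  for scale :: "complex \<Rightarrow> 'b::ab_group_add \<Rightarrow> 'b"
begin

text \<open>A bound rather than a value: \<open>dim\<close> is 0 when there is no finite basis,
  whereas this predicate implies finite-dimensionality. It is meaningful for arbitrary sets, such as
  unions of weight spaces.\<close>

definition dim_le :: "nat \<Rightarrow> 'b set \<Rightarrow> bool" where
  "dim_le n U \<longleftrightarrow> (\<exists>B. finite B \<and> card B \<le> n \<and> U \<subseteq> span B)"

lemma dim_le_mono: "dim_le n U \<Longrightarrow> n \<le> m \<Longrightarrow> W \<subseteq> U \<Longrightarrow> dim_le m W"
  unfolding dim_le_def by (meson order_trans)

lemma dim_le_basis:
  assumes "dim_le n U"
  obtains B where "B \<subseteq> U" "independent B" "U \<subseteq> span B" "finite B" "card B \<le> n"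
proof -
  obtain F where F: "finite F" "card F \<le> n" "U \<subseteq> span F"
    using assms unfolding dim_le_def by blast
  obtain B where B: "B \<subseteq> U" "independent B" "U \<subseteq> span B"
    using basis_exists[of U] by metis
  have "finite B \<and> card B \<le> card F"
    using independent_span_bound[OF F(1) B(2)] B(1) F(3) by blast
  then show thesis using that B F(2) by auto
qed

text \<open>Independence of an indexed family, expressed by coefficients so that repetitions are
  excluded too: if v i = v j, the coefficients 1 and -1 form a relation.\<close>

lemma card_le_of_lin_indep:
  assumes "finite I" "\<And>c. (\<Sum>i\<in>I. scale (c i) (v i)) = 0 \<Longrightarrow> \<forall>i\<in>I. c i = 0"
    and "v ` I \<subseteq> span F" "finite F"
  shows "card I \<le> card F"
proof -
  have inj: "inj_on v I"
  proof (rule inj_onI, rule ccontr)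
    fix i j assume ij: "i \<in> I" "j \<in> I" "v i = v j" "i \<noteq> j"
    let ?c = "\<lambda>k. if k = i then 1 else if k = j then - 1 else 0"
    have "(\<Sum>k\<in>I. scale (?c k) (v k)) = (\<Sum>k\<in>{i, j}. scale (?c k) (v k))"
      by (rule sum.mono_neutral_right) (use assms(1) ij in auto)
    also have "\<dots> = 0" using ij by simp
    finally show False using assms(2)[of ?c] ij by auto
  qed
  have "independent (v ` I)"
    unfolding independent_explicit_finite_subsets
  proof (intro allI impI ballI)
    fix S u w assume S: "S \<subseteq> v ` I" "finite S" "(\<Sum>v\<in>S. scale (u v) v) = 0" "w \<in> S"
    let ?c = "\<lambda>i. if v i \<in> S then u (v i) else 0"
    have "(\<Sum>i\<in>I. scale (?c i) (v i)) = (\<Sum>x\<in>v ` I. scale (if x \<in> S then u x else 0) x)"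
      by (simp add: sum.reindex[OF inj])
    also have "\<dots> = (\<Sum>x\<in>S. scale (if x \<in> S then u x else 0) x)"
      by (rule sum.mono_neutral_right) (use assms(1) S in auto)
    also have "\<dots> = 0" using S(3) by simp
    finally have "\<forall>i\<in>I. ?c i = 0" by (rule assms(2))
    moreover obtain i where "i \<in> I" "w = v i" using S by blast
    ultimately show "u w = 0" using S(4) by auto
  qed
  then have "card (v ` I) \<le> card F"
    using independent_span_bound assms(3,4) by blast
  then show ?thesis by (simp add: card_image[OF inj])
qed

text \<open>The operator T - e j removes the summand v j and multiplies each other v i by the
  nonzero factor e i - e j, so induction on S applies.\<close>

lemma eigenvectors_sum_zero:
  assumes T: "Vector_Spaces.linear scale scale T" and "finite S" and "inj_on e S"
    and "\<And>i. i \<in> S \<Longrightarrow> T (v i) = scale (e i) (v i)" "(\<Sum>i\<in>S. v i) = 0"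
  shows "\<forall>i\<in>S. v i = 0"
  using assms(2-)
proof (induction S arbitrary: v rule: finite_induct)
  case (insert j S)
  interpret T: Vector_Spaces.linear scale scale T by fact
  have "0 = T (\<Sum>i\<in>insert j S. v i) - scale (e j) (\<Sum>i\<in>insert j S. v i)"
    using insert.prems(3) by (simp add: T.zero)
  also have "\<dots> = (\<Sum>i\<in>insert j S. scale (e i - e j) (v i))"
    unfolding T.sum scale_sum_right sum_subtractf[symmetric]
    by (intro sum.cong) (auto simp: insert.prems(2) scale_left_diff_distrib)
  also have "\<dots> = (\<Sum>i\<in>S. scale (e i - e j) (v i))"
    using insert.hyps by simp
  finally have "\<forall>i\<in>S. scale (e i - e j) (v i) = 0"
    using insert.prems(1) by (intro insert.IH) (auto simp: insert.prems(2) T.scale scale_left_commute)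
  then have *: "\<forall>i\<in>S. v i = 0" using insert.hyps insert.prems(1) by (auto simp: inj_on_def)
  then have "(\<Sum>i\<in>S. v i) = 0" by (simp add: sum.neutral)
  then have "v j = 0" using insert.prems(3) insert.hyps by simp
  then show ?case using * by simp
qed simp

lemma finite_eigenvalues:
  assumes T: "Vector_Spaces.linear scale scale T" and U: "dim_le n U"
  shows "finite {a. \<exists>v\<in>U. v \<noteq> 0 \<and> T v = scale a v}" (is "finite ?E")
proof (rule ccontr)
  interpret T: Vector_Spaces.linear scale scale T by fact
  assume "infinite ?E"
  then obtain S where S: "S \<subseteq> ?E" "finite S" "card S = Suc n"
    by (meson infinite_arbitrarily_large)
  obtain F where F: "finite F" "card F \<le> n" "U \<subseteq> span F" using U unfolding dim_le_def by blast
  have "\<forall>a\<in>S. \<exists>v. v \<in> U \<and> v \<noteq> 0 \<and> T v = scale a v" using S by blast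
  then obtain v where v: "\<And>a. a \<in> S \<Longrightarrow> v a \<in> U \<and> v a \<noteq> 0 \<and> T (v a) = scale a (v a)" by metis
  have "card S \<le> card F"
  proof (rule card_le_of_lin_indep[of S v])
    fix c assume "(\<Sum>a\<in>S. scale (c a) (v a)) = 0"
    then have "\<forall>a\<in>S. scale (c a) (v a) = 0"
      by (intro eigenvectors_sum_zero[OF T S(2), of "\<lambda>a. a"]) (auto simp: T.scale v scale_left_commute)
    then show "\<forall>a\<in>S. c a = 0" using v by auto
  qed (use S v F in auto)
  then show False using S F by simp
qed

lemma linear_funpow:
  assumes "Vector_Spaces.linear scale scale W"
  shows "Vector_Spaces.linear scale scale (W ^^ i)"
proof (induction i)
  case 0
  show ?case using linear_ident by (simp add: id_def)
next
  case (Suc i)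
  then show ?case using Vector_Spaces.linear_compose[OF Suc assms] by (simp add: comp_def)
qed

text \<open>If m is the least exponent with W^m u = 0, then u, ..., W^(m-1) u are independent in U,
  so m \<le> n. The exponent depends only on the dimension bound, which later gives one exponent for
  all weight spaces.\<close>

lemma nilpotent_bound:
  assumes W: "Vector_Spaces.linear scale scale W" and U: "dim_le n U"
    and inv: "\<And>u. u \<in> U \<Longrightarrow> W u \<in> U" and u: "u \<in> U" and nil: "(W ^^ j) u = 0"
  shows "(W ^^ n) u = 0"
proof (rule ccontr)
  interpret W: Vector_Spaces.linear scale scale W by fact
  have pow: "Vector_Spaces.linear scale scale (W ^^ i)" for i
    by (rule linear_funpow) (rule W)
  assume n: "(W ^^ n) u \<noteq> 0"
  define m where "m = (LEAST j. (W ^^ j) u = 0)"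
  have m0: "(W ^^ m) u = 0" unfolding m_def by (rule LeastI) (rule nil)
  have mlt: "(W ^^ i) u \<noteq> 0" if "i < m" for i using not_less_Least that unfolding m_def by blast
  have z: "(W ^^ i) u = 0" if "i \<ge> m" for i
  proof -
    have *: "(W ^^ i) u = (W ^^ (i - m)) ((W ^^ m) u)" using that by (metis comp_apply funpow_add le_add_diff_inverse2)
    interpret P: Vector_Spaces.linear scale scale "W ^^ (i - m)" by (rule pow)
    show ?thesis using * m0 by (simp add: P.zero)
  qed
  have nm: "n < m" using n z by (meson not_le)
  obtain F where F: "finite F" "card F \<le> n" "U \<subseteq> span F" using U unfolding dim_le_def by blast
  have inU: "(W ^^ i) u \<in> U" for i by (induction i) (auto simp: u inv)
  have "card {..<m} \<le> card F"
  proof (rule card_le_of_lin_indep[of _ "\<lambda>i. (W ^^ i) u"])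
    fix c assume c: "(\<Sum>i<m. scale (c i) ((W ^^ i) u)) = 0"
    show "\<forall>i\<in>{..<m}. c i = 0"
    proof (rule ccontr)
      assume "\<not> ?thesis"
      then have ex: "\<exists>i. i < m \<and> c i \<noteq> 0" by auto
      define k where "k = (LEAST i. i < m \<and> c i \<noteq> 0)"
      have k: "k < m" "c k \<noteq> 0" using LeastI_ex[OF ex] unfolding k_def by auto
      have kl: "c i = 0" if "i < k" for i using not_less_Least[of i "\<lambda>i. i < m \<and> c i \<noteq> 0"] that k unfolding k_def by auto
      \<comment> \<open>With k the first index of a nonzero coefficient, this power maps the term k
        to W^(m-1) u and all later terms to 0.\<close>
      interpret P: Vector_Spaces.linear scale scale "W ^^ (m - 1 - k)" by (rule pow)
      have "0 = (W ^^ (m - 1 - k)) (\<Sum>i<m. scale (c i) ((W ^^ i) u))" unfolding c by (rule P.zero[symmetric])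
      also have "\<dots> = (\<Sum>i<m. scale (c i) ((W ^^ (m - 1 - k + i)) u))"
        by (simp only: P.sum P.scale funpow_add comp_apply)
      also have "\<dots> = (\<Sum>i\<in>{k}. scale (c i) ((W ^^ (m - 1 - k + i)) u))"
      proof (rule sum.mono_neutral_right)
        show "\<forall>i\<in>{..<m} - {k}. scale (c i) ((W ^^ (m - 1 - k + i)) u) = 0"
        proof
          fix i assume i: "i \<in> {..<m} - {k}"
          show "scale (c i) ((W ^^ (m - 1 - k + i)) u) = 0"
          proof (cases "i < k")
            case True then show ?thesis by (simp add: kl)
          next
            case False
            then have "m - 1 - k + i \<ge> m" using i k by auto
            then show ?thesis by (simp add: z)
          qed
        qed
      qed (use k in auto)
      finally have "scale (c k) ((W ^^ (m - 1)) u) = 0" using k by simp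
      then show False using mlt[of "m - 1"] k by auto
    qed
  qed (use inU F in auto)
  then show False using F nm by simp
qed

end

text \<open>S consists of preimages of a basis of the image; together with the kernel of f it spans
  U.\<close>

lemma linear_split_kernel:
  assumes f: "Vector_Spaces.linear s1 s2 f" and U: "module.subspace s1 U"
    and d: "complex_vs.dim_le s2 n (f ` U)"
  obtains S where "S \<subseteq> U" "finite S" "card S \<le> n"
    "\<And>u. u \<in> U \<Longrightarrow> \<exists>s\<in>module.span s1 S. f u = f s"
proof -
  interpret f: Vector_Spaces.linear s1 s2 f by fact
  interpret s2: complex_vs s2 ..
  obtain B where B: "B \<subseteq> f ` U" "f.vs2.independent B" "f ` U \<subseteq> f.vs2.span B" "finite B" "card B \<le> n"
    using s2.dim_le_basis[OF d] .
  define g where "g b = (SOME u. u \<in> U \<and> f u = b)" for b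
  have g: "g b \<in> U" "f (g b) = b" if "b \<in> B" for b
  proof -
    have "\<exists>u. u \<in> U \<and> f u = b" using that B(1) by blast
    then show "g b \<in> U" "f (g b) = b" unfolding g_def by (metis (mono_tags, lifting) someI_ex)+
  qed
  show thesis
  proof
    show "g ` B \<subseteq> U" "finite (g ` B)" "card (g ` B) \<le> n"
      using g B card_image_le[OF B(4), of g] by auto
    fix u assume "u \<in> U"
    have "f ` (g ` B) = B" using g by (force simp: image_image)
    then have "f ` f.vs1.span (g ` B) = f.vs2.span B" by (metis f.span_image)
    then show "\<exists>s\<in>f.vs1.span (g ` B). f u = f s" using B(3) \<open>u \<in> U\<close> by (metis image_subset_iff imageE)
  qed
qed

text \<open>Serves two purposes: bounding weight multiplicities, and, by contraposition on the
  infinite-dimensional space of Laurent polynomials, finding a nonzero f killed by finitely many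
  maps of finite rank. The induction restricts to the kernel of the first map and adds preimages of
  its image.\<close>

lemma dim_le_joint_kernel:
  assumes vs: "vector_space s1" "module.subspace s1 U"
    and fs: "\<And>f. f \<in> set fs \<Longrightarrow> Vector_Spaces.linear s1 s2 f \<and> complex_vs.dim_le s2 n (f ` U)"
    and z: "\<And>u. u \<in> U \<Longrightarrow> \<forall>f\<in>set fs. f u = 0 \<Longrightarrow> u = 0"
  shows "complex_vs.dim_le s1 (length fs * n) U"
  using assms(2-)
proof (induction fs arbitrary: U)
  case Nil
  interpret v: complex_vs s1 using vs(1) by (simp add: complex_vs_def)
  have "U \<subseteq> v.span {}" using Nil.prems(3) by auto
  then show ?case unfolding v.dim_le_def by (intro exI[of _ "{}"]) simp
next
  case (Cons f fs)
  interpret v: complex_vs s1 using vs(1) by (simp add: complex_vs_def)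
  interpret f: Vector_Spaces.linear s1 s2 f using Cons.prems(2) by auto
  interpret s2: complex_vs s2 ..
  let ?W = "U \<inter> {u. f u = 0}"
  have W: "v.subspace ?W" using f.subspace_kernel Cons.prems(1) by (simp add: v.subspace_inter)
  have "v.dim_le (length fs * n) ?W"
  proof (rule Cons.IH[OF W])
    fix g assume "g \<in> set fs"
    then show "Vector_Spaces.linear s1 s2 g \<and> s2.dim_le n (g ` ?W)"
      using Cons.prems(2)[of g] s2.dim_le_mono[of n "g ` U" n "g ` ?W"] by auto
  qed (use Cons.prems(3) in auto)
  then obtain B where B: "finite B" "card B \<le> length fs * n" "?W \<subseteq> v.span B"
    unfolding v.dim_le_def by blast
  obtain S where S: "S \<subseteq> U" "finite S" "card S \<le> n"
    "\<And>u. u \<in> U \<Longrightarrow> \<exists>s\<in>v.span S. f u = f s"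
    using linear_split_kernel[of s1 s2 f U n] Cons.prems(1,2) by auto
  have "U \<subseteq> v.span (B \<union> S)"
  proof
    fix u assume u: "u \<in> U"
    then obtain s where s: "s \<in> v.span S" "f u = f s" using S(4) by blast
    have "v.span S \<subseteq> U" using S(1) Cons.prems(1) by (simp add: v.span_minimal)
    then have "u - s \<in> ?W" using s u Cons.prems(1) by (auto simp: f.diff v.subspace_diff)
    then have "u - s \<in> v.span (B \<union> S)" using B(3) v.span_mono[of B "B \<union> S"] by blast
    moreover have "s \<in> v.span (B \<union> S)" using s v.span_mono[of S "B \<union> S"] by blast
    ultimately have "u - s + s \<in> v.span (B \<union> S)" by (rule v.span_add)
    then show "u \<in> v.span (B \<union> S)" by simp
  qed
  moreover have "card (B \<union> S) \<le> length (f # fs) * n"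
    using card_Un_le[of B S] B S by simp
  ultimately show ?case unfolding v.dim_le_def using B S by blast
qed


section \<open>Eigenvectors of one operator and of commuting families\<close>

context complex_vs
begin

definition poly_op :: "('b \<Rightarrow> 'b) \<Rightarrow> complex poly \<Rightarrow> 'b \<Rightarrow> 'b" where
  "poly_op T p v = (\<Sum>i\<le>degree p. scale (coeff p i) ((T ^^ i) v))"

lemma poly_op_bound:
  assumes "degree p \<le> n"
  shows "poly_op T p v = (\<Sum>i\<le>n. scale (coeff p i) ((T ^^ i) v))"
  unfolding poly_op_def
  by (rule sum.mono_neutral_left) (use assms in \<open>auto simp: coeff_eq_0\<close>)

lemma poly_op_linear_factor:
  assumes T: "Vector_Spaces.linear scale scale T"
  shows "poly_op T ([:- a, 1:] * q) v = T (poly_op T q v) - scale a (poly_op T q v)"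
proof -
  interpret T: Vector_Spaces.linear scale scale T by fact
  let ?n = "degree q"
  have d: "degree ([:- a, 1:] * q) \<le> Suc ?n"
    by (rule order_trans[OF degree_mult_le]) simp
  have c: "[:- a, 1:] * q = pCons 0 q - Polynomial.smult a q" by simp
  have "poly_op T ([:- a, 1:] * q) v = (\<Sum>i\<le>Suc ?n. scale (coeff (pCons 0 q) i) ((T ^^ i) v))
      - (\<Sum>i\<le>Suc ?n. scale (a * coeff q i) ((T ^^ i) v))"
    unfolding c poly_op_bound[OF d[unfolded c]]
    by (simp only: coeff_diff coeff_smult scale_left_diff_distrib sum_subtractf)
  also have "(\<Sum>i\<le>Suc ?n. scale (coeff (pCons 0 q) i) ((T ^^ i) v)) = T (poly_op T q v)"
    unfolding sum.atMost_Suc_shift poly_op_def by (simp add: T.sum T.scale)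
  also have "(\<Sum>i\<le>Suc ?n. scale (a * coeff q i) ((T ^^ i) v)) = scale a (poly_op T q v)"
    by (simp add: poly_op_bound[of q "Suc ?n"] scale_sum_right scale_right_distrib del: sum.atMost_Suc)
  finally show ?thesis .
qed

text \<open>The n + 1 vectors v, T v, ..., T^n v are dependent, which gives p \<noteq> 0 with p(T) v
  = 0. Linear factors are split off one by one; the last vector before 0 is an eigenvector.\<close>

lemma eigenvector_exists:
  assumes T: "Vector_Spaces.linear scale scale T" and U: "dim_le n U" "subspace U"
    and inv: "\<And>u. u \<in> U \<Longrightarrow> T u \<in> U" and v: "v \<in> U" "v \<noteq> 0"
  obtains a w where "w \<in> U" "w \<noteq> 0" "T w = scale a w"
proof -
  obtain F where F: "finite F" "card F \<le> n" "U \<subseteq> span F" using U unfolding dim_le_def by blast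
  have inU: "(T ^^ i) v \<in> U" for i by (induction i) (auto simp: v inv)
  have inU': "poly_op T p v \<in> U" for p
    unfolding poly_op_def by (intro subspace_sum[OF U(2)] subspace_scale[OF U(2)] inU)
  have "\<not> (\<forall>c. (\<Sum>i\<le>n. scale (c i) ((T ^^ i) v)) = 0 \<longrightarrow> (\<forall>i\<in>{..n}. c i = 0))"
  proof
    assume "\<forall>c. (\<Sum>i\<le>n. scale (c i) ((T ^^ i) v)) = 0 \<longrightarrow> (\<forall>i\<in>{..n}. c i = 0)"
    then have "card {..n} \<le> card F"
      by (intro card_le_of_lin_indep[of _ "\<lambda>i. (T ^^ i) v"]) (use inU F in auto)
    then show False using F by simp
  qed
  then obtain c k where c: "(\<Sum>i\<le>n. scale (c i) ((T ^^ i) v)) = 0" "k \<le> n" "c k \<noteq> 0" by auto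
  define p where "p = (\<Sum>i\<le>n. monom (c i) i)"
  have cp: "coeff p i = (if i \<le> n then c i else 0)" for i
    by (simp add: p_def coeff_sum coeff_monom)
  have dp: "degree p \<le> n" by (rule degree_le) (simp add: cp)
  have "p \<noteq> 0" using cp[of k] c by auto
  moreover have "poly_op T p v = 0" by (simp add: poly_op_bound[OF dp] cp c(1))
  ultimately show thesis
  proof (induction p rule: measure_induct_rule[of degree])
    case (less p)
    show thesis
    proof (cases "degree p = 0")
      case True
      then obtain b where "p = [:b:]" by (rule degree_eq_zeroE)
      then show thesis using less.prems v by (simp add: poly_op_def)
    next
      case False
      then obtain a where "poly p a = 0"
        using fundamental_theorem_of_algebra[of p] by (auto simp: constant_degree)
      then obtain q where q: "p = [:- a, 1:] * q" by (auto simp: poly_eq_0_iff_dvd elim: dvdE)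
      have q0: "q \<noteq> 0" using less.prems q by auto
      then have dq: "degree q < degree p" unfolding q by (subst degree_mult_eq) auto
      show thesis
      proof (cases "poly_op T q v = 0")
        case True
        then show thesis using less.IH[OF dq q0] by blast
      next
        case False
        have "T (poly_op T q v) = scale a (poly_op T q v)"
          using less.prems(2) unfolding q poly_op_linear_factor[OF T] by simp
        then show thesis using that inU' False by blast
      qed
    qed
  qed
qed

text \<open>The family may be infinite, so it is not exhausted one operator at a time. An invariant
  subspace W with least dimension bound is taken; an eigenspace of t inside W is invariant because
  the family commutes, hence equals W.\<close>

lemma common_eigenvector:
  assumes T: "\<And>t. t \<in> \<T> \<Longrightarrow> Vector_Spaces.linear scale scale t"
    and comm: "\<And>t s u. t \<in> \<T> \<Longrightarrow> s \<in> \<T> \<Longrightarrow> u \<in> U \<Longrightarrow> t (s u) = s (t u)"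
    and inv: "\<And>t u. t \<in> \<T> \<Longrightarrow> u \<in> U \<Longrightarrow> t u \<in> U"
    and U: "dim_le n U" "subspace U" and v: "v \<in> U" "v \<noteq> 0"
  obtains w where "w \<in> U" "w \<noteq> 0" "\<And>t. t \<in> \<T> \<Longrightarrow> \<exists>a. t w = scale a w"
proof -
  define Q where "Q m W \<longleftrightarrow> dim_le m W \<and> subspace W \<and> W \<subseteq> U \<and> W \<noteq> {0} \<and> (\<forall>t\<in>\<T>. \<forall>u\<in>W. t u \<in> W)"
    for m W
  have ex: "\<exists>m W. Q m W" using U v inv unfolding Q_def by (metis order_refl singletonD)
  define m where "m = (LEAST m. \<exists>W. Q m W)"
  obtain W where W: "Q m W" using LeastI_ex[OF ex] unfolding m_def by blast
  have least: "m \<le> m'" if "Q m' W'" for m' W' unfolding m_def by (rule Least_le) (use that in blast)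
  have sW: "subspace W" "dim_le m W" "W \<subseteq> U" using W unfolding Q_def by auto
  have "0 \<in> W" using sW(1) by (rule subspace_0)
  then obtain w where w: "w \<in> W" "w \<noteq> 0" using W unfolding Q_def by blast
  have "\<exists>a. \<forall>u\<in>W. t u = scale a u" if t: "t \<in> \<T>" for t
  proof -
    interpret t: Vector_Spaces.linear scale scale t by (rule T[OF t])
    obtain a x where x: "x \<in> W" "x \<noteq> 0" "t x = scale a x"
      using eigenvector_exists[OF T[OF t] sW(2,1) _ w] W t unfolding Q_def by metis
    let ?K = "W \<inter> {u. t u = scale a u}"
    have sK: "subspace ?K"
      using sW(1) by (auto simp: subspace_def t.zero t.add t.scale scale_right_distrib scale_left_commute)
    have K: "s u \<in> ?K" if "s \<in> \<T>" "u \<in> ?K" for s u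
    proof -
      interpret s: Vector_Spaces.linear scale scale s by (rule T[OF that(1)])
      have "t (s u) = s (t u)" using comm[OF t that(1)] that(2) sW by auto
      then show ?thesis using W that unfolding Q_def by (auto simp: s.scale)
    qed
    obtain B where B: "B \<subseteq> ?K" "independent B" "?K \<subseteq> span B" "finite B" "card B \<le> m"
      using dim_le_basis[OF dim_le_mono[OF sW(2) order_refl, of ?K]] by blast
    have "Q (card B) ?K"
      using sK K B x sW unfolding Q_def dim_le_def by blast
    then have mB: "card B = m" using least B(5) by (metis order_antisym)
    have "W \<subseteq> span B"
    proof
      fix y assume y: "y \<in> W"
      show "y \<in> span B"
      proof (rule ccontr)
        assume n: "y \<notin> span B"
        then have i: "independent (insert y B)" using B(2) by (simp add: independent_insertI)
        obtain F where F: "finite F" "card F \<le> m" "W \<subseteq> span F" using sW unfolding dim_le_def by blast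
        have "card (insert y B) \<le> card F"
          using independent_span_bound[OF F(1) i] B(1) y F(3) by blast
        moreover have "y \<notin> B" using n span_base by blast
        ultimately show False using B(4) mB F by simp
      qed
    qed
    also have "span B \<subseteq> ?K" using B(1) sK by (rule span_minimal)
    finally show ?thesis by blast
  qed
  then show thesis using that w sW by (metis subsetD)
qed

end

section \<open>Laurent polynomials and the loop algebra\<close>

text \<open>Fraction-free Gaussian elimination over an integral domain. For matrices of polynomials,
  g becomes a common denominator of the solution of the linear system.\<close>

lemma left_inverse_up_to_scalar:
  fixes a :: "'r \<Rightarrow> 'c \<Rightarrow> 'a::idom"
  assumes "finite R" "finite J"
    and "\<And>y. \<forall>r\<in>R. (\<Sum>j\<in>J. a r j * y j) = 0 \<Longrightarrow> \<forall>j\<in>J. y j = 0"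
  shows "\<exists>g c. g \<noteq> 0 \<and> (\<forall>i\<in>J. \<forall>j\<in>J. (\<Sum>r\<in>R. c i r * a r j) = (if i = j then g else 0))"
  using assms(2,3)
proof (induction J arbitrary: a rule: finite_induct)
  case empty
  then show ?case by (intro exI[of _ 1]) auto
next
  case (insert x J)
  have "\<exists>r0\<in>R. a r0 x \<noteq> 0"
  proof (rule ccontr)
    assume "\<not> ?thesis"
    then have "\<forall>r\<in>R. (\<Sum>j\<in>insert x J. a r j * (if j = x then 1 else 0)) = 0"
      using insert.hyps by (auto intro!: sum.neutral)
    then show False using insert.prems[of "\<lambda>j. if j = x then 1 else 0"] by simp
  qed
  then obtain r0 where r0: "r0 \<in> R" "a r0 x \<noteq> 0" by blast
  \<comment> \<open>The pivot in column x; \<open>a'\<close> below is the matrix after clearing this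
    column with row \<open>r0\<close>.\<close>
  define p where "p = a r0 x"
  define a' where "a' r j = p * a r j - a r x * a r0 j" for r j
  have "\<exists>g c. g \<noteq> 0 \<and> (\<forall>i\<in>J. \<forall>j\<in>J. (\<Sum>r\<in>R. c i r * a' r j) = (if i = j then g else 0))"
  proof (rule insert.IH)
    fix y assume y: "\<forall>r\<in>R. (\<Sum>j\<in>J. a' r j * y j) = 0"
    \<comment> \<open>The entry at x makes row \<open>r0\<close> vanish; scaling the other entries
      by p avoids a division.\<close>
    define y' where "y' j = (if j = x then - (\<Sum>j\<in>J. a r0 j * y j) else p * y j)" for j
    have "\<forall>r\<in>R. (\<Sum>j\<in>insert x J. a r j * y' j) = 0"
    proof
      fix r assume r: "r \<in> R"
      have "(\<Sum>j\<in>J. a r j * y' j) = (\<Sum>j\<in>J. a r j * (p * y j))"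
        using insert.hyps by (intro sum.cong) (auto simp: y'_def)
      then have "(\<Sum>j\<in>insert x J. a r j * y' j) = (\<Sum>j\<in>J. a' r j * y j)"
        using insert.hyps
        by (simp add: y'_def a'_def algebra_simps sum_subtractf sum_distrib_left)
      then show "(\<Sum>j\<in>insert x J. a r j * y' j) = 0" using y r by simp
    qed
    then have "\<forall>j\<in>insert x J. y' j = 0" by (rule insert.prems)
    then show "\<forall>j\<in>J. y j = 0" using insert.hyps r0 by (auto simp: y'_def p_def split: if_splits)
  qed
  then obtain g c where g: "g \<noteq> 0"
    and c: "\<And>i j. i \<in> J \<Longrightarrow> j \<in> J \<Longrightarrow> (\<Sum>r\<in>R. c i r * a' r j) = (if i = j then g else 0)"
    by blast
  \<comment> \<open>The rows d are the rows c rewritten for the original matrix: they reproduce the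
    products with \<open>a'\<close> and annihilate column x.\<close>
  define s where "s i = (\<Sum>r\<in>R. c i r * a r x)" for i
  define d where "d i r = p * c i r - (if r = r0 then s i else 0)" for i r
  have d_sum: "(\<Sum>r\<in>R. d i r * a r j) = p * (\<Sum>r\<in>R. c i r * a r j) - s i * a r0 j" for i j
    using assms(1) r0(1)
    by (simp add: d_def left_diff_distrib sum_subtractf sum_distrib_left mult.assoc if_distrib[of "\<lambda>z. z * _"] sum.delta cong: if_cong)
  have d1: "(\<Sum>r\<in>R. d i r * a r j) = (if i = j then g else 0)" if "i \<in> J" "j \<in> J" for i j
  proof -
    have "(\<Sum>r\<in>R. c i r * a' r j) = p * (\<Sum>r\<in>R. c i r * a r j) - s i * a r0 j"
      by (simp add: a'_def s_def right_diff_distrib sum_subtractf sum_distrib_left sum_distrib_right algebra_simps)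
    then show ?thesis using c[OF that] d_sum by simp
  qed
  have d2: "(\<Sum>r\<in>R. d i r * a r x) = 0" for i
    unfolding d_sum s_def[symmetric] by (simp add: p_def mult.commute)
  \<comment> \<open>Row x is g times the unit row at \<open>r0\<close>, corrected by the rows d so
    that the columns in J cancel; p * g remains in column x.\<close>
  define e where "e i r = (if i = x then (if r = r0 then g else 0) - (\<Sum>j\<in>J. a r0 j * d j r) else p * d i r)" for i r
  have ex: "(\<Sum>r\<in>R. e x r * a r l) = g * a r0 l - (\<Sum>j\<in>J. a r0 j * (\<Sum>r\<in>R. d j r * a r l))" for l
  proof -
    have "(\<Sum>r\<in>R. e x r * a r l) = (\<Sum>r\<in>R. (if r = r0 then g else 0) * a r l) - (\<Sum>r\<in>R. \<Sum>j\<in>J. a r0 j * d j r * a r l)"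
      by (simp add: e_def left_diff_distrib sum_subtractf sum_distrib_right)
    also have "(\<Sum>r\<in>R. (if r = r0 then g else 0) * a r l) = g * a r0 l"
      using assms(1) r0(1) by (simp add: if_distrib[of "\<lambda>z. z * _"] sum.delta cong: if_cong)
    also have "(\<Sum>r\<in>R. \<Sum>j\<in>J. a r0 j * d j r * a r l) = (\<Sum>j\<in>J. a r0 j * (\<Sum>r\<in>R. d j r * a r l))"
      by (subst sum.swap) (simp add: sum_distrib_left mult.assoc)
    finally show ?thesis .
  qed
  have exJ: "(\<Sum>j\<in>J. a r0 j * (\<Sum>r\<in>R. d j r * a r l)) = a r0 l * g" if "l \<in> J" for l
    using that insert.hyps(1) by (simp add: d1 if_distrib[of "\<lambda>z. _ * z"] sum.delta cong: if_cong)
  have "(\<Sum>r\<in>R. e i r * a r j) = (if i = j then p * g else 0)"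
    if "i \<in> insert x J" "j \<in> insert x J" for i j
  proof (cases "i = x")
    case True
    then show ?thesis
      using that insert.hyps ex[of j] exJ[of j] by (cases "j = x") (auto simp: d2 p_def mult.commute[of g])
  next
    case False
    then have "(\<Sum>r\<in>R. e i r * a r j) = p * (\<Sum>r\<in>R. d i r * a r j)"
      by (simp add: e_def sum_distrib_left mult.assoc)
    then show ?thesis using that False d1 d2 by (cases "j = x") auto
  qed
  moreover have "p * g \<noteq> 0" using g r0 by (simp add: p_def)
  ultimately show ?case by blast
qed

section \<open>Laurent polynomials and brackets of the elements d_m \<otimes> f\<close>

type_synonym laurent = "int \<Rightarrow>\<^sub>0 complex"

abbreviation tpow :: "int \<Rightarrow> laurent" where
  "tpow j \<equiv> Poly_Mapping.single j 1"

lemma poly_mapping_sum_induct [case_names zero single add]: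
  fixes f :: "'a \<Rightarrow>\<^sub>0 complex"
  assumes "P 0" "\<And>a c. P (Poly_Mapping.single a c)" "\<And>f g. P f \<Longrightarrow> P g \<Longrightarrow> P (f + g)"
  shows "P f"
proof -
  have "P (\<Sum>a\<in>A. Poly_Mapping.single a (Poly_Mapping.lookup f a))" if "finite A" for A
    using that by (induction A rule: finite_induct) (auto intro: assms)
  then show ?thesis by (subst sum_single_keys) simp
qed

lemma lin_ext_0 [simp]: "lin_ext g 0 = 0"
  by (simp add: lin_ext_def)

lemma lbracket_0 [simp]: "lbracket 0 y = 0" "lbracket x 0 = 0"
  using lbracket_linear(3)[of 0 0 y] lbracket_linear(4)[of x 0 0]
  by (simp_all add: free_vs.scale_zero_left)

text \<open>Here \<open>lin_ext (dt m) f\<close> is d_m \<otimes> f. Whole Laurent polynomials as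
  second factors remove the sums over powers of t from all later brackets.\<close>

lemma lbracket_d_d:
  "lbracket (lin_ext (dt m) f) (lin_ext (dt n) g) =
     cscale (of_int (n - m)) (lin_ext (dt (m + n)) (f * g)) +
     (if m + n = 0 then cscale (of_int (m ^ 3 - m) / 12) (lin_ext ct (f * g)) else 0)"
proof (induction f rule: poly_mapping_sum_induct)
  case (single i c)
  show ?case
  proof (induction g rule: poly_mapping_sum_induct)
    case (single j d)
    have "lbracket (dt m i) (dt n j) = cscale (of_int (n - m)) (dt (m + n) (i + j)) +
       (if m + n = 0 then cscale (of_int (m ^ 3 - m) / 12) (ct (i + j)) else 0)"
      by (simp add: dt_def ct_def lbracket_basis)
    then show ?case
      by (simp add: lin_ext_single lbracket_linear mult_single free_vs.scale_right_distrib
          mult.commute mult.left_commute if_distrib[of "cscale _"] cong: if_cong)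
        (simp add: mult.assoc)
  next
    case (add f g)
    then show ?case
      by (cases "m + n = 0") (simp_all only: lin_ext_add lbracket_linear distrib_left
          free_vs.scale_right_distrib if_True if_False simp_thms add_0_left add_0_right add.assoc add.commute add.left_commute)
  qed simp
next
  case (add f f')
  then show ?case
    by (cases "m + n = 0") (simp_all only: lin_ext_add lbracket_linear distrib_right
        free_vs.scale_right_distrib if_True if_False simp_thms add_0_left add_0_right add.assoc add.commute add.left_commute)
qed simp

lemma lbracket_central [simp]:
  "lbracket (lin_ext ct f) y = 0" "lbracket y (lin_ext ct f) = 0"
proof -
  have *: "lbracket (ct j) (Poly_Mapping.single b c) = 0 \<and> lbracket (Poly_Mapping.single b c) (ct j) = 0" for j b c
  proof -
    have "basis_bracket (Vir_c, j) b = 0 \<and> basis_bracket b (Vir_c, j) = 0"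
      by (cases b; cases "fst b") auto
    then have "lbracket (ct j) (Poly_Mapping.single b 1) = 0 \<and> lbracket (Poly_Mapping.single b 1) (ct j) = 0"
      by (simp add: ct_def lbracket_basis)
    then show ?thesis
      using lbracket_linear(4)[of "ct j" c "Poly_Mapping.single b 1"] lbracket_linear(3)[of c "Poly_Mapping.single b 1" "ct j"]
      by (simp add: cscale_single)
  qed
  have **: "lbracket (ct j) y = 0 \<and> lbracket y (ct j) = 0" for j y
    by (induction y rule: poly_mapping_sum_induct) (simp_all add: * lbracket_linear)
  show "lbracket (lin_ext ct f) y = 0" "lbracket y (lin_ext ct f) = 0"
    by (induction f rule: poly_mapping_sum_induct) (simp_all add: lin_ext_add lin_ext_single lbracket_linear **)
qed

text \<open>The embedding of C[t] into C[t, 1/t]; degrees and linear factors are taken on the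
  polynomial side.\<close>

definition laurent_of_poly :: "complex poly \<Rightarrow> laurent" where
  "laurent_of_poly p = poly (map_poly (Poly_Mapping.single 0) p) (tpow 1)"

lemma laurent_of_poly_0 [simp]: "laurent_of_poly 0 = 0"
  by (simp add: laurent_of_poly_def)

lemma laurent_of_poly_pCons [simp]:
  "laurent_of_poly (pCons a p) = Poly_Mapping.single 0 a + tpow 1 * laurent_of_poly p"
  by (simp add: laurent_of_poly_def map_poly_pCons)

lemma laurent_of_poly_1 [simp]: "laurent_of_poly 1 = 1"
  by (simp add: one_pCons)

lemma laurent_of_poly_add: "laurent_of_poly (p + q) = laurent_of_poly p + laurent_of_poly q"
proof (induction p arbitrary: q)
  case (pCons a p)
  show ?case
    by (cases q) (simp add: pCons.IH single_add distrib_left)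
qed simp

lemma laurent_of_poly_smult: "laurent_of_poly (Polynomial.smult c q) = Poly_Mapping.single 0 c * laurent_of_poly q"
  by (induction q) (simp_all add: mult_single algebra_simps)

lemma laurent_of_poly_mult: "laurent_of_poly (p * q) = laurent_of_poly p * laurent_of_poly q"
  by (induction p) (simp_all add: laurent_of_poly_add laurent_of_poly_smult algebra_simps)

lemma laurent_of_poly_monom: "laurent_of_poly (monom c n) = Poly_Mapping.single (int n) c"
  by (induction n) (simp_all add: monom_0 monom_Suc mult_single)

text \<open>Powers of t are units, so a nonzero ideal of Laurent polynomials contains a nonzero
  polynomial.\<close>

lemma laurent_shift_poly: "\<exists>(j::nat) p. tpow (int j) * f = laurent_of_poly p"
proof (induction f rule: poly_mapping_sum_induct)
  case (single a c)
  have "tpow (int (nat (- a))) * Poly_Mapping.single a c = laurent_of_poly (monom c (nat (int (nat (- a)) + a)))"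
    by (simp add: mult_single laurent_of_poly_monom)
  then show ?case by blast
next
  case (add f g)
  then obtain i p j q where *: "tpow (int i) * f = laurent_of_poly p" "tpow (int j) * g = laurent_of_poly q"
    by blast
  have "tpow (int (i + j)) = tpow (int i) * tpow (int j)" by (simp add: mult_single)
  then have "tpow (int (i + j)) * (f + g) = tpow (int j) * (tpow (int i) * f) + tpow (int i) * (tpow (int j) * g)"
    by (simp only: distrib_left distrib_right ac_simps)
  then have "tpow (int (i + j)) * (f + g) = laurent_of_poly (monom 1 j * p + monom 1 i * q)"
    by (simp add: * laurent_of_poly_add laurent_of_poly_mult laurent_of_poly_monom)
  then show ?case by blast
qed (use laurent_of_poly_0 mult_zero_right in metis)

lemma cscale_conv_const: "cscale a f = Poly_Mapping.single 0 a * (f :: laurent)"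
  by (rule cscale_conv_mult)

lemma not_finite_span_laurent: "finite S \<Longrightarrow> free_vs.span S \<noteq> (UNIV :: laurent set)"
proof
  assume S: "finite S" "free_vs.span S = (UNIV :: laurent set)"
  let ?K = "\<Union>s\<in>S. Poly_Mapping.keys s"
  have "x \<in> free_vs.span S \<Longrightarrow> Poly_Mapping.keys x \<subseteq> ?K" for x :: laurent
  proof (induction rule: free_vs.span_induct_alt)
    case (step c x y)
    have "Poly_Mapping.keys (cscale c x) \<subseteq> Poly_Mapping.keys x" by (auto simp: in_keys_iff lookup_cscale)
    then show ?case using step keys_add[of "cscale c x" y] by blast
  qed simp
  moreover have "finite ?K" using S by simp
  then obtain j :: int where "j \<notin> ?K" using infinite_UNIV_int by (metis UNIV_eq_I)
  moreover have "tpow j \<in> free_vs.span S" using S(2) by simp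
  ultimately show False by fastforce
qed

section \<open>Weight modules and the vanishing of killed vectors\<close>

text \<open>\<open>D n f\<close> stands for d_n \<otimes> f and \<open>Z f\<close> for c \<otimes>
  f. As abstract operators they admit a second instance on the same space, with d_n replaced by
  -d_(-n), which turns statements about high weights into statements about low weights.\<close>

locale loop_vir_ops = complex_vs scale
  for scale :: "complex \<Rightarrow> 'v::ab_group_add \<Rightarrow> 'v" +
  fixes D :: "int \<Rightarrow> laurent \<Rightarrow> 'v \<Rightarrow> 'v" and Z :: "laurent \<Rightarrow> 'v \<Rightarrow> 'v"
  assumes D_linear: "Vector_Spaces.linear scale scale (D n f)"
    and Z_linear: "Vector_Spaces.linear scale scale (Z f)"
    and D_add: "D n (f + g) v = D n f v + D n g v"
    and D_cscale: "D n (cscale a f) v = scale a (D n f v)"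
    and D_bracket: "D m f (D n g v) - D n g (D m f v) =
      scale (of_int (n - m)) (D (m + n) (f * g) v) +
      (if m + n = 0 then scale (of_int (m ^ 3 - m) / 12) (Z (f * g) v) else 0)"
    and Z_D: "Z f (D n g v) = D n g (Z f v)"
    and Z_Z: "Z f (Z g v) = Z g (Z f v)"
begin

sublocale D: Vector_Spaces.linear scale scale "D n f" for n f by (rule D_linear)
sublocale Z: Vector_Spaces.linear scale scale "Z f" for f by (rule Z_linear)

lemmas D_simps [simp] = D.zero D.add D.diff D.scale D.neg Z.zero Z.add Z.diff Z.scale Z.neg

lemma D_0 [simp]: "D n 0 v = 0"
  using D_cscale[of n 0 0 v] by simp

lemma D_diff: "D n (f - g) v = D n f v - D n g v"
  using D_add[of n "f - g" g v] by simp

lemma D_const: "D n (Poly_Mapping.single 0 a * f) v = scale a (D n f v)"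
  using D_cscale[of n a f v] by (simp add: cscale_conv_const)

lemma D_lin_arg: "Vector_Spaces.linear cscale scale (\<lambda>f. D n f v)"
  unfolding Vector_Spaces.linear_iff
  using vector_space_axioms free_vs.vector_space_axioms by (simp add: D_add D_cscale)

lemma D_swap:
  "m + n \<noteq> 0 \<Longrightarrow> D m f (D n g v) = D n g (D m f v) + scale (of_int (n - m)) (D (m + n) (f * g) v)"
  using D_bracket[of m f n g v] by (simp add: algebra_simps)

text \<open>The central coefficient m^3 - m vanishes at m = 1. This bracket supplies degree 0, which
  brackets with d_0 \<otimes> f cannot produce.\<close>

lemma D_swap1:
  "D 1 f (D (-1) g v) = D (-1) g (D 1 f v) - scale 2 (D 0 (f * g) v)"
  using D_bracket[of 1 f "-1" g v] by (simp add: algebra_simps)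

lemma D_0_swap: "D 0 f (D n g v) = D n g (D 0 f v) + scale (of_int n) (D n (f * g) v)"
  using D_bracket[of 0 f n g v] by (simp add: algebra_simps)

definition kills_from :: "laurent set \<Rightarrow> int \<Rightarrow> 'v \<Rightarrow> bool" where
  "kills_from J M v \<longleftrightarrow> (\<forall>n\<ge>M. \<forall>f\<in>J. D n f v = 0)"

lemma kills_from_mono: "kills_from J M v \<Longrightarrow> M \<le> M' \<Longrightarrow> kills_from J M' v"
  by (auto simp: kills_from_def)

lemma kills_from_closed:
  "kills_from J M 0"
  "kills_from J M u \<Longrightarrow> kills_from J M v \<Longrightarrow> kills_from J M (u + v)"
  "kills_from J M v \<Longrightarrow> kills_from J M (scale a v)"
  by (auto simp: kills_from_def)

lemma subspace_kills_from: "subspace {v. kills_from J M v}"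
  by (auto simp: subspace_def kills_from_closed)

definition annihilator :: "laurent set" where
  "annihilator = {f. \<forall>n v. D n f v = 0}"

lemma annihilatorD: "f \<in> annihilator \<Longrightarrow> D n f v = 0"
  by (simp add: annihilator_def)

text \<open>Up to the factor n, d_n \<otimes> f g is the bracket of d_0 \<otimes> f with d_n
  \<otimes> g; in degree 0 it comes from the degrees 1 and -1.\<close>

lemma annihilator_mult:
  assumes "f \<in> annihilator" shows "f * g \<in> annihilator"
  unfolding annihilator_def
proof (intro CollectI allI)
  fix n v
  show "D n (f * g) v = 0"
  proof (cases "n = 0")
    case True
    then show ?thesis using D_swap1[of f g v] annihilatorD[OF assms] by simp
  next
    case False
    then show ?thesis using D_0_swap[of f n g v] annihilatorD[OF assms] by simp
  qed
qed

lemma annihilator_add: "f \<in> annihilator \<Longrightarrow> g \<in> annihilator \<Longrightarrow> f + g \<in> annihilator"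
  by (simp add: annihilator_def D_add)

lemma annihilator_diff: "f \<in> annihilator \<Longrightarrow> g \<in> annihilator \<Longrightarrow> f - g \<in> annihilator"
  by (simp add: annihilator_def D_diff)

end

text \<open>A subspace stable under all \<open>D n f\<close> is a submodule, since c \<otimes> f is
  a combination of products of these operators. Weights are indexed by their integer distance from
  \<open>lam\<close>.\<close>

locale irreducible_ops = loop_vir_ops scale D Z
  for scale :: "complex \<Rightarrow> 'v::ab_group_add \<Rightarrow> 'v" and D Z +
  fixes lam :: complex
  assumes irreducible: "subspace N \<Longrightarrow> (\<And>n f v. v \<in> N \<Longrightarrow> D n f v \<in> N) \<Longrightarrow> N = {0} \<or> N = UNIV"
    and finite_dim: "\<exists>n. dim_le n {v. D 0 1 v = scale (lam + of_int k) v}"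
    and weights_span: "span (\<Union>k. {v. D 0 1 v = scale (lam + of_int k) v}) = UNIV"
    and weight_0: "{v. D 0 1 v = scale lam v} \<noteq> {0}"
begin

definition wt :: "int \<Rightarrow> 'v set" where
  "wt k = {v. D 0 1 v = scale (lam + of_int k) v}"

lemma wtD: "v \<in> wt k \<Longrightarrow> D 0 1 v = scale (lam + of_int k) v"
  by (simp add: wt_def)

lemma subspace_wt: "subspace (wt k)"
  by (auto simp: subspace_def wt_def scale_right_distrib scale_left_commute)

lemma zero_in_wt [simp]: "0 \<in> wt k"
  using subspace_wt by (rule subspace_0)

lemma span_wt: "span (\<Union>k. wt k) = UNIV"
  using weights_span by (simp add: wt_def)

lemma dim_le_wt: "\<exists>n. dim_le n (wt k)"
  using finite_dim by (simp add: wt_def)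

lemma D_wt: "v \<in> wt k \<Longrightarrow> D n f v \<in> wt (k + n)"
  by (simp add: wt_def D_0_swap scale_left_distrib algebra_simps)

lemma Z_wt: "v \<in> wt k \<Longrightarrow> Z f v \<in> wt k"
  by (simp add: wt_def Z_D[symmetric])

lemma submodule_UNIV:
  assumes "subspace N" "\<And>n f v. v \<in> N \<Longrightarrow> D n f v \<in> N" "v \<in> N" "v \<noteq> 0"
  shows "N = UNIV"
  using irreducible[OF assms(1,2)] assms(3,4) by blast

text \<open>Eigenvectors of d_0 for distinct weights are independent, so the expansion of v along
  the S j reduces to its component in S k.\<close>

lemma graded_span_component:
  assumes S: "\<And>k. subspace (S k)" "\<And>k. S k \<subseteq> wt k"
    and v: "v \<in> wt k" "v \<in> span (\<Union>k. S k)"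
  shows "v \<in> S k"
proof -
  have "\<exists>F s. finite F \<and> (\<forall>j. s j \<in> S j) \<and> x = (\<Sum>j\<in>F. s j)" if "x \<in> span (\<Union>k. S k)" for x
    using that
  proof (induction rule: span_induct_alt)
    case base
    show ?case using S(1) subspace_0 by (intro exI[of _ "{}"] exI[of _ "\<lambda>_. 0"]) auto
  next
    case (step c x y)
    then obtain i F s where i: "x \<in> S i" and F: "finite F" "\<forall>j. s j \<in> S j" "y = (\<Sum>j\<in>F. s j)" by blast
    define s' where "s' j = (if j = i then (if i \<in> F then s i else 0) + scale c x else s j)" for j
    have "(\<Sum>j\<in>insert i F. s' j) = scale c x + y"
    proof (cases "i \<in> F")
      case True
      have "(\<Sum>j\<in>insert i F. s' j) = s' i + (\<Sum>j\<in>F - {i}. s' j)"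
        using F(1) by (simp add: sum.insert_remove)
      also have "(\<Sum>j\<in>F - {i}. s' j) = (\<Sum>j\<in>F - {i}. s j)" by (intro sum.cong) (auto simp: s'_def)
      also have "s' i + \<dots> = scale c x + (s i + (\<Sum>j\<in>F - {i}. s j))" using True by (simp add: s'_def)
      finally show ?thesis using F True by (simp add: sum.remove)
    next
      case False
      then have "(\<Sum>j\<in>F. s' j) = (\<Sum>j\<in>F. s j)" by (intro sum.cong) (auto simp: s'_def)
      then show ?thesis using False F by (simp add: s'_def)
    qed
    moreover have "\<forall>j. s' j \<in> S j"
      using F(2) i by (auto simp: s'_def intro!: subspace_add[OF S(1)] subspace_scale[OF S(1)] subspace_0[OF S(1)])
    ultimately show ?case using F(1) by (metis finite_insert)
  qed
  then obtain F s where F: "finite F" "\<And>j. s j \<in> S j" "v = (\<Sum>j\<in>F. s j)" using v(2) by blast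
  \<comment> \<open>Subtracting v in component k produces weight vectors of distinct weights with
    sum 0.\<close>
  define s' where "s' j = (if j = k then (if k \<in> F then s k else 0) - v else s j)" for j
  have s'wt: "s' j \<in> wt j" for j
    using F(2)[of j] S(2)[of j] v(1) by (auto simp: s'_def intro!: subspace_diff[OF subspace_wt] subspace_neg[OF subspace_wt])
  have s'k: "s' k = (if k \<in> F then s k else 0) - v" by (simp add: s'_def)
  have "(\<Sum>j\<in>insert k F. s' j) = s' k + (\<Sum>j\<in>F - {k}. s' j)"
    using F(1) by (simp add: sum.insert_remove)
  also have "(\<Sum>j\<in>F - {k}. s' j) = (\<Sum>j\<in>F - {k}. s j)" by (intro sum.cong) (auto simp: s'_def)
  also have "s' k + \<dots> = 0"
    using F by (cases "k \<in> F") (simp_all add: s'k sum.remove)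
  finally have "\<forall>j\<in>insert k F. s' j = 0"
    by (intro eigenvectors_sum_zero[OF D_linear, of _ "\<lambda>j. lam + of_int j" 0 1])
       (use F(1) wtD[OF s'wt] in \<open>auto simp: inj_on_def\<close>)
  then have "s' k = 0" by simp
  then have "v = (if k \<in> F then s k else 0)" by (simp add: s'_def)
  then show ?thesis using F(2) subspace_0[OF S(1)] by (metis (full_types))
qed

lemma graded_UNIV_component:
  assumes "\<And>k. subspace (S k)" "\<And>k. S k \<subseteq> wt k" "span (\<Union>k. S k) = UNIV"
  shows "S k = wt k"
  using graded_span_component[OF assms(1,2)] assms(2,3) by blast

definition unbounded_above :: bool where
  "unbounded_above \<longleftrightarrow> (\<forall>K. \<exists>k\<ge>K. wt k \<noteq> {0})"

text \<open>The vectors killed from some M on form a submodule: [d_m \<otimes> g, d_n \<otimes> f]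
  lies in degree m + n, and its second factor g * f is again in J.\<close>

lemma kills_from_submodule:
  assumes J: "\<And>f g. f \<in> J \<Longrightarrow> f * g \<in> J" and v: "kills_from J M v" "v \<noteq> 0"
  shows "\<exists>M. kills_from J M w"
proof -
  let ?N = "{v. \<exists>M. kills_from J M v}"
  have "?N = UNIV"
  proof (rule submodule_UNIV)
    show "subspace ?N"
    proof (rule subspaceI)
      fix x y assume "x \<in> ?N" "y \<in> ?N"
      then obtain M M' where "kills_from J M x" "kills_from J M' y" by blast
      then have "kills_from J (max M M') (x + y)"
        by (intro kills_from_closed(2)) (auto elim: kills_from_mono)
      then show "x + y \<in> ?N" by blast
    qed (use kills_from_closed in blast)+
    fix n f v assume "v \<in> ?N"
    then obtain M where M: "kills_from J M v" by blast
    \<comment> \<open>The bound keeps m and m + n at least M, and m + n positive, so that no central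
      term occurs.\<close>
    have "kills_from J (max 1 (M + \<bar>n\<bar>) + \<bar>n\<bar>) (D n f v)"
      unfolding kills_from_def
    proof (intro allI impI ballI)
      fix m g assume m: "m \<ge> max 1 (M + \<bar>n\<bar>) + \<bar>n\<bar>" and g: "g \<in> J"
      have "D m g v = 0" "D (m + n) (g * f) v = 0"
        using M m g J unfolding kills_from_def by auto
      moreover have "m + n \<noteq> 0" using m by auto
      ultimately show "D m g (D n f v) = 0" by (simp add: D_swap)
    qed
    then show "D n f v \<in> ?N" by blast
  qed (use v in auto)
  then show ?thesis by blast
qed

text \<open>
  By a PBW argument, \<open>V\<close> is generated over \<open>\<L>\<^sub>+\<close> by its part of nonpositive degree.  Since
  \<open>d\<^sub>1\<close> and \<open>d\<^sub>2\<close> generate \<open>\<L>\<^sub>+\<close>, one reaches the positive degrees through degree 0 or 1.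
\<close>

inductive_set up_closure :: "'v set" where
  base: "v \<in> wt k \<Longrightarrow> k \<le> 0 \<Longrightarrow> v \<in> up_closure"
| add: "u \<in> up_closure \<Longrightarrow> v \<in> up_closure \<Longrightarrow> u + v \<in> up_closure"
| scale: "v \<in> up_closure \<Longrightarrow> scale a v \<in> up_closure"
| D1: "v \<in> up_closure \<Longrightarrow> D 1 g v \<in> up_closure"
| D2: "v \<in> up_closure \<Longrightarrow> D 2 g v \<in> up_closure"

text \<open>The closure is a submodule: operators of degree at most 0 are moved past d_1 \<otimes> g
  and d_2 \<otimes> g, the brackets having their degree raised by 1 or 2, and the positive degrees
  are generated by degrees 1 and 2.\<close>

lemma up_closure_UNIV: "up_closure = UNIV"
proof -
  have z: "0 \<in> up_closure" using up_closure.base[of 0 0] by simp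
  have Zc: "Z f v \<in> up_closure" if "v \<in> up_closure" for f v
    using that by induction (auto intro: up_closure.intros Z_wt simp: Z_D)
  have nonpos: "D n f v \<in> up_closure" if "v \<in> up_closure" "n \<le> 0" for n f v
    using that
  proof (induction arbitrary: n f)
    case (base v k)
    then show ?case using D_wt[of v k n f] by (intro up_closure.base[of _ "k + n"]) auto
  next
    case (D1 v g)
    have 1: "D (n + 1) (f * g) v \<in> up_closure"
      using D1 by (cases "n = 0") (auto intro: up_closure.D1)
    have "D n f (D 1 g v) = D 1 g (D n f v) + (scale (of_int (1 - n)) (D (n + 1) (f * g) v) +
      (if n + 1 = 0 then scale (of_int (n ^ 3 - n) / 12) (Z (f * g) v) else 0))"
      using D_bracket[of n f 1 g v] by (simp add: algebra_simps)
    also have "\<dots> \<in> up_closure"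
      using D1 1 z Zc by (intro up_closure.add up_closure.D1) (auto intro: up_closure.scale)
    finally show ?case .
  next
    case (D2 v g)
    have 1: "D (n + 2) (f * g) v \<in> up_closure"
      using D2 by (cases "n = 0"; cases "n = -1") (auto intro: up_closure.D1 up_closure.D2)
    have "D n f (D 2 g v) = D 2 g (D n f v) + (scale (of_int (2 - n)) (D (n + 2) (f * g) v) +
      (if n + 2 = 0 then scale (of_int (n ^ 3 - n) / 12) (Z (f * g) v) else 0))"
      using D_bracket[of n f 2 g v] by (simp add: algebra_simps)
    also have "\<dots> \<in> up_closure"
      using D2 1 z Zc by (intro up_closure.add up_closure.D2) (auto intro: up_closure.scale)
    finally show ?case .
  qed (auto intro: up_closure.intros)
  have pos: "D (int n + 1) f v \<in> up_closure" if "v \<in> up_closure" for n f v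
    using that
  proof (induction n arbitrary: f v)
    case (Suc n)
    show ?case
    proof (cases "n = 0")
      case False
      \<comment> \<open>The bracket of d_1 with degree n + 1 has coefficient n, so degree 2 is not
        reached from degree 1; hence the separate rule \<open>D2\<close>.\<close>
      have "D 1 1 (D (int n + 1) f v) - D (int n + 1) f (D 1 1 v) = scale (of_nat n) (D (int (Suc n) + 1) f v)"
        using D_bracket[of 1 1 "int n + 1" f v] by (simp add: algebra_simps)
      moreover have "D 1 1 (D (int n + 1) f v) + scale (- 1) (D (int n + 1) f (D 1 1 v)) \<in> up_closure"
        using Suc by (intro up_closure.add up_closure.scale) (auto intro: up_closure.D1)
      ultimately have "scale (of_nat n) (D (int (Suc n) + 1) f v) \<in> up_closure"
        by simp
      then have "scale (1 / of_nat n) (scale (of_nat n) (D (int (Suc n) + 1) f v)) \<in> up_closure"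
        by (rule up_closure.scale)
      then show ?thesis using False by simp
    qed (use Suc in \<open>auto intro: up_closure.D2\<close>)
  qed (auto intro: up_closure.D1)
  obtain v where v: "v \<noteq> 0" "v \<in> wt 0" using weight_0 zero_in_wt[of 0] by (auto simp: wt_def)
  show ?thesis
  proof (rule submodule_UNIV[OF _ _ _ v(1)])
    show "subspace up_closure" using z by (intro subspaceI) (auto intro: up_closure.intros)
    show "v \<in> up_closure" using v by (intro up_closure.base) auto
    fix n f w assume "w \<in> up_closure"
    then show "D n f w \<in> up_closure"
      using nonpos[of w n f] pos[of w "nat (n - 1)" f] by (cases "n \<le> 0") auto
  qed
qed

text \<open>A bound valid at weights 0 and 1 is inherited upwards: steps of size 1 and 2 from below
  cannot jump over both weights, and d_n \<otimes> g with n > 0 preserves being killed from M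
  on.\<close>

lemma kills_from_uniform:
  assumes J: "\<And>f g. f \<in> J \<Longrightarrow> f * g \<in> J" and kill: "\<And>v. \<exists>M. kills_from J M v"
  obtains M where "M \<ge> 1" "\<And>k v. k \<ge> 0 \<Longrightarrow> v \<in> wt k \<Longrightarrow> kills_from J M v"
proof -
  have fin: "\<exists>M. \<forall>v\<in>wt k. kills_from J M v" for k
  proof -
    obtain B where B: "finite B" "wt k \<subseteq> span B" using dim_le_wt[of k] unfolding dim_le_def by blast
    have "\<exists>M. \<forall>b\<in>B. kills_from J M b"
      using B(1)
    proof (induction rule: finite_induct)
      case (insert b B)
      then obtain M M' where "\<forall>b\<in>B. kills_from J M b" "kills_from J M' b" using kill by blast
      then show ?case
        by (intro exI[of _ "max M M'"]) (metis insert_iff kills_from_mono max.cobounded1 max.cobounded2)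
    qed simp
    then obtain M where "B \<subseteq> {v. kills_from J M v}" by blast
    then have "span B \<subseteq> {v. kills_from J M v}" using subspace_kills_from by (rule span_minimal)
    then show ?thesis using B(2) by blast
  qed
  obtain M0 M1 where M01: "\<forall>v\<in>wt 0. kills_from J M0 v" "\<forall>v\<in>wt 1. kills_from J M1 v" using fin by blast
  define M where "M = max 1 (max M0 M1)"
  have M: "\<And>v. v \<in> wt 0 \<Longrightarrow> kills_from J M v" "\<And>v. v \<in> wt 1 \<Longrightarrow> kills_from J M v"
    using M01 unfolding M_def by (auto elim!: kills_from_mono)
  \<comment> \<open>No condition is imposed at negative weights, so the starting vectors of
    \<open>up_closure\<close> all lie in the span of the S k.\<close>
  define S where "S k = (if k < 0 then wt k else wt k \<inter> {v. kills_from J M v})" for k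
  have S: "subspace (S k)" "S k \<subseteq> wt k" for k
    unfolding S_def using subspace_wt subspace_kills_from by (auto intro: subspace_inter)
  have step: "D n g v \<in> S (k + n)" if v: "v \<in> S k" and n: "n = 1 \<or> n = 2" for n g v k
  proof (cases "k < 0")
    case True
    then have "D n g v \<in> wt (k + n)" using v S(2) D_wt by blast
    moreover have "k + n < 0 \<or> k + n = 0 \<or> k + n = 1" using True n by auto
    ultimately show ?thesis unfolding S_def using M by auto
  next
    case False
    then have v: "v \<in> wt k" "kills_from J M v" using v by (auto simp: S_def)
    have "kills_from J M (D n g v)"
      unfolding kills_from_def
    proof (intro allI impI ballI)
      fix m f assume m: "m \<ge> M" "f \<in> J"
      then have "D m f v = 0" "D (m + n) (f * g) v = 0" using v(2) J n unfolding kills_from_def by auto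
      moreover have "m + n \<noteq> 0" using m n by (auto simp: M_def)
      ultimately show "D m f (D n g v) = 0" by (simp add: D_swap)
    qed
    then show ?thesis using D_wt[OF v(1), of n g] False n by (auto simp: S_def)
  qed
  have stepspan: "D n g v \<in> span (\<Union>k. S k)" if "v \<in> span (\<Union>k. S k)" "n = 1 \<or> n = 2" for n g v
    using that
  proof (induction rule: span_induct_alt)
    case (step c x y)
    then obtain k where "x \<in> S k" by blast
    then have "D n g x \<in> span (\<Union>k. S k)" using \<open>\<And>v k g n. v \<in> S k \<Longrightarrow> n = 1 \<or> n = 2 \<Longrightarrow> D n g v \<in> S (k + n)\<close> step.prems
      by (intro span_base) blast
    then show ?case using step by (auto intro!: span_add span_scale)
  qed (simp add: span_zero)
  have "v \<in> span (\<Union>k. S k)" if "v \<in> up_closure" for v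
    using that
  proof induction
    case (base v k)
    then have "v \<in> S k" using M by (cases "k = 0") (auto simp: S_def)
    then show ?case by (intro span_base) blast
  qed (auto intro: span_add span_scale stepspan)
  then have "span (\<Union>k. S k) = UNIV" using up_closure_UNIV by blast
  then have "S k = wt k" for k by (intro graded_UNIV_component S)
  then have "kills_from J M v" if "k \<ge> 0" "v \<in> wt k" for k v
    using that unfolding S_def by (metis IntD2 linorder_not_less mem_Collect_eq)
  then show thesis using that[of M] by (auto simp: M_def)
qed

end

text \<open>The summands must differ because [d_i, d_j] has coefficient j - i. Adding n or n + 1
  repeatedly reaches j * n + i for 1 \<le> i < j, the sum of j - i copies of n and i copies of n +
  1, without ever adding equal numbers.\<close>

lemma sum_closed_eventually:
  fixes n :: int
  assumes "n \<ge> 1" "P n" "P (n + 1)" and step: "\<And>i j. P i \<Longrightarrow> P j \<Longrightarrow> i \<noteq> j \<Longrightarrow> P (i + j)"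
    and m: "m \<ge> n * (n + 2)"
  shows "P m"
proof -
  have *: "P (int j * n + int i)" if "1 \<le> i" "i < j" for i j
    using that
  proof (induction j arbitrary: i)
    case (Suc j)
    show ?case
    proof (cases "j = 1")
      case True
      then have "i = 1" using Suc.prems by simp
      then show ?thesis using step[of n "n + 1"] assms(2,3) True by (simp add: algebra_simps)
    next
      case False
      show ?thesis
      proof (cases "i < j")
        case True
        then have "P (int j * n + int i)" using Suc by auto
        moreover have "1 * n \<le> int j * n" using assms(1) True by (intro mult_right_mono) auto
        moreover have "int i \<ge> 1" using Suc.prems by simp
        ultimately have "int j * n + int i \<noteq> n" by linarith
        from step[OF \<open>P (int j * n + int i)\<close> assms(2) this] have "P (int j * n + int i + n)" .
        then show ?thesis by (simp add: algebra_simps)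
      next
        case i: False
        then have ij: "i = j" using Suc.prems by simp
        then have "P (int j * n + int (j - 1))" using Suc.IH[of "j - 1"] Suc.prems False by auto
        moreover have "2 * n \<le> int j * n" using assms(1) False ij Suc.prems by (intro mult_right_mono) auto
        moreover have "int (j - 1) \<ge> 1" using False ij Suc.prems by simp
        ultimately have "int j * n + int (j - 1) \<noteq> n + 1" using assms(1) by linarith
        from step[OF \<open>P (int j * n + int (j - 1))\<close> assms(3) this]
        have "P (int j * n + int (j - 1) + (n + 1))" .
        moreover have "int j * n + int (j - 1) + (n + 1) = int (Suc j) * n + int i"
          using ij Suc.prems by (simp add: of_nat_diff algebra_simps)
        ultimately show ?thesis by simp
      qed
    qed
  qed simp
  \<comment> \<open>A multiple q * n has to be written as (q - 1) * n + n; the condition i < j then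
    reads n < q - 1, whence the bound n * (n + 2).\<close>
  define q r where "q = m div n" and "r = m mod n"
  have qr: "m = q * n + r" "0 \<le> r" "r < n" using assms(1) by (simp_all add: q_def r_def)
  have q: "n + 2 \<le> q"
  proof -
    have "(n + 2) * n div n \<le> m div n" using m assms(1) by (intro zdiv_mono1) (auto simp: mult.commute)
    then show ?thesis using assms(1) by (simp add: q_def)
  qed
  show ?thesis
  proof (cases "r = 0")
    case True
    have "P (int (nat (q - 1)) * n + int (nat n))" using q assms(1) by (intro *) auto
    then show ?thesis using q assms(1) qr True by (simp add: algebra_simps)
  next
    case False
    have "P (int (nat q) * n + int (nat r))" using q qr False by (intro *) auto
    then show ?thesis using q assms(1) qr by simp
  qed
qed

lemma not_dim_le_laurent: "\<not> complex_vs.dim_le cscale n (UNIV :: laurent set)"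
proof
  interpret A: complex_vs "cscale :: complex \<Rightarrow> laurent \<Rightarrow> laurent" ..
  assume "A.dim_le n UNIV"
  then obtain B where B: "finite B" "(UNIV :: laurent set) \<subseteq> free_vs.span B"
    unfolding A.dim_le_def free_span_def by blast
  then show False using not_finite_span_laurent[OF B(1)] by (simp add: top.extremum_unique)
qed

section \<open>From killed vectors to annihilating ideals\<close>

context irreducible_ops
begin

text \<open>At weight k the threshold M improves to M - k: d_(i-M) moves w to the weight k + i - M
  \<ge> 0, where d_M \<otimes> f still vanishes, and the bracket of the two operators is a nonzero
  multiple of d_i \<otimes> f.\<close>

lemma kills_from_uniform_low:
  assumes J: "\<And>k v. k \<ge> 0 \<Longrightarrow> v \<in> wt k \<Longrightarrow> kills_from J M v" and "M \<ge> 1"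
    and w: "w \<in> wt k" "f \<in> J" and i: "i \<ge> M - k" "k \<ge> 0" "i \<noteq> 0 \<or> k \<ge> M"
  shows "D i f w = 0"
proof -
  have *: "D i f w = 0" if "w \<in> wt k" "i \<ge> M - k" "k \<ge> 0" "i \<noteq> 0" for i k w
  proof (cases "i \<ge> M")
    case True
    then show ?thesis using J[of k w] that w(2) by (auto simp: kills_from_def)
  next
    case False
    have "D (i - M) 1 w \<in> wt (k + (i - M))" using that by (intro D_wt)
    then have "D M f (D (i - M) 1 w) = 0" "D M f w = 0"
      using J[of "k + (i - M)" "D (i - M) 1 w"] J[of k w] that w(2) by (auto simp: kills_from_def)
    then have "scale (of_int (i - M - M)) (D i f w) = 0"
      using D_swap[of M "i - M" f 1 w] that by simp
    moreover have "i - M - M \<noteq> 0" using False assms(2) by simp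
    ultimately show ?thesis by (metis of_int_eq_0_iff scale_eq_0_iff)
  qed
  show ?thesis
  proof (cases "i = 0")
    case True
    \<comment> \<open>Degree 0 comes from d_1 \<otimes> f and d_(-1); the latter lowers the weight
      to k - 1, which is where k \<ge> M enters.\<close>
    have "D 1 f w = 0" using *[of w k 1] w i True assms(2) by auto
    moreover have "D 1 f (D (-1) 1 w) = 0"
      using *[of "D (-1) 1 w" "k + (-1)" 1] D_wt[OF w(1), of "-1" 1] i True assms(2) by auto
    ultimately show ?thesis using True D_swap1[of f 1 w] by simp
  qed (use * w i in auto)
qed

text \<open>Otherwise d_0 itself would vanish on all high weight spaces, and two different weights
  would both be 0.\<close>

lemma no_killed_vector:
  assumes "unbounded_above" "kills_from UNIV M v"
  shows "v = 0"
proof (rule ccontr)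
  assume "v \<noteq> 0"
  then have "\<exists>M. kills_from UNIV M w" for w
    using kills_from_submodule[of UNIV M v w] assms(2) by simp
  then obtain M where M: "M \<ge> 1" "\<And>k v. k \<ge> 0 \<Longrightarrow> v \<in> wt k \<Longrightarrow> kills_from UNIV M v"
    using kills_from_uniform[of UNIV] by (metis UNIV_I)
  obtain k1 where k1: "k1 \<ge> M" "wt k1 \<noteq> {0}" using assms(1) unfolding unbounded_above_def by blast
  obtain k2 where k2: "k2 \<ge> k1 + 1" "wt k2 \<noteq> {0}" using assms(1) unfolding unbounded_above_def by blast
  have "lam + of_int k = 0" if k: "k \<ge> M" "wt k \<noteq> {0}" for k
  proof -
    obtain w where w: "w \<in> wt k" "w \<noteq> 0" using k(2) zero_in_wt by blast
    have "D 0 1 w = 0" by (rule kills_from_uniform_low[of UNIV M _ k]) (use M w k in auto)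
    then show ?thesis using wtD[OF w(1)] w(2) by simp
  qed
  from this[of k1] this[of k2] have "lam + of_int k1 = lam + of_int k2" using k1 k2 by simp
  then show False using k2 by simp
qed

text \<open>A vector w of high weight is killed by d_i \<otimes> f directly for i \<ge> M - k; for
  lower i the image d_i \<otimes> f w is killed in all high degrees and is 0 by
  \<open>no_killed_vector\<close>. The vectors killed by all of J form a submodule containing w,
  hence are all of V.\<close>

lemma kills_imp_annihilator:
  assumes ub: "unbounded_above" and J: "\<And>f g. f \<in> J \<Longrightarrow> f * g \<in> J"
    and v: "kills_from J M v" "v \<noteq> 0"
  shows "J \<subseteq> annihilator"
proof -
  have "\<exists>M. kills_from J M w" for w using kills_from_submodule[OF J v] by blast
  then obtain M where M: "M \<ge> 1" "\<And>k v. k \<ge> 0 \<Longrightarrow> v \<in> wt k \<Longrightarrow> kills_from J M v"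
    using kills_from_uniform[OF J] by metis
  have low: "D i f w = 0"
    if "w \<in> wt k" "f \<in> J" "i \<ge> M - k" "k \<ge> 0" "i \<noteq> 0 \<or> k \<ge> M" for i f w k
    by (rule kills_from_uniform_low[of J M _ k]) (use M that in auto)
  obtain k where k: "k \<ge> M + 1" "wt k \<noteq> {0}" using ub unfolding unbounded_above_def by blast
  then obtain w where w: "w \<in> wt k" "w \<noteq> 0" using zero_in_wt by blast
  have Dw: "D i f w = 0" if f: "f \<in> J" for i f
  proof (cases "i \<ge> M - k")
    case True
    then show ?thesis using low[OF w(1) f, of i] k M(1) by auto
  next
    case False
    have "kills_from UNIV (\<bar>i\<bar> + M + 1) (D i f w)"
      unfolding kills_from_def
    proof (intro allI impI ballI)
      fix s and g :: laurent assume s: "s \<ge> \<bar>i\<bar> + M + 1"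
      have "D i f (D s g w) = 0"
        using low[OF D_wt[OF w(1), of s g] f, of i] k s False M(1) by auto
      moreover have "D (i + s) (f * g) w = 0"
        using low[OF w(1) J[OF f], of "i + s"] k s M(1) by auto
      moreover have i_s: "i + s \<noteq> 0" using s M(1) by linarith
      ultimately show "D s g (D i f w) = 0"
        using D_swap[OF i_s, of f g w] by simp
    qed
    then show ?thesis by (rule no_killed_vector[OF ub])
  qed
  have Zw: "Z f w = 0" if f: "f \<in> J" for f
  proof -
    \<comment> \<open>As m \<ge> 2, the coefficient m^3 - m is nonzero, and c \<otimes> f can be
      read off from the degrees m and -m; k \<ge> M + 1 keeps the weight k - m nonnegative.\<close>
    define m where "m = M + 1"
    have "D (- m) 1 w \<in> wt (k + - m)" by (intro D_wt w)
    then have "D m f (D (- m) 1 w) = 0" using M(2)[of "k + - m"] k f by (auto simp: m_def kills_from_def)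
    then have "scale (of_int (m ^ 3 - m) / 12) (Z f w) = 0"
      using D_bracket[of m f "- m" 1 w] Dw[OF f] by simp
    moreover have "m ^ 3 - m = m * (m - 1) * (m + 1)" by (simp add: algebra_simps power3_eq_cube)
    then have "m ^ 3 - m \<noteq> 0" using M(1) by (simp add: m_def)
    then have "(of_int (m ^ 3 - m) :: complex) \<noteq> 0" by (metis of_int_eq_0_iff)
    ultimately show ?thesis by simp
  qed
  let ?K = "{w. \<forall>f\<in>J. Z f w = 0 \<and> (\<forall>i. D i f w = 0)}"
  have "?K = UNIV"
  proof (rule submodule_UNIV)
    show "subspace ?K" by (auto simp: subspace_def)
    fix n f v assume v: "v \<in> ?K"
    have "D m g (D n f v) = 0" if "g \<in> J" for m g
      using D_bracket[of m g n f v] v J[OF that] that by (simp split: if_splits)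
    then show "D n f v \<in> ?K" using v by (auto simp: Z_D)
  qed (use Dw Zw w in auto)
  then show ?thesis by (auto simp: annihilator_def)
qed

text \<open>The f with d_n \<otimes> f v = 0 form a space K of finite codimension, and brackets with
  d_(m-n) show that K kills v in all degrees m > 2 n. Choose b \<noteq> 0 with b and all b * s in K,
  where s runs through a finite set spanning modulo K; then every multiple of b kills v in high
  degrees.\<close>

lemma vir_killed_imp_annihilator:
  assumes ub: "unbounded_above" and v: "v \<noteq> 0" "v \<in> wt k" and M: "\<And>m. m \<ge> M \<Longrightarrow> D m 1 v = 0"
  shows "\<exists>b\<in>annihilator. b \<noteq> 0"
proof -
  interpret A: complex_vs "cscale :: complex \<Rightarrow> laurent \<Rightarrow> laurent" ..
  define n where "n = max 1 M"
  define K where "K = {P. D n P v = 0}"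
  have K: "D m P v = 0" if "P \<in> K" "m > 2 * n" for P m
  proof -
    have "D (m - n) 1 v = 0" using that M by (auto simp: n_def)
    then have "scale (of_int (n - (m - n))) (D m P v) = 0"
      using D_swap[of "m - n" n 1 P v] that by (simp add: K_def n_def)
    moreover have "(of_int (n - (m - n)) :: complex) \<noteq> 0" unfolding of_int_eq_0_iff using that by linarith
    ultimately show ?thesis by simp
  qed
  obtain d where d: "dim_le d (wt (k + n))" using dim_le_wt by blast
  have dim: "dim_le d ((\<lambda>f. D n (f * g) v) ` U)" for g U
    by (rule dim_le_mono[OF d]) (use D_wt[OF v(2)] in auto)
  have lin: "Vector_Spaces.linear cscale scale (\<lambda>f. D n (f * g) v)" for g
    unfolding Vector_Spaces.linear_iff
    using vector_space_axioms free_vs.vector_space_axioms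
    by (simp add: D_add D_cscale distrib_right cscale_mult_left)
  obtain S where S': "finite S"
      "\<And>f. f \<in> UNIV \<Longrightarrow> \<exists>s\<in>free_vs.span S. D n (f * 1) v = D n (s * 1) v"
    by (rule linear_split_kernel[OF lin[of 1] free_vs.subspace_UNIV dim[of 1 UNIV]])
       (auto simp only: free_span_def)
  have S: "\<exists>s\<in>free_vs.span S. D n f v = D n s v" for f
    using S'(2)[of f] by simp
  obtain Ss where Ss: "set Ss = S" using S'(1) finite_list by blast
  have "\<exists>b. b \<noteq> 0 \<and> (\<forall>g\<in>set (1 # Ss). D n (b * g) v = 0)"
  proof (rule ccontr)
    assume "\<not> ?thesis"
    then have "A.dim_le (length (map (\<lambda>g f. D n (f * g) v) (1 # Ss)) * d) UNIV"
      by (intro dim_le_joint_kernel[where ?s2.0 = scale]) (use lin lin[of 1, simplified] dim dim[of 1, simplified] free_vs.vector_space_axioms in auto)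
    then show False using not_dim_le_laurent by blast
  qed
  then obtain b where b: "b \<noteq> 0" "b \<in> K" "\<And>s. s \<in> S \<Longrightarrow> b * s \<in> K" by (auto simp: K_def Ss)
  have bS: "b * s \<in> K" if "s \<in> free_vs.span S" for s
    using that by (induction rule: free_vs.span_induct_alt)
      (use b in \<open>auto simp: K_def distrib_left cscale_mult_right D_add D_cscale\<close>)
  have "kills_from (range ((*) b)) (4 * n + 3) v"
    unfolding kills_from_def
  proof (intro allI impI ballI, elim rangeE)
    fix m f h assume m: "m \<ge> 4 * n + 3" and f: "f = b * h"
    obtain s where s: "s \<in> free_vs.span S" "D n h v = D n s v" using S by blast
    have p: "h - s \<in> K" using s(2) by (simp add: K_def D_diff)
    have n1: "n \<ge> 1" by (simp add: n_def)
    \<comment> \<open>For m \<ge> 4 n + 3 the degrees 2 n + 1 and m - (2 n + 1) both exceed 2 n, and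
      they differ, so the bracket has a nonzero coefficient.\<close>
    have "D (m - (2 * n + 1)) (h - s) v = 0" "D (2 * n + 1) b v = 0"
      using K[OF p] K[OF b(2)] m n1 by auto
    then have "scale (of_int (m - 2 * (2 * n + 1))) (D m (b * (h - s)) v) = 0"
      using D_swap[of "2 * n + 1" "m - (2 * n + 1)" b "h - s" v] m n1 by (simp add: algebra_simps)
    moreover have "(of_int (m - 2 * (2 * n + 1)) :: complex) \<noteq> 0"
      unfolding of_int_eq_0_iff using m by auto
    ultimately have "D m (b * (h - s)) v = 0" by simp
    moreover have "D m (b * s) v = 0" using K[OF bS[OF s(1)]] m n1 by simp
    ultimately show "D m f v = 0" using f D_add[of m "b * (h - s)" "b * s" v] by (simp add: algebra_simps)
  qed
  then have "range ((*) b) \<subseteq> annihilator"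
    by (intro kills_imp_annihilator[OF ub _ _ v(1)]) (auto simp: mult.assoc)
  then have "b * 1 \<in> annihilator" by blast
  then show ?thesis using b(1) by auto
qed

section \<open>The involution d_n -> -d_(-n), c -> -c\<close>

definition unbounded_below :: bool where
  "unbounded_below \<longleftrightarrow> (\<forall>K. \<exists>k\<le>K. wt k \<noteq> {0})"

text \<open>The central coefficient is odd in m, so c has to change its sign along with d_n.\<close>

lemma mirror_ops: "loop_vir_ops scale (\<lambda>n f v. - D (- n) f v) (\<lambda>f v. - Z f v)"
proof (intro loop_vir_ops.intro loop_vir_ops_axioms.intro)
  fix m n :: int and f g :: laurent and v :: 'v and a :: complex
  have c: "(of_int ((- m) ^ 3 - (- m)) / 12 :: complex) = - (of_int (m ^ 3 - m) / 12)"
    by (simp add: field_simps power3_eq_cube)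
  have "- D (- m) f (- D (- n) g v) - - D (- n) g (- D (- m) f v) = D (- m) f (D (- n) g v) - D (- n) g (D (- m) f v)"
    by simp
  also have "\<dots> = scale (of_int (- n - - m)) (D (- m + - n) (f * g) v) +
    (if - m + - n = 0 then scale (of_int ((- m) ^ 3 - (- m)) / 12) (Z (f * g) v) else 0)"
    by (rule D_bracket)
  also have "(- m + - n = 0) = (m + n = 0)" by auto
  also have "of_int (- n - - m) = - (of_int (n - m) :: complex)" by simp
  finally show "- D (- m) f (- D (- n) g v) - - D (- n) g (- D (- m) f v) =
       scale (of_int (n - m)) (- D (- (m + n)) (f * g) v) +
       (if m + n = 0 then scale (of_int (m ^ 3 - m) / 12) (- Z (f * g) v) else 0)"
    unfolding c scale_minus_left by (simp add: algebra_simps)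
  show "- Z f (- D (- n) g v) = - D (- n) g (- Z f v)" by (simp add: Z_D)
  show "- Z f (- Z g v) = - Z g (- Z f v)" by (simp add: Z_Z)
  show "- D (- n) (f + g) v = - D (- n) f v + - D (- n) g v" by (simp add: D_add)
  show "- D (- n) (cscale a f) v = scale a (- D (- n) f v)" by (simp add: D_cscale)
  show "Vector_Spaces.linear scale scale (\<lambda>v. - D (- n) f v)"
    and "Vector_Spaces.linear scale scale (\<lambda>v. - Z f v)"
    unfolding Vector_Spaces.linear_iff using vector_space_axioms by simp_all
qed (rule complex_vs_axioms)

lemma mirror_weight_space: "{v. - D (- 0) 1 v = scale (- lam + of_int k) v} = wt (- k)"
proof -
  have "- D 0 1 v = scale (- lam + of_int k) v \<longleftrightarrow> D 0 1 v = scale (lam + of_int (- k)) v" for v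
  proof -
    have "scale (lam + of_int (- k)) v = - scale (- lam + of_int k) v"
      unfolding scale_minus_left[symmetric] by simp
    then show ?thesis by (metis add.inverse_inverse)
  qed
  then show ?thesis by (simp add: wt_def)
qed

lemma mirror: "irreducible_ops scale (\<lambda>n f v. - D (- n) f v) (\<lambda>f v. - Z f v) (- lam)"
proof (intro irreducible_ops.intro irreducible_ops_axioms.intro, unfold mirror_weight_space)
  show "loop_vir_ops scale (\<lambda>n f v. - D (- n) f v) (\<lambda>f v. - Z f v)" by (rule mirror_ops)
  fix N assume N: "subspace N" "\<And>n f v. v \<in> N \<Longrightarrow> - D (- n) f v \<in> N"
  have "D n f v \<in> N" if "v \<in> N" for n f v
    using subspace_neg[OF N(1) N(2)[OF that, of "- n" f]] by simp
  then show "N = {0} \<or> N = UNIV" using irreducible N(1) by blast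
next
  fix k show "\<exists>n. dim_le n (wt (- k))" by (rule dim_le_wt)
next
  have "(\<Union>k. wt (- k)) = (\<Union>k. wt k)"
  proof (intro equalityI subsetI)
    fix x assume "x \<in> (\<Union>k. wt k)"
    then obtain k where "x \<in> wt (- (- k))" by auto
    then show "x \<in> (\<Union>k. wt (- k))" by blast
  qed auto
  then show "span (\<Union>k. wt (- k)) = UNIV" using span_wt by simp
next
  show "{v. - D (- 0) 1 v = scale (- lam) v} \<noteq> {0}"
    using mirror_weight_space[of 0] weight_0 by (simp add: wt_def)
qed

end

lemma (in irreducible_ops) mirror_wt:
  "irreducible_ops.wt scale (\<lambda>n f v. - D (- n) f v) (- lam) k = wt (- k)"
  unfolding irreducible_ops.wt_def[OF mirror] by (rule mirror_weight_space)

lemma (in irreducible_ops) mirror_unbounded: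
  "irreducible_ops.unbounded_above scale (\<lambda>n f v. - D (- n) f v) (- lam) \<longleftrightarrow> unbounded_below"
  unfolding irreducible_ops.unbounded_above_def[OF mirror] unbounded_below_def mirror_wt
proof safe
  fix K assume "\<forall>K. \<exists>k\<ge>K. wt (- k) \<noteq> {0}"
  then obtain k where "k \<ge> - K" "wt (- k) \<noteq> {0}" by blast
  then show "\<exists>k\<le>K. wt k \<noteq> {0}" by (intro exI[of _ "- k"]) auto
next
  fix K assume "\<forall>K. \<exists>k\<le>K. wt k \<noteq> {0}"
  then obtain k where "k \<le> - K" "wt k \<noteq> {0}" by blast
  then show "\<exists>k\<ge>K. wt (- k) \<noteq> {0}" by (intro exI[of _ "- k"]) auto
qed

lemma (in irreducible_ops) mirror_annihilator:
  "loop_vir_ops.annihilator (\<lambda>n f v. - D (- n) f v) = annihilator"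
  unfolding loop_vir_ops.annihilator_def[OF mirror_ops] annihilator_def
proof (intro Collect_cong iffI allI)
  fix f :: laurent and n v assume "\<forall>n v. - D (- n) f v = 0"
  from this[rule_format, of "- n" v] show "D n f v = 0" by simp
qed simp

section \<open>Bounded weight multiplicities\<close>

lemma (in complex_vs) dim_le_Un: "dim_le m U \<Longrightarrow> dim_le n W \<Longrightarrow> dim_le (m + n) (U \<union> W)"
  unfolding dim_le_def
proof (elim exE conjE)
  fix B C assume "finite B" "card B \<le> m" "U \<subseteq> span B" "finite C" "card C \<le> n" "W \<subseteq> span C"
  then show "\<exists>B. finite B \<and> card B \<le> m + n \<and> U \<union> W \<subseteq> span B"
    using span_mono[of B "B \<union> C"] span_mono[of C "B \<union> C"] card_Un_le[of B C]
    by (intro exI[of _ "B \<union> C"]) auto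
qed

context irreducible_ops
begin

text \<open>The operators of degrees n and n + 1 map the weight -n to the weights 0 and 1, whose
  dimensions do not depend on n. If the same finitely many f always have trivial joint kernel, the
  multiplicities are bounded.\<close>

lemma bounded_negative_weights:
  assumes z: "\<And>n v. n \<ge> 1 \<Longrightarrow> v \<in> wt (- n) \<Longrightarrow>
      \<forall>f\<in>set Ts. D n f v = 0 \<and> D (n + 1) f v = 0 \<Longrightarrow> v = 0"
  shows "\<exists>N. \<forall>n\<ge>1. dim_le N (wt (- n))"
proof -
  obtain d0 d1 where d: "dim_le d0 (wt 0)" "dim_le d1 (wt 1)" using dim_le_wt by blast
  define d where "d = max d0 d1"
  have d: "dim_le d (wt 0)" "dim_le d (wt 1)"
    using dim_le_mono[OF d(1), of d] dim_le_mono[OF d(2), of d] by (simp_all add: d_def)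
  have "dim_le (length (map (D n) Ts @ map (D (n + 1)) Ts) * d) (wt (- n))" if n: "n \<ge> 1" for n
  proof (rule dim_le_joint_kernel[where ?s2.0 = scale])
    fix h assume h: "h \<in> set (map (D n) Ts @ map (D (n + 1)) Ts)"
    have "D n f ` wt (- n) \<subseteq> wt 0" "D (n + 1) f ` wt (- n) \<subseteq> wt 1" for f
      using D_wt[of _ "- n" n f] D_wt[of _ "- n" "n + 1" f] by auto
    then show "Vector_Spaces.linear scale scale h \<and> dim_le d (h ` wt (- n))"
      using h dim_le_mono[OF d(1) order_refl] dim_le_mono[OF d(2) order_refl] by (auto simp: D_linear)
  next
    fix u assume "u \<in> wt (- n)" "\<forall>f\<in>set (map (D n) Ts @ map (D (n + 1)) Ts). f u = 0"
    then show "u = 0" using z[OF n, of u] by auto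
  qed (use vector_space_axioms subspace_wt in auto)
  then show ?thesis by (metis length_append length_map)
qed

definition bounded_dims :: "nat \<Rightarrow> bool" where
  "bounded_dims N \<longleftrightarrow> (\<forall>k. dim_le N (wt k))"

lemma bounded_dims_both:
  assumes "\<exists>N. \<forall>n\<ge>1. dim_le N (wt (- n))" "\<exists>N. \<forall>n\<ge>1. dim_le N (wt n)"
  shows "\<exists>N. bounded_dims N"
proof -
  obtain N1 N2 N3 where N: "\<forall>n\<ge>1. dim_le N1 (wt (- n))" "\<forall>n\<ge>1. dim_le N2 (wt n)" "dim_le N3 (wt 0)"
    using assms dim_le_wt by blast
  have "dim_le (N1 + N2 + N3) (wt k)" for k
  proof -
    consider "k \<le> -1" | "k = 0" | "k \<ge> 1" by linarith
    then show ?thesis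
    proof cases
      case 1
      then have "dim_le N1 (wt (- (- k)))" using N(1) by (metis minus_equation_iff neg_le_iff_le)
      then show ?thesis by (rule dim_le_mono) auto
    next
      case 2
      then have "dim_le N3 (wt k)" using N by simp
      then show ?thesis by (rule dim_le_mono) auto
    next
      case 3
      then have "dim_le N2 (wt k)" using N by simp
      then show ?thesis by (rule dim_le_mono) auto
    qed
  qed
  then show ?thesis unfolding bounded_dims_def by blast
qed

lemma mirror_bounded_positive:
  assumes z: "\<And>n v. n \<ge> 1 \<Longrightarrow> v \<in> wt n \<Longrightarrow>
      \<forall>f\<in>set Ts. D (- n) f v = 0 \<and> D (- (n + 1)) f v = 0 \<Longrightarrow> v = 0"
  shows "\<exists>N. \<forall>n\<ge>1. dim_le N (wt n)"
proof -
  have "\<exists>N. \<forall>n\<ge>1. dim_le N (irreducible_ops.wt scale (\<lambda>n f v. - D (- n) f v) (- lam) (- n))"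
    by (rule irreducible_ops.bounded_negative_weights[OF mirror, of Ts]) (use z in \<open>simp add: mirror_wt\<close>)
  then show ?thesis by (simp add: mirror_wt)
qed

text \<open>The coefficients of q give a linear recurrence for the sequence
  \<open>D n (tpow j) v\<close>. Its lowest and highest coefficients are nonzero, so it runs in both
  directions and hi - lo consecutive zeros spread to all j.\<close>

lemma window_generates:
  assumes q: "q \<in> annihilator" "q \<noteq> 0"
  obtains w :: nat where "\<And>n v f. (\<And>i. i \<in> {0..<int w} \<Longrightarrow> D n (tpow i) v = 0) \<Longrightarrow> D n f v = 0"
proof -
  let ?K = "Poly_Mapping.keys q"
  have K: "finite ?K" "?K \<noteq> {}" using q(2) by auto
  define lo hi where "lo = Min ?K" and "hi = Max ?K"
  have lohi: "lo \<in> ?K" "hi \<in> ?K" "\<And>i. i \<in> ?K \<Longrightarrow> lo \<le> i \<and> i \<le> hi"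
    using K by (auto simp: lo_def hi_def)
  define w where "w = nat (hi - lo)"
  have w: "int w = hi - lo" using lohi by (simp add: w_def)
  have rel: "(\<Sum>i\<in>?K. scale (Poly_Mapping.lookup q i) (D n (tpow (i + j)) v)) = 0" for n v j
  proof -
    have "q * tpow j = (\<Sum>i\<in>?K. cscale (Poly_Mapping.lookup q i) (tpow (i + j)))"
      by (subst sum_single_keys[of q]) (simp add: sum_distrib_right mult_single cscale_single)
    moreover have "D n (\<Sum>i\<in>A. cscale (Poly_Mapping.lookup q i) (tpow (i + j))) v =
        (\<Sum>i\<in>A. scale (Poly_Mapping.lookup q i) (D n (tpow (i + j)) v))" if "finite A" for A
      using that by (induction A rule: finite_induct) (simp_all add: D_add D_cscale)
    ultimately show ?thesis using annihilatorD[OF annihilator_mult[OF q(1)], of n "tpow j" v] K by simp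
  qed
  have pick: "D n (tpow (i0 + j)) v = 0"
    if "i0 \<in> ?K" "\<And>i. i \<in> ?K \<Longrightarrow> i \<noteq> i0 \<Longrightarrow> D n (tpow (i + j)) v = 0" for n v j i0
  proof -
    have "(\<Sum>i\<in>?K. scale (Poly_Mapping.lookup q i) (D n (tpow (i + j)) v)) =
        (\<Sum>i\<in>{i0}. scale (Poly_Mapping.lookup q i) (D n (tpow (i + j)) v))"
      using that K by (intro sum.mono_neutral_right) auto
    then show ?thesis using rel[of n j v] that(1) by (simp add: in_keys_iff)
  qed
  show thesis
  proof
    fix n v f assume z: "\<And>i. i \<in> {0..<int w} \<Longrightarrow> D n (tpow i) v = 0"
    have up: "D n (tpow (a + int w)) v = 0" if "\<And>i. i \<in> {a..<a + int w} \<Longrightarrow> D n (tpow i) v = 0" for a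
    proof -
      have "D n (tpow (hi + (a - lo))) v = 0"
        by (rule pick[OF lohi(2)]) (use that w lohi(3) in fastforce)
      moreover have "hi + (a - lo) = a + int w" using w by simp
      ultimately show ?thesis by metis
    qed
    have down: "D n (tpow (a - 1)) v = 0" if "\<And>i. i \<in> {a..<a + int w} \<Longrightarrow> D n (tpow i) v = 0" for a
    proof -
      have "D n (tpow (lo + (a - 1 - lo))) v = 0"
        by (rule pick[OF lohi(1)]) (use that w lohi(3) in fastforce)
      then show ?thesis by simp
    qed
    have win: "\<forall>i\<in>{a..<a + int w}. D n (tpow i) v = 0" for a
    proof (induction a rule: int_induct[where k = 0])
      case base
      then show ?case using z by auto
    next
      case (step1 a)
      show ?case
      proof
        fix i assume i: "i \<in> {a + 1..<a + 1 + int w}"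
        show "D n (tpow i) v = 0"
        proof (cases "i < a + int w")
          case True then show ?thesis using step1.IH i by auto
        next
          case False
          then have "i = a + int w" using i by auto
          then show ?thesis using up[of a] step1.IH by auto
        qed
      qed
    next
      case (step2 a)
      show ?case
      proof
        fix i assume i: "i \<in> {a - 1..<a - 1 + int w}"
        show "D n (tpow i) v = 0"
        proof (cases "i \<ge> a")
          case True then show ?thesis using step2.IH i by auto
        next
          case False
          then have "i = a - 1" using i by auto
          then show ?thesis using down[of a] step2.IH by auto
        qed
      qed
    qed
    have t: "D n (tpow i) v = 0" for i using up[of "i - int w"] win[of "i - int w"] by auto
    show "D n f v = 0"
    proof (induction f rule: poly_mapping_sum_induct)
      case (single a c)
      then show ?case using D_cscale[of n c "tpow a" v] t by (simp add: cscale_single)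
    qed (simp_all add: D_add)
  qed
qed

text \<open>The degrees in which all d_m \<otimes> f kill v are closed under sums of distinct
  elements, because d_(i+j) \<otimes> f comes from d_i \<otimes> f and d_j \<otimes> 1.\<close>

lemma killed_by_two:
  assumes "unbounded_above" "n \<ge> 1" "\<And>f. D n f v = 0" "\<And>f. D (n + 1) f v = 0"
  shows "v = 0"
proof -
  have "m \<ge> 1 \<and> (\<forall>f. D m f v = 0)" if "m \<ge> n * (n + 2)" for m
  proof (rule sum_closed_eventually[OF assms(2) _ _ _ that])
    fix i j :: int assume i: "i \<ge> 1 \<and> (\<forall>f. D i f v = 0)" and j: "j \<ge> 1 \<and> (\<forall>f. D j f v = 0)" and ij: "i \<noteq> j"
    have "D (i + j) f v = 0" for f
      using D_swap[of i j f 1 v] i j ij by simp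
    then show "1 \<le> i + j \<and> (\<forall>f. D (i + j) f v = 0)" using i j by auto
  qed (use assms in auto)
  then have "kills_from UNIV (n * (n + 2)) v" by (simp add: kills_from_def)
  then show ?thesis using no_killed_vector[OF assms(1)] by blast
qed

lemma mirror_killed_by_two:
  assumes "unbounded_below" "n \<ge> 1" "\<And>f. D (- n) f v = 0" "\<And>f. D (- (n + 1)) f v = 0"
  shows "v = 0"
  using irreducible_ops.killed_by_two[OF mirror, of n v] assms by (simp add: mirror_unbounded)

lemma annihilator_imp_bounded:
  assumes ub: "unbounded_above" "unbounded_below" and q: "q \<in> annihilator" "q \<noteq> 0"
  shows "\<exists>N. bounded_dims N"
proof -
  obtain w :: nat where w: "\<And>n v f. (\<And>i. i \<in> {0..<int w} \<Longrightarrow> D n (tpow i) v = 0) \<Longrightarrow> D n f v = 0"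
    using window_generates[OF q] by blast
  define Ts where "Ts = map (\<lambda>i. tpow (int i)) [0..<w]"
  have Ts: "D n f v = 0" if "\<forall>f\<in>set Ts. D n f v = 0" for n f v
  proof (rule w)
    fix i assume "i \<in> {0..<int w}"
    then have "tpow i \<in> set Ts" unfolding Ts_def by (auto intro!: image_eqI[of _ _ "nat i"])
    then show "D n (tpow i) v = 0" using that by blast
  qed
  show ?thesis
  proof (rule bounded_dims_both)
    show "\<exists>N. \<forall>n\<ge>1. dim_le N (wt (- n))"
      by (rule bounded_negative_weights[of Ts]) (use Ts killed_by_two[OF ub(1)] in blast)
    show "\<exists>N. \<forall>n\<ge>1. dim_le N (wt n)"
      by (rule mirror_bounded_positive[of Ts]) (use Ts mirror_killed_by_two[OF ub(2)] in blast)
  qed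
qed

section \<open>Descent with the subalgebra spanned by d_(-1), d_0, d_1\<close>

lemma D_lower_wt: "v \<in> wt k \<Longrightarrow> (D (-1) 1 ^^ j) v \<in> wt (k - int j)"
proof (induction j)
  case (Suc j)
  then show ?case using D_wt[of "(D (-1) 1 ^^ j) v" "k - int j" "-1" 1] by (simp add: algebra_simps)
qed simp

text \<open>The standard sl_2 computation for a vector killed by the raising operator, with
  [d_1, d_(-1)] = -2 d_0.\<close>

lemma casimir_descent:
  assumes v: "v \<in> wt k" "D 1 1 v = 0"
  shows "D 1 1 ((D (-1) 1 ^^ Suc j) v) =
    scale (- (of_nat (Suc j) * (2 * (lam + of_int k) - of_nat j))) ((D (-1) 1 ^^ j) v)"
proof (induction j)
  case 0
  have "D 1 1 ((D (-1) 1 ^^ Suc 0) v) = - scale 2 (scale (lam + of_int k) v)"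
    using v D_swap1[of 1 1 v] wtD[OF v(1)] by simp
  then show ?case unfolding scale_scale scale_minus_left[symmetric] by simp
next
  case (Suc j)
  have wt: "(D (-1) 1 ^^ j) v \<in> wt (k - int j)" for j
    by (rule D_lower_wt) (rule v)
  have "D 1 1 ((D (-1) 1 ^^ Suc (Suc j)) v) =
      D (-1) 1 (D 1 1 ((D (-1) 1 ^^ Suc j) v)) - scale 2 (D 0 1 ((D (-1) 1 ^^ Suc j) v))"
    using D_swap1[of 1 1 "(D (-1) 1 ^^ Suc j) v"] by simp
  also have "\<dots> = scale (- (of_nat (Suc j) * (2 * (lam + of_int k) - of_nat j))) ((D (-1) 1 ^^ Suc j) v)
      - scale 2 (scale (lam + of_int (k - int (Suc j))) ((D (-1) 1 ^^ Suc j) v))"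
    unfolding Suc wtD[OF wt] by simp
  also have "\<dots> = scale (- (of_nat (Suc (Suc j)) * (2 * (lam + of_int k) - of_nat (Suc j)))) ((D (-1) 1 ^^ Suc j) v)"
    unfolding scale_scale scale_left_diff_distrib[symmetric] by (simp add: algebra_simps)
  finally show ?case .
qed

text \<open>A nonzero vector of large weight k killed by d_1 descends under d_(-1)^k to an
  eigenvector of d_(-1) d_1 in the fixed weight space 0. The eigenvalues e k are distinct for large
  k, and a finite-dimensional space has only finitely many.\<close>

lemma eventually_injective:
  obtains k0 where "\<And>k v. k \<ge> k0 \<Longrightarrow> v \<in> wt k \<Longrightarrow> D 1 1 v = 0 \<Longrightarrow> v = 0"
proof -
  \<comment> \<open>From K on, the numbers 2 (lam + k) - j with j < k and 2 lam + k + l + 1 have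
    positive real part: the descent never reaches 0, and e is injective.\<close>
  define K where "K = nat \<lceil>\<bar>2 * Re lam\<bar>\<rceil> + 1"
  have K: "real K > \<bar>2 * Re lam\<bar>" unfolding K_def by linarith
  define T where "T v = D (-1) 1 (D 1 1 v)" for v
  have T: "Vector_Spaces.linear scale scale T"
    using Vector_Spaces.linear_compose[OF D_linear[of 1 1] D_linear[of "-1" 1]] by (simp add: T_def[abs_def] comp_def)
  obtain d where d: "dim_le d (wt 0)" using dim_le_wt by blast
  let ?E = "{a. \<exists>v\<in>wt 0. v \<noteq> 0 \<and> T v = scale a v}"
  have E: "finite ?E" by (rule finite_eigenvalues[OF T d])
  define e where "e k = - (of_nat k * (2 * lam + of_nat k + 1))" for k :: nat
  let ?B = "{k. k \<ge> K \<and> (\<exists>v\<in>wt (int k). v \<noteq> 0 \<and> D 1 1 v = 0)}"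
  have sub: "e ` ?B \<subseteq> ?E"
  proof
    fix a assume "a \<in> e ` ?B"
    then obtain k v where k: "k \<ge> K" "a = e k" and v: "v \<in> wt (int k)" "v \<noteq> 0" "D 1 1 v = 0" by blast
    have wt: "(D (-1) 1 ^^ j) v \<in> wt (int k - int j)" for j
      by (rule D_lower_wt) (rule v)
    have nz: "(D (-1) 1 ^^ j) v \<noteq> 0" if "j \<le> k" for j
      using that
    proof (induction j)
      case (Suc j)
      have "Re (2 * (lam + of_int (int k)) - of_nat j) > 0" using Suc.prems k(1) K by simp
      then have "2 * (lam + of_int (int k)) - of_nat j \<noteq> 0" by (metis less_irrefl zero_complex.simps(1))
      then have "D 1 1 ((D (-1) 1 ^^ Suc j) v) \<noteq> 0"
        unfolding casimir_descent[OF v(1,3)] using Suc by (simp del: funpow.simps of_nat_Suc)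
      then show ?case by (metis D.zero)
    qed (use v in simp)
    obtain j where j: "k = Suc j" using k(1) K_def by (cases k) auto
    have "T ((D (-1) 1 ^^ k) v) = scale a ((D (-1) 1 ^^ k) v)"
      unfolding T_def j casimir_descent[OF v(1,3)] by (simp add: k(2) e_def j algebra_simps)
    then show "a \<in> ?E" using nz[of k] wt[of k] by auto
  qed
  have inj: "inj_on e ?B"
  proof (rule inj_onI, rule ccontr)
    fix k l assume kl: "k \<in> ?B" "l \<in> ?B" "e k = e l" "k \<noteq> l"
    have "(of_nat k - of_nat l) * (2 * lam + of_nat k + of_nat l + 1) = 0"
      using kl(3) by (simp add: e_def algebra_simps)
    then have "2 * lam + of_nat k + of_nat l + 1 = 0" using kl(4) by simp
    then have "Re (2 * lam + of_nat k + of_nat l + 1) = 0" by (metis zero_complex.simps(1))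
    then show False using kl(1,2) K by simp
  qed
  have "finite ?B" by (rule finite_imageD[OF finite_subset[OF sub E] inj])
  then obtain M where "\<forall>k\<in>?B. k \<le> M" unfolding finite_nat_set_iff_bounded_le by (rule exE)
  then have M: "k \<le> M" if "k \<in> ?B" for k using that by (rule bspec)
  have "v = 0" if k: "k \<ge> int (max K (M + 1))" and v: "v \<in> wt k" "D 1 1 v = 0" for k v
  proof (rule ccontr)
    assume "v \<noteq> 0"
    then have "nat k \<in> ?B" using k v by (intro CollectI conjI bexI[of _ v]) simp_all
    then have "nat k \<le> M" by (rule M)
    then show False using k by simp
  qed
  then show thesis by (rule that)
qed

text \<open>Where d_1 is injective, multiplicities cannot decrease; being bounded, they attain their
  maximum at some \<open>k1\<close> and keep it, so d_1 is surjective from there on.\<close>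

lemma eventually_bijective:
  assumes N: "bounded_dims N"
  shows "\<exists>k0. (\<forall>k\<ge>k0. D 1 1 ` wt k = wt (k + 1)) \<and> (\<forall>k\<ge>k0. \<forall>v\<in>wt k. D 1 1 v = 0 \<longrightarrow> v = 0)"
proof -
  obtain k0 where k0: "\<And>k v. k \<ge> k0 \<Longrightarrow> v \<in> wt k \<Longrightarrow> D 1 1 v = 0 \<Longrightarrow> v = 0"
    using eventually_injective by blast
  define P where "P k n \<longleftrightarrow> (\<exists>B. B \<subseteq> wt k \<and> independent B \<and> finite B \<and> card B = n)" for k n
  define S where "S = {n. \<exists>k. k \<ge> k0 \<and> P k n}"
  have le: "card B \<le> N" if "B \<subseteq> wt k" "independent B" for B k
  proof -
    obtain F where "finite F" "card F \<le> N" "wt k \<subseteq> span F" using N unfolding bounded_dims_def dim_le_def by blast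
    then show ?thesis using independent_span_bound[of F B] that by force
  qed
  have "S \<subseteq> {..N}" using le unfolding S_def P_def by auto
  then have fin: "finite S" by (rule finite_subset) simp
  have "P k0 0" unfolding P_def by (intro exI[of _ "{}"]) (simp add: independent_empty)
  then have "S \<noteq> {}" unfolding S_def by blast
  then have "Max S \<in> S" and Mx: "\<And>n. n \<in> S \<Longrightarrow> n \<le> Max S"
    using fin by simp_all
  then obtain k1 where k1: "k1 \<ge> k0" "P k1 (Max S)" unfolding S_def by blast
  have spn: "span B = wt k" if "k \<ge> k0" "B \<subseteq> wt k" "independent B" "finite B" "card B = Max S" for k B
  proof
    show "span B \<subseteq> wt k" using that(2) subspace_wt by (rule span_minimal)
    show "wt k \<subseteq> span B"
    proof
      fix y assume y: "y \<in> wt k"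
      show "y \<in> span B"
      proof (rule ccontr)
        assume n: "y \<notin> span B"
        then have "independent (insert y B)" using that by (simp add: independent_insertI)
        moreover have "y \<notin> B" using n span_base by blast
        ultimately have "P k (Suc (Max S))" unfolding P_def using that y by (intro exI[of _ "insert y B"]) auto
        then have "Suc (Max S) \<in> S" unfolding S_def using that(1) by blast
        then show False using Mx by fastforce
      qed
    qed
  qed
  have inj_step: "independent (D 1 1 ` B) \<and> D 1 1 ` B \<subseteq> wt (k + 1) \<and> card (D 1 1 ` B) = card B"
    if "k \<ge> k0" "B \<subseteq> wt k" "independent B" "finite B" for k B
  proof -
    have "span B \<subseteq> wt k" using that(2) subspace_wt by (rule span_minimal)
    have inj: "inj_on (D 1 1) (span B)"
    proof (intro inj_onI)
      fix x y assume xy: "x \<in> span B" "y \<in> span B" "D 1 1 x = D 1 1 y"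
      then have "x - y \<in> wt k" using \<open>span B \<subseteq> wt k\<close> by (auto intro: subspace_diff[OF subspace_wt])
      moreover have "D 1 1 (x - y) = 0" using xy(3) by simp
      ultimately have "x - y = 0" using k0[OF that(1)] by blast
      then show "x = y" by simp
    qed
    then have "inj_on (D 1 1) B" by (rule inj_on_subset) (rule span_superset)
    then show ?thesis using D.independent_injective_image[OF that(3) inj] that(2) D_wt[of _ k 1 1]
      by (auto simp: card_image)
  qed
  have Pk: "P k (Max S)" if "k \<ge> k1" for k
    using that
  proof (induction k rule: int_ge_induct)
    case (step k)
    then obtain B where "B \<subseteq> wt k" "independent B" "finite B" "card B = Max S" unfolding P_def by blast
    then show ?case using inj_step[of k B] step.hyps k1(1) unfolding P_def
      by (intro exI[of _ "D 1 1 ` B"]) auto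
  qed (use k1 in blast)
  have "D 1 1 ` wt k = wt (k + 1)" if kk: "k \<ge> k1" for k
  proof -
    obtain B where B: "B \<subseteq> wt k" "independent B" "finite B" "card B = Max S"
      using Pk[OF kk] unfolding P_def by blast
    have "D 1 1 ` wt k = span (D 1 1 ` B)" using spn[OF _ B] kk k1(1) D.span_image by simp
    also have "\<dots> = wt (k + 1)"
      using inj_step[OF _ B(1-3)] B kk k1(1) by (intro spn) auto
    finally show ?thesis .
  qed
  moreover have "v = 0" if "k \<ge> k1" "v \<in> wt k" "D 1 1 v = 0" for k v
    using k0[of k v] that k1(1) by simp
  ultimately show ?thesis by (intro exI[of _ k1] conjI allI impI ballI) simp_all
qed

end

section \<open>The annihilating ideal of Laurent polynomials\<close>

context irreducible_ops
begin

text \<open>The f for which d_1 \<otimes> f vanishes on one weight space form a nonzero ideal. As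
  d_1 \<otimes> f commutes with d_1, and d_1 is surjective upwards, the vanishing propagates to all
  higher weights; brackets with d_(n-1) then give the degrees n \<ge> 3.\<close>

lemma annihilator_from_surjective:
  assumes ub: "unbounded_above" and k0: "wt k0 \<noteq> {0}"
    and surj: "\<And>k. k \<ge> k0 \<Longrightarrow> D 1 1 ` wt k = wt (k + 1)"
  shows "\<exists>b\<in>annihilator. b \<noteq> 0"
proof -
  define J where "J = {f. \<forall>v\<in>wt k0. D 1 f v = 0}"
  have J: "f * g \<in> J" if f: "f \<in> J" for f g
    unfolding J_def
  proof (intro CollectI ballI)
    fix v assume v: "v \<in> wt k0"
    have "D 0 g v \<in> wt k0" using D_wt[OF v, of 0 g] by simp
    then have "D 1 f (D 0 g v) = 0" "D 1 f v = 0" using f v by (auto simp: J_def)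
    then show "D 1 (f * g) v = 0" using D_0_swap[of g 1 f v] by (simp add: mult.commute)
  qed
  obtain d where d: "dim_le d (wt (k0 + 1))" using dim_le_wt by blast
  obtain n where "dim_le n (wt k0)" using dim_le_wt by blast
  then obtain B where B: "B \<subseteq> wt k0" "wt k0 \<subseteq> span B" "finite B" by (rule dim_le_basis)
  obtain Bs where Bs: "set Bs = B" using B(3) finite_list by blast
  have "\<exists>f. f \<noteq> 0 \<and> (\<forall>b\<in>set Bs. D 1 f b = 0)"
  proof (rule ccontr)
    assume *: "\<not> ?thesis"
    have "complex_vs.dim_le cscale (length (map (\<lambda>b f. D 1 f b) Bs) * d) (UNIV :: laurent set)"
    proof (rule dim_le_joint_kernel[where ?s2.0 = scale])
      fix h assume "h \<in> set (map (\<lambda>b f. D 1 f b) Bs)"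
      then obtain b where b: "b \<in> wt k0" "h = (\<lambda>f. D 1 f b)" using Bs B(1) by auto
      have "h ` UNIV \<subseteq> wt (k0 + 1)" using D_wt[OF b(1)] b(2) by auto
      then show "Vector_Spaces.linear cscale scale h \<and> dim_le d (h ` UNIV)"
        using D_lin_arg dim_le_mono[OF d order_refl] b(2) by simp
    next
      fix u :: laurent assume "\<forall>f\<in>set (map (\<lambda>b f. D 1 f b) Bs). f u = 0"
      then show "u = 0" using * by auto
    qed (simp_all add: free_vs.vector_space_axioms)
    then show False using not_dim_le_laurent by simp
  qed
  then obtain f where f: "f \<noteq> 0" "\<And>b. b \<in> B \<Longrightarrow> D 1 f b = 0" using Bs by blast
  have "span B \<subseteq> {v. D 1 f v = 0}"
    by (rule span_minimal) (use f in \<open>auto simp: subspace_def\<close>)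
  then have fJ: "f \<in> J" using B(2) by (auto simp: J_def)
  have high: "D 1 g v = 0" if "k \<ge> k0" "v \<in> wt k" "g \<in> J" for k v g
    using that(1,2)
  proof (induction k arbitrary: v rule: int_ge_induct)
    case base
    then show ?case using that(3) by (simp add: J_def)
  next
    case (step k)
    then obtain u where u: "u \<in> wt k" "v = D 1 1 u" using surj[OF step.hyps] by blast
    have "D 1 g u = 0" by (rule step.IH[OF u(1)])
    then show ?case using D_swap[of 1 1 g 1 u] u(2) by simp
  qed
  obtain v where v: "v \<in> wt k0" "v \<noteq> 0" using k0 zero_in_wt by blast
  have "kills_from J 3 v"
    unfolding kills_from_def
  proof (intro allI impI ballI)
    fix n g assume n: "(n::int) \<ge> 3" and g: "g \<in> J"
    have "D 1 g (D (n - 1) 1 v) = 0" by (rule high[OF _ D_wt[OF v(1)] g]) (use n in simp)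
    moreover have "D 1 g v = 0" by (rule high[OF _ v(1) g]) simp
    ultimately have "scale (of_int (n - 2)) (D n g v) = 0"
      using D_swap[of 1 "n - 1" g 1 v] n by simp
    moreover have "(of_int (n - 2) :: complex) \<noteq> 0" unfolding of_int_eq_0_iff using n by simp
    ultimately show "D n g v = 0" by simp
  qed
  then have "J \<subseteq> annihilator" by (intro kills_imp_annihilator[OF ub J _ v(2)])
  then show ?thesis using fJ f(1) by blast
qed

lemma wt_nonzero_high:
  assumes "unbounded_above" obtains k where "k \<ge> K" "wt k \<noteq> {0}"
  using assms unfolding unbounded_above_def by blast

text \<open>If the ideal were 0, no nonzero vector of weight -n could be killed by d_n and d_(n+1)
  alone, and symmetrically for weight n. The multiplicities would be bounded, d_1 eventually
  surjective, and the ideal nonzero after all.\<close>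

lemma annihilator_nonzero:
  assumes ub: "unbounded_above" "unbounded_below"
  shows "\<exists>b\<in>annihilator. b \<noteq> 0"
proof (rule ccontr)
  assume no: "\<not> ?thesis"
  have P: "m \<ge> 1 \<and> D m 1 v = 0"
    if "n \<ge> 1" "D n 1 v = 0" "D (n + 1) 1 v = 0" "m \<ge> n * (n + 2)" for m n :: int and v
  proof (rule sum_closed_eventually[OF that(1) _ _ _ that(4)])
    fix i j :: int assume "i \<ge> 1 \<and> D i 1 v = 0" "j \<ge> 1 \<and> D j 1 v = 0" "i \<noteq> j"
    then show "i + j \<ge> 1 \<and> D (i + j) 1 v = 0" using D_swap[of i j 1 1 v] by simp
  qed (use that in auto)
  have P': "m \<ge> 1 \<and> D (- m) 1 v = 0"
    if "n \<ge> 1" "D (- n) 1 v = 0" "D (- (n + 1)) 1 v = 0" "m \<ge> n * (n + 2)" for m n :: int and v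
  proof (rule sum_closed_eventually[OF that(1) _ _ _ that(4)])
    fix i j :: int assume "i \<ge> 1 \<and> D (- i) 1 v = 0" "j \<ge> 1 \<and> D (- j) 1 v = 0" "i \<noteq> j"
    then show "i + j \<ge> 1 \<and> D (- (i + j)) 1 v = 0" using D_swap[of "- i" "- j" 1 1 v] by simp
  qed (use that in auto)
  have "\<exists>N. bounded_dims N"
  proof (rule bounded_dims_both)
    show "\<exists>N. \<forall>n\<ge>1. dim_le N (wt (- n))"
    proof (rule bounded_negative_weights[of "[1]"])
      fix n v assume n: "(n::int) \<ge> 1" and v: "v \<in> wt (- n)" "\<forall>f\<in>set [1]. D n f v = 0 \<and> D (n + 1) f v = 0"
      show "v = 0"
      proof (rule ccontr)
        assume "v \<noteq> 0"
        then have "\<exists>b\<in>annihilator. b \<noteq> 0"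
          using v P[OF n, of v] by (intro vir_killed_imp_annihilator[OF ub(1) _ v(1), of "n * (n + 2)"]) auto
        then show False using no by simp
      qed
    qed
    show "\<exists>N. \<forall>n\<ge>1. dim_le N (wt n)"
    proof (rule mirror_bounded_positive[of "[1]"])
      fix n v assume n: "(n::int) \<ge> 1" and v: "v \<in> wt n" "\<forall>f\<in>set [1]. D (- n) f v = 0 \<and> D (- (n + 1)) f v = 0"
      show "v = 0"
      proof (rule ccontr)
        assume v0: "v \<noteq> 0"
        have "\<exists>b\<in>loop_vir_ops.annihilator (\<lambda>n f v. - D (- n) f v). b \<noteq> 0"
        proof (rule irreducible_ops.vir_killed_imp_annihilator[OF mirror _ v0])
          show "irreducible_ops.unbounded_above scale (\<lambda>n f v. - D (- n) f v) (- lam)"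
            using ub(2) by (simp add: mirror_unbounded)
          show "v \<in> irreducible_ops.wt scale (\<lambda>n f v. - D (- n) f v) (- lam) (- n)"
            using v(1) by (simp add: mirror_wt)
          show "- D (- m) 1 v = 0" if "m \<ge> n * (n + 2)" for m
            using P'[OF n _ _ that, of v] v(2) by simp
        qed
        then show False using no by (simp add: mirror_annihilator)
      qed
    qed
  qed
  then obtain N where N: "bounded_dims N" by blast
  obtain k0 where k0: "\<forall>k\<ge>k0. D 1 1 ` wt k = wt (k + 1)"
    using eventually_bijective[OF N] by (elim exE conjE)
  obtain k where k: "k \<ge> k0" "wt k \<noteq> {0}" using wt_nonzero_high[OF ub(1)] .
  have "\<exists>b\<in>annihilator. b \<noteq> 0"
    by (rule annihilator_from_surjective[OF ub(1) k(2)]) (use k0 k(1) in simp)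
  then show False using no by simp
qed

text \<open>Let W = d_0 \<otimes> f - x with x an eigenvalue. Since f^2 acts as 0, the bracket
  [W, d_n \<otimes> g] = n d_n \<otimes> f g commutes with W, so a power of W passes d_n \<otimes> g
  with only one correction term. W turns out to be nilpotent, and the image of its last nonzero
  power is killed by d_n \<otimes> f g for n \<ge> 1.\<close>

lemma annihilator_square:
  assumes ub: "unbounded_above" and N: "bounded_dims N" and ff: "f * f \<in> annihilator"
  shows "f \<in> annihilator"
proof -
  obtain u where u: "u \<in> wt 0" "u \<noteq> 0" using weight_0 zero_in_wt[of 0] by (auto simp: wt_def)
  have "dim_le N (wt 0)" using N by (simp add: bounded_dims_def)
  moreover have "D 0 f v \<in> wt 0" if "v \<in> wt 0" for v using D_wt[OF that, of 0 f] by simp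
  ultimately obtain x w where w: "w \<in> wt 0" "w \<noteq> 0" "D 0 f w = scale x w"
    using eigenvector_exists[OF D_linear[of 0 f] _ subspace_wt _ u] by blast
  define W where "W v = D 0 f v - scale x v" for v
  have W: "Vector_Spaces.linear scale scale W"
    unfolding Vector_Spaces.linear_iff using vector_space_axioms
    by (auto simp: W_def scale_right_distrib scale_right_diff_distrib scale_left_commute)
  interpret W: Vector_Spaces.linear scale scale W by (rule W)
  have pow: "Vector_Spaces.linear scale scale (W ^^ j)" for j by (rule linear_funpow[OF W])
  have W1: "W (D n g v) = D n g (W v) + scale (of_int n) (D n (f * g) v)" for n g v
    using D_0_swap[of f n g v] by (simp add: W_def)
  have W2: "W (D n (f * g) v) = D n (f * g) (W v)" for n g v
  proof -
    have "D n (f * (f * g)) v = 0" using annihilatorD[OF annihilator_mult[OF ff, of g], of n v] by (simp add: mult.assoc)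
    then show ?thesis using W1[of n "f * g" v] by simp
  qed
  have Wj: "(W ^^ Suc j) (D n g v) = D n g ((W ^^ Suc j) v) + scale (of_nat (Suc j) * of_int n) (D n (f * g) ((W ^^ j) v))" for j n g v
  proof (induction j)
    case (Suc j)
    have "(W ^^ Suc (Suc j)) (D n g v) = W (D n g ((W ^^ Suc j) v)) + scale (of_nat (Suc j) * of_int n) (W (D n (f * g) ((W ^^ j) v)))"
      using Suc by (simp add: W.add W.scale)
    also have "W (D n g ((W ^^ Suc j) v)) = D n g ((W ^^ Suc (Suc j)) v) + scale (of_int n) (D n (f * g) ((W ^^ Suc j) v))"
      using W1[of n g "(W ^^ Suc j) v"] by simp
    also have "W (D n (f * g) ((W ^^ j) v)) = D n (f * g) ((W ^^ Suc j) v)" by (simp add: W2)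
    finally have "(W ^^ Suc (Suc j)) (D n g v) = D n g ((W ^^ Suc (Suc j)) v) +
        scale (of_int n + of_nat (Suc j) * of_int n) (D n (f * g) ((W ^^ Suc j) v))"
      by (simp only: scale_left_distrib add.assoc)
    also have "of_int n + of_nat (Suc j) * of_int n = (of_nat (Suc (Suc j)) * of_int n :: complex)"
      by (simp add: algebra_simps)
    finally show ?case .
  qed (simp add: W1)
  have mono: "(W ^^ (i + j)) v = 0" if "(W ^^ j) v = 0" for i j v
  proof -
    interpret P: Vector_Spaces.linear scale scale "W ^^ i" by (rule pow)
    show ?thesis using that by (simp add: funpow_add P.zero)
  qed
  let ?N = "{v. \<exists>j. (W ^^ j) v = 0}"
  have "?N = UNIV"
  proof (rule submodule_UNIV)
    show "subspace ?N"
    proof (rule subspaceI)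
      show "0 \<in> ?N" by (auto intro!: exI[of _ 0])
      fix a b assume "a \<in> ?N" "b \<in> ?N"
      then obtain i j where "(W ^^ i) a = 0" "(W ^^ j) b = 0" by blast
      then have ab: "(W ^^ (j + i)) a = 0" "(W ^^ (i + j)) b = 0" using mono by auto
      interpret P: Vector_Spaces.linear scale scale "W ^^ (i + j)" by (rule pow)
      have "(W ^^ (i + j)) (a + b) = 0" using ab by (simp add: P.add add.commute)
      then show "a + b \<in> ?N" by blast
    next
      fix c a assume "a \<in> ?N"
      then obtain i where i: "(W ^^ i) a = 0" by blast
      interpret P: Vector_Spaces.linear scale scale "W ^^ i" by (rule pow)
      show "scale c a \<in> ?N" using i by (auto simp: P.scale intro!: exI[of _ i])
    qed
    fix n g v assume "v \<in> ?N"
    then obtain j where j: "(W ^^ j) v = 0" by blast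
    have "(W ^^ Suc j) v = 0" using mono[OF j, of 1] by simp
    then have "(W ^^ Suc j) (D n g v) = 0" unfolding Wj using j by simp
    then show "D n g v \<in> ?N" by blast
  next
    show "w \<in> ?N" using w by (auto simp: W_def intro!: exI[of _ 1])
  qed (rule w)
  then have nil: "\<exists>j. (W ^^ j) v = 0" for v by blast
  have Wwt: "W v \<in> wt k" if "v \<in> wt k" for v k
    unfolding W_def using that D_wt[OF that, of 0 f]
    by (intro subspace_diff[OF subspace_wt] subspace_scale[OF subspace_wt]) auto
  \<comment> \<open>Local nilpotency becomes nilpotency with a single exponent because N bounds all
    multiplicities.\<close>
  have WN: "(W ^^ N) v = 0" if v: "v \<in> wt k" for v k
  proof -
    obtain j where "(W ^^ j) v = 0" using nil by blast
    then show ?thesis using nilpotent_bound[OF W _ Wwt v] N by (simp add: bounded_dims_def)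
  qed
  interpret P: Vector_Spaces.linear scale scale "W ^^ N" by (rule pow)
  have "(\<Union>k. wt k) \<subseteq> {v. (W ^^ N) v = 0}" using WN by blast
  moreover have "subspace {v. (W ^^ N) v = 0}" by (auto simp: subspace_def P.zero P.add P.scale)
  ultimately have "span (\<Union>k. wt k) \<subseteq> {v. (W ^^ N) v = 0}" by (rule span_minimal)
  then have ex: "\<exists>r. \<forall>v. (W ^^ r) v = 0" using span_wt by blast
  define r where "r = (LEAST r. \<forall>v. (W ^^ r) v = 0)"
  have r: "(W ^^ r) v = 0" for v using LeastI_ex[OF ex] unfolding r_def by blast
  have "r \<noteq> 0"
  proof
    assume "r = 0"
    then show False using r[of u] u(2) by simp
  qed
  then obtain j where j: "r = Suc j" by (cases r) auto
  have "\<not> (\<forall>v. (W ^^ j) v = 0)" using not_less_Least[of j "\<lambda>r. \<forall>v. (W ^^ r) v = 0"] j unfolding r_def by simp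
  then obtain v where v: "(W ^^ j) v \<noteq> 0" by blast
  have "kills_from (range ((*) f)) 1 ((W ^^ j) v)"
    unfolding kills_from_def
  proof (intro allI impI ballI, elim rangeE)
    fix n h g assume n: "(n::int) \<ge> 1" and h: "h = f * g"
    have "scale (of_nat (Suc j) * of_int n) (D n (f * g) ((W ^^ j) v)) = 0"
      using Wj[of j n g v] r unfolding j by simp
    moreover have "(of_nat (Suc j) * of_int n :: complex) \<noteq> 0" using n by (simp del: of_nat_Suc)
    ultimately show "D n h ((W ^^ j) v) = 0" using h by (simp del: of_nat_Suc)
  qed
  then have "range ((*) f) \<subseteq> annihilator"
    by (intro kills_imp_annihilator[OF ub _ _ v]) (auto simp: mult.assoc)
  then have "f * 1 \<in> annihilator" by blast
  then show ?thesis by simp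
qed

text \<open>As f * h * f acts like f * h, the degrees in which all d_i \<otimes> f h kill v are
  closed under sums of distinct elements; two consecutive ones would put f into the
  annihilator.\<close>

lemma idempotent_up:
  assumes ub: "unbounded_above" and f: "f \<notin> annihilator" "f * f - f \<in> annihilator"
    and v: "v \<noteq> 0" and m: "m \<ge> 1"
  shows "\<exists>m'\<in>{m, m + 1}. \<exists>h. D m' (f * h) v \<noteq> 0"
proof (rule ccontr)
  assume "\<not> ?thesis"
  then have z: "D m (f * h) v = 0" "D (m + 1) (f * h) v = 0" for h by auto
  have ff: "D i (f * f * h) v = D i (f * h) v" for i h
  proof -
    have "D i ((f * f - f) * h) v = 0" using annihilatorD[OF annihilator_mult[OF f(2)]] .
    then show ?thesis by (simp add: left_diff_distrib D_diff)
  qed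
  have "n \<ge> 1 \<and> (\<forall>h. D n (f * h) v = 0)" if "n \<ge> m * (m + 2)" for n
  proof (rule sum_closed_eventually[OF m _ _ _ that])
    fix i j :: int assume i: "i \<ge> 1 \<and> (\<forall>h. D i (f * h) v = 0)" and j: "j \<ge> 1 \<and> (\<forall>h. D j (f * h) v = 0)" and ij: "i \<noteq> j"
    have "D (i + j) (f * h) v = 0" for h
    proof -
      have "D j (f * 1) v = 0" using j by blast
      then have "D j f v = 0" by simp
      then have "scale (of_int (j - i)) (D (i + j) (f * h * f) v) = 0"
        using D_swap[of i j "f * h" f v] i j by simp
      then have "D (i + j) (f * h * f) v = 0" using ij by simp
      moreover have "f * h * f = f * f * h" by (simp add: ac_simps)
      ultimately show ?thesis using ff by simp
    qed
    then show "1 \<le> i + j \<and> (\<forall>h. D (i + j) (f * h) v = 0)" using i j by auto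
  qed (use z m in auto)
  then have "kills_from (range ((*) f)) (m * (m + 2)) v"
    unfolding kills_from_def by auto
  then have "range ((*) f) \<subseteq> annihilator"
    by (intro kills_imp_annihilator[OF ub _ _ v]) (auto simp: mult.assoc)
  then have "f * 1 \<in> annihilator" by blast
  then show False using f(1) by simp
qed

text \<open>Raising by degree i with the f-part shifts the eigenvalue of d_0 \<otimes> f by i;
  lowering with the g-part leaves it unchanged and returns to weight -1, 0 or 1. If both parts acted
  nontrivially, a finite-dimensional space would carry infinitely many eigenvalues.\<close>

lemma annihilator_idempotent:
  assumes ub: "unbounded_above" "unbounded_below" and fg: "f + g = 1" "f * g \<in> annihilator"
  shows "f \<in> annihilator \<or> g \<in> annihilator"
proof (rule ccontr)
  assume "\<not> ?thesis"
  then have nf: "f \<notin> annihilator" and ng: "g \<notin> annihilator" by auto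
  have g: "g = 1 - f" using fg(1) by (metis add_diff_cancel_left')
  have "- (f * g) \<in> annihilator" using annihilator_diff[OF _ fg(2), of 0] by (simp add: annihilator_def)
  moreover have "f * f - f = - (f * g)" "g * g - g = - (f * g)"
    unfolding g by (simp_all add: algebra_simps)
  ultimately have ff: "f * f - f \<in> annihilator" and gg: "g * g - g \<in> annihilator" by simp_all
  obtain u where u: "u \<in> wt 0" "u \<noteq> 0" using weight_0 zero_in_wt[of 0] by (auto simp: wt_def)
  obtain d where d: "dim_le d (wt 0)" using dim_le_wt by blast
  moreover have "D 0 f v \<in> wt 0" if "v \<in> wt 0" for v using D_wt[OF that, of 0 f] by simp
  ultimately obtain x v where v: "v \<in> wt 0" "v \<noteq> 0" "D 0 f v = scale x v"
    using eigenvector_exists[OF D_linear[of 0 f] _ subspace_wt _ u] by blast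
  obtain d1 d2 where "dim_le d1 (wt (-1))" "dim_le d2 (wt 1)" using dim_le_wt by blast
  then have "dim_le (d1 + d + d2) (wt (-1) \<union> wt 0 \<union> wt 1)" using d by (intro dim_le_Un)
  then have fin: "finite {a. \<exists>v\<in>wt (-1) \<union> wt 0 \<union> wt 1. v \<noteq> 0 \<and> D 0 f v = scale a v}" (is "finite ?E")
    by (rule finite_eigenvalues[OF D_linear])
  have key: "\<exists>i\<ge>m. x + of_int i \<in> ?E" if m: "m \<ge> 1" for m :: int
  proof -
    obtain i h where i: "i \<in> {m, m + 1}" "D i (f * h) v \<noteq> 0" using idempotent_up[OF ub(1) nf ff v(2) m] by blast
    define y where "y = D i (f * h) v"
    have "\<exists>j\<in>{m, m + 1}. \<exists>h. - D (- j) (g * h) y \<noteq> 0"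
      by (rule irreducible_ops.idempotent_up[OF mirror]) (use ub(2) ng gg i m in \<open>simp_all add: mirror_unbounded mirror_annihilator y_def\<close>)
    then obtain j h' where j: "j \<in> {m, m + 1}" and "- D (- j) (g * h') y \<noteq> 0" by blast
    then have j2: "D (- j) (g * h') y \<noteq> 0" by simp
    have "D i (f * (f * h)) v = D i (f * h) v"
    proof -
      have "D i ((f * f - f) * h) v = 0" using annihilatorD[OF annihilator_mult[OF ff]] .
      then show ?thesis by (simp add: left_diff_distrib D_diff mult.assoc)
    qed
    then have "D 0 f y = scale (x + of_int i) y"
      unfolding y_def D_0_swap[of f i "f * h" v] v(3) by (simp add: scale_left_distrib)
    moreover have "D (- j) (f * (g * h')) y = 0"
      using annihilatorD[OF annihilator_mult[OF fg(2), of h']] by (simp add: mult.assoc)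
    ultimately have "D 0 f (D (- j) (g * h') y) = scale (x + of_int i) (D (- j) (g * h') y)"
      unfolding D_0_swap[of f "- j" "g * h'" y] by simp
    moreover have "D (- j) (g * h') y \<in> wt (0 + i + - j)" unfolding y_def by (intro D_wt v(1))
    then have "D (- j) (g * h') y \<in> wt (-1) \<union> wt 0 \<union> wt 1" using i(1) j by auto
    ultimately have "x + of_int i \<in> ?E" using j2 by blast
    moreover have "i \<ge> m" using i(1) by auto
    ultimately show ?thesis by blast
  qed
  have fin': "finite ((\<lambda>i::int. x + of_int i) -` ?E)"
    by (rule finite_vimageI[OF fin]) (auto simp: inj_on_def)
  define M where "M = Max (insert 0 ((\<lambda>i::int. x + of_int i) -` ?E))"
  have M: "i \<le> M" if "x + of_int i \<in> ?E" for i :: int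
    unfolding M_def using fin' by (rule Max_ge[OF finite.insertI]) (rule insertI2, rule vimageI2, rule that)
  obtain i where "i \<ge> max 1 (M + 1)" "x + of_int i \<in> ?E" using key[of "max 1 (M + 1)"] by auto
  then show False using M[of i] by simp
qed

text \<open>Write p = (X - \<alpha>)^r * p2. If p2 is not constant, the two coprime factors give
  complementary idempotents, and one factor alone lies in the ideal. If p2 is constant and r > 1,
  then (X - \<alpha>)^(r-1) lies in the ideal, its square being a multiple of p up to a constant.
  Both contradict minimality.\<close>

lemma annihilator_minimal_degree:
  assumes ub: "unbounded_above" "unbounded_below"
    and p: "p \<noteq> 0" "laurent_of_poly p \<in> annihilator" "degree p \<noteq> 0"
    and least: "\<And>q. q \<noteq> 0 \<Longrightarrow> laurent_of_poly q \<in> annihilator \<Longrightarrow> degree p \<le> degree q"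
  shows "degree p = 1"
proof -
  have ann_mult: "laurent_of_poly (q * r) \<in> annihilator" if "laurent_of_poly q \<in> annihilator" for q r
    unfolding laurent_of_poly_mult by (rule annihilator_mult[OF that])
  obtain \<alpha> where \<alpha>: "poly p \<alpha> = 0"
    using fundamental_theorem_of_algebra[of p] p(3) by (auto simp: constant_degree)
  define r where "r = order \<alpha> p"
  have r: "r \<ge> 1" using \<alpha> p(1) unfolding r_def by (simp add: order_root Suc_leI)
  define l where "l = [:- \<alpha>, 1:]"
  obtain p2 where p2: "p = l ^ r * p2" "\<not> l dvd p2"
    using order_decomp[OF p(1), of \<alpha>] unfolding r_def l_def by blast
  have p20: "p2 \<noteq> 0" using p2 p(1) by auto
  have dl: "degree (l ^ n) = n" for n by (simp add: l_def degree_linear_power)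
  have l0: "l ^ n \<noteq> 0" for n by (simp add: l_def)
  have dp: "degree p = r + degree p2" unfolding p2(1) using l0 p20 by (subst degree_mult_eq) (auto simp: dl)
  have "degree p2 = 0"
  proof (rule ccontr)
    assume d2: "degree p2 \<noteq> 0"
    define c where "c = poly p2 \<alpha>"
    have c: "c \<noteq> 0" using p2(2) by (simp add: c_def l_def poly_eq_0_iff_dvd)
    have "l dvd p2 - [:c:]" unfolding l_def by (simp add: c_def flip: poly_eq_0_iff_dvd)
    then obtain s where s: "p2 - [:c:] = l * s" by (rule dvdE)
    define A where "A = [:1 / c:]"
    have one: "p2 * A + l * (- s * A) = 1"
    proof -
      have "p2 * A + l * (- s * A) = (p2 - l * s) * A" by (simp add: algebra_simps)
      also have "p2 - l * s = [:c:]" using s by (simp add: algebra_simps)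
      also have "[:c:] * A = 1" using c by (simp add: A_def one_pCons)
      finally show ?thesis .
    qed
    \<comment> \<open>Raising the Bezout relation \<open>one\<close> for p2 and l to the power r
      gives one for p2 and l^r.\<close>
    have "\<exists>z. (p2 * A + l * (- s * A)) ^ n = p2 * z + (l * (- s * A)) ^ n" for n
    proof (induction n)
      case (Suc n)
      then obtain z where z: "(p2 * A + l * (- s * A)) ^ n = p2 * z + (l * (- s * A)) ^ n" by blast
      have "(p2 * A + l * (- s * A)) ^ Suc n = p2 * (A * (p2 * z + (l * (- s * A)) ^ n) + l * (- s * A) * z) + (l * (- s * A)) ^ Suc n"
        unfolding power_Suc z by (simp add: algebra_simps)
      then show ?case by blast
    qed (auto intro!: exI[of _ 0])
    then obtain z where z: "1 = p2 * z + (l * (- s * A)) ^ r" unfolding one by (metis power_one)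
    define f g where "f = laurent_of_poly ((l * (- s * A)) ^ r)" and "g = laurent_of_poly (p2 * z)"
    have fg: "f + g = 1" unfolding f_def g_def laurent_of_poly_add[symmetric] using z by (simp add: add.commute)
    have eq: "(l * (- s * A)) ^ r * (p2 * z) = p * ((- s * A) ^ r * z)"
      unfolding p2(1) power_mult_distrib by (simp add: ac_simps)
    have "f * g \<in> annihilator"
      unfolding f_def g_def laurent_of_poly_mult[symmetric] eq by (rule ann_mult[OF p(2)])
    from annihilator_idempotent[OF ub fg this] show False
    proof
      assume f: "f \<in> annihilator"
      have "l ^ r = (l * (- s * A)) ^ r * l ^ r + p * z"
      proof -
        have "l ^ r = l ^ r * (p2 * z + (l * (- s * A)) ^ r)" using z by simp
        also have "\<dots> = (l * (- s * A)) ^ r * l ^ r + p * z" unfolding p2(1) by (simp add: algebra_simps)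
        finally show ?thesis .
      qed
      then have eq: "laurent_of_poly (l ^ r) = f * laurent_of_poly (l ^ r) + laurent_of_poly (p * z)"
        unfolding f_def laurent_of_poly_mult[symmetric] laurent_of_poly_add[symmetric] by simp
      have "laurent_of_poly (l ^ r) \<in> annihilator"
        by (subst eq) (intro annihilator_add annihilator_mult f ann_mult p(2))
      then have "degree p \<le> degree (l ^ r)" using least l0 by blast
      then show False using dp dl d2 by simp
    next
      assume g: "g \<in> annihilator"
      have "p2 = p2 * z * p2 + p * (- s * A) ^ r"
      proof -
        have "p2 = (p2 * z + (l * (- s * A)) ^ r) * p2" using z by simp
        also have "\<dots> = p2 * z * p2 + p * (- s * A) ^ r" unfolding p2(1) power_mult_distrib by (simp add: algebra_simps)
        finally show ?thesis .
      qed
      then have eq: "laurent_of_poly p2 = g * laurent_of_poly p2 + laurent_of_poly (p * (- s * A) ^ r)"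
        unfolding g_def laurent_of_poly_mult[symmetric] laurent_of_poly_add[symmetric] by simp
      have "laurent_of_poly p2 \<in> annihilator"
        by (subst eq) (intro annihilator_add annihilator_mult g ann_mult p(2))
      then have "degree p \<le> degree p2" using least p20 by blast
      then show False using dp r by simp
    qed
  qed
  then obtain c where c: "p2 = [:c:]" by (rule degree_eq_zeroE)
  have c0: "c \<noteq> 0" using c p20 by auto
  have lrp: "l ^ r = p * [:1 / c:]" unfolding p2(1) c using c0 by (simp add: ac_simps)
  have lr: "laurent_of_poly (l ^ r) \<in> annihilator" unfolding lrp by (rule ann_mult[OF p(2)])
  have "r = 1"
  proof (rule ccontr)
    assume "r \<noteq> 1"
    then have "r - 1 + (r - 1) = r + (r - 2)" using r by simp
    then have eq: "l ^ (r - 1) * l ^ (r - 1) = l ^ r * l ^ (r - 2)"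
      unfolding power_add[symmetric] by (simp only:)
    have sq: "laurent_of_poly (l ^ (r - 1)) * laurent_of_poly (l ^ (r - 1)) \<in> annihilator"
      unfolding laurent_of_poly_mult[symmetric] eq by (rule ann_mult[OF lr])
    obtain b where b: "b \<in> annihilator" "b \<noteq> 0" using annihilator_nonzero[OF ub] by blast
    obtain N where "bounded_dims N" using annihilator_imp_bounded[OF ub b] ..
    then have "laurent_of_poly (l ^ (r - 1)) \<in> annihilator"
      by (rule annihilator_square[OF ub(1) _ sq])
    then have "degree p \<le> degree (l ^ (r - 1))" using least l0 by blast
    then show False using dp dl r by simp
  qed
  then show ?thesis using dp \<open>degree p2 = 0\<close> by simp
qed

text \<open>Unless the ideal is everything, a polynomial of least degree in it is linear, so t is
  congruent to a constant \<alpha>. It is nonzero because t is invertible, and all powers t^i become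
  constants.\<close>

lemma annihilator_evaluation:
  assumes ub: "unbounded_above" "unbounded_below"
  shows "\<exists>c. f - Poly_Mapping.single 0 c \<in> annihilator"
proof -
  obtain b where b: "b \<in> annihilator" "b \<noteq> 0" using annihilator_nonzero[OF ub] by blast
  obtain j p0 where j: "tpow (int j) * b = laurent_of_poly p0" using laurent_shift_poly by blast
  let ?P = "\<lambda>q. q \<noteq> 0 \<and> laurent_of_poly q \<in> annihilator"
  have "laurent_of_poly p0 \<in> annihilator"
    unfolding j[symmetric] by (subst mult.commute) (rule annihilator_mult[OF b(1)])
  moreover have "p0 \<noteq> 0"
  proof
    assume "p0 = 0"
    then have "tpow (int j) * b = 0" using j by simp
    then show False using b(2) lookup_single_eq[of "int j" "1::complex"] by auto
  qed
  ultimately have "?P p0" by simp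
  then obtain p where p: "?P p" and least: "\<And>q. ?P q \<Longrightarrow> degree p \<le> degree q"
    using ex_has_least_nat[of ?P p0 degree] by blast
  have one: "f \<in> annihilator" if "1 \<in> annihilator" for f
    using annihilator_mult[OF that, of f] by simp
  show ?thesis
  proof (cases "1 \<in> annihilator")
    case True
    then show ?thesis using one by blast
  next
    case n1: False
    have d0: "degree p \<noteq> 0"
    proof
      assume "degree p = 0"
      then obtain c where c: "p = [:c:]" by (rule degree_eq_zeroE)
      then have "Poly_Mapping.single 0 c * Poly_Mapping.single 0 (1 / c) \<in> annihilator"
        using p annihilator_mult[of "Poly_Mapping.single 0 c"] by simp
      then show False using n1 c p by (simp add: mult_single)
    qed
    have "degree p = 1"
      by (rule annihilator_minimal_degree[OF ub]) (use p least d0 in simp_all)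
    define x y where "x = coeff p 0" and "y = coeff p 1"
    have "p = [:x, y:]"
    proof (rule poly_eqI)
      fix n
      show "coeff p n = coeff [:x, y:] n"
        using coeff_eq_0[of p n] \<open>degree p = 1\<close>
        by (cases "n \<le> 1") (auto simp: x_def y_def coeff_pCons le_Suc_eq split: nat.splits)
    qed
    moreover have "y \<noteq> 0" using leading_coeff_neq_0[of p] p \<open>degree p = 1\<close> by (auto simp: y_def)
    ultimately have xy: "p = [:x, y:]" "y \<noteq> 0" by simp_all
    define \<alpha> where "\<alpha> = - x / y"
    have eq: "laurent_of_poly p * Poly_Mapping.single 0 (1 / y) = tpow 1 - Poly_Mapping.single 0 \<alpha>"
      using xy by (simp add: distrib_right mult_single \<alpha>_def single_uminus[symmetric])
    have t: "tpow 1 - Poly_Mapping.single 0 \<alpha> \<in> annihilator"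
      unfolding eq[symmetric] by (rule annihilator_mult) (use p in simp)
    have \<alpha>0: "\<alpha> \<noteq> 0"
    proof
      assume "\<alpha> = 0"
      then have "tpow 1 * tpow (-1) \<in> annihilator" using annihilator_mult[OF t, of "tpow (-1)"] by simp
      then show False using n1 by (simp add: mult_single)
    qed
    have shift: "tpow i - Poly_Mapping.single 0 a \<in> annihilator \<Longrightarrow>
        tpow (i + 1) - Poly_Mapping.single 0 (\<alpha> * a) \<in> annihilator" for i a
    proof -
      assume *: "tpow i - Poly_Mapping.single 0 a \<in> annihilator"
      have "(tpow i - Poly_Mapping.single 0 a) * tpow 1 + (tpow 1 - Poly_Mapping.single 0 \<alpha>) * Poly_Mapping.single 0 a \<in> annihilator"
        by (intro annihilator_add annihilator_mult * t)
      then show ?thesis by (simp add: left_diff_distrib mult_single)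
    qed
    have shift': "tpow (i + 1) - Poly_Mapping.single 0 (\<alpha> * a) \<in> annihilator \<Longrightarrow>
        tpow i - Poly_Mapping.single 0 a \<in> annihilator" for i a
    proof -
      assume *: "tpow (i + 1) - Poly_Mapping.single 0 (\<alpha> * a) \<in> annihilator"
      have "((tpow (i + 1) - Poly_Mapping.single 0 (\<alpha> * a)) - (tpow 1 - Poly_Mapping.single 0 \<alpha>) * tpow i) * Poly_Mapping.single 0 (1 / \<alpha>) \<in> annihilator"
        by (intro annihilator_diff annihilator_mult * t)
      then show ?thesis using \<alpha>0 by (simp add: left_diff_distrib mult_single add.commute)
    qed
    have pow: "\<exists>a. tpow i - Poly_Mapping.single 0 a \<in> annihilator" for i
    proof (induction i rule: int_induct[where k = 0])
      case base
      have "tpow 0 - Poly_Mapping.single 0 1 \<in> annihilator" by (simp add: annihilator_def)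
      then show ?case by blast
    next
      case (step1 i)
      then show ?case using shift by blast
    next
      case (step2 i)
      then obtain a where "tpow (i - 1 + 1) - Poly_Mapping.single 0 (\<alpha> * (a / \<alpha>)) \<in> annihilator"
        using \<alpha>0 by auto
      then show ?case using shift' by blast
    qed
    show ?thesis
    proof (induction f rule: poly_mapping_sum_induct)
      case zero
      then show ?case by (auto simp: annihilator_def intro!: exI[of _ 0])
    next
      case (single i c)
      obtain a where "tpow i - Poly_Mapping.single 0 a \<in> annihilator" using pow by blast
      from annihilator_mult[OF this, of "Poly_Mapping.single 0 c"]
      show ?case by (auto simp: left_diff_distrib mult_single)
    next
      case (add f g)
      then obtain c d where "f - Poly_Mapping.single 0 c \<in> annihilator" "g - Poly_Mapping.single 0 d \<in> annihilator" by blast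
      from annihilator_add[OF this] have "f + g - Poly_Mapping.single 0 (c + d) \<in> annihilator"
        by (simp add: single_add algebra_simps)
      then show ?case by blast
    qed
  qed
qed

end

section \<open>The matrix equations satisfied by \<open>d\<^sub>2\<close>\<close>

text \<open>\<open>subtop p d\<close> is the coefficient just below degree \<open>d\<close>, and 0 for \<open>d = 0\<close>.\<close>

abbreviation subtop :: "complex poly \<Rightarrow> nat \<Rightarrow> complex" where
  "subtop p d \<equiv> coeff (pCons 0 p) d"

lemma coeff_top_mult:
  fixes p q :: "complex poly"
  assumes "degree p \<le> m" "degree q \<le> n"
  shows "coeff (p * q) (m + n) = coeff p m * coeff q n"
proof -
  have "coeff (p * q) (m + n) = (\<Sum>i\<le>m + n. coeff p i * coeff q (m + n - i))" by (rule coeff_mult)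
  also have "\<dots> = (\<Sum>i\<in>{m}. coeff p i * coeff q (m + n - i))"
  proof (rule sum.mono_neutral_right)
    show "\<forall>i\<in>{..m + n} - {m}. coeff p i * coeff q (m + n - i) = 0"
    proof
      fix i assume i: "i \<in> {..m + n} - {m}"
      then consider "i < m" | "i > m" by force
      then show "coeff p i * coeff q (m + n - i) = 0"
        by cases (use i assms in \<open>auto simp: coeff_eq_0\<close>)
    qed
  qed auto
  finally show ?thesis by simp
qed

text \<open>In the equations for d_2 the leading coefficients agree automatically, so the
  information sits one degree lower. The degrees m and n are mere bounds, which lets polynomials of
  different degrees be compared at once.\<close>

lemma coeff_subtop_mult:
  fixes p q :: "complex poly"
  assumes "degree p \<le> m" "degree q \<le> n"
  shows "subtop (p * q) (m + n) = coeff p m * subtop q n + subtop p m * coeff q n"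
proof (cases m)
  case 0
  then obtain a where "p = [:a:]" using assms(1) by (metis degree_eq_zeroE le_zero_eq)
  then show ?thesis using 0 by (cases n) simp_all
next
  case m: (Suc m')
  show ?thesis
  proof (cases n)
    case 0
    then obtain a where "q = [:a:]" using assms(2) by (metis degree_eq_zeroE le_zero_eq)
    then show ?thesis using 0 m by simp
  next
    case n: (Suc n')
    have "subtop (p * q) (m + n) = (\<Sum>i\<le>Suc (m' + n'). coeff p i * coeff q (Suc (m' + n') - i))"
      by (simp add: m n coeff_mult)
    also have "\<dots> = (\<Sum>i\<in>{m', Suc m'}. coeff p i * coeff q (Suc (m' + n') - i))"
    proof (rule sum.mono_neutral_right)
      show "\<forall>i\<in>{..Suc (m' + n')} - {m', Suc m'}. coeff p i * coeff q (Suc (m' + n') - i) = 0"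
      proof
        fix i assume i: "i \<in> {..Suc (m' + n')} - {m', Suc m'}"
        then consider "i < m'" | "i > Suc m'" by force
        then show "coeff p i * coeff q (Suc (m' + n') - i) = 0"
          by cases (use i assms m n in \<open>auto simp: coeff_eq_0\<close>)
      qed
    qed auto
    also have "\<dots> = coeff p m * subtop q n + subtop p m * coeff q n"
      by (simp add: m n Suc_diff_le)
    finally show ?thesis .
  qed
qed

lemma degree_mult_le': "degree p \<le> m \<Longrightarrow> degree q \<le> n \<Longrightarrow> degree (p * q) \<le> m + n"
  for p q :: "complex poly"
  by (rule order_trans[OF degree_mult_le]) simp

lemma coeff_sum_mult_0:
  fixes f g :: "nat \<Rightarrow> complex poly"
  assumes "\<And>l. l < N \<Longrightarrow> degree (f l) \<le> e" "\<And>l. l < N \<Longrightarrow> degree (g l) \<le> d"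
  shows "coeff (\<Sum>l<N. f l * g l) (2 + e + d) = 0" "subtop (\<Sum>l<N. f l * g l) (2 + e + d) = 0"
proof -
  have "degree (\<Sum>l<N. f l * g l) \<le> e + d"
    by (rule degree_sum_le) (use assms degree_mult_le' in auto)
  then show "coeff (\<Sum>l<N. f l * g l) (2 + e + d) = 0" "subtop (\<Sum>l<N. f l * g l) (2 + e + d) = 0"
    by (simp_all add: coeff_eq_0)
qed

text \<open>A translation leaves the leading coefficient alone and becomes visible only in the next
  one; this is what separates the shifted from the unshifted terms.\<close>

lemma shift_top:
  fixes p :: "complex poly"
  assumes "degree p \<le> d"
  shows "degree (pcompose p [:s, 1:]) \<le> d \<and> coeff (pcompose p [:s, 1:]) d = coeff p d \<and>
    subtop (pcompose p [:s, 1:]) d = subtop p d + of_nat d * s * coeff p d"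
  using assms
proof (induction p arbitrary: d)
  case 0
  then show ?case by (cases d) auto
next
  case (pCons a p)
  show ?case
  proof (cases d)
    case 0
    then have "p = 0" using pCons.prems by (metis degree_pCons_eq le_zero_eq nat.distinct(1))
    then show ?thesis using 0 by simp
  next
    case (Suc e)
    then have "degree p \<le> e" using pCons.prems by (cases "p = 0") auto
    from pCons.IH[OF this] have IH: "degree (pcompose p [:s, 1:]) \<le> e" "coeff (pcompose p [:s, 1:]) e = coeff p e"
      "subtop (pcompose p [:s, 1:]) e = subtop p e + of_nat e * s * coeff p e" by auto
    have l: "degree [:s, 1:] \<le> 1" by simp
    have e: "pcompose (pCons a p) [:s, 1:] = [:a:] + [:s, 1:] * pcompose p [:s, 1:]" by (simp add: pcompose_pCons)
    have "degree ([:s, 1:] * pcompose p [:s, 1:]) \<le> 1 + e" using degree_mult_le'[OF l IH(1)] .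
    then have "degree (pcompose (pCons a p) [:s, 1:]) \<le> d"
      unfolding e Suc by (intro degree_add_le) auto
    moreover have "coeff (pcompose (pCons a p) [:s, 1:]) d = coeff (pCons a p) d"
      unfolding e Suc using coeff_top_mult[OF l IH(1)] IH(2) by simp
    moreover have "subtop (pcompose (pCons a p) [:s, 1:]) d = subtop (pCons a p) d + of_nat d * s * coeff (pCons a p) d"
    proof -
      have "subtop ([:s, 1:] * pcompose p [:s, 1:]) (1 + e) = subtop (pcompose p [:s, 1:]) e + s * coeff p e"
        unfolding coeff_subtop_mult[OF l IH(1)] using IH(2) by simp
      then have "subtop ([:s, 1:] * pcompose p [:s, 1:]) (Suc e) = subtop p e + of_nat (Suc e) * s * coeff p e"
        using IH(3) by (simp add: algebra_simps)
      then show ?thesis unfolding e Suc by (cases e) (simp_all add: algebra_simps)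
    qed
    ultimately show ?thesis by blast
  qed
qed

lemma poly_zero_on_progression:
  assumes "\<And>n. n \<ge> n0 \<Longrightarrow> poly p (k + of_nat n) = (0::complex)"
  shows "p = 0"
proof (rule ccontr)
  assume "p \<noteq> 0"
  then have "finite {x. poly p x = 0}" by (rule poly_roots_finite)
  moreover have "(\<lambda>n. k + of_nat n) ` {n0..} \<subseteq> {x. poly p x = 0}" using assms by auto
  ultimately have "finite ((\<lambda>n. k + of_nat n) ` {n0..})" by (rule finite_subset[rotated])
  then have "finite {n0..}" by (rule finite_imageD) (auto simp: inj_on_def)
  then show False by (simp add: infinite_Ici)
qed

lemma poly_eq_on_progression:
  assumes "\<And>n. n \<ge> n0 \<Longrightarrow> poly p (k + of_nat n) = (poly q (k + of_nat n) :: complex)"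
  shows "p = q"
  using poly_zero_on_progression[of n0 "p - q" k] assms by simp

text \<open>
  In the basis of the weight spaces transported by \<open>d\<^sub>1\<close>, the operator \<open>d\<^bsub>-1\<^esub>\<close> becomes
  \<open>\<kappa>\<^sup>2 - \<kappa> + C\<close> and \<open>d\<^bsub>-2\<^esub>\<close> becomes \<open>\<kappa>\<^sup>3 - 3\<kappa>\<^sup>2 + 2\<kappa> + 3\<kappa>C + E\<close> with constant matrices
  \<open>C, E\<close>; \<open>X n\<close> is the matrix of \<open>d\<^sub>2\<close> at weight \<open>\<kappa> = k + n\<close>.
\<close>

definition sq :: "complex \<Rightarrow> complex" where "sq x = x\<^sup>2 - x"
definition cub :: "complex \<Rightarrow> complex" where "cub x = x ^ 3 - 3 * x\<^sup>2 + 2 * x"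

definition sqp :: "complex \<Rightarrow> complex poly" where "sqp s = [:s * s - s, 2 * s - 1, 1:]"
definition cubp :: "complex \<Rightarrow> complex poly" where
  "cubp s = [:s ^ 3 - 3 * s\<^sup>2 + 2 * s, 3 * s\<^sup>2 - 6 * s + 2, 3 * s - 3, 1:]"

lemma poly_sqp [simp]: "poly (sqp s) x = sq (x + s)"
  by (simp add: sqp_def sq_def power2_eq_square algebra_simps)

lemma poly_cubp [simp]: "poly (cubp s) x = cub (x + s)"
  by (simp add: cubp_def cub_def power2_eq_square power3_eq_cube algebra_simps)

lemma sqp_top: "degree (sqp s) \<le> 2" "coeff (sqp s) 2 = 1" "subtop (sqp s) 2 = 2 * s - 1"
  by (simp_all add: sqp_def numeral_2_eq_2)

lemma cubp_top: "degree (cubp s) \<le> 3" "coeff (cubp s) 3 = 1" "subtop (cubp s) 3 = 3 * s - 3"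
  by (simp_all add: cubp_def numeral_3_eq_3)

text \<open>\<open>eq1\<close> is [d_(-1), d_2] = 3 d_1, with d_1 the identity matrix, and
  \<open>eq2\<close> is [d_(-2), d_2] = 4 d_0 - c / 2, with c acting by \<zeta>. The left-hand sides
  contain k + n + 2 because the lowering operator acts there after d_2.\<close>

locale d2_system =
  fixes N :: nat and k :: complex and C E :: "nat \<Rightarrow> nat \<Rightarrow> complex"
    and X :: "nat \<Rightarrow> nat \<Rightarrow> nat \<Rightarrow> complex" and \<zeta> :: complex
  assumes N: "N > 0"
    and eq1: "\<And>n i j. i < N \<Longrightarrow> j < N \<Longrightarrow> n \<ge> 1 \<Longrightarrow>
      sq (k + of_nat n + 2) * X n i j + (\<Sum>l<N. C i l * X n l j) =
      sq (k + of_nat n) * X (n - 1) i j + (\<Sum>l<N. X (n - 1) i l * C l j) + (if i = j then 3 else 0)"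
    and eq2: "\<And>n i j. i < N \<Longrightarrow> j < N \<Longrightarrow> n \<ge> 2 \<Longrightarrow>
      cub (k + of_nat n + 2) * X n i j + (\<Sum>l<N. (3 * (k + of_nat n + 2) * C i l + E i l) * X n l j) =
      cub (k + of_nat n) * X (n - 2) i j + (\<Sum>l<N. X (n - 2) i l * (3 * (k + of_nat n) * C l j + E l j)) +
      (if i = j then 4 * (k + of_nat n) - \<zeta> / 2 else 0)"
begin

definition J :: "(nat \<times> nat \<times> nat) set" where "J = {..<3} \<times> {..<N} \<times> {..<N}"

text \<open>
  The unknowns \<open>y (u, _, _)\<close>, \<open>u = 0, 1, 2\<close>, stand for \<open>X n\<close>, \<open>X (n - 1)\<close>, \<open>X (n - 2)\<close>; rows
  0 and 1 are the first equation at \<open>n\<close> and \<open>n - 1\<close>, row 2 is the second one at \<open>n\<close>.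
\<close>

definition row :: "(nat \<Rightarrow> nat \<Rightarrow> 'a::comm_ring_1) \<Rightarrow> (nat \<Rightarrow> nat \<Rightarrow> nat \<Rightarrow> 'a) \<Rightarrow> (nat \<Rightarrow> nat \<Rightarrow> nat \<Rightarrow> 'a) \<Rightarrow>
    nat \<times> nat \<times> nat \<Rightarrow> (nat \<times> nat \<times> nat \<Rightarrow> 'a) \<Rightarrow> 'a" where
  "row a A B r y = (case r of (t, i, j) \<Rightarrow>
     let u = (if t = 1 then 1 else 0); v = (if t = 0 then 1 else 2) in
     a t 0 * y (u, i, j) + (\<Sum>l<N. A t i l * y (u, l, j)) -
     (a t 1 * y (v, i, j) + (\<Sum>l<N. y (v, i, l) * B t l j)))"

lemma row_linear_combination:
  assumes "r \<in> J"
  shows "row a A B r y = (\<Sum>c\<in>J. row a A B r (\<lambda>c'. if c' = c then 1 else 0) * y c)"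
proof -
  obtain t i j where r: "r = (t, i, j)" "t < 3" "i < N" "j < N" using assms by (auto simp: J_def)
  have fin: "finite J" by (simp add: J_def)
  have d: "(\<Sum>c\<in>J. f * (if c0 = c then 1 else 0) * y c) = f * y c0" if "c0 \<in> J" for c0 and f :: 'a
  proof -
    have "(\<Sum>c\<in>J. f * (if c0 = c then 1 else 0) * y c) = (\<Sum>c\<in>J. if c0 = c then f * y c else 0)"
      by (rule sum.cong) auto
    also have "\<dots> = f * y c0" using fin that by simp
    finally show ?thesis .
  qed
  have d': "(\<Sum>c\<in>J. \<Sum>l<N. f l * (if c0 l = c then 1 else 0) * y c) = (\<Sum>l<N. f l * y (c0 l))"
    if "\<And>l. l < N \<Longrightarrow> c0 l \<in> J" for c0 :: "nat \<Rightarrow> nat \<times> nat \<times> nat" and f :: "nat \<Rightarrow> 'a"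
    by (subst sum.swap) (intro sum.cong refl d, use that in auto)
  define u v where "u = (if t = 1 then 1 else 0 :: nat)" and "v = (if t = 0 then 1 else 2 :: nat)"
  have J: "(u, i, j) \<in> J" "(v, i, j) \<in> J" "l < N \<Longrightarrow> (u, l, j) \<in> J" "l < N \<Longrightarrow> (v, i, l) \<in> J" for l
    using r by (auto simp: J_def u_def v_def)
  have row: "row a A B r y = a t 0 * y (u, i, j) + (\<Sum>l<N. A t i l * y (u, l, j)) -
     (a t 1 * y (v, i, j) + (\<Sum>l<N. B t l j * y (v, i, l)))" for y
    unfolding row_def r(1) u_def v_def by (simp add: Let_def mult.commute)
  have "(\<Sum>c\<in>J. row a A B r (\<lambda>c'. if c' = c then 1 else 0) * y c) =
    (\<Sum>c\<in>J. a t 0 * (if (u, i, j) = c then 1 else 0) * y c)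
    + (\<Sum>c\<in>J. \<Sum>l<N. A t i l * (if (u, l, j) = c then 1 else 0) * y c)
    - ((\<Sum>c\<in>J. a t 1 * (if (v, i, j) = c then 1 else 0) * y c)
    + (\<Sum>c\<in>J. \<Sum>l<N. B t l j * (if (v, i, l) = c then 1 else 0) * y c))"
    unfolding row
    by (simp only: left_diff_distrib distrib_right sum_subtractf sum.distrib sum_distrib_right)
  also have "\<dots> = row a A B r y"
    unfolding row by (simp only: d[OF J(1)] d[OF J(2)] d'[OF J(3)] d'[OF J(4)])
  finally show ?thesis ..
qed

text \<open>The second index is 0 for left-hand and 1 for right-hand sides. Row 1 is taken at weight
  \<kappa> - 1, hence the shifts 1 and -1 in place of 2 and 0; the entry 6 C comes from 3 (\<kappa>
  + 2) C.\<close>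

definition pa :: "nat \<Rightarrow> nat \<Rightarrow> complex poly" where
  "pa t s = (if s = 0 then [sqp 2, sqp 1, cubp 2] ! t else [sqp 0, sqp (-1), cubp 0] ! t)"
definition pA :: "nat \<Rightarrow> nat \<Rightarrow> nat \<Rightarrow> complex poly" where
  "pA t i l = (if t = 2 then [:6 * C i l + E i l, 3 * C i l:] else [:C i l:])"
definition pB :: "nat \<Rightarrow> nat \<Rightarrow> nat \<Rightarrow> complex poly" where
  "pB t l j = (if t = 2 then [:E l j, 3 * C l j:] else [:C l j:])"

text \<open>In the maximal degree d all rows equate leading coefficients, so the three unknowns
  share one leading coefficient a. Their next coefficients p, q, r satisfy q = p + 4 a and r = q + 4
  a by rows 0 and 1, but r = p + 6 a by row 2; hence a = 0.\<close>

lemma row_injective: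
  assumes y: "\<forall>r\<in>J. row pa pA pB r y = 0"
  shows "\<forall>c\<in>J. y c = 0"
proof (rule ccontr)
  assume "\<not> ?thesis"
  then obtain c1 where c1: "c1 \<in> J" "y c1 \<noteq> 0" by blast
  have fin: "finite J" "J \<noteq> {}" using c1 by (auto simp: J_def)
  define d where "d = Max ((\<lambda>c. degree (y c)) ` J)"
  have d: "degree (y c) \<le> d" if "c \<in> J" for c unfolding d_def using fin that by auto
  have "d \<in> (\<lambda>c. degree (y c)) ` J" unfolding d_def using fin by (intro Max_in) auto
  then obtain c2 where c2: "c2 \<in> J" "degree (y c2) = d" by blast
  have 0: "coeff (y (0, i, j)) d = 0 \<and> coeff (y (1, i, j)) d = 0 \<and> coeff (y (2, i, j)) d = 0"
    if ij: "i < N" "j < N" for i j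
  proof -
    have J: "(u, i', j') \<in> J" if "u < 3" "i' < N" "j' < N" for u i' j' using that by (simp add: J_def)
    have A: "degree (pA t i l) \<le> (if t = 2 then 1 else 0)" "degree (pB t i l) \<le> (if t = 2 then 1 else 0)" for t i l
      by (auto simp: pA_def pB_def)
    have top: "coeff (pa t s * y c) (2 + (if t = 2 then 1 else 0) + d) = coeff (y c) d"
      "subtop (pa t s * y c) (2 + (if t = 2 then 1 else 0) + d) = subtop (y c) d + subtop (pa t s) (2 + (if t = 2 then 1 else 0)) * coeff (y c) d"
      if "t < 3" "s < 2" "c \<in> J" for t s c
    proof -
      have "t = 0 \<or> t = 1 \<or> t = 2" "s = 0 \<or> s = 1" using that by auto
      then have p: "degree (pa t s) \<le> 2 + (if t = 2 then 1 else 0)" "coeff (pa t s) (2 + (if t = 2 then 1 else 0)) = 1"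
        by (auto simp: pa_def sqp_def cubp_def)
      show "coeff (pa t s * y c) (2 + (if t = 2 then 1 else 0) + d) = coeff (y c) d"
        unfolding coeff_top_mult[OF p(1) d[OF that(3)]] p(2) by simp
      show "subtop (pa t s * y c) (2 + (if t = 2 then 1 else 0) + d) = subtop (y c) d + subtop (pa t s) (2 + (if t = 2 then 1 else 0)) * coeff (y c) d"
        unfolding coeff_subtop_mult[OF p(1) d[OF that(3)]] p(2) by simp
    qed
    have eq: "coeff (y (if t = 1 then 1 else 0, i, j)) d = coeff (y (if t = 0 then 1 else 2, i, j)) d \<and>
      subtop (y (if t = 1 then 1 else 0, i, j)) d + subtop (pa t 0) (2 + (if t = 2 then 1 else 0)) * coeff (y (if t = 1 then 1 else 0, i, j)) d =
      subtop (y (if t = 0 then 1 else 2, i, j)) d + subtop (pa t 1) (2 + (if t = 2 then 1 else 0)) * coeff (y (if t = 0 then 1 else 2, i, j)) d"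
      if t: "t < 3" for t
    proof -
      define u v e where "u = (if t = 1 then 1 else 0 :: nat)" and "v = (if t = 0 then 1 else 2 :: nat)"
        and "e = (if t = 2 then 1 else 0 :: nat)"
      have uv: "u < 3" "v < 3" by (auto simp: u_def v_def)
      have "row pa pA pB (t, i, j) y = 0" using y J[OF t ij] by blast
      then have r: "pa t 0 * y (u, i, j) + (\<Sum>l<N. pA t i l * y (u, l, j)) =
         pa t 1 * y (v, i, j) + (\<Sum>l<N. pB t l j * y (v, i, l))"
        by (simp add: row_def Let_def u_def v_def mult.commute)
      have A': "\<And>l. degree (pA t i l) \<le> e" "\<And>l. degree (pB t l j) \<le> e"
        using A by (simp_all add: e_def)
      have g: "\<And>l. l < N \<Longrightarrow> degree (y (u, l, j)) \<le> d" "\<And>l. l < N \<Longrightarrow> degree (y (v, i, l)) \<le> d"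
        using d[OF J] uv ij by simp_all
      have s1: "coeff (\<Sum>l<N. pA t i l * y (u, l, j)) (2 + e + d) = 0"
        "subtop (\<Sum>l<N. pA t i l * y (u, l, j)) (2 + e + d) = 0"
        by (rule coeff_sum_mult_0[OF A'(1) g(1)]; assumption)+
      have s2: "coeff (\<Sum>l<N. pB t l j * y (v, i, l)) (2 + e + d) = 0"
        "subtop (\<Sum>l<N. pB t l j * y (v, i, l)) (2 + e + d) = 0"
        by (rule coeff_sum_mult_0[OF A'(2) g(2)]; assumption)+
      have "coeff (pa t 0 * y (u, i, j) + (\<Sum>l<N. pA t i l * y (u, l, j))) (2 + e + d) = coeff (y (u, i, j)) d"
        unfolding coeff_add s1 using top(1)[OF t, of 0 "(u, i, j)"] J[OF uv(1) ij] by (simp add: e_def)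
      moreover have "coeff (pa t 1 * y (v, i, j) + (\<Sum>l<N. pB t l j * y (v, i, l))) (2 + e + d) = coeff (y (v, i, j)) d"
        unfolding coeff_add s2 using top(1)[OF t, of 1 "(v, i, j)"] J[OF uv(2) ij] by (simp add: e_def)
      moreover have pC: "pCons 0 (p + q) = pCons 0 p + pCons 0 q" for p q :: "complex poly" by simp
      have "subtop (pa t 0 * y (u, i, j) + (\<Sum>l<N. pA t i l * y (u, l, j))) (2 + e + d) =
          subtop (y (u, i, j)) d + subtop (pa t 0) (2 + e) * coeff (y (u, i, j)) d"
        unfolding pC coeff_add s1 using top(2)[OF t, of 0 "(u, i, j)"] J[OF uv(1) ij] unfolding e_def by (simp only: add_0_right)
      moreover have "subtop (pa t 1 * y (v, i, j) + (\<Sum>l<N. pB t l j * y (v, i, l))) (2 + e + d) =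
          subtop (y (v, i, j)) d + subtop (pa t 1) (2 + e) * coeff (y (v, i, j)) d"
        unfolding pC coeff_add s2 using top(2)[OF t, of 1 "(v, i, j)"] J[OF uv(2) ij] unfolding e_def by (simp only: add_0_right)
      ultimately show ?thesis unfolding r u_def[symmetric] v_def[symmetric] e_def[symmetric] by simp
    qed
    have s: "coeff (pa 0 0) (Suc 0) = 3" "coeff (pa 0 (Suc 0)) (Suc 0) = - 1"
      "coeff (pa (Suc 0) 0) (Suc 0) = 1" "coeff (pa (Suc 0) (Suc 0)) (Suc 0) = - 3"
      "coeff (pa 2 0) (Suc (Suc 0)) = 3" "coeff (pa 2 (Suc 0)) (Suc (Suc 0)) = - 3"
      by (simp_all add: pa_def sqp_def cubp_def)
    have s': "subtop (pa 0 0) 2 = 3" "subtop (pa 0 (Suc 0)) 2 = - 1"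
      "subtop (pa (Suc 0) 0) 2 = 1" "subtop (pa (Suc 0) (Suc 0)) 2 = - 3"
      "subtop (pa 2 0) 3 = 3" "subtop (pa 2 (Suc 0)) 3 = - 3"
      by (simp_all add: pa_def sqp_def cubp_def numeral_2_eq_2 numeral_3_eq_3)
    have elim: "a = 0" if "p + 3 * a = q - a" "q + a = r - 3 * a" "6 * a + p = r" for a p q r :: complex
      using that by algebra
    from eq[of 0] eq[of 1] eq[of 2] show ?thesis
      by (simp add: s s') (metis elim)
  qed
  have "coeff (y c2) d = 0" using 0 c2(1) by (auto simp: J_def less_Suc_eq numeral_3_eq_3 numeral_2_eq_2)
  \<comment> \<open>All coefficients in degree d vanish, so an unknown attaining the degree d is 0.
    Then d = 0, and the unknowns are constants with vanishing coefficient.\<close>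
  then have "y c2 = 0" "d = 0" using c2(2) by (metis leading_coeff_0_iff, metis leading_coeff_0_iff degree_0)
  then have "coeff (y c1) 0 = 0" using 0 c1(1) by (auto simp: J_def less_Suc_eq numeral_3_eq_3 numeral_2_eq_2)
  moreover have "degree (y c1) = 0" using d[OF c1(1)] \<open>d = 0\<close> by simp
  ultimately show False using c1(2) by (metis leading_coeff_0_iff)
qed

end

section \<open>d_2 as a rational function of the weight\<close>

context d2_system
begin

text \<open>The polynomial g is a common denominator and Y the matrix of numerators along the
  progression k + n. Only large n count, so a common linear factor can be cancelled even if its root
  lies on the progression.\<close>

definition rational_form :: "complex poly \<Rightarrow> (nat \<Rightarrow> nat \<Rightarrow> complex poly) \<Rightarrow> bool" where
  "rational_form g Y \<longleftrightarrow> g \<noteq> 0 \<and> (\<exists>n0. \<forall>n\<ge>n0. \<forall>i<N. \<forall>j<N.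
     poly g (k + of_nat n) * X n i j = poly (Y i j) (k + of_nat n))"

text \<open>The coefficient matrix over the polynomials has trivial kernel; its left inverse up to
  g, applied to the right-hand sides, solves for d_2 at all weights simultaneously.\<close>

lemma rational_exists: "\<exists>g Y. rational_form g Y"
proof -
  define a where "a r c = row pa pA pB r (\<lambda>c'. if c' = c then 1 else 0)" for r c
  have fin: "finite J" by (simp add: J_def)
  have "\<exists>g c. g \<noteq> 0 \<and> (\<forall>i\<in>J. \<forall>j\<in>J. (\<Sum>r\<in>J. c i r * a r j) = (if i = j then g else 0))"
  proof (rule left_inverse_up_to_scalar[OF fin fin])
    fix y assume "\<forall>r\<in>J. (\<Sum>j\<in>J. a r j * y j) = 0"
    then have "\<forall>r\<in>J. row pa pA pB r y = 0"
      by (simp add: a_def row_linear_combination[symmetric])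
    then show "\<forall>j\<in>J. y j = 0" by (rule row_injective)
  qed
  then obtain g c where g: "g \<noteq> 0" and c: "\<And>i j. i \<in> J \<Longrightarrow> j \<in> J \<Longrightarrow> (\<Sum>r\<in>J. c i r * a r j) = (if i = j then g else 0)"
    by blast
  define rhs :: "nat \<times> nat \<times> nat \<Rightarrow> complex poly" where
    "rhs r = (case r of (t, i, j) \<Rightarrow> if i = j then (if t = 2 then [:- \<zeta> / 2, 4:] else [:3:]) else 0)" for r
  define Y where "Y i j = (\<Sum>r\<in>J. c (0, i, j) r * rhs r)" for i j
  have "poly g (k + of_nat n) * X n i j = poly (Y i j) (k + of_nat n)" if n: "n \<ge> 2" and ij: "i < N" "j < N" for n i j
  proof -
    define x where "x c = (case c of (u, i, j) \<Rightarrow> X (n - u) i j)" for c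
    define \<kappa> where "\<kappa> = k + of_nat n"
    have x0: "x (0, i, j) = X n i j" "x (1, i, j) = X (n - 1) i j" "x (2, i, j) = X (n - 2) i j" for i j
      by (simp_all add: x_def)
    have r: "(\<Sum>c\<in>J. poly (a r c) \<kappa> * x c) = poly (rhs r) \<kappa>" if r: "r \<in> J" for r
    proof -
      obtain t i j where tij: "r = (t, i, j)" "t < 3" "i < N" "j < N" using r by (auto simp: J_def)
      have "poly (a r c) \<kappa> = row (\<lambda>t s. poly (pa t s) \<kappa>) (\<lambda>t i l. poly (pA t i l) \<kappa>) (\<lambda>t l j. poly (pB t l j) \<kappa>) r
          (\<lambda>c'. if c' = c then 1 else 0)" for c
        unfolding a_def row_def tij(1)
        by (simp add: Let_def poly_sum if_distrib[of "\<lambda>p. poly p \<kappa>"] cong: if_cong)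
      then have "(\<Sum>c\<in>J. poly (a r c) \<kappa> * x c) = row (\<lambda>t s. poly (pa t s) \<kappa>) (\<lambda>t i l. poly (pA t i l) \<kappa>) (\<lambda>t l j. poly (pB t l j) \<kappa>) r x"
        by (simp only: row_linear_combination[OF r, symmetric])
      also have "\<dots> = poly (rhs r) \<kappa>"
      proof -
        have t: "t = 0 \<or> t = 1 \<or> t = 2" using tij(2) by auto
        have k1: "k + of_nat (n - 1) = \<kappa> - 1" using n by (simp add: \<kappa>_def of_nat_diff)
        have n1: "n - 1 - 1 = n - 2" by simp
        have e0: "sq (\<kappa> + 2) * X n i j + (\<Sum>l<N. C i l * X n l j) =
          sq \<kappa> * X (n - 1) i j + (\<Sum>l<N. X (n - 1) i l * C l j) + (if i = j then 3 else 0)"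
          using eq1[OF tij(3,4), of n] n by (simp add: \<kappa>_def)
        have e1: "sq (\<kappa> + 1) * X (n - 1) i j + (\<Sum>l<N. C i l * X (n - 1) l j) =
          sq (\<kappa> - 1) * X (n - 2) i j + (\<Sum>l<N. X (n - 2) i l * C l j) + (if i = j then 3 else 0)"
          using eq1[OF tij(3,4), of "n - 1"] n unfolding k1 n1 by (simp add: algebra_simps)
        have e2: "cub (\<kappa> + 2) * X n i j + (\<Sum>l<N. (3 * (\<kappa> + 2) * C i l + E i l) * X n l j) =
          cub \<kappa> * X (n - 2) i j + (\<Sum>l<N. X (n - 2) i l * (3 * \<kappa> * C l j + E l j)) +
          (if i = j then 4 * \<kappa> - \<zeta> / 2 else 0)"
          using eq2[OF tij(3,4) n] by (simp add: \<kappa>_def)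
        from t show ?thesis
        proof (elim disjE)
          assume "t = 0"
          then show ?thesis using e0 by (simp add: row_def tij(1) pa_def pA_def pB_def rhs_def x_def)
        next
          assume "t = 1"
          then show ?thesis using e1 by (simp add: row_def tij(1) pa_def pA_def pB_def rhs_def x_def)
        next
          assume t2: "t = 2"
          have A: "(\<Sum>l<N. poly (pA 2 i l) \<kappa> * X n l j) = (\<Sum>l<N. (3 * (\<kappa> + 2) * C i l + E i l) * X n l j)"
            by (rule sum.cong) (simp_all add: pA_def algebra_simps)
          have B: "(\<Sum>l<N. X (n - 2) i l * poly (pB 2 l j) \<kappa>) = (\<Sum>l<N. X (n - 2) i l * (3 * \<kappa> * C l j + E l j))"
            by (rule sum.cong) (simp_all add: pB_def algebra_simps)
          have "row (\<lambda>t s. poly (pa t s) \<kappa>) (\<lambda>t i l. poly (pA t i l) \<kappa>) (\<lambda>t l j. poly (pB t l j) \<kappa>) r x =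
             cub (\<kappa> + 2) * X n i j + (\<Sum>l<N. poly (pA 2 i l) \<kappa> * X n l j) -
             (cub \<kappa> * X (n - 2) i j + (\<Sum>l<N. X (n - 2) i l * poly (pB 2 l j) \<kappa>))"
            using t2 by (simp add: row_def tij(1) pa_def x_def)
          also have "\<dots> = (if i = j then 4 * \<kappa> - \<zeta> / 2 else 0)" unfolding A B using e2 by simp
          finally show ?thesis using t2 by (simp add: tij(1) rhs_def)
        qed
      qed
      finally show ?thesis .
    qed
    have cJ: "(0, i, j) \<in> J" using ij by (simp add: J_def)
    have "poly (Y i j) \<kappa> = (\<Sum>r\<in>J. poly (c (0, i, j) r) \<kappa> * (\<Sum>d\<in>J. poly (a r d) \<kappa> * x d))"
      unfolding Y_def poly_sum poly_mult by (intro sum.cong refl) (simp add: r)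
    also have "\<dots> = (\<Sum>d\<in>J. (\<Sum>r\<in>J. poly (c (0, i, j) r) \<kappa> * poly (a r d) \<kappa>) * x d)"
      unfolding sum_distrib_left sum_distrib_right by (subst sum.swap) (simp add: mult.assoc)
    also have "\<dots> = (\<Sum>d\<in>J. (if (0, i, j) = d then poly g \<kappa> else 0) * x d)"
    proof (rule sum.cong)
      fix d assume d: "d \<in> J"
      have "(\<Sum>r\<in>J. poly (c (0, i, j) r) \<kappa> * poly (a r d) \<kappa>) = poly (\<Sum>r\<in>J. c (0, i, j) r * a r d) \<kappa>"
        by (simp add: poly_sum)
      also have "\<dots> = (if (0, i, j) = d then poly g \<kappa> else 0)" unfolding c[OF cJ d] by simp
      finally show "(\<Sum>r\<in>J. poly (c (0, i, j) r) \<kappa> * poly (a r d) \<kappa>) * x d = (if (0, i, j) = d then poly g \<kappa> else 0) * x d"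
        by simp
    qed simp
    also have "\<dots> = (\<Sum>d\<in>J. if (0, i, j) = d then poly g \<kappa> * x d else 0)" by (rule sum.cong) auto
    also have "\<dots> = poly g \<kappa> * X n i j" using fin cJ by (simp add: x_def)
    finally show ?thesis by (simp add: \<kappa>_def)
  qed
  then show ?thesis unfolding rational_form_def using g by blast
qed

text \<open>After multiplication by both denominators the recurrence holds at infinitely many
  points, hence as an identity of polynomials, which may be evaluated at the roots of g.\<close>

lemma rational_identity1:
  assumes "rational_form g Y" and ij: "i < N" "j < N"
  shows "pcompose g [:-1, 1:] * (sqp 2 * Y i j + (\<Sum>l<N. [:C i l:] * Y l j)) =
    g * (sqp 0 * pcompose (Y i j) [:-1, 1:] + (\<Sum>l<N. [:C l j:] * pcompose (Y i l) [:-1, 1:])) +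
    (if i = j then [:3:] * g * pcompose g [:-1, 1:] else 0)"
proof -
  obtain n0 where n0: "\<And>n i j. n \<ge> n0 \<Longrightarrow> i < N \<Longrightarrow> j < N \<Longrightarrow> poly (Y i j) (k + of_nat n) = poly g (k + of_nat n) * X n i j"
    using assms(1) unfolding rational_form_def by metis
  show ?thesis
  proof (rule poly_eq_on_progression[of "n0 + 1" _ k])
    fix n assume n: "n \<ge> n0 + 1"
    define \<kappa> where "\<kappa> = k + of_nat n"
    have k1: "k + of_nat (n - 1) = \<kappa> - 1" using n by (simp add: \<kappa>_def of_nat_diff)
    have Y0: "poly (Y i j) \<kappa> = poly g \<kappa> * X n i j" if "i < N" "j < N" for i j
      using n0[of n i j] that n by (simp add: \<kappa>_def)
    have Y1: "poly (Y i j) (\<kappa> - 1) = poly g (\<kappa> - 1) * X (n - 1) i j" if "i < N" "j < N" for i j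
      using n0[of "n - 1" i j] that n unfolding k1 by simp
    have e: "sq (\<kappa> + 2) * X n i j + (\<Sum>l<N. C i l * X n l j) =
          sq \<kappa> * X (n - 1) i j + (\<Sum>l<N. X (n - 1) i l * C l j) + (if i = j then 3 else 0)"
      using eq1[OF ij, of n] n by (simp add: \<kappa>_def)
    have s0: "(\<Sum>l<N. C i l * poly (Y l j) \<kappa>) = poly g \<kappa> * (\<Sum>l<N. C i l * X n l j)"
      unfolding sum_distrib_left by (rule sum.cong) (use Y0 ij in simp_all)
    have s1: "(\<Sum>l<N. C l j * poly (Y i l) (\<kappa> - 1)) = poly g (\<kappa> - 1) * (\<Sum>l<N. X (n - 1) i l * C l j)"
      unfolding sum_distrib_left by (rule sum.cong) (use Y1 ij in simp_all)
    have "poly g (\<kappa> - 1) * (sq (\<kappa> + 2) * poly (Y i j) \<kappa> + (\<Sum>l<N. C i l * poly (Y l j) \<kappa>)) =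
      poly g (\<kappa> - 1) * poly g \<kappa> * (sq (\<kappa> + 2) * X n i j + (\<Sum>l<N. C i l * X n l j))"
      unfolding s0 Y0[OF ij] by (simp add: algebra_simps)
    also have "\<dots> = poly g \<kappa> * (sq \<kappa> * poly (Y i j) (\<kappa> - 1) + (\<Sum>l<N. C l j * poly (Y i l) (\<kappa> - 1)))
       + (if i = j then 3 * poly g \<kappa> * poly g (\<kappa> - 1) else 0)"
      unfolding s1 Y1[OF ij] e by (simp add: algebra_simps)
    finally show "poly (pcompose g [:-1, 1:] * (sqp 2 * Y i j + (\<Sum>l<N. [:C i l:] * Y l j))) (k + of_nat n) =
      poly (g * (sqp 0 * pcompose (Y i j) [:-1, 1:] + (\<Sum>l<N. [:C l j:] * pcompose (Y i l) [:-1, 1:])) +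
      (if i = j then [:3:] * g * pcompose g [:-1, 1:] else 0)) (k + of_nat n)"
      unfolding \<kappa>_def[symmetric] by (simp add: poly_pcompose poly_sum if_distrib[of "\<lambda>p. poly p \<kappa>"] mult.assoc cong: if_cong)
  qed
qed

lemma rational_identity2:
  assumes "rational_form g Y" and ij: "i < N" "j < N"
  shows "pcompose g [:-2, 1:] * (cubp 2 * Y i j + (\<Sum>l<N. [:6 * C i l + E i l, 3 * C i l:] * Y l j)) =
    g * (cubp 0 * pcompose (Y i j) [:-2, 1:] + (\<Sum>l<N. [:E l j, 3 * C l j:] * pcompose (Y i l) [:-2, 1:])) +
    (if i = j then [:- \<zeta> / 2, 4:] * g * pcompose g [:-2, 1:] else 0)"
proof -
  obtain n0 where n0: "\<And>n i j. n \<ge> n0 \<Longrightarrow> i < N \<Longrightarrow> j < N \<Longrightarrow> poly (Y i j) (k + of_nat n) = poly g (k + of_nat n) * X n i j"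
    using assms(1) unfolding rational_form_def by metis
  show ?thesis
  proof (rule poly_eq_on_progression[of "n0 + 2" _ k])
    fix n assume n: "n \<ge> n0 + 2"
    define \<kappa> where "\<kappa> = k + of_nat n"
    have k1: "k + of_nat (n - 2) = \<kappa> - 2" using n by (simp add: \<kappa>_def of_nat_diff)
    have Y0: "poly (Y i j) \<kappa> = poly g \<kappa> * X n i j" if "i < N" "j < N" for i j
      using n0[of n i j] that n by (simp add: \<kappa>_def)
    have Y1: "poly (Y i j) (\<kappa> - 2) = poly g (\<kappa> - 2) * X (n - 2) i j" if "i < N" "j < N" for i j
      using n0[of "n - 2" i j] that n unfolding k1 by simp
    have e: "cub (\<kappa> + 2) * X n i j + (\<Sum>l<N. (3 * (\<kappa> + 2) * C i l + E i l) * X n l j) =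
          cub \<kappa> * X (n - 2) i j + (\<Sum>l<N. X (n - 2) i l * (3 * \<kappa> * C l j + E l j)) +
          (if i = j then 4 * \<kappa> - \<zeta> / 2 else 0)"
      using eq2[OF ij, of n] n by (simp add: \<kappa>_def)
    have s0: "(\<Sum>l<N. poly [:6 * C i l + E i l, 3 * C i l:] \<kappa> * poly (Y l j) \<kappa>) = poly g \<kappa> * (\<Sum>l<N. (3 * (\<kappa> + 2) * C i l + E i l) * X n l j)"
      unfolding sum_distrib_left by (rule sum.cong) (use Y0 ij in \<open>simp_all add: algebra_simps\<close>)
    have s1: "(\<Sum>l<N. poly [:E l j, 3 * C l j:] \<kappa> * poly (Y i l) (\<kappa> - 2)) = poly g (\<kappa> - 2) * (\<Sum>l<N. X (n - 2) i l * (3 * \<kappa> * C l j + E l j))"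
      unfolding sum_distrib_left by (rule sum.cong) (use Y1 ij in \<open>simp_all add: algebra_simps\<close>)
    have "poly g (\<kappa> - 2) * (cub (\<kappa> + 2) * poly (Y i j) \<kappa> + (\<Sum>l<N. poly [:6 * C i l + E i l, 3 * C i l:] \<kappa> * poly (Y l j) \<kappa>)) =
      poly g (\<kappa> - 2) * poly g \<kappa> * (cub (\<kappa> + 2) * X n i j + (\<Sum>l<N. (3 * (\<kappa> + 2) * C i l + E i l) * X n l j))"
      unfolding s0 Y0[OF ij] by (simp add: algebra_simps)
    also have "\<dots> = poly g \<kappa> * (cub \<kappa> * poly (Y i j) (\<kappa> - 2) + (\<Sum>l<N. poly [:E l j, 3 * C l j:] \<kappa> * poly (Y i l) (\<kappa> - 2)))
       + (if i = j then (4 * \<kappa> - \<zeta> / 2) * (poly g \<kappa> * poly g (\<kappa> - 2)) else 0)"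
      unfolding s1 Y1[OF ij] e by (simp add: algebra_simps)
    finally have *: "poly g (\<kappa> - 2) * (cub (\<kappa> + 2) * poly (Y i j) \<kappa> + (\<Sum>l<N. poly [:6 * C i l + E i l, 3 * C i l:] \<kappa> * poly (Y l j) \<kappa>)) =
      poly g \<kappa> * (cub \<kappa> * poly (Y i j) (\<kappa> - 2) + (\<Sum>l<N. poly [:E l j, 3 * C l j:] \<kappa> * poly (Y i l) (\<kappa> - 2)))
       + (if i = j then (4 * \<kappa> - \<zeta> / 2) * (poly g \<kappa> * poly g (\<kappa> - 2)) else 0)" .
    have sh: "poly (pcompose p [:-2, 1:]) \<kappa> = poly p (\<kappa> - 2)" for p by (simp add: poly_pcompose)
    have l: "poly [:- \<zeta> / 2, 4:] \<kappa> = 4 * \<kappa> - \<zeta> / 2" by simp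
    show "poly (pcompose g [:-2, 1:] * (cubp 2 * Y i j + (\<Sum>l<N. [:6 * C i l + E i l, 3 * C i l:] * Y l j))) (k + of_nat n) =
      poly (g * (cubp 0 * pcompose (Y i j) [:-2, 1:] + (\<Sum>l<N. [:E l j, 3 * C l j:] * pcompose (Y i l) [:-2, 1:])) +
      (if i = j then [:- \<zeta> / 2, 4:] * g * pcompose g [:-2, 1:] else 0)) (k + of_nat n)"
      unfolding \<kappa>_def[symmetric] poly_mult poly_add poly_sum sh poly_cubp add_0_right *
      by (cases "i = j") (simp_all only: if_True if_False poly_mult sh l poly_0 mult.assoc simp_thms)
  qed
qed

text \<open>The second coefficients of a polynomial solution of degree at most d give (d + 4) times
  its coefficient in degree d equal to 0, so the solution vanishes; the inhomogeneous term 3 rules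
  this out.\<close>

lemma no_polynomial_solution:
  assumes "rational_form g Y" shows "degree g \<noteq> 0"
proof
  assume "degree g = 0"
  then obtain c where c: "g = [:c:]" by (rule degree_eq_zeroE)
  have c0: "c \<noteq> 0" using assms c by (auto simp: rational_form_def)
  have id: "sqp 2 * Y i j + (\<Sum>l<N. [:C i l:] * Y l j) =
    sqp 0 * pcompose (Y i j) [:-1, 1:] + (\<Sum>l<N. [:C l j:] * pcompose (Y i l) [:-1, 1:]) +
    (if i = j then [:3 * c:] else 0)" if ij: "i < N" "j < N" for i j
  proof -
    have "[:c:] * (sqp 2 * Y i j + (\<Sum>l<N. [:C i l:] * Y l j)) =
      [:c:] * (sqp 0 * pcompose (Y i j) [:-1, 1:] + (\<Sum>l<N. [:C l j:] * pcompose (Y i l) [:-1, 1:]) +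
    (if i = j then [:3 * c:] else 0))"
      using rational_identity1[OF assms ij] unfolding c pcompose_const
      by (cases "i = j") (simp_all add: smult_add_right mult.commute mult.left_commute)
    then show ?thesis using c0 by (simp only: mult_cancel_left) simp
  qed
  define S where "S = {..<N} \<times> {..<N}"
  define d where "d = Max ((\<lambda>(i, j). degree (Y i j)) ` S)"
  have fin: "finite S" "S \<noteq> {}" using N by (auto simp: S_def)
  have d: "degree (Y i j) \<le> d" if "i < N" "j < N" for i j
    unfolding d_def using fin that by (intro Max_ge) (auto simp: S_def)
  have top: "coeff (Y i j) d = 0" if ij: "i < N" "j < N" for i j
  proof -
    note sh = shift_top[OF d, of _ _ "-1"]
    have s1: "coeff (\<Sum>l<N. [:C i l:] * Y l j) (2 + 0 + d) = 0" "subtop (\<Sum>l<N. [:C i l:] * Y l j) (2 + 0 + d) = 0"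
      using coeff_sum_mult_0[of N "\<lambda>l. [:C i l:]" 0 "\<lambda>l. Y l j" d] d ij by simp_all
    have s2: "coeff (\<Sum>l<N. [:C l j:] * pcompose (Y i l) [:-1, 1:]) (2 + 0 + d) = 0"
      "subtop (\<Sum>l<N. [:C l j:] * pcompose (Y i l) [:-1, 1:]) (2 + 0 + d) = 0"
      using coeff_sum_mult_0[of N "\<lambda>l. [:C l j:]" 0 "\<lambda>l. pcompose (Y i l) [:-1, 1:]" d] sh ij by simp_all
    have pC: "pCons 0 (p + q) = pCons 0 p + pCons 0 q" for p q :: "complex poly" by simp
    have l: "subtop (sqp 2 * Y i j) (2 + d) = subtop (Y i j) d + 3 * coeff (Y i j) d"
      unfolding coeff_subtop_mult[OF sqp_top(1) d[OF ij]] sqp_top by simp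
    have r: "subtop (sqp 0 * pcompose (Y i j) [:-1, 1:]) (2 + d) =
        subtop (Y i j) d - of_nat d * coeff (Y i j) d - coeff (Y i j) d"
      unfolding coeff_subtop_mult[OF sqp_top(1) conjunct1[OF sh[OF ij]]] sqp_top using sh[OF ij] by simp
    have "subtop (if i = j then [:3 * c:] else 0) (2 + d) = 0" by simp
    then have "subtop (Y i j) d + 3 * coeff (Y i j) d = subtop (Y i j) d - of_nat d * coeff (Y i j) d - coeff (Y i j) d"
      using arg_cong[OF id[OF ij], of "\<lambda>p. subtop p (2 + d)"] s1(2) s2(2) unfolding pC coeff_add l r by simp
    then have "(of_nat (d + 4) :: complex) * coeff (Y i j) d = 0" by (simp add: algebra_simps)
    then show ?thesis by (simp del: of_nat_add)
  qed
  have "d \<in> (\<lambda>(i, j). degree (Y i j)) ` S" unfolding d_def using fin by (intro Max_in) auto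
  then obtain i j where ij: "i < N" "j < N" "degree (Y i j) = d" by (auto simp: S_def)
  then have "Y i j = 0" using top[OF ij(1,2)] by (metis leading_coeff_0_iff)
  then have d0: "d = 0" using ij(3) by simp
  have Y0: "Y i j = 0" if "i < N" "j < N" for i j
    using top[OF that] d[OF that] unfolding d0 by (metis le_zero_eq leading_coeff_0_iff)
  have z: "(\<Sum>l<N. [:C 0 l:] * Y l 0) = 0" "(\<Sum>l<N. [:C l 0:] * pcompose (Y 0 l) [:-1, 1:]) = 0"
    using Y0 N by (auto intro!: sum.neutral)
  show False using id[OF N N] Y0[OF N N] c0 unfolding z by simp
qed

text \<open>At a root \<open>x0\<close> every term with the factor g drops out, while g is nonzero
  at x0 - 1 and x0 - 2. So each column of Y at \<open>x0\<close> is killed by the matrices of d_(-1)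
  and d_(-2) at weight x0 + 2; minimality of the denominator makes some column nonzero.\<close>

lemma common_eigenvector_exists:
  "\<exists>\<omega> e. (\<exists>i<N. e i \<noteq> 0) \<and> (\<forall>i<N. sq \<omega> * e i + (\<Sum>l<N. C i l * e l) = 0) \<and>
     (\<forall>i<N. cub \<omega> * e i + (\<Sum>l<N. (3 * \<omega> * C i l + E i l) * e l) = 0)"
proof -
  obtain g0 Y0 where g0: "rational_form g0 Y0" using rational_exists by blast
  obtain g where g: "\<exists>Y. rational_form g Y" and least: "\<And>h Y. rational_form h Y \<Longrightarrow> degree g \<le> degree h"
    using ex_has_least_nat[of "\<lambda>g. \<exists>Y. rational_form g Y" g0 degree] g0 by blast
  obtain Y where Y: "rational_form g Y" using g by blast
  have g0: "g \<noteq> 0" using Y by (simp add: rational_form_def)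
  have "degree g \<noteq> 0" by (rule no_polynomial_solution[OF Y])
  then obtain x where "poly g x = 0"
    using fundamental_theorem_of_algebra[of g] by (auto simp: constant_degree)
  then have ne: "{x. poly g x = 0} \<noteq> {}" by blast
  have fin: "finite {x. poly g x = 0}" by (rule poly_roots_finite[OF g0])
  define x0 where "x0 = arg_min_on Re {x. poly g x = 0}"
  have x0: "poly g x0 = 0" "\<And>x. poly g x = 0 \<Longrightarrow> Re x0 \<le> Re x"
    using arg_min_if_finite[OF fin ne, of Re] unfolding x0_def by (auto simp: not_less)
  have n1: "poly g (x0 - 1) \<noteq> 0" using x0(2)[of "x0 - 1"] by auto
  have n2: "poly g (x0 - 2) \<noteq> 0" using x0(2)[of "x0 - 2"] by auto
  have "\<exists>i<N. \<exists>j<N. poly (Y i j) x0 \<noteq> 0"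
  proof (rule ccontr)
    assume "\<not> ?thesis"
    then have "\<exists>Z. i < N \<longrightarrow> j < N \<longrightarrow> Y i j = [:- x0, 1:] * Z" for i j
      by (cases "i < N \<and> j < N") (auto simp: poly_eq_0_iff_dvd dvd_def)
    then obtain Z where Z: "\<And>i j. i < N \<Longrightarrow> j < N \<Longrightarrow> Y i j = [:- x0, 1:] * Z i j" by metis
    obtain h where h: "g = [:- x0, 1:] * h" using x0(1) by (auto simp: poly_eq_0_iff_dvd dvd_def)
    have h0: "h \<noteq> 0" using g0 h by auto
    obtain n0 where n0: "\<And>n i j. n \<ge> n0 \<Longrightarrow> i < N \<Longrightarrow> j < N \<Longrightarrow> poly g (k + of_nat n) * X n i j = poly (Y i j) (k + of_nat n)"
      using Y unfolding rational_form_def by metis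
    obtain n1 :: nat where n1: "real n1 > \<bar>Re (x0 - k)\<bar>" using reals_Archimedean2 by blast
    have "rational_form h Z"
      unfolding rational_form_def
    proof (intro conjI h0 exI[of _ "max n0 n1"] allI impI)
      fix n i j assume n: "n \<ge> max n0 n1" and ij: "i < N" "j < N"
      have "real n1 \<le> real n" using n by simp
      then have "Re (k + of_nat n - x0) > 0" using n1 by simp
      then have nz: "k + of_nat n - x0 \<noteq> 0" by (metis less_irrefl zero_complex.simps(1))
      have "(k + of_nat n - x0) * (poly h (k + of_nat n) * X n i j) = (k + of_nat n - x0) * poly (Z i j) (k + of_nat n)"
        using n0[of n i j] n ij unfolding h Z[OF ij] by (simp add: algebra_simps)
      then show "poly h (k + of_nat n) * X n i j = poly (Z i j) (k + of_nat n)" using nz by simp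
    qed
    then have "degree g \<le> degree h" by (rule least)
    moreover have "degree g = 1 + degree h" unfolding h using h0 by (subst degree_mult_eq) auto
    ultimately show False by simp
  qed
  then obtain i0 j where ij: "i0 < N" "j < N" "poly (Y i0 j) x0 \<noteq> 0" by blast
  define e where "e i = poly (Y i j) x0" for i
  have 1: "sq (x0 + 2) * e i + (\<Sum>l<N. C i l * e l) = 0" if i: "i < N" for i
  proof -
    have "poly g (x0 - 1) * (sq (x0 + 2) * e i + (\<Sum>l<N. C i l * e l)) = 0"
      using arg_cong[OF rational_identity1[OF Y i ij(2)], of "\<lambda>p. poly p x0"] x0(1)
      by (simp add: poly_pcompose poly_sum e_def split: if_splits)
    then show ?thesis using n1 by simp
  qed
  have 2: "cub (x0 + 2) * e i + (\<Sum>l<N. (3 * (x0 + 2) * C i l + E i l) * e l) = 0" if i: "i < N" for i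
  proof -
    have s: "(\<Sum>l<N. poly [:6 * C i l + E i l, 3 * C i l:] x0 * poly (Y l j) x0) = (\<Sum>l<N. (3 * (x0 + 2) * C i l + E i l) * e l)"
      by (rule sum.cong) (simp_all add: e_def algebra_simps)
    have "poly g (x0 - 2) * (cub (x0 + 2) * e i + (\<Sum>l<N. poly [:6 * C i l + E i l, 3 * C i l:] x0 * poly (Y l j) x0)) = 0"
      using arg_cong[OF rational_identity2[OF Y i ij(2)], of "\<lambda>p. poly p x0"] x0(1)
      by (simp add: poly_pcompose poly_sum e_def distrib_right mult.assoc split: if_splits)
    then show ?thesis unfolding s using n2 by simp
  qed
  show ?thesis
    by (intro exI[of _ "x0 + 2"] exI[of _ e]) (use 1 2 ij in \<open>auto simp: e_def\<close>)
qed

lemma poly_eventually_nonzero: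
  assumes "p \<noteq> 0" shows "\<exists>n0. \<forall>n\<ge>n0. poly p (k + of_nat n) \<noteq> 0"
proof -
  have "finite {x. poly p x = 0}" using assms by (rule poly_roots_finite)
  then have "finite ((\<lambda>n. k + of_nat n) -` {x. poly p x = 0})"
    by (rule finite_vimageI) (auto simp: inj_on_def)
  then obtain n0 where "\<forall>n\<in>(\<lambda>n. k + of_nat n) -` {x. poly p x = 0}. n \<le> n0"
    unfolding finite_nat_set_iff_bounded_le by blast
  then show ?thesis by (intro exI[of _ "Suc n0"]) auto
qed

text \<open>Let m be the degree of G and d the maximal degree of the y i. If some y i is nonzero,
  the second coefficients of \<open>H1\<close> force m = d + 4. Then only the \<zeta> term of
  \<open>H2\<close> can reach degree 2 m, so \<zeta> = 0, and the second coefficients of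
  \<open>H2\<close> force m = d + 3.\<close>

lemma homogeneous_solution_zero:
  assumes G: "G \<noteq> 0" and e: "i0 < N" "e i0 \<noteq> 0"
    and H1: "\<And>i. i < N \<Longrightarrow> pcompose G [:-1, 1:] * (sqp 2 * y i + (\<Sum>l<N. [:C i l:] * y l)) =
      (sqp 0 + [:c:]) * (G * pcompose (y i) [:-1, 1:])"
    and H2: "\<And>i. i < N \<Longrightarrow> pcompose G [:-2, 1:] * (cubp 2 * y i + (\<Sum>l<N. [:6 * C i l + E i l, 3 * C i l:] * y l)) +
      [:\<zeta> / 2 * e i:] * (G * pcompose G [:-2, 1:]) = (cubp 0 + [:z, 3 * c:]) * (G * pcompose (y i) [:-2, 1:])"
  shows "\<zeta> = 0 \<and> (\<forall>i<N. y i = 0)"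
proof -
  define m \<gamma> where "m = degree G" and "\<gamma> = coeff G m"
  have dG: "degree G \<le> m" by (simp add: m_def)
  have \<gamma>: "\<gamma> \<noteq> 0" using G by (simp add: \<gamma>_def m_def)
  have shG: "degree (pcompose G [:s, 1:]) \<le> m" "coeff (pcompose G [:s, 1:]) m = \<gamma>"
    "subtop (pcompose G [:s, 1:]) m = subtop G m + of_nat m * s * \<gamma>" for s
    using shift_top[OF dG, of s] by (simp_all add: \<gamma>_def)
  have p: "degree (sqp 0 + [:c:]) \<le> 2" "coeff (sqp 0 + [:c:]) 2 = 1" "subtop (sqp 0 + [:c:]) 2 = - 1"
    by (simp_all add: sqp_def numeral_2_eq_2)
  have q: "degree (cubp 0 + [:z, 3 * c:]) \<le> 3" "coeff (cubp 0 + [:z, 3 * c:]) 3 = 1" "subtop (cubp 0 + [:z, 3 * c:]) 3 = - 3"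
    by (simp_all add: cubp_def numeral_3_eq_3)
  have pC: "pCons 0 (p + q) = pCons 0 p + pCons 0 q" for p q :: "complex poly" by simp
  have y0: "y i = 0" if "i < N" for i
  proof (rule ccontr)
    assume "y i \<noteq> 0"
    have N': "{..<N} \<noteq> {}" using that by auto
    define d where "d = Max ((\<lambda>i. degree (y i)) ` {..<N})"
    have d: "degree (y i) \<le> d" if "i < N" for i unfolding d_def using that by (intro Max_ge) auto
    have "d \<in> (\<lambda>i. degree (y i)) ` {..<N}" unfolding d_def using N' by (intro Max_in) auto
    then obtain i1 where i1: "i1 < N" "degree (y i1) = d" by auto
    have "\<exists>i1<N. coeff (y i1) d \<noteq> 0"
    proof (cases "y i1 = 0")
      case True
      then have "d = 0" using i1 by simp
      then have "coeff (y i) d \<noteq> 0" using d[OF that] \<open>y i \<noteq> 0\<close> by (metis le_zero_eq leading_coeff_0_iff)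
      then show ?thesis using that by blast
    next
      case False
      then show ?thesis using i1 by (metis leading_coeff_0_iff)
    qed
    then obtain j where j: "j < N" "coeff (y j) d \<noteq> 0" by blast
    have sh: "degree (pcompose (y i) [:s, 1:]) \<le> d" "coeff (pcompose (y i) [:s, 1:]) d = coeff (y i) d"
      "subtop (pcompose (y i) [:s, 1:]) d = subtop (y i) d + of_nat d * s * coeff (y i) d" if "i < N" for s i
      using shift_top[OF d[OF that], of s] by simp_all
    have Gy: "degree (G * pcompose (y i) [:s, 1:]) \<le> m + d"
      "coeff (G * pcompose (y i) [:s, 1:]) (m + d) = \<gamma> * coeff (y i) d"
      "subtop (G * pcompose (y i) [:s, 1:]) (m + d) = \<gamma> * (subtop (y i) d + of_nat d * s * coeff (y i) d) + subtop G m * coeff (y i) d"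
      if "i < N" for s i
      using degree_mult_le'[OF dG sh(1)[OF that]] coeff_top_mult[OF dG sh(1)[OF that]]
        coeff_subtop_mult[OF dG sh(1)[OF that]] sh(2,3)[OF that] by (simp_all add: \<gamma>_def)
    have S1: "degree (sqp 2 * y i + (\<Sum>l<N. [:C i l:] * y l)) \<le> 2 + d"
      "coeff (sqp 2 * y i + (\<Sum>l<N. [:C i l:] * y l)) (2 + d) = coeff (y i) d"
      "subtop (sqp 2 * y i + (\<Sum>l<N. [:C i l:] * y l)) (2 + d) = subtop (y i) d + 3 * coeff (y i) d" if "i < N" for i
    proof -
      have "degree (\<Sum>l<N. [:C i l:] * y l) \<le> 0 + d"
        by (rule degree_sum_le) (use degree_mult_le'[of "[:C i _:]" 0] d in auto)
      then show "degree (sqp 2 * y i + (\<Sum>l<N. [:C i l:] * y l)) \<le> 2 + d"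
        using degree_mult_le'[OF sqp_top(1) d[OF that]] by (intro degree_add_le) auto
      have s: "coeff (\<Sum>l<N. [:C i l:] * y l) (2 + d) = 0" "subtop (\<Sum>l<N. [:C i l:] * y l) (2 + d) = 0"
        using coeff_sum_mult_0[of N "\<lambda>l. [:C i l:]" 0 y d] d by simp_all
      show "coeff (sqp 2 * y i + (\<Sum>l<N. [:C i l:] * y l)) (2 + d) = coeff (y i) d"
        unfolding coeff_add s coeff_top_mult[OF sqp_top(1) d[OF that]] sqp_top by simp
      show "subtop (sqp 2 * y i + (\<Sum>l<N. [:C i l:] * y l)) (2 + d) = subtop (y i) d + 3 * coeff (y i) d"
        unfolding pC coeff_add s coeff_subtop_mult[OF sqp_top(1) d[OF that]] sqp_top by simp
    qed
    have S2: "degree (cubp 2 * y i + (\<Sum>l<N. [:6 * C i l + E i l, 3 * C i l:] * y l)) \<le> 3 + d"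
      "coeff (cubp 2 * y i + (\<Sum>l<N. [:6 * C i l + E i l, 3 * C i l:] * y l)) (3 + d) = coeff (y i) d"
      "subtop (cubp 2 * y i + (\<Sum>l<N. [:6 * C i l + E i l, 3 * C i l:] * y l)) (3 + d) = subtop (y i) d + 3 * coeff (y i) d" if "i < N" for i
    proof -
      have "degree (\<Sum>l<N. [:6 * C i l + E i l, 3 * C i l:] * y l) \<le> 1 + d"
        by (rule degree_sum_le) (use degree_mult_le'[of "[:6 * C i _ + E i _, 3 * C i _:]" 1] d in auto)
      then show "degree (cubp 2 * y i + (\<Sum>l<N. [:6 * C i l + E i l, 3 * C i l:] * y l)) \<le> 3 + d"
        using degree_mult_le'[OF cubp_top(1) d[OF that]] by (intro degree_add_le) auto
      have s: "coeff (\<Sum>l<N. [:6 * C i l + E i l, 3 * C i l:] * y l) (3 + d) = 0"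
        "subtop (\<Sum>l<N. [:6 * C i l + E i l, 3 * C i l:] * y l) (3 + d) = 0"
        using coeff_sum_mult_0[of N "\<lambda>l. [:6 * C i l + E i l, 3 * C i l:]" 1 y d] d by (simp_all add: numeral_3_eq_3)
      show "coeff (cubp 2 * y i + (\<Sum>l<N. [:6 * C i l + E i l, 3 * C i l:] * y l)) (3 + d) = coeff (y i) d"
        unfolding coeff_add s coeff_top_mult[OF cubp_top(1) d[OF that]] cubp_top by simp
      show "subtop (cubp 2 * y i + (\<Sum>l<N. [:6 * C i l + E i l, 3 * C i l:] * y l)) (3 + d) = subtop (y i) d + 3 * coeff (y i) d"
        unfolding pC coeff_add s coeff_subtop_mult[OF cubp_top(1) d[OF that]] cubp_top by simp
    qed
    define A A' where "A = coeff (y j) d" and "A' = subtop (y j) d"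
    have "subtop (pcompose G [:-1, 1:] * (sqp 2 * y j + (\<Sum>l<N. [:C j l:] * y l))) (m + (2 + d)) =
        \<gamma> * (A' + 3 * A) + (subtop G m - of_nat m * \<gamma>) * A"
      unfolding coeff_subtop_mult[OF shG(1) S1(1)[OF j(1)]] S1[OF j(1)] shG A_def A'_def by simp
    moreover have "subtop ((sqp 0 + [:c:]) * (G * pcompose (y j) [:-1, 1:])) (2 + (m + d)) =
        \<gamma> * (A' - of_nat d * A) + subtop G m * A - \<gamma> * A"
      unfolding coeff_subtop_mult[OF p(1) Gy(1)[OF j(1)]] Gy[OF j(1)] p A_def A'_def by simp
    moreover have "m + (2 + d) = 2 + (m + d)" by simp
    ultimately have "\<gamma> * (A' + 3 * A) + (subtop G m - of_nat m * \<gamma>) * A = \<gamma> * (A' - of_nat d * A) + subtop G m * A - \<gamma> * A"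
      using H1[OF j(1)] by metis
    then have "(\<gamma> * A) * (of_nat (d + 4) - of_nat m) = 0" by (simp add: algebra_simps)
    then have "(of_nat (d + 4) :: complex) = of_nat m" using \<gamma> j(2) by (simp add: A_def)
    then have m: "m = d + 4" by (simp only: of_nat_eq_iff)
    \<comment> \<open>Both terms without \<zeta> have degree at most m + 3 + d = 2 m - 1.\<close>
    have "coeff (pcompose G [:-2, 1:] * (cubp 2 * y i0 + (\<Sum>l<N. [:6 * C i0 l + E i0 l, 3 * C i0 l:] * y l))) (m + m) = 0"
      by (rule coeff_eq_0) (use degree_mult_le'[OF shG(1)[of "-2"] S2(1)[OF e(1)]] m in simp)
    moreover have "coeff ((cubp 0 + [:z, 3 * c:]) * (G * pcompose (y i0) [:-2, 1:])) (m + m) = 0"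
      by (rule coeff_eq_0) (use degree_mult_le'[OF q(1) Gy(1)[OF e(1), of "-2"]] m in simp)
    moreover have "coeff ([:\<zeta> / 2 * e i0:] * (G * pcompose G [:-2, 1:])) (m + m) = \<zeta> / 2 * e i0 * (\<gamma> * \<gamma>)"
      using coeff_top_mult[OF dG shG(1)[of "-2"]] shG(2)[of "-2"] by (simp add: \<gamma>_def)
    ultimately have "\<zeta> / 2 * e i0 * (\<gamma> * \<gamma>) = 0"
      using arg_cong[OF H2[OF e(1)], of "\<lambda>p. coeff p (m + m)"] by (simp only: coeff_add add_0_left)
    then have \<zeta>: "\<zeta> = 0" using e(2) \<gamma> by simp
    have "subtop (pcompose G [:-2, 1:] * (cubp 2 * y j + (\<Sum>l<N. [:6 * C j l + E j l, 3 * C j l:] * y l))) (m + (3 + d)) =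
        \<gamma> * (A' + 3 * A) + (subtop G m - 2 * of_nat m * \<gamma>) * A"
      unfolding coeff_subtop_mult[OF shG(1) S2(1)[OF j(1)]] S2[OF j(1)] shG A_def A'_def by simp
    moreover have "subtop ((cubp 0 + [:z, 3 * c:]) * (G * pcompose (y j) [:-2, 1:])) (3 + (m + d)) =
        \<gamma> * (A' - 2 * of_nat d * A) + subtop G m * A - 3 * \<gamma> * A"
      unfolding coeff_subtop_mult[OF q(1) Gy(1)[OF j(1)]] Gy[OF j(1)] q A_def A'_def by simp
    moreover have "m + (3 + d) = 3 + (m + d)" by simp
    moreover have "pcompose G [:-2, 1:] * (cubp 2 * y j + (\<Sum>l<N. [:6 * C j l + E j l, 3 * C j l:] * y l)) =
      (cubp 0 + [:z, 3 * c:]) * (G * pcompose (y j) [:-2, 1:])"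
      using H2[OF j(1)] \<zeta> by simp
    ultimately have "\<gamma> * (A' + 3 * A) + (subtop G m - 2 * of_nat m * \<gamma>) * A = \<gamma> * (A' - 2 * of_nat d * A) + subtop G m * A - 3 * \<gamma> * A"
      by metis
    then have "2 * (\<gamma> * A) * (of_nat (d + 3) - of_nat m) = 0" by (simp add: algebra_simps)
    then have "(of_nat (d + 3) :: complex) = of_nat m" using \<gamma> j(2) by (simp add: A_def)
    then have "m = d + 3" by (simp only: of_nat_eq_iff)
    then show False using m by simp
  qed
  have s: "(\<Sum>l<N. [:6 * C i0 l + E i0 l, 3 * C i0 l:] * y l) = 0" using y0 by (simp add: sum.neutral)
  have "[:\<zeta> / 2 * e i0:] * (G * pcompose G [:-2, 1:]) = 0" using H2[OF e(1)] y0[OF e(1)] unfolding s by simp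
  moreover have "pcompose G [:-2, 1:] \<noteq> 0" using shG(2)[of "-2"] \<gamma> by auto
  ultimately have "\<zeta> = 0" using G e(2) by simp
  then show ?thesis using y0 by blast
qed

end

section \<open>The value of d_2 on a common eigenvector\<close>

context d2_system
begin

text \<open>The function \<xi> is a rational solution of both recurrences with \<zeta> = 0. The
  difference of X n e and \<xi> e solves the homogeneous equations up to a \<zeta> term; multiplied
  by G = g * h it is polynomial, and \<open>homogeneous_solution_zero\<close> applies.\<close>

lemma d2_on_eigenvector:
  assumes e: "i0 < N" "e i0 \<noteq> 0"
    and Ce: "\<And>i. i < N \<Longrightarrow> (\<Sum>l<N. C i l * e l) = c * e i"
    and Ee: "\<And>i. i < N \<Longrightarrow> (\<Sum>l<N. E i l * e l) = z * e i"
    and h: "h \<noteq> 0"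
    and \<xi>: "\<And>x. poly h x \<noteq> 0 \<Longrightarrow> \<xi> x = poly a x / poly h x"
    and \<xi>1: "\<And>x. poly h x \<noteq> 0 \<Longrightarrow> poly h (x - 1) \<noteq> 0 \<Longrightarrow> (sq (x + 2) + c) * \<xi> x = (sq x + c) * \<xi> (x - 1) + 3"
    and \<xi>2: "\<And>x. poly h x \<noteq> 0 \<Longrightarrow> poly h (x - 2) \<noteq> 0 \<Longrightarrow>
       (cub (x + 2) + 3 * (x + 2) * c + z) * \<xi> x = (cub x + 3 * x * c + z) * \<xi> (x - 2) + 4 * x"
  shows "\<zeta> = 0 \<and> (\<exists>n0. \<forall>n\<ge>n0. \<forall>i<N. (\<Sum>j<N. X n i j * e j) = \<xi> (k + of_nat n) * e i)"
proof -
  obtain g Y where Y: "rational_form g Y" using rational_exists by blast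
  have g: "g \<noteq> 0" using Y by (simp add: rational_form_def)
  obtain n1 where n1: "\<And>n i j. n \<ge> n1 \<Longrightarrow> i < N \<Longrightarrow> j < N \<Longrightarrow> poly (Y i j) (k + of_nat n) = poly g (k + of_nat n) * X n i j"
    using Y unfolding rational_form_def by metis
  obtain n2 where n2: "\<And>n. n \<ge> n2 \<Longrightarrow> poly h (k + of_nat n) \<noteq> 0"
    using poly_eventually_nonzero[OF h] by blast
  define n0 where "n0 = max n1 n2"
  define G where "G = g * h"
  have G0: "G \<noteq> 0" using g h by (simp add: G_def)
  define y where "y i = h * (\<Sum>j<N. Y i j * [:e j:]) - g * a * [:e i:]" for i
  define w where "w n i = (\<Sum>j<N. X n i j * e j) - \<xi> (k + of_nat n) * e i" for n i
  have yw: "poly (y i) (k + of_nat n) = poly G (k + of_nat n) * w n i" if n: "n \<ge> n0" and i: "i < N" for n i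
  proof -
    define \<kappa> where "\<kappa> = k + of_nat n"
    have hn: "poly h \<kappa> \<noteq> 0" using n2 n by (simp add: n0_def \<kappa>_def)
    have "(\<Sum>j<N. poly (Y i j) \<kappa> * e j) = poly g \<kappa> * (\<Sum>j<N. X n i j * e j)"
      unfolding sum_distrib_left by (rule sum.cong) (use n1[of n i] n i in \<open>simp_all add: n0_def \<kappa>_def\<close>)
    then have "poly (y i) \<kappa> = poly h \<kappa> * (poly g \<kappa> * (\<Sum>j<N. X n i j * e j)) - poly g \<kappa> * poly a \<kappa> * e i"
      by (simp add: y_def poly_sum mult.commute[of "e _"])
    also have "\<dots> = poly G \<kappa> * w n i"
      using hn by (simp add: w_def G_def \<kappa>_def[symmetric] \<xi>[OF hn] field_simps)
    finally show ?thesis by (simp add: \<kappa>_def)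
  qed
  have swap: "(\<Sum>j<N. (\<Sum>l<N. M l * Q l j) * e j) = (\<Sum>l<N. M l * (\<Sum>j<N. Q l j * e j))" for M Q
    unfolding sum_distrib_left sum_distrib_right by (subst sum.swap) (simp add: mult.assoc)
  have W1: "sq (k + of_nat n + 2) * w n i + (\<Sum>l<N. C i l * w n l) = (sq (k + of_nat n) + c) * w (n - 1) i"
    if n: "n \<ge> n0 + 1" and i: "i < N" for n i
  proof -
    define \<kappa> where "\<kappa> = k + of_nat n"
    have k1: "k + of_nat (n - 1) = \<kappa> - 1" using n by (simp add: \<kappa>_def of_nat_diff)
    have hn: "poly h \<kappa> \<noteq> 0" "poly h (\<kappa> - 1) \<noteq> 0"
      using n2[of n] n2[of "n - 1"] n unfolding k1 by (simp_all add: n0_def \<kappa>_def)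
    have "(\<Sum>j<N. (sq (\<kappa> + 2) * X n i j + (\<Sum>l<N. C i l * X n l j)) * e j) =
      (\<Sum>j<N. (sq \<kappa> * X (n - 1) i j + (\<Sum>l<N. X (n - 1) i l * C l j) + (if i = j then 3 else 0)) * e j)"
      by (rule sum.cong) (use eq1[OF i, of _ n] n in \<open>simp_all add: \<kappa>_def\<close>)
    then have "sq (\<kappa> + 2) * (\<Sum>j<N. X n i j * e j) + (\<Sum>l<N. C i l * (\<Sum>j<N. X n l j * e j)) =
      sq \<kappa> * (\<Sum>j<N. X (n - 1) i j * e j) + (\<Sum>l<N. X (n - 1) i l * (c * e l)) + 3 * e i"
      using i by (simp add: distrib_right sum.distrib swap Ce mult.assoc if_distrib[of "\<lambda>x. x * _"] cong: if_cong)
        (simp add: sum_distrib_left)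
    moreover have "(\<Sum>l<N. X (n - 1) i l * (c * e l)) = c * (\<Sum>j<N. X (n - 1) i j * e j)"
      by (simp add: sum_distrib_left ac_simps)
    moreover have "(\<Sum>l<N. C i l * w n l) = (\<Sum>l<N. C i l * (\<Sum>j<N. X n l j * e j)) - \<xi> \<kappa> * (c * e i)"
      unfolding Ce[OF i, symmetric] by (simp add: w_def right_diff_distrib sum_subtractf sum_distrib_left \<kappa>_def ac_simps)
    moreover have "w (n - 1) i = (\<Sum>j<N. X (n - 1) i j * e j) - \<xi> (\<kappa> - 1) * e i" unfolding w_def k1 ..
    moreover have "w n i = (\<Sum>j<N. X n i j * e j) - \<xi> \<kappa> * e i" by (simp add: w_def \<kappa>_def)
    moreover note \<xi>1[OF hn]
    ultimately show ?thesis unfolding \<kappa>_def[symmetric] by algebra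
  qed
  have W2: "cub (k + of_nat n + 2) * w n i + (\<Sum>l<N. (3 * (k + of_nat n + 2) * C i l + E i l) * w n l) + \<zeta> / 2 * e i =
      (cub (k + of_nat n) + 3 * (k + of_nat n) * c + z) * w (n - 2) i"
    if n: "n \<ge> n0 + 2" and i: "i < N" for n i
  proof -
    define \<kappa> where "\<kappa> = k + of_nat n"
    have k1: "k + of_nat (n - 2) = \<kappa> - 2" using n by (simp add: \<kappa>_def of_nat_diff)
    have hn: "poly h \<kappa> \<noteq> 0" "poly h (\<kappa> - 2) \<noteq> 0"
      using n2[of n] n2[of "n - 2"] n unfolding k1 by (simp_all add: n0_def \<kappa>_def)
    have "(\<Sum>j<N. (cub (\<kappa> + 2) * X n i j + (\<Sum>l<N. (3 * (\<kappa> + 2) * C i l + E i l) * X n l j)) * e j) =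
      (\<Sum>j<N. (cub \<kappa> * X (n - 2) i j + (\<Sum>l<N. X (n - 2) i l * (3 * \<kappa> * C l j + E l j)) + (if i = j then 4 * \<kappa> - \<zeta> / 2 else 0)) * e j)"
      by (rule sum.cong) (use eq2[OF i, of _ n] n in \<open>simp_all add: \<kappa>_def\<close>)
    moreover have AB: "(\<Sum>j<N. (3 * x * C l j + E l j) * e j) = (3 * x * c + z) * e l" if "l < N" for l x
    proof -
      have "(\<Sum>j<N. (3 * x * C l j + E l j) * e j) = 3 * x * (\<Sum>j<N. C l j * e j) + (\<Sum>j<N. E l j * e j)"
        by (simp add: distrib_right sum.distrib sum_distrib_left mult.assoc)
      then show ?thesis using Ce[OF that] Ee[OF that] by (simp add: algebra_simps)
    qed
    ultimately have "cub (\<kappa> + 2) * (\<Sum>j<N. X n i j * e j) + (\<Sum>l<N. (3 * (\<kappa> + 2) * C i l + E i l) * (\<Sum>j<N. X n l j * e j)) =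
      cub \<kappa> * (\<Sum>j<N. X (n - 2) i j * e j) + (\<Sum>l<N. X (n - 2) i l * ((3 * \<kappa> * c + z) * e l)) + (4 * \<kappa> - \<zeta> / 2) * e i"
      using i unfolding distrib_right[of _ _ "e _"] sum.distrib swap
      by (simp add: mult.assoc if_distrib[of "\<lambda>x. x * _"] sum_distrib_left[symmetric] cong: if_cong)
    moreover have "(\<Sum>l<N. X (n - 2) i l * ((3 * \<kappa> * c + z) * e l)) = (3 * \<kappa> * c + z) * (\<Sum>j<N. X (n - 2) i j * e j)"
      unfolding sum_distrib_left by (rule sum.cong) (simp_all only: ac_simps)
    moreover have "(\<Sum>l<N. (3 * (\<kappa> + 2) * C i l + E i l) * w n l) =
        (\<Sum>l<N. (3 * (\<kappa> + 2) * C i l + E i l) * (\<Sum>j<N. X n l j * e j)) - \<xi> \<kappa> * ((3 * (\<kappa> + 2) * c + z) * e i)"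
      unfolding AB[OF i, symmetric] w_def \<kappa>_def[symmetric] right_diff_distrib sum_subtractf sum_distrib_left[of "\<xi> \<kappa>"]
      by (simp only: ac_simps)
    moreover have "w (n - 2) i = (\<Sum>j<N. X (n - 2) i j * e j) - \<xi> (\<kappa> - 2) * e i" unfolding w_def k1 ..
    moreover have "w n i = (\<Sum>j<N. X n i j * e j) - \<xi> \<kappa> * e i" by (simp add: w_def \<kappa>_def)
    moreover have "(cub (\<kappa> + 2) + (3 * (\<kappa> + 2) * c + z)) * \<xi> \<kappa> = (cub \<kappa> + (3 * \<kappa> * c + z)) * \<xi> (\<kappa> - 2) + 4 * \<kappa>"
      using \<xi>2[OF hn] by (simp only: add.assoc)
    moreover have "p * v + r + d * f = (q + q') * v2"
      if "p * s + t = q * s2 + t2 + (4 * \<kappa> - d) * f" "t2 = q' * s2" "r = t - x * (p' * f)"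
        "v2 = s2 - x2 * f" "v = s - x * f" "(p + p') * x = (q + q') * x2 + 4 * \<kappa>"
      for p v r d f q q' v2 s t s2 t2 x p' x2 :: complex
      unfolding that(2-5) using that(1,6)[unfolded that(2)] by algebra
    ultimately show ?thesis unfolding \<kappa>_def[symmetric] add.assoc[of "cub \<kappa>"] by blast
  qed
  have H1: "pcompose G [:-1, 1:] * (sqp 2 * y i + (\<Sum>l<N. [:C i l:] * y l)) =
      (sqp 0 + [:c:]) * (G * pcompose (y i) [:-1, 1:])" if i: "i < N" for i
  proof (rule poly_eq_on_progression[of "n0 + 1" _ k])
    fix n assume n: "n \<ge> n0 + 1"
    define \<kappa> where "\<kappa> = k + of_nat n"
    have k1: "k + of_nat (n - 1) = \<kappa> - 1" using n by (simp add: \<kappa>_def of_nat_diff)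
    have y0: "poly (y l) \<kappa> = poly G \<kappa> * w n l" if "l < N" for l using yw[of n l] n that by (simp add: \<kappa>_def)
    have y1: "poly (y i) (\<kappa> - 1) = poly G (\<kappa> - 1) * w (n - 1) i" using yw[of "n - 1" i] n i unfolding k1 by simp
    have s: "(\<Sum>l<N. C i l * poly (y l) \<kappa>) = poly G \<kappa> * (\<Sum>l<N. C i l * w n l)"
      unfolding sum_distrib_left by (rule sum.cong) (simp_all add: y0)
    have "poly G (\<kappa> - 1) * (sq (\<kappa> + 2) * poly (y i) \<kappa> + (\<Sum>l<N. C i l * poly (y l) \<kappa>)) =
      poly G (\<kappa> - 1) * poly G \<kappa> * (sq (\<kappa> + 2) * w n i + (\<Sum>l<N. C i l * w n l))"
      unfolding s y0[OF i] by (simp add: algebra_simps)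
    also have "\<dots> = (sq \<kappa> + c) * (poly G \<kappa> * poly (y i) (\<kappa> - 1))"
      using W1[OF n i] unfolding \<kappa>_def[symmetric] y1 by simp
    finally show "poly (pcompose G [:-1, 1:] * (sqp 2 * y i + (\<Sum>l<N. [:C i l:] * y l))) (k + of_nat n) =
      poly ((sqp 0 + [:c:]) * (G * pcompose (y i) [:-1, 1:])) (k + of_nat n)"
      unfolding \<kappa>_def[symmetric] by (simp add: poly_pcompose poly_sum)
  qed
  have H2: "pcompose G [:-2, 1:] * (cubp 2 * y i + (\<Sum>l<N. [:6 * C i l + E i l, 3 * C i l:] * y l)) +
      [:\<zeta> / 2 * e i:] * (G * pcompose G [:-2, 1:]) = (cubp 0 + [:z, 3 * c:]) * (G * pcompose (y i) [:-2, 1:])" if i: "i < N" for i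
  proof (rule poly_eq_on_progression[of "n0 + 2" _ k])
    fix n assume n: "n \<ge> n0 + 2"
    define \<kappa> where "\<kappa> = k + of_nat n"
    have k1: "k + of_nat (n - 2) = \<kappa> - 2" using n by (simp add: \<kappa>_def of_nat_diff)
    have y0: "poly (y l) \<kappa> = poly G \<kappa> * w n l" if "l < N" for l using yw[of n l] n that by (simp add: \<kappa>_def)
    have y1: "poly (y i) (\<kappa> - 2) = poly G (\<kappa> - 2) * w (n - 2) i" using yw[of "n - 2" i] n i unfolding k1 by simp
    have s: "(\<Sum>l<N. poly [:6 * C i l + E i l, 3 * C i l:] \<kappa> * poly (y l) \<kappa>) = poly G \<kappa> * (\<Sum>l<N. (3 * (\<kappa> + 2) * C i l + E i l) * w n l)"
      unfolding sum_distrib_left by (rule sum.cong) (simp_all add: y0 algebra_simps)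
    have sh: "poly (pcompose p [:-2, 1:]) \<kappa> = poly p (\<kappa> - 2)" for p by (simp add: poly_pcompose)
    have "poly G (\<kappa> - 2) * (cub (\<kappa> + 2) * poly (y i) \<kappa> + (\<Sum>l<N. poly [:6 * C i l + E i l, 3 * C i l:] \<kappa> * poly (y l) \<kappa>)) + \<zeta> / 2 * e i * (poly G \<kappa> * poly G (\<kappa> - 2)) =
      poly G (\<kappa> - 2) * poly G \<kappa> * (cub (\<kappa> + 2) * w n i + (\<Sum>l<N. (3 * (\<kappa> + 2) * C i l + E i l) * w n l) + \<zeta> / 2 * e i)"
      unfolding s y0[OF i] by (simp add: algebra_simps)
    also have "\<dots> = (cub \<kappa> + 3 * \<kappa> * c + z) * (poly G \<kappa> * poly (y i) (\<kappa> - 2))"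
      using W2[OF n i] unfolding \<kappa>_def[symmetric] y1 by simp
    finally have *: "poly G (\<kappa> - 2) * (cub (\<kappa> + 2) * poly (y i) \<kappa> + (\<Sum>l<N. poly [:6 * C i l + E i l, 3 * C i l:] \<kappa> * poly (y l) \<kappa>)) + \<zeta> / 2 * e i * (poly G \<kappa> * poly G (\<kappa> - 2)) =
      (cub \<kappa> + 3 * \<kappa> * c + z) * (poly G \<kappa> * poly (y i) (\<kappa> - 2))" .
    have l: "poly [:\<zeta> / 2 * e i:] \<kappa> = \<zeta> / 2 * e i" "poly [:z, 3 * c:] \<kappa> = 3 * \<kappa> * c + z" by simp_all
    show "poly (pcompose G [:-2, 1:] * (cubp 2 * y i + (\<Sum>l<N. [:6 * C i l + E i l, 3 * C i l:] * y l)) +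
      [:\<zeta> / 2 * e i:] * (G * pcompose G [:-2, 1:])) (k + of_nat n) = poly ((cubp 0 + [:z, 3 * c:]) * (G * pcompose (y i) [:-2, 1:])) (k + of_nat n)"
      unfolding \<kappa>_def[symmetric] poly_add poly_mult poly_sum sh l poly_cubp add_0_right * by simp
  qed
  have "\<zeta> = 0 \<and> (\<forall>i<N. y i = 0)" by (rule homogeneous_solution_zero[OF G0 e H1 H2])
  moreover obtain n3 where n3: "\<And>n. n \<ge> n3 \<Longrightarrow> poly G (k + of_nat n) \<noteq> 0"
    using poly_eventually_nonzero[OF G0] by blast
  ultimately have "\<zeta> = 0" "w n i = 0" if "n \<ge> max n0 n3" "i < N" for n i
    using yw[of n i] that by auto
  then show ?thesis
    using \<open>\<zeta> = 0 \<and> (\<forall>i<N. y i = 0)\<close>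
    by (intro conjI exI[of _ "max n0 n3"] allI impI) (auto simp: w_def)
qed

lemma density_structure:
  "\<zeta> = 0 \<and> (\<exists>b e n0. (\<exists>i<N. e i \<noteq> 0) \<and>
     (\<forall>i<N. (\<Sum>l<N. C i l * e l) = (b - b\<^sup>2) * e i) \<and>
     (\<forall>i<N. (\<Sum>l<N. E i l * e l) = - 2 * b * (b - 1) * (b - 2) * e i) \<and>
     (\<forall>n\<ge>n0. \<forall>i<N. (k + of_nat n + b) * (k + of_nat n + b + 1) * (\<Sum>j<N. X n i j * e j) = (k + of_nat n + 2 * b) * e i))"
proof -
  obtain \<omega> e i0 where e: "i0 < N" "e i0 \<noteq> 0"
    and 1: "\<And>i. i < N \<Longrightarrow> sq \<omega> * e i + (\<Sum>l<N. C i l * e l) = 0"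
    and 2: "\<And>i. i < N \<Longrightarrow> cub \<omega> * e i + (\<Sum>l<N. (3 * \<omega> * C i l + E i l) * e l) = 0"
    using common_eigenvector_exists by blast
  \<comment> \<open>In the density module, in the frame where d_1 is the identity, d_(-1) and d_(-2)
    at weight x are (x - b) (x + b - 1) and (x - 2 b) (x + b - 1) (x + b - 2); 1 - b is a common
    root.\<close>
  define b where "b = 1 - \<omega>"
  have \<omega>: "\<omega> = 1 - b" by (simp add: b_def)
  have Ce: "(\<Sum>l<N. C i l * e l) = (b - b\<^sup>2) * e i" if "i < N" for i
  proof -
    have s1: "sq \<omega> = - (b - b\<^sup>2)" by (simp add: sq_def \<omega> power2_eq_square algebra_simps)
    have s2: "(\<Sum>l<N. C i l * e l) = - (sq \<omega> * e i)" using 1[OF that] by (metis add_eq_0_iff)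
    show ?thesis unfolding s2 s1 by (simp only: minus_mult_left[symmetric] minus_minus)
  qed
  have Ee: "(\<Sum>l<N. E i l * e l) = - 2 * b * (b - 1) * (b - 2) * e i" if "i < N" for i
  proof -
    have "(\<Sum>l<N. (3 * \<omega> * C i l + E i l) * e l) = 3 * \<omega> * (\<Sum>l<N. C i l * e l) + (\<Sum>l<N. E i l * e l)"
      by (simp add: distrib_right sum.distrib sum_distrib_left mult.assoc)
    then have "cub \<omega> * e i + (3 * \<omega> * ((b - b\<^sup>2) * e i) + (\<Sum>l<N. E i l * e l)) = 0"
      using 2[OF that] unfolding Ce[OF that] by simp
    moreover have "S = - (x + y * d) * f" if "x * f + (y * (d * f) + S) = 0" for x f y d S :: complex
      using that by algebra
    ultimately have "(\<Sum>l<N. E i l * e l) = - (cub \<omega> + 3 * \<omega> * (b - b\<^sup>2)) * e i" by blast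
    also have "- (cub \<omega> + 3 * \<omega> * (b - b\<^sup>2)) = - 2 * b * (b - 1) * (b - 2)"
      by (simp add: cub_def \<omega> power2_eq_square power3_eq_cube algebra_simps)
    finally show ?thesis .
  qed
  define h where "h = [:b, 1:] * [:b + 1, 1:]"
  \<comment> \<open>In the module with d_n w_x = (x + n b) w_(x+n) this is the coefficient x + 2 b
    of d_2 divided by the coefficients x + b and x + b + 1 of two steps of d_1.\<close>
  define \<xi> where "\<xi> x = (x + 2 * b) / ((x + b) * (x + b + 1))" for x
  have hx: "poly h x = (x + b) * (x + b + 1)" for x by (simp add: h_def algebra_simps)
  have sqb: "sq x + (b - b\<^sup>2) = (x - b) * (x + b - 1)" for x
    by (simp add: sq_def power2_eq_square algebra_simps)
  have cubb: "cub x + 3 * x * (b - b\<^sup>2) + - 2 * b * (b - 1) * (b - 2) = (x - 2 * b) * (x + b - 1) * (x + b - 2)" for x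
    by (simp add: cub_def power2_eq_square power3_eq_cube algebra_simps)
  have "\<zeta> = 0 \<and> (\<exists>n0. \<forall>n\<ge>n0. \<forall>i<N. (\<Sum>j<N. X n i j * e j) = \<xi> (k + of_nat n) * e i)"
  proof (rule d2_on_eigenvector[OF e Ce Ee])
    show "h \<noteq> 0" by (simp add: h_def)
    show "\<xi> x = poly [:2 * b, 1:] x / poly h x" for x by (simp add: \<xi>_def hx add.commute)
    fix x
    show "(sq (x + 2) + (b - b\<^sup>2)) * \<xi> x = (sq x + (b - b\<^sup>2)) * \<xi> (x - 1) + 3"
      if n: "poly h x \<noteq> 0" "poly h (x - 1) \<noteq> 0"
    proof -
      have nz: "x + b \<noteq> 0" "x + b + 1 \<noteq> 0" "x - 1 + b \<noteq> 0" using n by (auto simp: hx)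
      have t: "x + 2 + b - 1 = x + b + 1" "x - 1 + b + 1 = x + b" "x + b - 1 = x - 1 + b" by simp_all
      have "(sq (x + 2) + (b - b\<^sup>2)) * \<xi> x = (x + 2 - b) * (x + 2 * b) / (x + b)"
        unfolding sqb \<xi>_def t(1) using nz by simp
      moreover have "(sq x + (b - b\<^sup>2)) * \<xi> (x - 1) = (x - b) * (x - 1 + 2 * b) / (x + b)"
        unfolding sqb \<xi>_def t(2,3) using nz by simp
      moreover have "(x + 2 - b) * (x + 2 * b) / (x + b) = (x - b) * (x - 1 + 2 * b) / (x + b) + 3"
        using nz by (simp add: field_simps)
      ultimately show ?thesis by simp
    qed
    show "(cub (x + 2) + 3 * (x + 2) * (b - b\<^sup>2) + - 2 * b * (b - 1) * (b - 2)) * \<xi> x =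
       (cub x + 3 * x * (b - b\<^sup>2) + - 2 * b * (b - 1) * (b - 2)) * \<xi> (x - 2) + 4 * x"
      if n: "poly h x \<noteq> 0" "poly h (x - 2) \<noteq> 0"
    proof -
      have nz: "x + b \<noteq> 0" "x + b + 1 \<noteq> 0" "x - 2 + b \<noteq> 0" "x - 2 + b + 1 \<noteq> 0" using n by (auto simp: hx)
      have t: "x + 2 + b - 1 = x + b + 1" "x + 2 + b - 2 = x + b" "x - 2 + b + 1 = x + b - 1" "x - 2 + b = x + b - 2" by simp_all
      have p1: "(x + 2 - 2 * b) * (x + 2 + b - 1) * (x + 2 + b - 2) * \<xi> x = (x + 2 - 2 * b) * (x + 2 * b)"
        unfolding \<xi>_def t(1,2) using nz by simp
      have p2: "(x - 2 * b) * (x + b - 1) * (x + b - 2) * \<xi> (x - 2) = (x - 2 * b) * (x - 2 + 2 * b)"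
        unfolding \<xi>_def using nz unfolding t by simp
      show ?thesis unfolding cubb p1 p2 by (simp add: algebra_simps)
    qed
  qed
  then obtain n0 where z: "\<zeta> = 0" and n0: "\<And>n i. n \<ge> n0 \<Longrightarrow> i < N \<Longrightarrow> (\<Sum>j<N. X n i j * e j) = \<xi> (k + of_nat n) * e i"
    by blast
  obtain n1 where n1: "\<And>n. n \<ge> n1 \<Longrightarrow> poly h (k + of_nat n) \<noteq> 0"
    using poly_eventually_nonzero[of h] by (auto simp: h_def)
  have "(k + of_nat n + b) * (k + of_nat n + b + 1) * (\<Sum>j<N. X n i j * e j) = (k + of_nat n + 2 * b) * e i"
    if "n \<ge> max n0 n1" "i < N" for n i
  proof -
    have "(k + of_nat n + b) * (k + of_nat n + b + 1) \<noteq> 0" using n1[of n] that unfolding hx by simp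
    then show ?thesis using n0[of n i] that by (simp add: \<xi>_def)
  qed
  then show ?thesis using z Ce Ee e by blast
qed

end

section \<open>Strings of density vectors\<close>

text \<open>\<open>sq\<close> and \<open>cub\<close> solve the difference equations that
  [d_1, d_(-1)] = -2 d_0 and [d_1, d_(-2)] = -3 d_(-1) become when d_1 is the identity
  matrix.\<close>

lemma sq_Suc: "sq (x + 1) = sq x + 2 * x"
  by (simp add: sq_def power2_eq_square algebra_simps)

lemma cub_Suc: "cub (x + 1) = cub x + 3 * sq x"
  by (simp add: cub_def sq_def power2_eq_square power3_eq_cube algebra_simps)

context irreducible_ops
begin

text \<open>Schur's lemma: c has an eigenvector in a finite-dimensional weight space, and its
  eigenspaces are submodules.\<close>

lemma central_scalar:
  obtains z where "\<And>v. Z 1 v = scale z v"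
proof -
  obtain u where u: "u \<in> wt 0" "u \<noteq> 0" using weight_0 zero_in_wt[of 0] by (auto simp: wt_def)
  obtain d where d: "dim_le d (wt 0)" using dim_le_wt by blast
  obtain z w where w: "w \<noteq> 0" "Z 1 w = scale z w"
    by (rule eigenvector_exists[OF Z_linear[of 1] d subspace_wt Z_wt u])
  have "{v. Z 1 v = scale z v} = UNIV"
  proof (rule submodule_UNIV)
    show "subspace {v. Z 1 v = scale z v}"
      by (auto simp: subspace_def scale_right_distrib scale_left_commute)
    show "D n f v \<in> {v. Z 1 v = scale z v}" if "v \<in> {v. Z 1 v = scale z v}" for n f v
      using that by (simp add: Z_D)
  qed (use w in auto)
  then show thesis by (intro that[of z]) blast
qed

end

text \<open>The vectors \<open>v i n\<close>, i < N, are a basis of the weight space k1 + n, carried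
  along by d_1; in these coordinates d_1 is the identity matrix at every level.\<close>

locale vir_gauge = irreducible_ops scale D Z lam
  for scale :: "complex \<Rightarrow> 'v::ab_group_add \<Rightarrow> 'v" and D Z lam +
  fixes k1 :: int and N :: nat and v :: "nat \<Rightarrow> nat \<Rightarrow> 'v"
  assumes N: "N > 0"
    and v_wt: "i < N \<Longrightarrow> v i n \<in> wt (k1 + int n)"
    and D1_v: "D 1 1 (v i n) = v i (Suc n)"
    and v_span: "x \<in> wt (k1 + int n) \<Longrightarrow> \<exists>c. x = (\<Sum>i<N. scale (c i) (v i n))"
    and v_indep: "(\<Sum>i<N. scale (c i) (v i n)) = 0 \<Longrightarrow> i < N \<Longrightarrow> c i = 0"
begin

definition V :: "(nat \<Rightarrow> complex) \<Rightarrow> nat \<Rightarrow> 'v" where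
  "V c n = (\<Sum>i<N. scale (c i) (v i n))"

definition kap :: "nat \<Rightarrow> complex" where
  "kap n = lam + of_int k1 + of_nat n"

definition dl :: "nat \<Rightarrow> nat \<Rightarrow> complex" where "dl i j = (if i = j then 1 else 0)"

lemma kap_Suc: "kap (Suc n) = kap n + 1"
  by (simp add: kap_def)

lemma V_wt: "V c n \<in> wt (k1 + int n)"
  unfolding V_def by (intro subspace_sum[OF subspace_wt] subspace_scale[OF subspace_wt] v_wt) auto

lemma V_add: "V c n + V d n = V (\<lambda>i. c i + d i) n"
  by (simp add: V_def scale_left_distrib sum.distrib)

lemma V_scale: "scale a (V c n) = V (\<lambda>i. a * c i) n"
  by (simp add: V_def scale_sum_right)

lemma V_inj: "V c n = V d n \<Longrightarrow> i < N \<Longrightarrow> c i = d i"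
  using v_indep[of "\<lambda>i. c i - d i" n i] by (simp add: V_def scale_left_diff_distrib sum_subtractf)

lemma V_zero: "V c n = 0 \<Longrightarrow> i < N \<Longrightarrow> c i = 0"
  using v_indep[of c n i] by (simp add: V_def)

lemma v_V: "j < N \<Longrightarrow> v j n = V (\<lambda>i. dl i j) n"
  by (simp add: V_def dl_def if_distrib[of "\<lambda>x. scale x _"] cong: if_cong)

lemma D1_V: "D 1 1 (V c n) = V c (Suc n)"
  by (simp add: V_def D.sum D1_v)

lemma D0_V: "D 0 1 (V c n) = scale (kap n) (V c n)"
  using wtD[OF V_wt[of c n]] by (simp add: kap_def add.assoc)

lemma matrix_exists:
  assumes "k1 + int n + m = k1 + int n'"
  shows "\<exists>M. \<forall>j<N. D m 1 (v j n) = V (\<lambda>i. M i j) n'"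
proof -
  have "\<exists>c. j < N \<longrightarrow> D m 1 (v j n) = V c n'" for j
    using v_span[of "D m 1 (v j n)" n'] D_wt[OF v_wt[of j n], of m 1] assms
    unfolding V_def by auto
  then obtain c where "\<And>j. j < N \<longrightarrow> D m 1 (v j n) = V (c j) n'" by metis
  then show ?thesis by (intro exI[of _ "\<lambda>i j. c j i"]) auto
qed

lemma matrix_apply:
  assumes "\<forall>j<N. D m 1 (v j n) = V (\<lambda>i. M i j) n'"
  shows "D m 1 (V c n) = V (\<lambda>i. \<Sum>j<N. M i j * c j) n'"
proof -
  have "D m 1 (V c n) = (\<Sum>j<N. scale (c j) (V (\<lambda>i. M i j) n'))"
    unfolding V_def[of c] D.sum by (intro sum.cong) (use assms in auto)
  also have "\<dots> = (\<Sum>i<N. \<Sum>j<N. scale (M i j * c j) (v i n'))"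
    unfolding V_def scale_sum_right by (subst sum.swap) (simp add: mult.commute)
  finally show ?thesis by (simp add: V_def scale_sum_left)
qed

text \<open>\<open>P\<close> and \<open>Q\<close> are indexed by the target level of d_(-1) and
  d_(-2), \<open>X\<close> by the source level of d_2.\<close>

definition P where "P n = (SOME M. \<forall>j<N. D (-1) 1 (v j (Suc n)) = V (\<lambda>i. M i j) n)"
definition Q where "Q n = (SOME M. \<forall>j<N. D (-2) 1 (v j (Suc (Suc n))) = V (\<lambda>i. M i j) n)"
definition X where "X n = (SOME M. \<forall>j<N. D 2 1 (v j n) = V (\<lambda>i. M i j) (Suc (Suc n)))"

lemma P: "\<forall>j<N. D (-1) 1 (v j (Suc n)) = V (\<lambda>i. P n i j) n"
  unfolding P_def by (rule someI_ex[OF matrix_exists]) simp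
lemma Q: "\<forall>j<N. D (-2) 1 (v j (Suc (Suc n))) = V (\<lambda>i. Q n i j) n"
  unfolding Q_def by (rule someI_ex[OF matrix_exists]) simp
lemma X: "\<forall>j<N. D 2 1 (v j n) = V (\<lambda>i. X n i j) (Suc (Suc n))"
  unfolding X_def by (rule someI_ex[OF matrix_exists]) simp

lemma D0_v: "j < N \<Longrightarrow> D 0 1 (v j n) = scale (kap n) (v j n)"
  using D0_V[of "\<lambda>i. dl i j" n] v_V[of j n] by simp

lemma P_step: "i < N \<Longrightarrow> j < N \<Longrightarrow> P (Suc n) i j = P n i j + 2 * kap (Suc n) * dl i j"
proof -
  assume ij: "i < N" "j < N"
  have "V (\<lambda>i. P n i j) (Suc n) = D 1 1 (D (-1) 1 (v j (Suc n)))" using P[of n] ij by (simp add: D1_V)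
  also have "\<dots> = D (-1) 1 (v j (Suc (Suc n))) - scale 2 (scale (kap (Suc n)) (v j (Suc n)))"
    using D_swap1[of 1 1 "v j (Suc n)"] D0_v[OF ij(2)] by (simp add: D1_v)
  finally have "V (\<lambda>i. P (Suc n) i j) (Suc n) = V (\<lambda>i. P n i j) (Suc n) + scale (2 * kap (Suc n)) (v j (Suc n))"
    using P[of "Suc n"] ij by (simp add: algebra_simps)
  also have "\<dots> = V (\<lambda>i. P n i j + 2 * kap (Suc n) * dl i j) (Suc n)"
    unfolding v_V[OF ij(2)] V_scale V_add ..
  finally show ?thesis using V_inj[OF _ ij(1)] by metis
qed

text \<open>The constant of integration of the difference equation \<open>P_step\<close>.\<close>

definition C where "C i j = P 0 i j - sq (kap 1) * dl i j"

lemma P_formula: "i < N \<Longrightarrow> j < N \<Longrightarrow> P n i j = sq (kap (Suc n)) * dl i j + C i j"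
proof (induction n)
  case 0
  then show ?case by (simp add: C_def)
next
  case (Suc n)
  have "sq (kap (Suc (Suc n))) = sq (kap (Suc n)) + 2 * kap (Suc n)"
    unfolding kap_Suc[of "Suc n"] by (rule sq_Suc)
  then show ?case using P_step[of i j n] Suc by (simp add: algebra_simps)
qed

lemma Q_step: "i < N \<Longrightarrow> j < N \<Longrightarrow> Q (Suc n) i j = Q n i j + 3 * P (Suc n) i j"
proof -
  assume ij: "i < N" "j < N"
  have "V (\<lambda>i. Q n i j) (Suc n) = D 1 1 (D (-2) 1 (v j (Suc (Suc n))))" using Q[of n] ij by (simp add: D1_V)
  also have "\<dots> = D (-2) 1 (v j (Suc (Suc (Suc n)))) + scale (-3) (D (-1) 1 (v j (Suc (Suc n))))"
    using D_swap[of 1 "-2" 1 1 "v j (Suc (Suc n))"] by (simp add: D1_v)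
  finally have "V (\<lambda>i. Q n i j) (Suc n) = V (\<lambda>i. Q (Suc n) i j + (-3) * P (Suc n) i j) (Suc n)"
    using Q[of "Suc n"] P[of "Suc n"] ij by (simp only: V_scale V_add)
  from V_inj[OF this ij(1)] show ?thesis by simp
qed

definition E where "E i j = Q 0 i j - cub (kap 2) * dl i j - 3 * kap 2 * C i j"

lemma Q_formula: "i < N \<Longrightarrow> j < N \<Longrightarrow> Q n i j = cub (kap (Suc (Suc n))) * dl i j + (3 * kap (Suc (Suc n)) * C i j + E i j)"
proof (induction n)
  case 0
  then show ?case by (simp add: E_def numeral_2_eq_2)
next
  case (Suc n)
  have k: "kap (Suc (Suc (Suc n))) = kap (Suc (Suc n)) + 1" by (rule kap_Suc)
  have "cub (kap (Suc (Suc (Suc n)))) = cub (kap (Suc (Suc n))) + 3 * sq (kap (Suc (Suc n)))"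
    unfolding k by (rule cub_Suc)
  then show ?case using Q_step[of i j n] P_formula[of i j "Suc n"] Suc k
    by (simp add: algebra_simps)
qed

lemma dl_sum: "j < N \<Longrightarrow> (\<Sum>l<N. f l * (a * dl l j)) = a * f j"
  "i < N \<Longrightarrow> (\<Sum>l<N. a * dl i l * f l) = a * f i"
  by (simp_all add: dl_def if_distrib[of "\<lambda>x. _ * x"] if_distrib[of "\<lambda>x. x * _"] cong: if_cong)

lemma X_eq1:
  assumes ij: "i < N" "j < N" and n: "n \<ge> 1"
  shows "sq (kap n + 2) * X n i j + (\<Sum>l<N. C i l * X n l j) =
      sq (kap n) * X (n - 1) i j + (\<Sum>l<N. X (n - 1) i l * C l j) + (if i = j then 3 else 0)"
proof -
  obtain n' where n': "n = Suc n'" using n by (cases n) auto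
  have k2: "kap (Suc (Suc n)) = kap n + 2" by (simp add: kap_def)
  have "D (-1) 1 (D 2 1 (v j n)) = V (\<lambda>i. \<Sum>l<N. P (Suc n) i l * X n l j) (Suc n)"
    using X[of n] ij matrix_apply[OF P[of "Suc n"]] by simp
  moreover have "D 2 1 (D (-1) 1 (v j n)) = V (\<lambda>i. \<Sum>l<N. X n' i l * P n' l j) (Suc n)"
    using P[of n'] ij matrix_apply[OF X[of n']] by (simp add: n')
  moreover have "D (-1) 1 (D 2 1 (v j n)) = D 2 1 (D (-1) 1 (v j n)) + scale 3 (v j (Suc n))"
    using D_swap[of "-1" 2 1 1 "v j n"] by (simp add: D1_v)
  ultimately have "V (\<lambda>i. \<Sum>l<N. P (Suc n) i l * X n l j) (Suc n) =
      V (\<lambda>i. (\<Sum>l<N. X n' i l * P n' l j) + 3 * dl i j) (Suc n)"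
    by (simp add: v_V[OF ij(2)] V_scale V_add)
  from V_inj[OF this ij(1)] have h1: "(\<Sum>l<N. P (Suc n) i l * X n l j) = (\<Sum>l<N. X n' i l * P n' l j) + 3 * dl i j" .
  have h2: "(\<Sum>l<N. P (Suc n) i l * X n l j) = sq (kap n + 2) * X n i j + (\<Sum>l<N. C i l * X n l j)"
  proof -
    have "(\<Sum>l<N. P (Suc n) i l * X n l j) = (\<Sum>l<N. sq (kap n + 2) * dl i l * X n l j + C i l * X n l j)"
      by (rule sum.cong) (simp_all add: P_formula[OF ij(1)] k2 distrib_right)
    then show ?thesis by (simp only: sum.distrib dl_sum(2)[OF ij(1)])
  qed
  have h3: "(\<Sum>l<N. X n' i l * P n' l j) = sq (kap n) * X n' i j + (\<Sum>l<N. X n' i l * C l j)"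
  proof -
    have "(\<Sum>l<N. X n' i l * P n' l j) = (\<Sum>l<N. X n' i l * (sq (kap n) * dl l j) + X n' i l * C l j)"
      by (rule sum.cong) (simp_all add: P_formula[OF _ ij(2)] n' distrib_left)
    then show ?thesis by (simp only: sum.distrib dl_sum(1)[OF ij(2)])
  qed
  show ?thesis using h1 unfolding h2 h3 by (cases "i = j") (simp_all add: n' dl_def)
qed

lemma X_eq2:
  assumes ij: "i < N" "j < N" and n: "n \<ge> 2" and z: "\<And>x. Z 1 x = scale z x"
  shows "cub (kap n + 2) * X n i j + (\<Sum>l<N. (3 * (kap n + 2) * C i l + E i l) * X n l j) =
      cub (kap n) * X (n - 2) i j + (\<Sum>l<N. X (n - 2) i l * (3 * kap n * C l j + E l j)) +
      (if i = j then 4 * kap n - z / 2 else 0)"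
proof -
  obtain n' where n': "n = Suc (Suc n')" using n by (metis add_2_eq_Suc le_Suc_ex)
  have k2: "kap (Suc (Suc n)) = kap n + 2" by (simp add: kap_def)
  have "D (-2) 1 (D 2 1 (v j n)) = V (\<lambda>i. \<Sum>l<N. Q n i l * X n l j) n"
    using X[of n] ij matrix_apply[OF Q[of n]] by simp
  moreover have "D 2 1 (D (-2) 1 (v j n)) = V (\<lambda>i. \<Sum>l<N. X n' i l * Q n' l j) n"
    using Q[of n'] ij matrix_apply[OF X[of n']] by (simp add: n')
  moreover have "D (-2) 1 (D 2 1 (v j n)) = D 2 1 (D (-2) 1 (v j n)) + scale (4 * kap n - z / 2) (v j n)"
    using D_bracket[of "-2" 1 2 1 "v j n"] D0_v[OF ij(2), of n]
    by (simp add: z scale_left_diff_distrib algebra_simps)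
  ultimately have "V (\<lambda>i. \<Sum>l<N. Q n i l * X n l j) n =
      V (\<lambda>i. (\<Sum>l<N. X n' i l * Q n' l j) + (4 * kap n - z / 2) * dl i j) n"
    by (simp add: v_V[OF ij(2)] V_scale V_add)
  from V_inj[OF this ij(1)] have h1: "(\<Sum>l<N. Q n i l * X n l j) = (\<Sum>l<N. X n' i l * Q n' l j) + (4 * kap n - z / 2) * dl i j" .
  have h2: "(\<Sum>l<N. Q n i l * X n l j) = cub (kap n + 2) * X n i j + (\<Sum>l<N. (3 * (kap n + 2) * C i l + E i l) * X n l j)"
  proof -
    have "(\<Sum>l<N. Q n i l * X n l j) = (\<Sum>l<N. cub (kap n + 2) * dl i l * X n l j + (3 * (kap n + 2) * C i l + E i l) * X n l j)"
      by (rule sum.cong) (simp_all only: Q_formula[OF ij(1)] k2 distrib_right lessThan_iff)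
    then show ?thesis by (simp only: sum.distrib dl_sum(2)[OF ij(1)])
  qed
  have h3: "(\<Sum>l<N. X n' i l * Q n' l j) = cub (kap n) * X n' i j + (\<Sum>l<N. X n' i l * (3 * kap n * C l j + E l j))"
  proof -
    have "(\<Sum>l<N. X n' i l * Q n' l j) = (\<Sum>l<N. X n' i l * (cub (kap n) * dl l j) + X n' i l * (3 * kap n * C l j + E l j))"
      by (rule sum.cong) (simp_all only: Q_formula[OF _ ij(2)] n' distrib_left lessThan_iff)
    then show ?thesis by (simp only: sum.distrib dl_sum(1)[OF ij(2)])
  qed
  show ?thesis using h1 unfolding h2 h3 by (cases "i = j") (simp_all add: n' dl_def)
qed

text \<open>The same coordinate vector e serves at all levels, because C and E do not depend on the
  level; the vectors f n are therefore linked by d_1.\<close>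

lemma density_vectors:
  obtains b f n0 where "\<And>v. Z 1 v = 0" "\<And>n. f n \<in> wt (k1 + int n)" "\<And>n. f n \<noteq> 0"
    "\<And>n. D 1 1 (f n) = f (Suc n)"
    "\<And>n. D (-1) 1 (f (Suc n)) = scale ((kap (Suc n) - b) * (kap (Suc n) + b - 1)) (f n)"
    "\<And>n. D (-2) 1 (f (Suc (Suc n))) = scale ((kap (Suc (Suc n)) - 2 * b) * (kap (Suc (Suc n)) + b - 1) * (kap (Suc (Suc n)) + b - 2)) (f n)"
    "\<And>n. n \<ge> n0 \<Longrightarrow> scale ((kap n + b) * (kap n + b + 1)) (D 2 1 (f n)) = scale (kap n + 2 * b) (f (Suc (Suc n)))"
proof -
  obtain z where z: "\<And>x. Z 1 x = scale z x" using central_scalar by blast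
  interpret S: d2_system N "lam + of_int k1" C E X z
  proof
    show "0 < N" by (rule N)
    fix n i j :: nat assume "i < N" "j < N"
    then show "n \<ge> 1 \<Longrightarrow> sq (lam + of_int k1 + of_nat n + 2) * X n i j + (\<Sum>l<N. C i l * X n l j) =
      sq (lam + of_int k1 + of_nat n) * X (n - 1) i j + (\<Sum>l<N. X (n - 1) i l * C l j) + (if i = j then 3 else 0)"
      "n \<ge> 2 \<Longrightarrow> cub (lam + of_int k1 + of_nat n + 2) * X n i j + (\<Sum>l<N. (3 * (lam + of_int k1 + of_nat n + 2) * C i l + E i l) * X n l j) =
      cub (lam + of_int k1 + of_nat n) * X (n - 2) i j + (\<Sum>l<N. X (n - 2) i l * (3 * (lam + of_int k1 + of_nat n) * C l j + E l j)) +
      (if i = j then 4 * (lam + of_int k1 + of_nat n) - z / 2 else 0)"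
      using X_eq1[of i j n] X_eq2[of i j n z, OF _ _ _ z] unfolding kap_def by blast+
  qed
  obtain b e n0 i0 where z0: "z = 0" and e: "i0 < N" "e i0 \<noteq> 0"
    and Ce: "\<And>i. i < N \<Longrightarrow> (\<Sum>l<N. C i l * e l) = (b - b\<^sup>2) * e i"
    and Ee: "\<And>i. i < N \<Longrightarrow> (\<Sum>l<N. E i l * e l) = - 2 * b * (b - 1) * (b - 2) * e i"
    and Xe: "\<And>n i. n \<ge> n0 \<Longrightarrow> i < N \<Longrightarrow> (kap n + b) * (kap n + b + 1) * (\<Sum>j<N. X n i j * e j) = (kap n + 2 * b) * e i"
    using S.density_structure unfolding kap_def by blast
  have Veq: "V c n = V d n" if "\<And>i. i < N \<Longrightarrow> c i = d i" for c d n
    unfolding V_def by (rule sum.cong) (use that in auto)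
  show thesis
  proof (rule that[of "V e" b n0])
    show "Z 1 v = 0" for v by (simp add: z z0)
    show "V e n \<in> wt (k1 + int n)" for n by (rule V_wt)
    show "V e n \<noteq> 0" for n using V_zero[of e n i0] e by blast
    show "D 1 1 (V e n) = V e (Suc n)" for n by (rule D1_V)
    show "D (-1) 1 (V e (Suc n)) = scale ((kap (Suc n) - b) * (kap (Suc n) + b - 1)) (V e n)" for n
      unfolding matrix_apply[OF P] V_scale
    proof (rule Veq)
      fix i assume i: "i < N"
      have "(\<Sum>j<N. P n i j * e j) = (\<Sum>j<N. sq (kap (Suc n)) * dl i j * e j + C i j * e j)"
        by (rule sum.cong) (simp_all add: P_formula[OF i] distrib_right)
      then have "(\<Sum>j<N. P n i j * e j) = sq (kap (Suc n)) * e i + (b - b\<^sup>2) * e i"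
        by (simp only: sum.distrib dl_sum(2)[OF i] Ce[OF i])
      then show "(\<Sum>j<N. P n i j * e j) = (kap (Suc n) - b) * (kap (Suc n) + b - 1) * e i"
        by (simp add: sq_def power2_eq_square algebra_simps)
    qed
    show "D (-2) 1 (V e (Suc (Suc n))) = scale ((kap (Suc (Suc n)) - 2 * b) * (kap (Suc (Suc n)) + b - 1) * (kap (Suc (Suc n)) + b - 2)) (V e n)" for n
      unfolding matrix_apply[OF Q] V_scale
    proof (rule Veq)
      fix i assume i: "i < N"
      let ?k = "kap (Suc (Suc n))"
      have "(\<Sum>j<N. Q n i j * e j) = (\<Sum>j<N. cub ?k * dl i j * e j + (3 * ?k * (C i j * e j) + E i j * e j))"
        by (rule sum.cong) (simp_all add: Q_formula[OF i] distrib_right mult.assoc)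
      then have "(\<Sum>j<N. Q n i j * e j) = cub ?k * e i + (3 * ?k * ((b - b\<^sup>2) * e i) + - 2 * b * (b - 1) * (b - 2) * e i)"
        by (simp only: sum.distrib dl_sum(2)[OF i] Ce[OF i] Ee[OF i] sum_distrib_left[symmetric])
      then show "(\<Sum>j<N. Q n i j * e j) = (?k - 2 * b) * (?k + b - 1) * (?k + b - 2) * e i"
        by (simp add: cub_def power2_eq_square power3_eq_cube algebra_simps)
    qed
    show "scale ((kap n + b) * (kap n + b + 1)) (D 2 1 (V e n)) = scale (kap n + 2 * b) (V e (Suc (Suc n)))" if "n \<ge> n0" for n
      unfolding matrix_apply[OF X] V_scale by (rule Veq) (rule Xe[OF that])
  qed
qed

end

section \<open>Existence, normalisation and downward continuation of the string\<close>

context irreducible_ops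
begin

lemma gauge_exists:
  assumes ub: "unbounded_above" "unbounded_below"
  shows "\<exists>k1 N v. vir_gauge scale D Z lam k1 N v"
proof -
  obtain q where q: "q \<in> annihilator" "q \<noteq> 0" using annihilator_nonzero[OF ub] by blast
  obtain M where M: "bounded_dims M" using annihilator_imp_bounded[OF ub q] by blast
  obtain k0 where k0: "\<forall>k\<ge>k0. D 1 1 ` wt k = wt (k + 1)"
    "\<forall>k\<ge>k0. \<forall>v\<in>wt k. D 1 1 v = 0 \<longrightarrow> v = 0"
    using eventually_bijective[OF M] by (elim exE conjE)
  have sur: "D 1 1 ` wt k = wt (k + 1)" if "k \<ge> k0" for k using k0(1) that by simp
  have inj: "v = 0" if "k \<ge> k0" "v \<in> wt k" "D 1 1 v = 0" for k v using k0(2) that by simp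
  obtain k1 where k1: "k1 \<ge> k0" "wt k1 \<noteq> {0}" by (rule wt_nonzero_high[OF ub(1)])
  obtain d where d: "dim_le d (wt k1)" using dim_le_wt by blast
  obtain B where B: "B \<subseteq> wt k1" "independent B" "wt k1 \<subseteq> span B" "finite B"
    by (rule dim_le_basis[OF d])
  obtain e where e: "bij_betw e {..<card B} B"
    using ex_bij_betw_nat_finite[OF B(4)] by (auto simp: atLeast0LessThan)
  let ?v = "\<lambda>i n. (D 1 1 ^^ n) (e i)"
  have ev: "e i \<in> wt k1" if "i < card B" for i using that e B(1) by (auto simp: bij_betw_def)
  have re: "(\<Sum>i<card B. scale (f (e i)) (e i)) = (\<Sum>x\<in>B. scale (f x) x)" for f
    using sum.reindex_bij_betw[OF e, of "\<lambda>x. scale (f x) x"] .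
  have wt: "?v i n \<in> wt (k1 + int n)" if "i < card B" for i n
  proof (induction n)
    case (Suc n)
    then show ?case using D_wt[of "?v i n" "k1 + int n" 1 1] by (simp add: add_ac)
  qed (simp add: ev[OF that])
  have up: "(\<Sum>i<card B. scale (c i) (?v i (Suc n))) = D 1 1 (\<Sum>i<card B. scale (c i) (?v i n))" for c n
    by (simp add: D.sum)
  have sum_wt: "(\<Sum>i<card B. scale (c i) (?v i n)) \<in> wt (k1 + int n)" for c n
    by (intro subspace_sum[OF subspace_wt] subspace_scale[OF subspace_wt] wt) auto
  have "vir_gauge scale D Z lam k1 (card B) ?v"
  proof
    show "card B > 0" using B k1(2) subspace_0[OF subspace_wt] by (cases "B = {}") (auto simp: card_gt_0_iff)
    show "?v i n \<in> wt (k1 + int n)" if "i < card B" for i n by (rule wt[OF that])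
    show "D 1 1 (?v i n) = ?v i (Suc n)" for i n by simp
    show "\<exists>c. x = (\<Sum>i<card B. scale (c i) (?v i n))" if "x \<in> wt (k1 + int n)" for x n
      using that
    proof (induction n arbitrary: x)
      case 0
      then have "x \<in> span B" using B(3) by auto
      then obtain f where "x = (\<Sum>y\<in>B. scale (f y) y)" unfolding span_finite[OF B(4)] by (elim imageE)
      then show ?case by (intro exI[of _ "\<lambda>i. f (e i)"]) (simp add: re)
    next
      case (Suc n)
      then have "x \<in> D 1 1 ` wt (k1 + int n)" using sur[of "k1 + int n"] k1(1) by (simp add: add_ac)
      then obtain y where y: "y \<in> wt (k1 + int n)" "x = D 1 1 y" by blast
      obtain c where c: "y = (\<Sum>i<card B. scale (c i) (?v i n))" using Suc.IH[OF y(1)] by blast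
      show ?case unfolding up by (rule exI[of _ c]) (simp only: y(2) c)
    qed
    show "c i = 0" if "(\<Sum>i<card B. scale (c i) (?v i n)) = 0" "i < card B" for c i n
      using that
    proof (induction n)
      case 0
      let ?f = "\<lambda>x. c (inv_into {..<card B} e x)"
      have f: "?f (e j) = c j" if "j < card B" for j
        using that e by (simp add: bij_betw_def inv_into_f_f)
      have "(\<Sum>x\<in>B. scale (?f x) x) = (\<Sum>j<card B. scale (c j) (e j))"
        unfolding re[symmetric] by (rule sum.cong) (simp_all add: f)
      then have "(\<Sum>x\<in>B. scale (?f x) x) = 0" using 0 by simp
      moreover have "e i \<in> B" using e 0 by (auto simp: bij_betw_def)
      ultimately have "?f (e i) = 0"
        using independentD[OF B(2) B(4) order_refl, of ?f "e i"] by simp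
      then show ?case using f 0 by simp
    next
      case (Suc n)
      have "D 1 1 (\<Sum>i<card B. scale (c i) (?v i n)) = 0" using Suc.prems(1) unfolding up .
      then have "(\<Sum>i<card B. scale (c i) (?v i n)) = 0"
        using inj[of "k1 + int n", OF _ sum_wt] k1(1) by simp
      then show ?case using Suc by blast
    qed
  qed
  then show ?thesis by blast
qed

text \<open>Degrees beyond 2 and -2 come from brackets with d_1 and d_(-1); the degrees 2 and -2 do
  not, as [d_1, d_1] = 0. The two steps have the same sign, so intermediate weights stay above
  K.\<close>

lemma density_extend:
  assumes w: "\<And>k. k \<ge> K \<Longrightarrow> w k \<in> wt k"
    and base: "\<And>k n. k \<ge> K \<Longrightarrow> k + n \<ge> K \<Longrightarrow> \<bar>n\<bar> \<le> 2 \<Longrightarrow> D n 1 (w k) = scale (lam + of_int k + of_int n * b) (w (k + n))"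
    and k: "k \<ge> K" "k + n \<ge> K"
  shows "D n 1 (w k) = scale (lam + of_int k + of_int n * b) (w (k + n))"
proof -
  define P where "P n \<longleftrightarrow> (\<forall>k. k \<ge> K \<longrightarrow> k + n \<ge> K \<longrightarrow> D n 1 (w k) = scale (lam + of_int k + of_int n * b) (w (k + n)))" for n
  have P_small: "P n" if "\<bar>n\<bar> \<le> 2" for n using base that unfolding P_def by blast
  have step: "P (n + s)" if P: "P n" "P s" and s: "n \<noteq> s" "n + s \<noteq> 0"
    and between: "\<And>k. k \<ge> K \<Longrightarrow> k + (n + s) \<ge> K \<Longrightarrow> k + s \<ge> K \<and> k + n \<ge> K" for n s
    unfolding P_def
  proof (intro allI impI)
    fix k assume k: "k \<ge> K" "k + (n + s) \<ge> K"
    let ?\<kappa> = "lam + of_int k"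
    have ks: "k + s \<ge> K" "k + n \<ge> K" using between[OF k] by auto
    have e: "D s 1 (D n 1 (w k)) = scale ((?\<kappa> + of_int n * b) * (?\<kappa> + of_int n + of_int s * b)) (w (k + (n + s)))"
      "D n 1 (D s 1 (w k)) = scale ((?\<kappa> + of_int s * b) * (?\<kappa> + of_int s + of_int n * b)) (w (k + (n + s)))"
      using P k ks unfolding P_def by (simp_all add: add_ac)
    have "scale (of_int (n - s)) (D (n + s) 1 (w k)) = D s 1 (D n 1 (w k)) - D n 1 (D s 1 (w k))"
      using D_swap[of s n 1 1 "w k"] s by (simp add: add.commute)
    also have "\<dots> = scale (of_int (n - s)) (scale (?\<kappa> + of_int (n + s) * b) (w (k + (n + s))))"
      unfolding e scale_left_diff_distrib[symmetric] scale_scale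
      by (rule arg_cong[of _ _ "\<lambda>a. scale a _"]) (simp add: algebra_simps)
    finally show "D (n + s) 1 (w k) = scale (?\<kappa> + of_int (n + s) * b) (w (k + (n + s)))"
      by (rule scale_left_imp_eq[rotated]) (use s(1) in simp)
  qed
  have "P (int m) \<and> P (- int m)" for m
  proof (induction m)
    case 0
    show ?case using P_small[of 0] by simp
  next
    case (Suc m)
    show ?case
    proof (cases "m \<le> 1")
      case True
      then show ?thesis using P_small[of "int (Suc m)"] P_small[of "- int (Suc m)"] by simp
    next
      case False
      have "P (int m + 1)" by (rule step) (use False Suc P_small[of 1] in auto)
      moreover have "P (- int m + - 1)" by (rule step) (use False Suc P_small[of "-1"] in auto)
      ultimately show ?thesis by (simp add: add.commute)
    qed
  qed
  then have "P n" by (cases n rule: int_cases2) auto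
  then show ?thesis using k unfolding P_def by blast
qed

lemma density_tail:
  assumes ub: "unbounded_above" "unbounded_below"
  obtains b K w where "\<And>v. Z 1 v = 0" "\<And>k. k \<ge> K \<Longrightarrow> w k \<in> wt k" "\<And>k. k \<ge> K \<Longrightarrow> w k \<noteq> 0"
    "\<And>k n. k \<ge> K \<Longrightarrow> k + n \<ge> K \<Longrightarrow> D n 1 (w k) = scale (lam + of_int k + of_int n * b) (w (k + n))"
proof -
  obtain k1 N v where "vir_gauge scale D Z lam k1 N v" using gauge_exists[OF ub] by blast
  then interpret G: vir_gauge scale D Z lam k1 N v .
  obtain b f n0 where Z0: "\<And>v. Z 1 v = 0" and f: "\<And>n. f n \<in> wt (k1 + int n)" "\<And>n. f n \<noteq> 0"
    and up: "\<And>n. D 1 1 (f n) = f (Suc n)"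
    and down: "\<And>n. D (-1) 1 (f (Suc n)) = scale ((G.kap (Suc n) - b) * (G.kap (Suc n) + b - 1)) (f n)"
    and down2: "\<And>n. D (-2) 1 (f (Suc (Suc n))) = scale ((G.kap (Suc (Suc n)) - 2 * b) * (G.kap (Suc (Suc n)) + b - 1) * (G.kap (Suc (Suc n)) + b - 2)) (f n)"
    and up2: "\<And>n. n \<ge> n0 \<Longrightarrow> scale ((G.kap n + b) * (G.kap n + b + 1)) (D 2 1 (f n)) = scale (G.kap n + 2 * b) (f (Suc (Suc n)))"
    by (rule G.density_vectors) blast
  obtain n1 where n1: "n1 \<ge> n0" "\<And>n. n \<ge> n1 \<Longrightarrow> G.kap n + b \<noteq> 0"
  proof -
    obtain m :: nat where m: "norm (lam + of_int k1 + b) < of_nat m" using reals_Archimedean2 by blast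
    show thesis
    proof (rule that[of "max n0 m"])
      fix n assume "n \<ge> max n0 m"
      then have "norm (lam + of_int k1 + b) < norm (complex_of_nat n)" using m by simp
      then have "lam + of_int k1 + b \<noteq> - of_nat n" by (metis norm_minus_cancel less_irrefl)
      then show "G.kap n + b \<noteq> 0" by (simp add: G.kap_def eq_neg_iff_add_eq_0 algebra_simps)
    qed simp
  qed
  \<comment> \<open>Dividing by g turns d_1 f n = f (n + 1) into the coefficient kap n + b of a
    density module; the product starts at \<open>n1\<close> because earlier factors may
    vanish.\<close>
  define g where "g n = (\<Prod>i\<in>{n1..<n}. G.kap i + b)" for n
  have g0: "g n \<noteq> 0" for n using n1(2) by (auto simp: g_def)
  have gS: "g (Suc n) = g n * (G.kap n + b)" if "n \<ge> n1" for n using that by (simp add: g_def)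
  define W where "W n = scale (1 / g n) (f n)" for n
  have W1: "D 1 1 (W n) = scale (G.kap n + b) (W (Suc n))" if "n \<ge> n1" for n
    using n1(2)[OF that] by (simp add: W_def up gS[OF that])
  have W2: "D (-1) 1 (W (Suc n)) = scale (G.kap (Suc n) - b) (W n)" if "n \<ge> n1" for n
  proof -
    have "1 / g (Suc n) * ((G.kap (Suc n) - b) * (G.kap (Suc n) + b - 1)) =
      ((G.kap (Suc n) - b) * (1 / g n)) * ((G.kap n + b) / (G.kap n + b))"
      using that by (simp add: gS G.kap_Suc)
    then show ?thesis using n1(2)[OF that] unfolding W_def D.scale down scale_scale by simp
  qed
  have W3: "D (-2) 1 (W (Suc (Suc n))) = scale (G.kap (Suc (Suc n)) - 2 * b) (W n)" if "n \<ge> n1" for n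
  proof -
    have "G.kap n + 1 + b \<noteq> 0" "G.kap n + b \<noteq> 0" using n1(2)[of "Suc n"] n1(2)[of n] that by (simp_all add: G.kap_Suc)
    moreover have "1 / g (Suc (Suc n)) * ((G.kap (Suc (Suc n)) - 2 * b) * (G.kap (Suc (Suc n)) + b - 1) * (G.kap (Suc (Suc n)) + b - 2)) =
      ((G.kap (Suc (Suc n)) - 2 * b) * (1 / g n)) * ((G.kap n + 1 + b) / (G.kap n + 1 + b)) * ((G.kap n + b) / (G.kap n + b))"
      using that by (simp add: gS G.kap_Suc) (simp add: add_ac)
    ultimately have "1 / g (Suc (Suc n)) * ((G.kap (Suc (Suc n)) - 2 * b) * (G.kap (Suc (Suc n)) + b - 1) * (G.kap (Suc (Suc n)) + b - 2)) =
      (G.kap (Suc (Suc n)) - 2 * b) * (1 / g n)" by simp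
    then show ?thesis unfolding W_def D.scale down2 scale_scale by (simp only:)
  qed
  have W4: "D 2 1 (W n) = scale (G.kap n + 2 * b) (W (Suc (Suc n)))" if n: "n \<ge> n1" for n
  proof -
    have k: "G.kap n + b + 1 \<noteq> 0" "G.kap n + b \<noteq> 0" using n1(2)[of "Suc n"] n1(2)[of n] n by (simp_all add: G.kap_Suc add_ac)
    have gg: "g (Suc (Suc n)) = g n * ((G.kap n + b) * (G.kap n + b + 1))"
      using n by (simp add: gS G.kap_Suc add_ac)
    have "D 2 1 (f n) = scale ((G.kap n + 2 * b) / ((G.kap n + b) * (G.kap n + b + 1))) (f (Suc (Suc n)))"
      using arg_cong[OF up2[of n], of "scale (1 / ((G.kap n + b) * (G.kap n + b + 1)))"] k n n1(1) by simp
    then show ?thesis unfolding W_def D.scale gg by simp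
  qed
  define K where "K = k1 + int n1"
  define w where "w k = W (nat (k - k1))" for k
  have nat_k: "\<exists>n. k = k1 + int n \<and> n \<ge> n1" if "k \<ge> K" for k
    using that by (intro exI[of _ "nat (k - k1)"]) (auto simp: K_def)
  have w_W: "w (k1 + int n) = W n" for n by (simp add: w_def)
  have kap: "G.kap n = lam + of_int (k1 + int n)" for n by (simp add: G.kap_def add.assoc)
  have wk: "w k \<in> wt k" if "k \<ge> K" for k
    using nat_k[OF that] by (auto simp: w_W W_def intro!: subspace_scale[OF subspace_wt] f)
  have base: "D n 1 (w k) = scale (lam + of_int k + of_int n * b) (w (k + n))"
    if k: "k \<ge> K" "k + n \<ge> K" "\<bar>n\<bar> \<le> 2" for k n
  proof -
    obtain j where j: "k = k1 + int j" "j \<ge> n1" using nat_k[OF k(1)] by blast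
    obtain i where i: "k + n = k1 + int i" "i \<ge> n1" using nat_k[OF k(2)] by blast
    have "n = int i - int j" using i j by simp
    then consider "n = 0" "i = j" | "n = 1" "i = Suc j" | "n = -1" "j = Suc i" | "n = 2" "i = Suc (Suc j)" | "n = -2" "j = Suc (Suc i)"
      using k(3) by linarith
    then show ?thesis
    proof cases
      case 1
      then show ?thesis using wtD[OF wk[OF k(1)]] by simp
    next
      case 2
      then show ?thesis unfolding i(1) using W1[OF j(2)] unfolding j(1) w_W kap by simp
    next
      case 3
      then show ?thesis unfolding i(1) using W2[OF i(2)] unfolding j(1) w_W kap by simp
    next
      case 4
      then show ?thesis unfolding i(1) using W4[OF j(2)] unfolding j(1) w_W kap by simp
    next
      case 5
      then show ?thesis unfolding i(1) using W3[OF i(2)] unfolding j(1) w_W kap by simp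
    qed
  qed
  show thesis
  proof (rule that[of K w b])
    show "Z 1 v = 0" for v by (rule Z0)
    show "w k \<in> wt k" if "k \<ge> K" for k by (rule wk[OF that])
    show "w k \<noteq> 0" if "k \<ge> K" for k using nat_k[OF that] g0 f(2) by (auto simp: w_W W_def)
    show "D n 1 (w k) = scale (lam + of_int k + of_int n * b) (w (k + n))" if "k \<ge> K" "k + n \<ge> K" for k n
      by (rule density_extend[OF wk base that])
  qed
qed

text \<open>The string exists only for large k, and u k m reaches below it. The number c k m is the
  coefficient d_(-m) would have in a full density module; raising u k m back into the string gives a
  vector depending on m only through the factor c k m, so \<open>no_killed_vector\<close> puts the u
  k m with fixed k on one line.\<close>

lemma wt_dim_le_1:
  assumes ub: "unbounded_above" "unbounded_below"
  shows "dim_le 1 (wt k)"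
proof -
  obtain b K w where Z0: "\<And>v. Z 1 v = 0" and w: "\<And>k. k \<ge> K \<Longrightarrow> w k \<in> wt k" "\<And>k. k \<ge> K \<Longrightarrow> w k \<noteq> 0"
    and Dw: "\<And>k n. k \<ge> K \<Longrightarrow> k + n \<ge> K \<Longrightarrow> D n 1 (w k) = scale (lam + of_int k + of_int n * b) (w (k + n))"
    by (rule density_tail[OF ub]) blast
  have "\<exists>x. \<forall>f. f - Poly_Mapping.single 0 (x f) \<in> annihilator"
    using annihilator_evaluation[OF ub] by (intro choice) blast
  then obtain \<chi> where \<chi>: "\<And>f. f - Poly_Mapping.single 0 (\<chi> f) \<in> annihilator" by blast
  have D\<chi>: "D n f v = scale (\<chi> f) (D n 1 v)" for n f v
    using annihilatorD[OF \<chi>[of f], of n v] D_const[of n "\<chi> f" 1 v] by (simp add: D_diff)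
  define u where "u k m = D (- m) 1 (w (k + m))" for k m
  define c where "c k m = lam + of_int k + of_int m * (1 - b)" for k m
  have u_wt: "u k m \<in> wt k" if "k + m \<ge> K" for k m
    using D_wt[OF w(1)[OF that], of "- m" 1] by (simp add: u_def)
  have swap: "D s 1 (u k m) = D (- m) 1 (D s 1 (w (k + m))) - scale (of_int (m + s)) (D (s - m) 1 (w (k + m)))" for s k m
    using D_bracket[of s 1 "- m" 1 "w (k + m)"] by (simp add: u_def Z0 algebra_simps)
  have raise: "D s 1 (u k m) = scale ((lam + of_int k + of_int s * b) * c k m) (w (k + s))"
    if "k + m \<ge> K" "k + s \<ge> K" "k + m + s \<ge> K" for s k m
  proof -
    have "D (- m) 1 (D s 1 (w (k + m))) = scale ((lam + of_int (k + m) + of_int s * b) * (lam + of_int (k + m + s) - of_int m * b)) (w (k + s))"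
    proof -
      have "D s 1 (w (k + m)) = scale (lam + of_int (k + m) + of_int s * b) (w (k + m + s))"
        by (rule Dw) (use that in auto)
      moreover have "D (- m) 1 (w (k + m + s)) = scale (lam + of_int (k + m + s) - of_int m * b) (w (k + s))"
        using Dw[of "k + m + s" "- m"] that by (simp add: add.commute add.left_commute)
      ultimately show ?thesis by (simp only: D.scale scale_scale)
    qed
    moreover have "D (s - m) 1 (w (k + m)) = scale (lam + of_int (k + m) + of_int (s - m) * b) (w (k + s))"
      using Dw[of "k + m" "s - m"] that by simp
    ultimately have "D s 1 (u k m) = scale ((lam + of_int (k + m) + of_int s * b) * (lam + of_int (k + m + s) - of_int m * b)
        - of_int (m + s) * (lam + of_int (k + m) + of_int (s - m) * b)) (w (k + s))"
      by (simp only: swap scale_scale scale_left_diff_distrib)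
    moreover have "(lam + of_int (k + m) + of_int s * b) * (lam + of_int (k + m + s) - of_int m * b)
        - of_int (m + s) * (lam + of_int (k + m) + of_int (s - m) * b) = (lam + of_int k + of_int s * b) * c k m"
      by (simp add: c_def) (simp add: algebra_simps)
    ultimately show ?thesis by simp
  qed
  have zero: "x = 0" if "\<And>s. s \<ge> M \<Longrightarrow> D s 1 x = 0" for x M
  proof (rule no_killed_vector[OF ub(1)])
    show "kills_from UNIV M x"
      unfolding kills_from_def
    proof (intro allI impI ballI)
      fix n f assume "n \<ge> M"
      then show "D n f x = 0" using that D\<chi>[of n f x] by simp
    qed
  qed
  have cross: "scale (c k m') (u k m) = scale (c k m) (u k m')" if "k + m \<ge> K" "k + m' \<ge> K" for k m m'
  proof -
    have "scale (c k m') (u k m) - scale (c k m) (u k m') = 0"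
    proof (rule zero[of "max (K - k) (max (K - k - m) (K - k - m'))"])
      fix s assume "s \<ge> max (K - k) (max (K - k - m) (K - k - m'))"
      then show "D s 1 (scale (c k m') (u k m) - scale (c k m) (u k m')) = 0"
        using that by (simp add: raise mult_ac)
    qed
    then show ?thesis by simp
  qed
  have vanish: "u k m = 0" if "k + m \<ge> K" "c k m = 0" for k m
  proof (rule zero[of "max (K - k) (K - k - m)"])
    fix s assume "s \<ge> max (K - k) (K - k - m)"
    then show "D s 1 (u k m) = 0" using that by (simp add: raise)
  qed
  define S where "S k = span {u k m | m. k + m \<ge> K}" for k
  have S_sub: "subspace (S k)" for k by (simp add: S_def)
  have S_wt: "S k \<subseteq> wt k" for k
    unfolding S_def by (rule span_minimal) (use u_wt subspace_wt in auto)
  have S_dim: "dim_le 1 (S k)" for k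
  proof (cases "\<exists>m. k + m \<ge> K \<and> c k m \<noteq> 0")
    case True
    then obtain m0 where m0: "k + m0 \<ge> K" "c k m0 \<noteq> 0" by blast
    have "u k m \<in> span {u k m0}" if "k + m \<ge> K" for m
    proof -
      have "u k m = scale (c k m / c k m0) (u k m0)"
        using arg_cong[OF cross[OF that m0(1)], of "scale (1 / c k m0)"] m0(2) by simp
      then show ?thesis by (simp add: span_base span_scale)
    qed
    then have "S k \<subseteq> span {u k m0}" unfolding S_def by (intro span_minimal) auto
    then show ?thesis unfolding dim_le_def by (intro exI[of _ "{u k m0}"]) simp
  next
    case False
    then have "{u k m | m. k + m \<ge> K} \<subseteq> {0}" using vanish by auto
    then have "S k \<subseteq> span {0}" unfolding S_def by (rule span_mono)
    then show ?thesis unfolding dim_le_def by (intro exI[of _ "{0}"]) simp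
  qed
  \<comment> \<open>Trading m for a larger index makes room to expand d_n d_(-m) w with all indices
    of the string at least K.\<close>
  have far: "\<exists>a m'. m' \<ge> M \<and> k + m' \<ge> K \<and> u k m = scale a (u k m')" if m: "k + m \<ge> K" for k m M
  proof -
    define M' where "M' = max M (K - k)"
    have M': "M' \<ge> M" "k + M' \<ge> K" by (auto simp: M'_def)
    have *: ?thesis if "m' \<ge> M'" "c k m' \<noteq> 0" for m'
    proof -
      have k: "k + m' \<ge> K" "m' \<ge> M" using that(1) M' by auto
      have "u k m = scale (c k m / c k m') (u k m')"
        using arg_cong[OF cross[OF m k(1)], of "scale (1 / c k m')"] that(2) by simp
      then show ?thesis using k by blast
    qed
    show ?thesis
    proof (cases "c k M' = 0 \<and> c k (M' + 1) = 0")
      case True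
      then have z: "c k M' = 0" "c k (M' + 1) = 0" by auto
      \<comment> \<open>As a function of m, c k m is affine with slope 1 - b, so two consecutive
        zeros make it vanish identically.\<close>
      have "1 - b = c k (M' + 1) - c k M'" by (simp add: c_def algebra_simps)
      then have "1 - b = 0" using z by simp
      then have "c k m = 0" using z(1) by (simp add: c_def)
      then have "u k m = scale 0 (u k M')" using vanish[OF m] by simp
      then show ?thesis using M' by blast
    next
      case False
      then show ?thesis using *[of M'] *[of "M' + 1"] by auto
    qed
  qed
  have Du: "D n f (u k m) \<in> S (k + n)" if km: "k + m \<ge> K" for n f k m
  proof -
    obtain a m' where m': "K - k - n \<le> m'" "k + m' \<ge> K" "u k m = scale a (u k m')"
      using far[of k m "K - k - n", OF km] by blast
    have in_S: "u (k + n) j \<in> S (k + n)" if "k + n + j \<ge> K" for j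
      unfolding S_def by (rule span_base) (use that in blast)
    have "D (- m') 1 (D n 1 (w (k + m'))) = scale (lam + of_int (k + m') + of_int n * b) (u (k + n) m')"
      using Dw[of "k + m'" n] m' by (simp add: u_def add_ac)
    moreover have "D (n - m') 1 (w (k + m')) = u (k + n) (m' - n)" by (simp add: u_def)
    ultimately have "D n 1 (u k m') \<in> S (k + n)"
      unfolding swap using in_S[of m'] in_S[of "m' - n"] m'
      by (auto intro!: subspace_diff[OF S_sub] subspace_scale[OF S_sub])
    then show ?thesis unfolding D\<chi>[of n f] m'(3) D.scale by (intro subspace_scale[OF S_sub])
  qed
  let ?N = "span (\<Union>k. S k)"
  have S_N: "S k \<subseteq> ?N" for k by (intro subsetI span_base UN_I[of k]) simp_all
  have N_eq: "?N = span (\<Union>k. {u k m | m. k + m \<ge> K})"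
  proof (rule antisym)
    show "?N \<subseteq> span (\<Union>k. {u k m | m. k + m \<ge> K})"
      unfolding S_def by (intro span_minimal UN_least span_mono) auto
    show "span (\<Union>k. {u k m | m. k + m \<ge> K}) \<subseteq> ?N"
      unfolding S_def by (intro span_mono UN_mono subsetI span_base) auto
  qed
  \<comment> \<open>At such a weight u k 0 = d_0 w k is a nonzero multiple of w k, so the span
    contains a nonzero vector.\<close>
  obtain k where k: "k \<ge> K" "lam + of_int k \<noteq> 0"
  proof (cases "lam + of_int K = 0")
    case True
    then have "lam + of_int (K + 1) \<noteq> 0" by (simp add: add.assoc[symmetric])
    then show thesis by (intro that[of "K + 1"]) auto
  qed (use that in blast)
  have "?N = UNIV"
  proof (rule submodule_UNIV[of _ "w k"])
    show "subspace ?N" by simp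
    show "D n f x \<in> ?N" if "x \<in> ?N" for n f x
      using that[unfolded N_eq]
    proof (induction rule: span_induct_alt)
      case base
      then show ?case by (simp add: span_zero)
    next
      case (step a x y)
      then have "D n f x \<in> ?N" using Du S_N by blast
      then show ?case using step(2) by (simp add: span_add span_scale)
    qed
    have "u k 0 = scale (lam + of_int k) (w k)" using wtD[OF w(1)[OF k(1)]] by (simp add: u_def)
    moreover have "u k 0 \<in> ?N" unfolding N_eq
    proof (intro span_base UN_I[of k] UNIV_I CollectI exI[of _ 0] conjI refl)
      show "K \<le> k + 0" using k(1) by simp
    qed
    ultimately have "scale (1 / (lam + of_int k)) (scale (lam + of_int k) (w k)) \<in> ?N" by (metis span_scale)
    then show "w k \<in> ?N" using k(2) by simp
  qed (use w(2) k in blast)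
  then have "S k = wt k" for k by (rule graded_UNIV_component[OF S_sub S_wt])
  then show ?thesis using S_dim by metis
qed

end

section \<open>Verma modules\<close>

lemma env_of_add: "env_of (x + y) = env_of x + env_of y"
  by transfer (simp add: tensor_of_def lin_ext_add env_ideal_closed)

lemma env_of_cscale: "env_of (cscale a x) = env_scale a (env_of x)"
  by transfer (simp add: tensor_of_def lin_ext_cscale env_ideal_closed)

lemma env_of_lbracket: "env_of (lbracket x y) = env_of x * env_of y - env_of y * env_of x"
proof -
  have "env_of x * env_of y - env_of y * env_of x = env_of (lbracket x y)"
  proof transfer
    fix x y
    let ?z = "tensor_of x * tensor_of y - tensor_of y * tensor_of x - tensor_of (lbracket x y)"
    have "?z = 1 * ?z * 1" by simp
    then show "?z \<in> env_ideal" unfolding env_ideal_def by (intro free_vs.span_base) blast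
  qed
  then show ?thesis by simp
qed

lemma env_mult_scale: "u * env_scale a v = env_scale a (u * v)"
  by transfer (simp add: cscale_mult_right env_ideal_closed)

lemma env_scale_mult: "env_scale a u * v = env_scale a (u * v)"
  by transfer (simp add: cscale_mult_left env_ideal_closed)

text \<open>Products grow by left multiplication with basis vectors, which is how the Lie algebra
  acts on the first tensor factor.\<close>

lemma env_alg_induct:
  assumes one: "Q 1" and add: "\<And>u v. Q u \<Longrightarrow> Q v \<Longrightarrow> Q (u + v)" and scale: "\<And>a u. Q u \<Longrightarrow> Q (env_scale a u)"
    and mult: "\<And>b u. Q u \<Longrightarrow> Q (env_of (Poly_Mapping.single b 1) * u)"
  shows "Q u"
proof (induction u rule: env_alg.abs_induct)
  case (1 p)
  have word: "Q (abs_env_alg (Poly_Mapping.single (Word bs) 1))" for bs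
  proof (induction bs)
    case Nil
    have "abs_env_alg (Poly_Mapping.single (Word []) 1) = 1"
      by (simp add: one_env_alg_def zero_word_def[symmetric])
    then show ?case using one by simp
  next
    case (Cons b bs)
    have "Poly_Mapping.single (Word (b # bs)) (1::complex) = Poly_Mapping.single (Word [b]) 1 * Poly_Mapping.single (Word bs) 1"
      by (simp add: mult_single plus_word_def)
    then have "abs_env_alg (Poly_Mapping.single (Word (b # bs)) 1) =
        env_of (Poly_Mapping.single b 1) * abs_env_alg (Poly_Mapping.single (Word bs) 1)"
      by (simp add: env_of.abs_eq times_env_alg.abs_eq tensor_of_def lin_ext_single)
    then show ?case using mult[OF Cons] by simp
  qed
  show ?case
  proof (induction p rule: poly_mapping_sum_induct)
    case zero
    show ?case using scale[OF one, of 0]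
      by (simp add: one_env_alg_def env_scale.abs_eq)
  next
    case (single w c)
    have "abs_env_alg (Poly_Mapping.single w c) = env_scale c (abs_env_alg (Poly_Mapping.single w 1))"
      by (simp add: env_scale.abs_eq cscale_single)
    then show ?case using scale[OF word[of "letters w"], of c] by simp
  next
    case (add p q)
    then show ?case using assms(2) by (simp add: plus_env_alg.abs_eq[symmetric])
  qed
qed

definition basis_degree :: "vir_basis \<times> int \<Rightarrow> int" where
  "basis_degree b = (case fst b of Vir_d i \<Rightarrow> i | Vir_c \<Rightarrow> 0)"

abbreviation basis_vector :: "'a \<Rightarrow> 'a \<Rightarrow>\<^sub>0 complex" where
  "basis_vector b \<equiv> Poly_Mapping.single b 1"

lemma basis_vector_graded: "basis_vector b \<in> graded_part (basis_degree b)"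
proof (cases "fst b")
  case (Vir_d i)
  then have "basis_vector b = dt i (snd b)" by (cases b) (simp add: dt_def)
  then show ?thesis using Vir_d unfolding graded_part_def by (intro free_vs.span_base) (auto simp: basis_degree_def)
next
  case Vir_c
  then have "basis_vector b = ct (snd b)" by (cases b) (simp add: ct_def)
  then show ?thesis using Vir_c unfolding graded_part_def by (intro free_vs.span_base) (auto simp: basis_degree_def)
qed

lemma lbracket_basis_vector:
  obtains a b' a' b'' where "lbracket (basis_vector b) (basis_vector c) = cscale a (basis_vector b') + cscale a' (basis_vector b'')"
proof -
  obtain x i where b: "b = (x, i)" by (cases b)
  obtain y j where c: "c = (y, j)" by (cases c)
  show thesis
  proof (cases "x = Vir_c \<or> y = Vir_c")
    case True
    then have "lbracket (basis_vector b) (basis_vector c) = 0"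
      by (cases x; cases y) (auto simp: b c lbracket_basis)
    then show thesis by (intro that[of 0 b 0 b]) simp
  next
    case False
    then obtain m n where "x = Vir_d m" "y = Vir_d n" by (cases x; cases y) auto
    then show thesis
      by (intro that[of "of_int (n - m)" "(Vir_d (m + n), i + j)" "if m + n = 0 then of_int (m ^ 3 - m) / 12 else 0" "(Vir_c, i + j)"])
        (simp add: b c lbracket_basis dt_def ct_def)
  qed
qed

lemma lbracket_weight: "lbracket (dt 0 0) (basis_vector b) = cscale (of_int (basis_degree b)) (basis_vector b)"
proof -
  obtain x i where b: "b = (x, i)" by (cases b)
  show ?thesis by (cases x) (simp_all add: b dt_def lbracket_basis basis_degree_def)
qed

definition tensor_act :: "loop_vir \<Rightarrow> ((env_alg \<times> complex) \<Rightarrow>\<^sub>0 complex) \<Rightarrow> ((env_alg \<times> complex) \<Rightarrow>\<^sub>0 complex)" where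
  "tensor_act x = lin_ext (\<lambda>(u, z). pure_tensor (env_of x * u) z)"

lemma tensor_act_add: "tensor_act x (v + w) = tensor_act x v + tensor_act x w"
  by (simp add: tensor_act_def lin_ext_add)

lemma tensor_act_cscale: "tensor_act x (cscale a w) = cscale a (tensor_act x w)"
  by (simp add: tensor_act_def lin_ext_cscale)

lemma tensor_act_0 [simp]: "tensor_act x 0 = 0"
  by (simp add: tensor_act_def)

lemma tensor_act_diff: "tensor_act x (v - w) = tensor_act x v - tensor_act x w"
  using tensor_act_add[of x "v - w" w] by simp

lemma tensor_act_pure: "tensor_act x (pure_tensor u z) = pure_tensor (env_of x * u) z"
  by (simp add: tensor_act_def lin_ext_single pure_tensor_def)

lemma free_tensor_induct [case_names pure add scale]:
  assumes "\<And>u z. Q (pure_tensor u z)" "\<And>v w. Q v \<Longrightarrow> Q w \<Longrightarrow> Q (v + w)" "\<And>a w. Q w \<Longrightarrow> Q (cscale a w)"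
  shows "Q w"
proof (induction w rule: poly_mapping_sum_induct)
  case zero
  show ?case using assms(3)[OF assms(1), of 0] by simp
next
  case (single b c)
  obtain u z where "b = (u, z)" by (cases b)
  then have "Poly_Mapping.single b c = cscale c (pure_tensor u z)" by (simp add: pure_tensor_def cscale_single)
  then show ?case using assms(1,3) by simp
qed (rule assms(2))

text \<open>With \<open>eps\<close> equal to 1 or -1 the same development covers highest and lowest
  weight modules; lowering degrees i are those with eps * i < 0.\<close>

locale verma =
  fixes eps :: int and P :: "loop_vir set" and \<phi> :: "loop_vir \<Rightarrow> complex"
  assumes P_eq: "P = free_span (\<Union>i\<in>{i. eps * i > 0}. graded_part i)"
    and eps: "eps \<noteq> 0"
    and linear_\<phi>: "linear_on_degree_zero \<phi>"
begin

abbreviation R where "R \<equiv> tensor_relations P \<phi>"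

lemma R_closed:
  "0 \<in> R" "v \<in> R \<Longrightarrow> w \<in> R \<Longrightarrow> v + w \<in> R" "v \<in> R \<Longrightarrow> w \<in> R \<Longrightarrow> v - w \<in> R" "v \<in> R \<Longrightarrow> cscale a v \<in> R"
  unfolding tensor_relations_def
  by (simp_all add: free_vs.span_zero free_vs.span_add free_vs.span_diff free_vs.span_scale)

lemma R_gen:
  "pure_tensor (u + u') z - pure_tensor u z - pure_tensor u' z \<in> R"
  "pure_tensor u (z + z') - pure_tensor u z - pure_tensor u z' \<in> R"
  "pure_tensor (env_scale a u) z - cscale a (pure_tensor u z) \<in> R"
  "pure_tensor u (a * z) - cscale a (pure_tensor u z) \<in> R"
  "h \<in> graded_part 0 \<Longrightarrow> n \<in> P \<Longrightarrow> pure_tensor (u * env_of (h + n)) z - pure_tensor u (\<phi> h * z) \<in> R"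
  unfolding tensor_relations_def by (rule free_vs.span_base; blast)+

lemma R_induct [consumes 1, case_names add scale r1 r2 r3 r4 r5]:
  assumes "w \<in> R"
    and "\<And>v w. Q v \<Longrightarrow> Q w \<Longrightarrow> Q (v + w)" "\<And>a w. Q w \<Longrightarrow> Q (cscale a w)"
    and "\<And>u u' z. Q (pure_tensor (u + u') z - pure_tensor u z - pure_tensor u' z)"
    "\<And>u z z'. Q (pure_tensor u (z + z') - pure_tensor u z - pure_tensor u z')"
    "\<And>a u z. Q (pure_tensor (env_scale a u) z - cscale a (pure_tensor u z))"
    "\<And>a u z. Q (pure_tensor u (a * z) - cscale a (pure_tensor u z))"
    "\<And>u h n z. h \<in> graded_part 0 \<Longrightarrow> n \<in> P \<Longrightarrow> Q (pure_tensor (u * env_of (h + n)) z - pure_tensor u (\<phi> h * z))"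
  shows "Q w"
  using assms(1) unfolding tensor_relations_def
proof (induction w rule: free_vs.span_induct_alt)
  case base
  show ?case using assms(3)[OF assms(4), of 0] by simp
next
  case (step c x y)
  from step(1) have "Q x" using assms(4-8) by (elim UnE CollectE exE conjE) simp_all
  then show ?case using step(2) assms(2,3) by simp
qed

lemma tensor_act_R: "w \<in> R \<Longrightarrow> tensor_act x w \<in> R"
proof (induction w rule: R_induct)
  case (add v w)
  then show ?case by (simp add: tensor_act_add R_closed)
next
  case (scale a w)
  then show ?case by (simp add: tensor_act_cscale R_closed)
qed (simp_all add: tensor_act_diff tensor_act_cscale tensor_act_pure distrib_left env_mult_scale R_gen mult.assoc[symmetric])

text \<open>Computations are done on representatives modulo R; cosets enter only when the quotient
  modules themselves are compared.\<close>

definition rel :: "((env_alg \<times> complex) \<Rightarrow>\<^sub>0 complex) \<Rightarrow> ((env_alg \<times> complex) \<Rightarrow>\<^sub>0 complex) \<Rightarrow> bool" (infix "\<approx>" 50) where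
  "v \<approx> w \<longleftrightarrow> v - w \<in> R"

lemma rel_refl [simp]: "v \<approx> v"
  by (simp add: rel_def R_closed)

lemma rel_sym: "v \<approx> w \<Longrightarrow> w \<approx> v"
  using R_closed(3)[OF R_closed(1), of "v - w"] by (simp add: rel_def)

lemma rel_trans [trans]: "u \<approx> v \<Longrightarrow> v \<approx> w \<Longrightarrow> u \<approx> w"
  using R_closed(2)[of "u - v" "v - w"] by (simp add: rel_def)

lemma rel_add: "v \<approx> w \<Longrightarrow> v' \<approx> w' \<Longrightarrow> v + v' \<approx> w + w'"
  using R_closed(2)[of "v - w" "v' - w'"] by (simp add: rel_def algebra_simps)

lemma rel_diff: "v \<approx> w \<Longrightarrow> v' \<approx> w' \<Longrightarrow> v - v' \<approx> w - w'"
  using R_closed(3)[of "v - w" "v' - w'"] by (simp add: rel_def algebra_simps)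

lemma rel_cscale: "v \<approx> w \<Longrightarrow> cscale a v \<approx> cscale a w"
  using R_closed(4)[of "v - w" a] by (simp add: rel_def free_vs.scale_right_diff_distrib)

lemma rel_act: "v \<approx> w \<Longrightarrow> tensor_act x v \<approx> tensor_act x w"
  using tensor_act_R[of "v - w" x] by (simp add: rel_def tensor_act_diff)

lemma rel_0: "v \<approx> 0 \<longleftrightarrow> v \<in> R"
  by (simp add: rel_def)

lemma tensor_act_add_left: "tensor_act (x + y) w \<approx> tensor_act x w + tensor_act y w"
proof (induction w rule: free_tensor_induct)
  case (pure u z)
  then show ?case using R_gen(1)[of "env_of x * u" "env_of y * u" z]
    by (simp add: tensor_act_pure env_of_add distrib_right rel_def diff_diff_eq)
next
  case (add v w)
  from rel_add[OF this] show ?case by (simp add: tensor_act_add add_ac)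
next
  case (scale a w)
  from rel_cscale[OF this] show ?case by (simp add: tensor_act_cscale free_vs.scale_right_distrib)
qed

lemma tensor_act_scale_left: "tensor_act (cscale a x) w \<approx> cscale a (tensor_act x w)"
proof (induction w rule: free_tensor_induct)
  case (pure u z)
  then show ?case using R_gen(3)[of a "env_of x * u" z]
    by (simp add: tensor_act_pure env_of_cscale env_scale_mult rel_def)
next
  case (add v w)
  from rel_add[OF this] show ?case by (simp add: tensor_act_add free_vs.scale_right_distrib)
next
  case (scale b w)
  from rel_cscale[OF this, of b] show ?case by (simp add: tensor_act_cscale mult.commute)
qed

lemma tensor_act_lbracket: "tensor_act x (tensor_act y w) \<approx> tensor_act y (tensor_act x w) + tensor_act (lbracket x y) w"
proof (induction w rule: free_tensor_induct)
  case (pure u z)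
  have "env_of x * (env_of y * u) = env_of y * (env_of x * u) + env_of (lbracket x y) * u"
    by (simp add: env_of_lbracket algebra_simps)
  then show ?case using R_gen(1)[of "env_of y * (env_of x * u)" "env_of (lbracket x y) * u" z]
    by (simp add: tensor_act_pure rel_def diff_diff_eq)
next
  case (add v w)
  from rel_add[OF this] show ?case by (simp add: tensor_act_add add_ac)
next
  case (scale a w)
  from rel_cscale[OF this, of a] show ?case by (simp add: tensor_act_cscale free_vs.scale_right_distrib)
qed

abbreviation top_vector where "top_vector \<equiv> pure_tensor 1 1"

lemma generated:
  assumes N: "\<And>w. w \<in> R \<Longrightarrow> w \<in> N" "\<And>v w. v \<in> N \<Longrightarrow> w \<in> N \<Longrightarrow> v + w \<in> N" "\<And>a w. w \<in> N \<Longrightarrow> cscale a w \<in> N"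
    and act: "\<And>b w. w \<in> N \<Longrightarrow> tensor_act (basis_vector b) w \<in> N" and top: "top_vector \<in> N"
  shows "w \<in> N"
proof -
  have rel: "v \<in> N" if "v \<approx> w" "w \<in> N" for v w
    using N(2)[OF that(2) N(1)[OF that(1)[unfolded rel_def]]] by simp
  have unit: "pure_tensor u 1 \<in> N" for u
  proof (induction u rule: env_alg_induct)
    case 1
    show ?case by (rule top)
  next
    case (2 u v)
    show ?case
      by (rule rel[OF _ N(2)[OF 2]]) (use R_gen(1)[of u v 1] in \<open>simp add: rel_def diff_diff_eq\<close>)
  next
    case (3 a u)
    show ?case by (rule rel[OF _ N(3)[OF 3]]) (use R_gen(3)[of a u 1] in \<open>simp add: rel_def\<close>)
  next
    case (4 b u)
    show ?case using act[OF 4, of b] by (simp add: tensor_act_pure)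
  qed
  show ?thesis
  proof (induction w rule: free_tensor_induct)
    case (pure u z)
    show ?case by (rule rel[OF _ N(3)[OF unit]]) (use R_gen(4)[of u z 1] in \<open>simp add: rel_def\<close>)
  qed (use N in auto)
qed

lemma \<phi>_0: "\<phi> 0 = 0"
proof -
  have "0 \<in> graded_part 0" by (simp add: graded_part_def free_vs.span_zero)
  then have "\<phi> (cscale 0 0) = 0 * \<phi> 0" using linear_\<phi> unfolding linear_on_degree_zero_def by blast
  then show ?thesis by simp
qed

lemma top_degree_0: "h \<in> graded_part 0 \<Longrightarrow> tensor_act h top_vector \<approx> cscale (\<phi> h) top_vector"
proof -
  assume h: "h \<in> graded_part 0"
  have "0 \<in> P" by (simp add: P_eq free_vs.span_zero)
  from R_gen(5)[OF h this, of 1 1] have "pure_tensor (env_of h) 1 \<approx> pure_tensor 1 (\<phi> h * 1)" by (simp add: rel_def)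
  moreover have "pure_tensor 1 (\<phi> h * 1) \<approx> cscale (\<phi> h) top_vector" using R_gen(4)[of 1 "\<phi> h" 1] by (simp add: rel_def)
  ultimately show ?thesis using rel_trans by (simp add: tensor_act_pure)
qed

lemma top_positive:
  assumes "n \<in> P" shows "tensor_act n top_vector \<approx> 0"
proof -
  have "0 \<in> graded_part 0" by (simp add: graded_part_def free_vs.span_zero)
  from R_gen(5)[OF this assms, of 1 1] have "pure_tensor (env_of n) 1 \<approx> pure_tensor 1 (0 * 1)" by (simp add: rel_def \<phi>_0)
  moreover have "pure_tensor 1 (0 * 1) \<approx> 0" using R_gen(4)[of 1 0 1] by (simp add: rel_def)
  ultimately show ?thesis using rel_trans by (simp add: tensor_act_pure)
qed

text \<open>The spanning half of the Poincare-Birkhoff-Witt theorem. That the top vector is not in R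
  is read off later from its image in V under \<open>ev\<close>.\<close>

inductive_set lowered :: "((env_alg \<times> complex) \<Rightarrow>\<^sub>0 complex) set" where
  R: "w \<in> R \<Longrightarrow> w \<in> lowered"
| top: "top_vector \<in> lowered"
| add: "v \<in> lowered \<Longrightarrow> w \<in> lowered \<Longrightarrow> v + w \<in> lowered"
| scale: "w \<in> lowered \<Longrightarrow> cscale a w \<in> lowered"
| act: "w \<in> lowered \<Longrightarrow> eps * basis_degree b < 0 \<Longrightarrow> tensor_act (basis_vector b) w \<in> lowered"

lemma lowered_rel: "v \<approx> w \<Longrightarrow> w \<in> lowered \<Longrightarrow> v \<in> lowered"
  using lowered.add[OF _ lowered.R, of w "v - w"] by (simp add: rel_def)

lemma lowered_UNIV: "w \<in> lowered"
proof (rule generated)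
  show "tensor_act (basis_vector b) w \<in> lowered" if "w \<in> lowered" for b w
    using that
  proof (induction w arbitrary: b)
    case (R w)
    then show ?case by (intro lowered.R tensor_act_R)
  next
    case top
    consider "eps * basis_degree b < 0" | "basis_degree b = 0" | "eps * basis_degree b > 0"
      using eps by (metis linorder_neqE_linordered_idom mult_eq_0_iff)
    then show ?case
    proof cases
      case 1
      then show ?thesis by (intro lowered.act lowered.top)
    next
      case 2
      then show ?thesis using basis_vector_graded[of b]
        by (intro lowered_rel[OF top_degree_0 lowered.scale[OF lowered.top]]) simp
    next
      case 3
      then have "basis_vector b \<in> P" unfolding P_eq using basis_vector_graded[of b] by (intro free_vs.span_base) blast
      then show ?thesis by (intro lowered_rel[OF top_positive lowered.R[OF R_closed(1)]])
    qed
  next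
    case (add v w)
    then show ?case by (simp add: tensor_act_add lowered.add)
  next
    case (scale w a)
    then show ?case by (simp add: tensor_act_cscale lowered.scale)
  next
    case (act w c)
    show ?case
    proof (cases "eps * basis_degree b < 0")
      case True
      show ?thesis by (rule lowered.act[OF act.IH True])
    next
      case False
      \<comment> \<open>A basis vector b that is not lowering is moved past c. Then b and the
        bracket act on w, where the induction hypothesis covers every basis vector.\<close>
      obtain a b' a' b'' where br: "lbracket (basis_vector b) (basis_vector c) = cscale a (basis_vector b') + cscale a' (basis_vector b'')"
        by (rule lbracket_basis_vector)
      have "tensor_act (basis_vector b) (tensor_act (basis_vector c) w) \<approx>
          tensor_act (basis_vector c) (tensor_act (basis_vector b) w) + tensor_act (lbracket (basis_vector b) (basis_vector c)) w"
        by (rule tensor_act_lbracket)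
      moreover have "tensor_act (lbracket (basis_vector b) (basis_vector c)) w \<in> lowered"
        unfolding br
        by (rule lowered_rel[OF tensor_act_add_left], rule lowered.add; rule lowered_rel[OF tensor_act_scale_left], rule lowered.scale, rule act.IH)
      ultimately show ?thesis
        using lowered_rel lowered.add lowered.act[OF act.IH act.hyps(2)] by metis
    qed
  qed
qed (auto intro: lowered.intros)

definition weight_part :: "complex \<Rightarrow> ((env_alg \<times> complex) \<Rightarrow>\<^sub>0 complex) set" where
  "weight_part \<nu> = {w. tensor_act (dt 0 0) w \<approx> cscale \<nu> w}"

definition top_weight :: complex where "top_weight = \<phi> (dt 0 0)"

lemma weight_part_act:
  assumes "w \<in> weight_part \<nu>"
  shows "tensor_act (basis_vector b) w \<in> weight_part (\<nu> + of_int (basis_degree b))"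
proof -
  let ?x = "basis_vector b"
  have w: "tensor_act (dt 0 0) w \<approx> cscale \<nu> w" using assms by (simp add: weight_part_def)
  have "tensor_act (dt 0 0) (tensor_act ?x w) \<approx> tensor_act ?x (tensor_act (dt 0 0) w) + tensor_act (lbracket (dt 0 0) ?x) w"
    by (rule tensor_act_lbracket)
  also have "\<dots> \<approx> cscale \<nu> (tensor_act ?x w) + cscale (of_int (basis_degree b)) (tensor_act ?x w)"
    using rel_act[OF w, of ?x] unfolding lbracket_weight
    by (intro rel_add tensor_act_scale_left) (simp add: tensor_act_cscale)
  finally show ?thesis by (simp add: weight_part_def free_vs.scale_left_distrib)
qed

lemma top_vector_weight: "top_vector \<in> weight_part top_weight"
proof -
  have "dt 0 0 \<in> graded_part 0" unfolding graded_part_def by (intro free_vs.span_base) simp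
  then show ?thesis using top_degree_0 by (simp add: weight_part_def top_weight_def)
qed

text \<open>
  \<open>cut m\<close> is the Lagrange product that annihilates the first \<open>m\<close> weights next to the top weight.
\<close>

fun cut :: "nat \<Rightarrow> ((env_alg \<times> complex) \<Rightarrow>\<^sub>0 complex) \<Rightarrow> ((env_alg \<times> complex) \<Rightarrow>\<^sub>0 complex)" where
  "cut 0 w = w"
| "cut (Suc m) w = tensor_act (dt 0 0) (cut m w) - cscale (top_weight - of_int (sgn eps * int (Suc m))) (cut m w)"

lemma cut_linear: "cut m (v + w) = cut m v + cut m w" "cut m (cscale a w) = cscale a (cut m w)"
  by (induction m) (simp_all add: tensor_act_add tensor_act_cscale free_vs.scale_right_distrib
      free_vs.scale_right_diff_distrib mult.commute)

lemma cut_weight: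
  assumes "w \<in> weight_part \<nu>"
  shows "cut m w \<approx> cscale (\<Prod>i\<in>{1..m}. \<nu> - top_weight + of_int (sgn eps * int i)) w"
proof (induction m)
  case (Suc m)
  let ?c = "\<Prod>i\<in>{1..m}. \<nu> - top_weight + of_int (sgn eps * int i)"
  let ?a = "top_weight - of_int (sgn eps * int (Suc m))"
  have w: "tensor_act (dt 0 0) w \<approx> cscale \<nu> w" using assms by (simp add: weight_part_def)
  have "cut (Suc m) w \<approx> tensor_act (dt 0 0) (cscale ?c w) - cscale ?a (cscale ?c w)"
    unfolding cut.simps by (intro rel_diff rel_act rel_cscale Suc)
  also have "\<dots> \<approx> cscale ?c (cscale \<nu> w) - cscale ?a (cscale ?c w)"
    unfolding tensor_act_cscale by (intro rel_diff rel_cscale w rel_refl)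
  also have "cscale ?c (cscale \<nu> w) - cscale ?a (cscale ?c w) = cscale (?c * (\<nu> - ?a)) w"
    by (simp add: free_vs.scale_left_diff_distrib algebra_simps del: of_int_mult)
  also have "?c * (\<nu> - ?a) = (\<Prod>i\<in>{1..Suc m}. \<nu> - top_weight + of_int (sgn eps * int i))"
    by (simp add: algebra_simps)
  finally show ?case .
qed simp

text \<open>The sum of the weight parts strictly beyond the top weight in the lowering direction. It
  contains R, whose elements lie in every weight part.\<close>

inductive_set lower_part :: "((env_alg \<times> complex) \<Rightarrow>\<^sub>0 complex) set" where
  base: "w \<in> weight_part (top_weight - of_int (sgn eps * int j)) \<Longrightarrow> j \<ge> 1 \<Longrightarrow> w \<in> lower_part"
| add: "v \<in> lower_part \<Longrightarrow> w \<in> lower_part \<Longrightarrow> v + w \<in> lower_part"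
| scale: "w \<in> lower_part \<Longrightarrow> cscale a w \<in> lower_part"

lemma degree_negative:
  assumes "eps * i < 0" obtains j where "j \<ge> 1" "i = - (sgn eps * int j)"
proof (rule that[of "nat \<bar>i\<bar>"])
  show "nat \<bar>i\<bar> \<ge> 1" using assms by (cases "i = 0") auto
  show "i = - (sgn eps * int (nat \<bar>i\<bar>))" using assms eps by (auto simp: sgn_if abs_if mult_less_0_iff)
qed

lemma lower_part_act:
  assumes "w \<in> lower_part" "eps * basis_degree b < 0"
  shows "tensor_act (basis_vector b) w \<in> lower_part"
  using assms(1)
proof induction
  case (base w j)
  obtain i where i: "i \<ge> 1" "basis_degree b = - (sgn eps * int i)" using assms(2) by (rule degree_negative)
  have "top_weight - of_int (sgn eps * int j) + of_int (basis_degree b) = top_weight - of_int (sgn eps * int (j + i))"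
    unfolding i(2) by (simp add: distrib_left)
  with weight_part_act[OF base(1), of b]
  have "tensor_act (basis_vector b) w \<in> weight_part (top_weight - of_int (sgn eps * int (j + i)))" by (simp only:)
  then show ?case using i(1) by (rule lower_part.base[OF _ trans_le_add2])
qed (simp_all add: tensor_act_add tensor_act_cscale lower_part.intros)

lemma decomposition: "\<exists>a. w - cscale a top_vector \<in> lower_part"
  using lowered_UNIV[of w]
proof induction
  case (R w)
  have "tensor_act (dt 0 0) w - cscale (top_weight - of_int (sgn eps * int 1)) w \<in> R"
    using R by (intro R_closed tensor_act_R)
  then have "w \<in> lower_part" by (intro lower_part.base[of w 1]) (simp_all add: weight_part_def rel_def)
  then show ?case by (intro exI[of _ 0]) simp
next
  case top
  have "0 \<in> lower_part" using R_closed(1) by (intro lower_part.base[of 0 1]) (simp_all add: weight_part_def)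
  then show ?case by (intro exI[of _ 1]) simp
next
  case (add v w)
  then obtain a b where "v - cscale a top_vector \<in> lower_part" "w - cscale b top_vector \<in> lower_part" by blast
  from lower_part.add[OF this] show ?case
    by (intro exI[of _ "a + b"]) (simp add: free_vs.scale_left_distrib algebra_simps)
next
  case (scale w c)
  then obtain a where "w - cscale a top_vector \<in> lower_part" by blast
  from lower_part.scale[OF this, of c] show ?case
    by (intro exI[of _ "c * a"]) (simp add: free_vs.scale_right_diff_distrib)
next
  case (act w b)
  then obtain a where a: "w - cscale a top_vector \<in> lower_part" by blast
  obtain i where i: "i \<ge> 1" "basis_degree b = - (sgn eps * int i)" using act(2) by (rule degree_negative)
  have "tensor_act (basis_vector b) top_vector \<in> lower_part"
    using weight_part_act[OF top_vector_weight, of b] i by (intro lower_part.base[of _ i]) simp_all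
  then have "tensor_act (basis_vector b) (w - cscale a top_vector) + cscale a (tensor_act (basis_vector b) top_vector) \<in> lower_part"
    by (intro lower_part.add[OF lower_part_act[OF a act(2)] lower_part.scale])
  moreover have "tensor_act (basis_vector b) (w - cscale a top_vector) + cscale a (tensor_act (basis_vector b) top_vector) = tensor_act (basis_vector b) w"
    by (simp add: tensor_act_diff tensor_act_cscale)
  ultimately show ?case by (intro exI[of _ 0]) simp
qed

lemma cut_lower_part: "w \<in> lower_part \<Longrightarrow> \<exists>m0. \<forall>m\<ge>m0. cut m w \<in> R"
proof (induction rule: lower_part.induct)
  case (base w j)
  have "cut m w \<in> R" if "m \<ge> j" for m
  proof -
    have "(\<Prod>i\<in>{1..m}. (top_weight - of_int (sgn eps * int j)) - top_weight + of_int (sgn eps * int i)) = 0"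
      using that base(2) by (intro prod_zero bexI[of _ j]) simp_all
    then show ?thesis using cut_weight[OF base(1), of m] by (simp only: rel_0 free_vs.scale_zero_left)
  qed
  then show ?case by blast
next
  case (add v w)
  then obtain m m' where "\<forall>n\<ge>m. cut n v \<in> R" "\<forall>n\<ge>m'. cut n w \<in> R" by blast
  then have "\<forall>n\<ge>max m m'. cut n (v + w) \<in> R" by (simp add: cut_linear R_closed)
  then show ?case by blast
next
  case (scale w a)
  then show ?case unfolding cut_linear using R_closed(4) by blast
qed

text \<open>For large m the operator \<open>cut m\<close> kills the lower part of w and multiplies
  the top vector by c \<noteq> 0: up to c it is the projection to the top. Being built from the
  action of d_0, it preserves submodules.\<close>

lemma cut_eventually_top:
  obtains a c m where "cut m w \<approx> cscale (a * c) top_vector" "cut m top_vector \<approx> cscale c top_vector" "c \<noteq> 0"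
proof -
  obtain a where a: "w - cscale a top_vector \<in> lower_part" using decomposition by blast
  obtain m where m: "cut m (w - cscale a top_vector) \<in> R" using cut_lower_part[OF a] by blast
  define c where "c = (\<Prod>i\<in>{1..m}. complex_of_int (sgn eps * int i))"
  have c: "cut m top_vector \<approx> cscale c top_vector" using cut_weight[OF top_vector_weight, of m] by (simp add: c_def)
  have "w = (w - cscale a top_vector) + cscale a top_vector" by simp
  then have "cut m w = cut m (w - cscale a top_vector) + cscale a (cut m top_vector)" by (metis cut_linear)
  also have "\<dots> \<approx> 0 + cscale a (cscale c top_vector)" using m c by (intro rel_add rel_cscale) (simp_all add: rel_0)
  finally have "cut m w \<approx> cscale (a * c) top_vector" by simp
  moreover have "c \<noteq> 0" using eps by (auto simp: c_def sgn_if)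
  ultimately show thesis using c that by blast
qed

end

section \<open>The Verma module as a set of cosets\<close>

context verma
begin

abbreviation cls where "cls \<equiv> coset free_tensor_module R"

lemma cls_eq: "cls w = {v. v \<approx> w}"
proof -
  have "v \<in> cls w \<longleftrightarrow> v \<approx> w" for v
    unfolding coset_def free_tensor_module_def rel_def
    by (auto intro!: exI[of _ "v - w"])
  then show ?thesis by blast
qed

lemma cls_inject: "cls v = cls w \<longleftrightarrow> v \<approx> w"
  unfolding cls_eq using rel_sym rel_trans rel_refl by blast

lemma Verma_simps:
  "carrier (Verma P \<phi>) = range cls"
  "zero (Verma P \<phi>) = cls 0"
  "add (Verma P \<phi>) (cls v) (cls w) = cls (v + w)"
  "lmod.smult (Verma P \<phi>) a (cls w) = cls (cscale a w)"
  "act (Verma P \<phi>) x (cls w) = cls (tensor_act x w)"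
proof -
  show "carrier (Verma P \<phi>) = range cls" by (simp add: Verma_def quotient_module_def free_tensor_module_def)
  have "R = cls 0" unfolding cls_eq by (simp add: rel_0)
  then show "zero (Verma P \<phi>) = cls 0" by (simp add: Verma_def quotient_module_def)
  have "{v' + w' | v' w'. v' \<approx> v \<and> w' \<approx> w} = {x. x \<approx> v + w}"
  proof (intro set_eqI iffI)
    fix x assume "x \<in> {x. x \<approx> v + w}"
    then have "x - w \<approx> v" by (simp add: rel_def algebra_simps)
    then show "x \<in> {v' + w' | v' w'. v' \<approx> v \<and> w' \<approx> w}" by (intro CollectI exI[of _ "x - w"] exI[of _ w]) simp
  qed (auto intro: rel_add)
  then show "add (Verma P \<phi>) (cls v) (cls w) = cls (v + w)"
    by (simp add: Verma_def quotient_module_def cls_eq) (simp add: free_tensor_module_def)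
  have "(\<Union>v\<in>cls w. cls (cscale a v)) = cls (cscale a w)"
    unfolding cls_eq using rel_trans[OF _ rel_cscale] rel_refl by blast
  then show "lmod.smult (Verma P \<phi>) a (cls w) = cls (cscale a w)"
    by (simp add: Verma_def quotient_module_def) (simp add: free_tensor_module_def)
  have "(\<Union>v\<in>cls w. cls (tensor_act x v)) = cls (tensor_act x w)"
    unfolding cls_eq using rel_trans[OF _ rel_act] rel_refl by blast
  then show "act (Verma P \<phi>) x (cls w) = cls (tensor_act x w)"
    by (simp add: Verma_def quotient_module_def) (simp add: free_tensor_module_def tensor_act_def)
qed

lemma Verma_submodule:
  assumes "is_submodule (Verma P \<phi>) N"
  shows "w \<in> R \<Longrightarrow> cls w \<in> N" "cls v \<in> N \<Longrightarrow> cls w \<in> N \<Longrightarrow> cls (v + w) \<in> N"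
    "cls w \<in> N \<Longrightarrow> cls (cscale a w) \<in> N" "cls w \<in> N \<Longrightarrow> cls (tensor_act x w) \<in> N" "N \<subseteq> range cls"
proof -
  have N: "cls 0 \<in> N" "\<forall>u\<in>N. \<forall>v\<in>N. add (Verma P \<phi>) u v \<in> N"
    "\<forall>a. \<forall>v\<in>N. lmod.smult (Verma P \<phi>) a v \<in> N" "\<forall>x. \<forall>v\<in>N. act (Verma P \<phi>) x v \<in> N"
    using assms unfolding is_submodule_def Verma_simps by auto
  show "cls w \<in> N" if "w \<in> R" using N(1) that cls_inject[of w 0] by (simp add: rel_0)
  show "cls v \<in> N \<Longrightarrow> cls w \<in> N \<Longrightarrow> cls (v + w) \<in> N" using N(2) Verma_simps(3) by metis
  show "cls w \<in> N \<Longrightarrow> cls (cscale a w) \<in> N" using N(3) Verma_simps(4) by metis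
  show "cls w \<in> N \<Longrightarrow> cls (tensor_act x w) \<in> N" using N(4) Verma_simps(5) by metis
  show "N \<subseteq> range cls" using assms unfolding is_submodule_def Verma_simps by blast
qed

end

section \<open>The action of the enveloping algebra on a module\<close>

context loop_vir_module
begin

definition lext :: "('a \<Rightarrow> 'v) \<Rightarrow> ('a \<Rightarrow>\<^sub>0 complex) \<Rightarrow> 'v" where
  "lext g p = (\<Sum>a\<in>Poly_Mapping.keys p. scale (Poly_Mapping.lookup p a) (g a))"

lemma lext_superset:
  assumes "finite A" "Poly_Mapping.keys p \<subseteq> A"
  shows "lext g p = (\<Sum>a\<in>A. scale (Poly_Mapping.lookup p a) (g a))"
  unfolding lext_def using assms
  by (intro sum.mono_neutral_left) (auto simp: in_keys_iff)

lemma lext_add: "lext g (p + q) = lext g p + lext g q"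
proof -
  let ?A = "Poly_Mapping.keys p \<union> Poly_Mapping.keys q"
  have "lext g (p + q) = (\<Sum>a\<in>?A. scale (Poly_Mapping.lookup (p + q) a) (g a))"
    by (rule lext_superset) (auto simp: keys_add)
  also have "\<dots> = lext g p + lext g q"
    by (simp add: lookup_add scale_left_distrib sum.distrib lext_superset[of ?A])
  finally show ?thesis .
qed

lemma lext_cscale: "lext g (cscale c p) = scale c (lext g p)"
proof -
  have "lext g (cscale c p) = (\<Sum>a\<in>Poly_Mapping.keys p. scale (Poly_Mapping.lookup (cscale c p) a) (g a))"
    by (rule lext_superset) (auto simp: in_keys_iff lookup_cscale)
  then show ?thesis by (simp add: lext_def lookup_cscale scale_sum_right)
qed

lemma lext_single: "lext g (Poly_Mapping.single a c) = scale c (g a)"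
  by (subst lext_superset[of "{a}"]) auto

lemma lext_0 [simp]: "lext g 0 = 0"
  by (simp add: lext_def)

lemma lext_diff: "lext g (p - q) = lext g p - lext g q"
  using lext_add[of g "p - q" q] by simp

lemma action_0_left [simp]: "action 0 v = 0"
  using action_scale_left[of 0 0 v] by simp

lemma action_0_right [simp]: "action x 0 = 0"
  using action_scale_right[of x 0 0] by simp

definition word_act :: "(vir_basis \<times> int) word \<Rightarrow> 'v \<Rightarrow> 'v" where
  "word_act w v = foldr (\<lambda>b. action (basis_vector b)) (letters w) v"

definition tensor_rep :: "loop_vir_tensor \<Rightarrow> 'v \<Rightarrow> 'v" where
  "tensor_rep p v = lext (\<lambda>w. word_act w v) p"

lemma word_act_linear: "word_act w (u + v) = word_act w u + word_act w v"
  "word_act w (scale a v) = scale a (word_act w v)"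
proof -
  have "foldr (\<lambda>b. action (basis_vector b)) bs (u + v) = foldr (\<lambda>b. action (basis_vector b)) bs u + foldr (\<lambda>b. action (basis_vector b)) bs v"
    "foldr (\<lambda>b. action (basis_vector b)) bs (scale a v) = scale a (foldr (\<lambda>b. action (basis_vector b)) bs v)" for bs
    by (induction bs) (simp_all add: action_add_right action_scale_right)
  then show "word_act w (u + v) = word_act w u + word_act w v" "word_act w (scale a v) = scale a (word_act w v)"
    by (simp_all add: word_act_def)
qed

lemma tensor_rep_linear: "tensor_rep p (u + v) = tensor_rep p u + tensor_rep p v"
  "tensor_rep p (scale a v) = scale a (tensor_rep p v)"
  by (simp_all add: tensor_rep_def lext_def word_act_linear scale_right_distrib sum.distrib scale_sum_right
      mult.commute)

lemma tensor_rep_mult: "tensor_rep (p * q) v = tensor_rep p (tensor_rep q v)"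
proof (induction p rule: poly_mapping_sum_induct)
  case zero
  show ?case by (simp add: tensor_rep_def)
next
  case (single w c)
  show ?case
  proof (induction q rule: poly_mapping_sum_induct)
    case zero
    show ?case using tensor_rep_linear(2)[of "Poly_Mapping.single w c" 0 0] by (simp add: tensor_rep_def)
  next
    case (single w' d)
    then show ?case
      by (simp add: tensor_rep_def mult_single lext_single word_act_linear)
        (simp add: word_act_def plus_word_def)
  next
    case (add f g)
    have "tensor_rep (f + g) v = tensor_rep f v + tensor_rep g v" by (simp add: tensor_rep_def lext_add)
    then show ?case using add by (simp add: distrib_left tensor_rep_linear) (simp add: tensor_rep_def lext_add)
  qed
next
  case (add f g)
  then show ?case by (simp add: distrib_right) (simp add: tensor_rep_def lext_add)
qed

lemma tensor_rep_tensor_of: "tensor_rep (tensor_of x) v = action x v"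
proof (induction x rule: poly_mapping_sum_induct)
  case (single b c)
  have "action (Poly_Mapping.single b c) v = scale c (action (basis_vector b) v)"
    using action_scale_left[of c "basis_vector b" v] by (simp add: cscale_single)
  then show ?case by (simp add: tensor_of_def tensor_rep_def lin_ext_single lext_cscale lext_single word_act_def)
qed (simp_all add: tensor_of_def tensor_rep_def lin_ext_add lext_add action_add_left)

lemma tensor_rep_env_ideal: "z \<in> env_ideal \<Longrightarrow> tensor_rep z v = 0"
  unfolding env_ideal_def
proof (induction z rule: free_vs.span_induct_alt)
  case base
  show ?case by (simp add: tensor_rep_def)
next
  case (step c z z')
  then obtain a b x y where z: "z = a * (tensor_of x * tensor_of y - tensor_of y * tensor_of x
      - tensor_of (lbracket x y)) * b" by blast
  have d: "tensor_rep (p - q) u = tensor_rep p u - tensor_rep q u" for p q u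
    by (simp add: tensor_rep_def lext_diff)
  have "tensor_rep z v = tensor_rep a 0"
    unfolding z by (simp add: tensor_rep_mult d tensor_rep_tensor_of action_lbracket)
  then have "tensor_rep z v = 0" using tensor_rep_linear(2)[of a 0 0] by simp
  then show ?case using step(2) by (simp add: tensor_rep_def lext_add lext_cscale)
qed

text \<open>Computed on a chosen representative; \<open>tensor_rep_env_ideal\<close> makes the
  choice irrelevant.\<close>

definition env_rep :: "env_alg \<Rightarrow> 'v \<Rightarrow> 'v" where
  "env_rep u = tensor_rep (rep_env_alg u)"

lemma env_rep_abs: "env_rep (abs_env_alg p) v = tensor_rep p v"
proof -
  have "rep_env_alg (abs_env_alg p) - p \<in> env_ideal"
    using Quotient3_rep_abs[OF Quotient3_env_alg, of p] by (simp add: env_ideal_closed)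
  then have "tensor_rep (rep_env_alg (abs_env_alg p) - p) v = 0" by (rule tensor_rep_env_ideal)
  then show ?thesis by (simp add: env_rep_def tensor_rep_def lext_diff)
qed

lemma env_rep_simps:
  "env_rep 1 v = v"
  "env_rep (u + u') v = env_rep u v + env_rep u' v"
  "env_rep (env_scale a u) v = scale a (env_rep u v)"
  "env_rep (u * u') v = env_rep u (env_rep u' v)"
  "env_rep (env_of x) v = action x v"
  "env_rep u (scale a v) = scale a (env_rep u v)"
proof -
  obtain p where p: "u = abs_env_alg p" by (induct u rule: env_alg.abs_induct) blast
  obtain q where q: "u' = abs_env_alg q" by (induct u' rule: env_alg.abs_induct) blast
  have "tensor_rep 1 v = v"
    unfolding single_one[symmetric] by (simp only: tensor_rep_def lext_single) (simp add: word_act_def zero_word_def)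
  then show "env_rep 1 v = v" by (simp add: one_env_alg_def env_rep_abs)
  show "env_rep (u + u') v = env_rep u v + env_rep u' v"
    unfolding p q by (simp add: plus_env_alg.abs_eq env_rep_abs) (simp add: tensor_rep_def lext_add)
  show "env_rep (env_scale a u) v = scale a (env_rep u v)"
    unfolding p by (simp add: env_scale.abs_eq env_rep_abs) (simp add: tensor_rep_def lext_cscale)
  show "env_rep (u * u') v = env_rep u (env_rep u' v)"
    unfolding p q by (simp add: times_env_alg.abs_eq env_rep_abs tensor_rep_mult)
  show "env_rep (env_of x) v = action x v"
    by (simp add: env_of.abs_eq env_rep_abs tensor_rep_tensor_of)
  show "env_rep u (scale a v) = scale a (env_rep u v)"
    by (simp add: env_rep_def tensor_rep_linear)
qed

end

locale extremal_vector = loop_vir_module scale action + verma eps P \<phi>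
  for scale :: "complex \<Rightarrow> 'v::ab_group_add \<Rightarrow> 'v" and action eps P \<phi> +
  fixes v0 :: 'v
  assumes v0: "v0 \<noteq> 0"
    and v0_0: "h \<in> graded_part 0 \<Longrightarrow> action h v0 = scale (\<phi> h) v0"
    and v0_P: "n \<in> P \<Longrightarrow> action n v0 = 0"
    and irreducible: "subspace N \<Longrightarrow> (\<And>x v. v \<in> N \<Longrightarrow> action x v \<in> N) \<Longrightarrow> N = {0} \<or> N = UNIV"
begin

text \<open>The homomorphism sending u \<otimes> z to z u v0, written on representatives; it
  vanishes on R and so factors through the Verma module.\<close>

definition ev :: "((env_alg \<times> complex) \<Rightarrow>\<^sub>0 complex) \<Rightarrow> 'v" where
  "ev = lext (\<lambda>(u, z). scale z (env_rep u v0))"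

lemma ev_simps:
  "ev 0 = 0" "ev (v + w) = ev v + ev w" "ev (v - w) = ev v - ev w" "ev (cscale a w) = scale a (ev w)"
  "ev (pure_tensor u z) = scale z (env_rep u v0)"
  by (simp_all add: ev_def lext_add lext_diff lext_cscale pure_tensor_def lext_single)

lemma ev_act: "ev (tensor_act x w) = action x (ev w)"
  by (induction w rule: free_tensor_induct)
    (simp_all add: ev_simps tensor_act_pure tensor_act_add tensor_act_cscale env_rep_simps action_add_right action_scale_right)

lemma ev_R: "w \<in> R \<Longrightarrow> ev w = 0"
  by (induction w rule: R_induct)
    (simp_all add: ev_simps env_rep_simps scale_left_distrib action_add_left v0_0 v0_P mult.commute scale_right_distrib)

lemma ev_rel: "v \<approx> w \<Longrightarrow> ev v = ev w"
  using ev_R[of "v - w"] by (simp add: rel_def ev_simps)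

lemma submodule_image:
  assumes N: "\<And>v w. v \<in> N \<Longrightarrow> w \<in> N \<Longrightarrow> v + w \<in> N" "\<And>a w. w \<in> N \<Longrightarrow> cscale a w \<in> N"
    "\<And>x w. w \<in> N \<Longrightarrow> tensor_act x w \<in> N" and w: "w \<in> N" "ev w \<noteq> 0"
  shows "ev ` N = UNIV"
proof -
  have "ev ` N = {0} \<or> ev ` N = UNIV"
  proof (rule irreducible)
    show "subspace (ev ` N)"
    proof (rule subspaceI)
      show "0 \<in> ev ` N" using N(2)[OF w(1), of 0] by (intro image_eqI[of _ _ "cscale 0 w"]) (simp_all add: ev_simps)
    next
      fix x y assume "x \<in> ev ` N" "y \<in> ev ` N"
      then show "x + y \<in> ev ` N" using N(1) by (auto simp: ev_simps(2)[symmetric])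
    next
      fix a x assume "x \<in> ev ` N"
      then show "scale a x \<in> ev ` N" using N(2) by (auto simp: ev_simps(4)[symmetric])
    qed
    show "action x v \<in> ev ` N" if "v \<in> ev ` N" for x v using that N(3) by (auto simp: ev_act[symmetric])
  qed
  then show ?thesis using w by auto
qed

lemma ev_top: "ev top_vector = v0"
  by (simp add: ev_simps env_rep_simps)

lemma ev_surj: "\<exists>w. ev w = v"
proof -
  have "ev ` UNIV = UNIV" by (rule submodule_image[of UNIV top_vector]) (simp_all add: ev_top v0)
  then show ?thesis by (metis UNIV_I imageE)
qed

definition radical where "radical = cls ` {w. ev w = 0}"

lemma cls_radical: "cls w \<in> radical \<longleftrightarrow> ev w = 0"
  unfolding radical_def using ev_rel by (auto simp: cls_inject)

text \<open>If \<open>ev\<close> does not vanish on N, irreducibility of V gives w in N with ev w =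
  v0. Cutting w leaves a multiple of the top vector, and applying \<open>ev\<close> shows that it is
  nonzero; so N contains the top vector and is everything. Thus the kernel of \<open>ev\<close> is
  the only maximal proper submodule.\<close>

lemma proper_submodule_subset:
  assumes N: "is_submodule (Verma P \<phi>) N" "N \<noteq> carrier (Verma P \<phi>)"
  shows "N \<subseteq> radical"
proof (rule ccontr)
  assume "\<not> N \<subseteq> radical"
  note sub = Verma_submodule[OF N(1)]
  then obtain w0 where w0: "cls w0 \<in> N" "cls w0 \<notin> radical" using \<open>\<not> N \<subseteq> radical\<close> by blast
  have "ev ` {w. cls w \<in> N} = UNIV"
  proof (rule submodule_image[of _ w0])
    show "ev w0 \<noteq> 0" using w0(2) by (simp add: cls_radical)
  qed (use sub(2-4) w0(1) in auto)
  then have "v0 \<in> ev ` {w. cls w \<in> N}" by simp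
  then have "\<exists>w. cls w \<in> N \<and> v0 = ev w" by (simp only: image_iff mem_Collect_eq Bex_def)
  then obtain w where w: "cls w \<in> N" "ev w = v0" by (elim exE conjE) (rule that, assumption, rule sym)
  obtain a c m where ac: "cut m w \<approx> cscale (a * c) top_vector" "cut m top_vector \<approx> cscale c top_vector" "c \<noteq> 0"
    by (rule cut_eventually_top)
  have cut_N: "cls (cut m w) \<in> N" if "cls w \<in> N" for m w
  proof (induction m)
    case (Suc m)
    let ?a = "top_weight - of_int (sgn eps * int (Suc m))"
    have "cls (tensor_act (dt 0 0) (cut m w) + cscale (- ?a) (cut m w)) \<in> N"
      by (rule sub(2)[OF sub(4)[OF Suc] sub(3)[OF Suc]])
    then show ?case by (simp only: cut.simps free_vs.scale_minus_left diff_conv_add_uminus)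
  qed (simp add: that)
  have ev_cut: "ev (cut m w) = ev (cut m w')" if "ev w = ev w'" for w w' m
    using that by (induction m) (simp_all add: ev_simps ev_act)
  \<comment> \<open>The vectors w and the top vector have the same image under \<open>ev\<close>,
    hence so do their cuts.\<close>
  have "scale (a * c) v0 = scale c v0"
    using ev_rel[OF ac(1)] ev_rel[OF ac(2)] ev_cut[of w top_vector m] w(2) by (simp add: ev_simps ev_top env_rep_simps)
  then have "a = 1" using ac(3) v0 by (metis mult_cancel_right1 scale_right_imp_eq)
  then have "cls (cut m w) = cls (cscale c top_vector)" using ac(1) by (simp add: cls_inject)
  then have "cls (cscale (1 / c) (cscale c top_vector)) \<in> N" using cut_N[OF w(1)] sub(3) by metis
  then have top: "cls top_vector \<in> N" using ac(3) by simp
  have "cls w \<in> N" for w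
    by (rule generated[of "{w. cls w \<in> N}", simplified]) (use sub top in auto)
  then show False using N sub(5) by (auto simp: Verma_simps)
qed

lemma radical_submodule: "is_submodule (Verma P \<phi>) radical"
proof -
  have *: "\<exists>w. v = cls w \<and> ev w = 0" if "v \<in> radical" for v using that unfolding radical_def by blast
  show ?thesis
    unfolding is_submodule_def
  proof (intro conjI ballI allI)
    show "radical \<subseteq> carrier (Verma P \<phi>)" by (auto simp: Verma_simps radical_def)
    show "zero (Verma P \<phi>) \<in> radical" by (simp add: Verma_simps cls_radical ev_simps)
    fix u v a x assume u: "u \<in> radical"
    then show "lmod.smult (Verma P \<phi>) a u \<in> radical" "act (Verma P \<phi>) x u \<in> radical"
      using *[OF u] by (auto simp: Verma_simps cls_radical ev_simps ev_act)
    assume "v \<in> radical"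
    then show "add (Verma P \<phi>) u v \<in> radical"
      using *[OF u] *[of v] by (auto simp: Verma_simps cls_radical ev_simps)
  qed
qed

lemma radical_proper: "radical \<noteq> carrier (Verma P \<phi>)"
  using cls_radical[of top_vector] v0 by (auto simp: ev_top Verma_simps)

lemma the_maximal_submodule: "(THE N. maximal_proper_submodule (Verma P \<phi>) N) = radical"
proof (rule the_equality)
  show "maximal_proper_submodule (Verma P \<phi>) radical"
    unfolding maximal_proper_submodule_def
    using radical_submodule radical_proper proper_submodule_subset by blast
  show "N = radical" if "maximal_proper_submodule (Verma P \<phi>) N" for N
    using that radical_submodule radical_proper proper_submodule_subset[of N]
    unfolding maximal_proper_submodule_def by blast
qed

abbreviation quot where "quot \<equiv> Verma_simple_quotient P \<phi>"

text \<open>The inverse of the isomorphism that \<open>ev\<close> induces on the quotient by its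
  kernel.\<close>

definition fibre :: "'v \<Rightarrow> ((env_alg \<times> complex) \<Rightarrow>\<^sub>0 complex) set set" where
  "fibre v = cls ` {w. ev w = v}"

lemma coset_radical: "coset (Verma P \<phi>) radical (cls w) = fibre (ev w)"
proof (intro set_eqI iffI)
  fix x assume "x \<in> coset (Verma P \<phi>) radical (cls w)"
  then obtain k where "x = add (Verma P \<phi>) (cls w) (cls k)" "ev k = 0" by (auto simp: coset_def radical_def)
  then show "x \<in> fibre (ev w)" by (auto simp: Verma_simps fibre_def ev_simps)
next
  fix x assume "x \<in> fibre (ev w)"
  then obtain w' where w': "x = cls w'" "ev w' = ev w" by (auto simp: fibre_def)
  then have "x = add (Verma P \<phi>) (cls w) (cls (w' - w))" "cls (w' - w) \<in> radical"
    by (simp_all add: Verma_simps cls_radical ev_simps)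
  then show "x \<in> coset (Verma P \<phi>) radical (cls w)" unfolding coset_def by blast
qed

lemma cls_fibre: "cls w \<in> fibre v \<longleftrightarrow> ev w = v"
  unfolding fibre_def using ev_rel by (auto simp: cls_inject)

lemma quot_def: "quot = quotient_module (Verma P \<phi>) radical"
  by (simp add: Verma_simple_quotient_def the_maximal_submodule)

lemma isomorphic_quot: "isomorphic as_lmod quot"
  unfolding isomorphic_def
proof (intro exI[of _ fibre] conjI ballI allI)
  show "bij_betw fibre (carrier as_lmod) (carrier quot)"
  proof -
    have "inj fibre"
    proof (rule injI)
      fix v v' assume eq: "fibre v = fibre v'"
      obtain w where "ev w = v" using ev_surj by blast
      then show "v = v'" using eq cls_fibre[of w v] cls_fibre[of w v'] by simp
    qed
    moreover have "range fibre = carrier quot"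
    proof -
      have "carrier quot = range (\<lambda>w. fibre (ev w))"
        by (simp add: quot_def quotient_module_def Verma_simps image_image coset_radical)
      moreover have "range ev = UNIV"
      proof (intro set_eqI iffI UNIV_I)
        fix v obtain w where "ev w = v" using ev_surj by blast
        then show "v \<in> range ev" by blast
      qed
      ultimately show ?thesis by (metis image_image)
    qed
    ultimately show ?thesis by (simp add: bij_betw_def as_lmod_def)
  qed
next
  fix u v
  show "fibre (add as_lmod u v) = add quot (fibre u) (fibre v)"
  proof (intro set_eqI iffI)
    fix x assume "x \<in> fibre (add as_lmod u v)"
    then obtain w where w: "x = cls w" "ev w = u + v" by (auto simp: fibre_def as_lmod_def)
    obtain w' where w': "ev w' = u" using ev_surj by blast
    have "x = add (Verma P \<phi>) (cls w') (cls (w - w'))" by (simp add: w(1) Verma_simps)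
    moreover have "cls w' \<in> fibre u" "cls (w - w') \<in> fibre v" using w(2) w' by (simp_all add: cls_fibre ev_simps)
    ultimately show "x \<in> add quot (fibre u) (fibre v)" by (auto simp: quot_def quotient_module_def)
  next
    fix x assume "x \<in> add quot (fibre u) (fibre v)"
    then obtain a b where "x = add (Verma P \<phi>) (cls a) (cls b)" "ev a = u" "ev b = v"
      by (auto simp: quot_def quotient_module_def fibre_def)
    then show "x \<in> fibre (add as_lmod u v)" by (simp add: Verma_simps cls_fibre ev_simps as_lmod_def)
  qed
next
  fix a v
  obtain w where w: "ev w = v" using ev_surj by blast
  have "lmod.smult quot a (fibre v) = (\<Union>w\<in>{w. ev w = v}. fibre (ev (cscale a w)))"
    by (simp add: quot_def quotient_module_def fibre_def[of v] Verma_simps coset_radical)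
  then show "fibre (lmod.smult as_lmod a v) = lmod.smult quot a (fibre v)" using w by (auto simp: ev_simps as_lmod_def)
next
  fix x v
  obtain w where w: "ev w = v" using ev_surj by blast
  have "act quot x (fibre v) = (\<Union>w\<in>{w. ev w = v}. fibre (ev (tensor_act x w)))"
    by (simp add: quot_def quotient_module_def fibre_def[of v] Verma_simps coset_radical)
  then show "fibre (act as_lmod x v) = act quot x (fibre v)" using w by (auto simp: ev_act as_lmod_def)
qed

end

section \<open>The classification\<close>

lemma int_greatest:
  assumes "Q (0::int)" "\<And>k. k \<ge> K \<Longrightarrow> \<not> Q k"
  shows "\<exists>k. Q k \<and> (\<forall>j\<ge>1. \<not> Q (k + j))"
proof -
  let ?B = "\<lambda>n::nat. \<forall>k\<ge>int n. \<not> Q k"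
  have B: "?B (LEAST n. ?B n)" by (rule LeastI[of ?B "nat K"]) (use assms(2) in auto)
  then obtain m where m: "(LEAST n. ?B n) = Suc m" using assms(1) by (cases "LEAST n. ?B n") auto
  have "\<not> ?B m" by (rule not_less_Least) (simp add: m)
  then obtain k where k: "k \<ge> int m" "Q k" by blast
  have "\<not> Q (k + j)" if "j \<ge> 1" for j using B k(1) that unfolding m by auto
  then show ?thesis using k(2) by blast
qed

locale irreducible_Harish_Chandra = loop_vir_module scale action
  for scale :: "complex \<Rightarrow> 'v::ab_group_add \<Rightarrow> 'v" and action +
  assumes irr: "irreducible_module as_lmod" and HC: "Harish_Chandra"
begin

sublocale complex_vs scale by unfold_locales

definition D where "D n f = action (lin_ext (dt n) f)"
definition Z where "Z f = action (lin_ext ct f)"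

lemma D_tpow: "D n (tpow j) = action (dt n j)"
  by (simp add: D_def lin_ext_single)

lemma Z_tpow: "Z (tpow j) = action (ct j)"
  by (simp add: Z_def lin_ext_single)

lemma action_linear: "Vector_Spaces.linear scale scale (action x)"
  unfolding Vector_Spaces.linear_iff using vector_space_axioms
  by (simp add: action_add_right action_scale_right)

lemma ops: "loop_vir_ops scale D Z"
proof (intro loop_vir_ops.intro loop_vir_ops_axioms.intro)
  show "complex_vs scale" by (rule complex_vs_axioms)
  show "Vector_Spaces.linear scale scale (D n f)" "Vector_Spaces.linear scale scale (Z f)" for n f
    unfolding D_def Z_def by (rule action_linear)+
  fix m n :: int and f g :: laurent and a v
  show "D n (f + g) v = D n f v + D n g v" by (simp add: D_def lin_ext_add action_add_left)
  show "D n (cscale a f) v = scale a (D n f v)" by (simp add: D_def lin_ext_cscale action_scale_left)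
  show "D m f (D n g v) - D n g (D m f v) = scale (of_int (n - m)) (D (m + n) (f * g) v) +
      (if m + n = 0 then scale (of_int (m ^ 3 - m) / 12) (Z (f * g) v) else 0)"
    unfolding D_def Z_def action_lbracket[symmetric] lbracket_d_d
    by (simp add: action_add_left action_scale_left)
  show "Z f (D n g v) = D n g (Z f v)" "Z f (Z g v) = Z g (Z f v)"
    using action_lbracket[of "lin_ext ct f" _ v] by (simp_all add: D_def Z_def)
qed

lemma irreducible_sub:
  assumes N: "subspace N" "\<And>b v. v \<in> N \<Longrightarrow> action (basis_vector b) v \<in> N"
  shows "N = {0} \<or> N = UNIV"
proof -
  have "action x v \<in> N" if v: "v \<in> N" for x v
  proof (induction x rule: poly_mapping_sum_induct)
    case (single b c)
    have "action (Poly_Mapping.single b c) v = scale c (action (basis_vector b) v)"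
      using action_scale_left[of c "basis_vector b" v] by (simp add: cscale_single)
    then show ?case using N(2)[OF v] N(1) by (simp add: subspace_scale)
  qed (simp_all add: subspace_0[OF N(1)] action_add_left subspace_add[OF N(1)])
  then have "is_submodule as_lmod N"
    using N(1) unfolding is_submodule_def as_lmod_def subspace_def by simp
  then show ?thesis using irr unfolding irreducible_module_def by (simp add: as_lmod_def)
qed

lemma weight_act:
  assumes "v \<in> weight_space \<nu>"
  shows "action (basis_vector b) v \<in> weight_space (\<nu> + of_int (basis_degree b))"
  using action_lbracket[of "dt 0 0" "basis_vector b" v] assms
  by (simp add: weight_space_def lbracket_weight action_scale_left action_scale_right
      scale_left_distrib algebra_simps)

lemma weight_subspace: "subspace (weight_space \<nu>)"
  by (auto simp: subspace_def weight_space_def action_add_right action_scale_right scale_right_distrib scale_left_commute)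

lemma D_weight: "{v. D 0 1 v = scale \<nu> v} = weight_space \<nu>"
proof -
  have "D 0 1 = action (dt 0 0)" using D_tpow[of 0 0] by simp
  then show ?thesis by (simp add: weight_space_def)
qed

lemma irreducible_ops_at:
  assumes \<mu>: "weight_space \<mu> \<noteq> {0}"
  shows "irreducible_ops scale D Z \<mu>"
proof -
  interpret ops: loop_vir_ops scale D Z by (rule ops)
  show ?thesis
  proof (intro irreducible_ops.intro irreducible_ops_axioms.intro)
    show "loop_vir_ops scale D Z" by (rule ops)
    show "N = {0} \<or> N = UNIV" if N: "subspace N" "\<And>n f v. v \<in> N \<Longrightarrow> D n f v \<in> N" for N
    proof (rule irreducible_sub[OF N(1)])
      fix b :: "vir_basis \<times> int" and v assume v: "v \<in> N"
      obtain x j where b: "b = (x, j)" by (cases b)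
      show "action (basis_vector b) v \<in> N"
      proof (cases x)
        case (Vir_d n)
        then show ?thesis using N(2)[OF v, of n "tpow j"] by (simp add: D_tpow b dt_def)
      next
        case Vir_c
        \<comment> \<open>c \<otimes> t^j is recovered from [d_2, d_(-2) \<otimes> t^j] = -4 d_0
          \<otimes> t^j + (1/2) c \<otimes> t^j.\<close>
        have "D 2 1 (D (-2) (tpow j) v) - D (-2) (tpow j) (D 2 1 v) + scale 4 (D 0 (tpow j) v) \<in> N"
          using v N by (intro subspace_add subspace_diff subspace_scale) auto
        also have "D 2 1 (D (-2) (tpow j) v) - D (-2) (tpow j) (D 2 1 v) + scale 4 (D 0 (tpow j) v) = scale (1/2) (Z (tpow j) v)"
          using ops.D_bracket[of 2 1 "-2" "tpow j" v] by simp
        finally have "scale 2 (scale (1/2) (Z (tpow j) v)) \<in> N" by (rule subspace_scale[OF N(1)])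
        then show ?thesis using Vir_c by (simp add: Z_tpow b ct_def)
      qed
    qed
    show "\<exists>n. dim_le n {v. D 0 1 v = scale (\<mu> + of_int k) v}" for k
    proof -
      obtain B where "finite B" "span B = weight_space (\<mu> + of_int k)" using HC unfolding Harish_Chandra_def by blast
      then show ?thesis unfolding D_weight dim_le_def by blast
    qed
    show "span (\<Union>k. {v. D 0 1 v = scale (\<mu> + of_int k) v}) = UNIV"
      unfolding D_weight
    proof -
      let ?W = "\<Union>k. weight_space (\<mu> + of_int k)"
      have "span ?W = {0} \<or> span ?W = UNIV"
      proof (rule irreducible_sub)
        show "action (basis_vector b) v \<in> span ?W" if "v \<in> span ?W" for b v
          using that
        proof (induction rule: span_induct_alt)
          case base
          show ?case by (simp add: span_zero)
        next
          case (step c x y)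
          then obtain k where "x \<in> weight_space (\<mu> + of_int k)" by blast
          from weight_act[OF this, of b] have "action (basis_vector b) x \<in> weight_space (\<mu> + of_int (k + basis_degree b))"
            by (simp add: add.assoc)
          then have "action (basis_vector b) x \<in> span ?W" by (intro span_base) blast
          then show ?case using step(2) by (simp add: action_add_right action_scale_right span_add span_scale)
        qed
      qed simp
      moreover have "span ?W \<noteq> {0}"
      proof -
        obtain v where v: "v \<in> weight_space \<mu>" "v \<noteq> 0" using \<mu> subspace_0[OF weight_subspace] by blast
        then have "v \<in> span ?W" by (intro span_base UN_I[of 0]) simp_all
        then show ?thesis using v(2) by blast
      qed
      ultimately show "span ?W = UNIV" by blast
    qed
    show "{v. D 0 1 v = scale \<mu> v} \<noteq> {0}" unfolding D_weight by (rule \<mu>)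
  qed
qed

text \<open>\<open>eps\<close> points towards the empty weights. The operators of degree 0 commute
  and preserve the extreme weight space, which yields a common eigenvector w; \<phi> collects its
  eigenvalues.\<close>

lemma extremal_isomorphic:
  assumes eps: "eps = 1 \<or> eps = -1" and top: "weight_space \<mu> \<noteq> {0}"
    and zero: "\<And>k. k \<ge> 1 \<Longrightarrow> weight_space (\<mu> + of_int (eps * k)) = {0}"
  shows "\<exists>\<phi>. linear_on_degree_zero \<phi> \<and>
    isomorphic as_lmod (Verma_simple_quotient (free_span (\<Union>i\<in>{i. eps * i > 0}. graded_part i)) \<phi>)"
proof -
  obtain v where v: "v \<in> weight_space \<mu>" "v \<noteq> 0" using top subspace_0[OF weight_subspace] by blast
  obtain B where "finite B" "span B = weight_space \<mu>" using HC unfolding Harish_Chandra_def by blast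
  then have dim: "dim_le (card B) (weight_space \<mu>)" unfolding dim_le_def by blast
  let ?T = "{action (basis_vector b) | b. basis_degree b = 0}"
  obtain w where w: "w \<in> weight_space \<mu>" "w \<noteq> 0" and eig: "\<And>t. t \<in> ?T \<Longrightarrow> \<exists>a. t w = scale a w"
  proof (rule common_eigenvector[of ?T "weight_space \<mu>", OF _ _ _ dim weight_subspace v])
    show "Vector_Spaces.linear scale scale t" if "t \<in> ?T" for t using that action_linear by blast
    show "t (s u) = s (t u)" if t: "t \<in> ?T" and s: "s \<in> ?T" for t s u
    proof -
      obtain b where b: "t = action (basis_vector b)" "basis_degree b = 0"
        using t by blast
      obtain c where c: "s = action (basis_vector c)" "basis_degree c = 0"
        using s by blast
      have "lbracket (basis_vector b) (basis_vector c) = 0"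
        using b(2) c(2) by (cases b; cases c; cases "fst b"; cases "fst c") (auto simp: lbracket_basis basis_degree_def)
      then show ?thesis using action_lbracket[of "basis_vector b" "basis_vector c" u] by (simp add: b c)
    qed
    show "t u \<in> weight_space \<mu>" if t: "t \<in> ?T" and u: "u \<in> weight_space \<mu>" for t u
    proof -
      obtain b where b: "t = action (basis_vector b)" "basis_degree b = 0" using t by blast
      show ?thesis using weight_act[OF u, of b] by (simp add: b)
    qed
  qed blast
  have eig0: "\<exists>a. action h w = scale a w" if "h \<in> graded_part 0" for h
    using that unfolding graded_part_def
  proof (induction h rule: free_vs.span_induct_alt)
    case base
    show ?case by (intro exI[of _ 0]) simp
  next
    case (step c x y)
    then have "action x \<in> ?T"
      by (auto simp: dt_def ct_def basis_degree_def intro: exI[of _ "(Vir_d 0, _)"] exI[of _ "(Vir_c, _)"])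
    then obtain a where a: "action x w = scale a w" using eig by blast
    obtain a' where a': "action y w = scale a' w" using step(2) by blast
    have "action (cscale c x + y) w = scale (c * a + a') w"
      by (simp add: action_add_left action_scale_left a a' scale_left_distrib)
    then show ?case by blast
  qed
  define \<phi> where "\<phi> h = (SOME a. action h w = scale a w)" for h
  have \<phi>: "action h w = scale (\<phi> h) w" if "h \<in> graded_part 0" for h
    unfolding \<phi>_def by (rule someI_ex[OF eig0[OF that]])
  have \<phi>_eq: "\<phi> h = a" if "h \<in> graded_part 0" "action h w = scale a w" for h a
    using \<phi>[OF that(1)] that(2) w(2) by simp
  let ?P = "free_span (\<Union>i\<in>{i. eps * i > 0}. graded_part i)"
  have lin: "linear_on_degree_zero \<phi>"
    unfolding linear_on_degree_zero_def
  proof (intro conjI ballI allI)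
    fix x y a assume x: "x \<in> graded_part 0"
    have "cscale a x \<in> graded_part 0" using x unfolding graded_part_def by (rule free_vs.span_scale)
    then show "\<phi> (cscale a x) = a * \<phi> x" by (rule \<phi>_eq) (simp add: action_scale_left \<phi>[OF x])
    assume y: "y \<in> graded_part 0"
    have "x + y \<in> graded_part 0" using x y unfolding graded_part_def by (rule free_vs.span_add)
    then show "\<phi> (x + y) = \<phi> x + \<phi> y" by (rule \<phi>_eq) (simp add: action_add_left \<phi>[OF x] \<phi>[OF y] scale_left_distrib)
  qed
  have kill_i: "action n w = 0" if n: "n \<in> graded_part i" and pos: "eps * i > 0" for n i
    using n unfolding graded_part_def
  proof (induction n rule: free_vs.span_induct_alt)
    case base
    show ?case by simp
  next
    case (step c x y)
    then obtain j where x: "x = basis_vector (Vir_d i, j)" using pos by (auto simp: dt_def split: if_splits)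
    have i: "i = eps * (eps * i)" "eps * i \<ge> 1" using eps pos by auto
    have "action x w \<in> weight_space (\<mu> + of_int i)" using weight_act[OF w(1), of "(Vir_d i, j)"] by (simp add: x basis_degree_def)
    also have "weight_space (\<mu> + of_int i) = {0}" by (subst i(1)) (rule zero[OF i(2)])
    finally show ?case using step(2) by (simp add: action_add_left action_scale_left)
  qed
  have kill: "action n w = 0" if "n \<in> ?P" for n
    using that
  proof (induction n rule: free_vs.span_induct_alt)
    case base
    show ?case by simp
  next
    case (step c x y)
    then have "action x w = 0" using kill_i by blast
    then show ?case using step(2) by (simp add: action_add_left action_scale_left)
  qed
  have "extremal_vector scale action eps ?P \<phi> w"
  proof (intro extremal_vector.intro extremal_vector_axioms.intro verma.intro)
    show "loop_vir_module scale action" by (rule loop_vir_module_axioms)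
    show "eps \<noteq> 0" using eps by auto
    show "N = {0} \<or> N = UNIV" if "subspace N" "\<And>x v. v \<in> N \<Longrightarrow> action x v \<in> N" for N
      by (rule irreducible_sub[OF that])
  qed (use lin w \<phi> kill in auto)
  then interpret extremal_vector scale action eps ?P \<phi> w .
  show ?thesis using lin isomorphic_quot by blast
qed

text \<open>Any weight \<mu> may serve as the origin of the grading, so in the case unbounded on
  both sides it is enough to know the multiplicity at index 0.\<close>

lemma weight_trichotomy:
  assumes \<mu>: "weight_space \<mu> \<noteq> {0}"
  shows "highest_weight_module as_lmod \<or> lowest_weight_module as_lmod \<or> dim (weight_space \<mu>) = 1"
proof -
  interpret I: irreducible_ops scale D Z \<mu> by (rule irreducible_ops_at[OF \<mu>])
  have wt: "I.wt k = weight_space (\<mu> + of_int k)" for k by (simp add: I.wt_def D_weight)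
  have pos: "loop_vir_pos = free_span (\<Union>i\<in>{i. 1 * i > 0}. graded_part i)"
    unfolding loop_vir_pos_def greaterThan_def by simp
  have neg: "loop_vir_neg = free_span (\<Union>i\<in>{i. (-1) * i > 0}. graded_part i)"
    unfolding loop_vir_neg_def lessThan_def by simp
  consider "\<not> I.unbounded_above" | "\<not> I.unbounded_below" | "I.unbounded_above" "I.unbounded_below" by blast
  then show ?thesis
  proof cases
    case 1
    then obtain K where K: "\<And>k. k \<ge> K \<Longrightarrow> \<not> I.wt k \<noteq> {0}" unfolding I.unbounded_above_def by blast
    have "\<exists>k. I.wt k \<noteq> {0} \<and> (\<forall>j\<ge>1. \<not> I.wt (k + j) \<noteq> {0})"
      by (rule int_greatest[of _ K]) (use \<mu> K in \<open>simp_all add: wt[of 0]\<close>)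
    then obtain k where k: "I.wt k \<noteq> {0}" "\<And>j. j \<ge> 1 \<Longrightarrow> I.wt (k + j) = {0}" by auto
    have "highest_weight_module as_lmod"
      unfolding highest_weight_module_def pos
      by (intro conjI irr extremal_isomorphic[of 1 "\<mu> + of_int k"]) (use k in \<open>simp_all add: wt add.assoc\<close>)
    then show ?thesis by simp
  next
    case 2
    then obtain K where K: "\<And>k. k \<le> K \<Longrightarrow> \<not> I.wt k \<noteq> {0}" unfolding I.unbounded_below_def by blast
    have "\<exists>k. I.wt (- k) \<noteq> {0} \<and> (\<forall>j\<ge>1. \<not> I.wt (- (k + j)) \<noteq> {0})"
      by (rule int_greatest[of _ "- K"]) (use \<mu> K in \<open>simp_all add: wt[of 0]\<close>)
    then obtain k where k: "I.wt (- k) \<noteq> {0}" "\<And>j. j \<ge> 1 \<Longrightarrow> I.wt (- (k + j)) = {0}" by auto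
    have "lowest_weight_module as_lmod"
      unfolding lowest_weight_module_def neg
      by (intro conjI irr extremal_isomorphic[of "-1" "\<mu> + of_int (- k)"]) (use k in \<open>simp_all add: wt algebra_simps\<close>)
    then show ?thesis by simp
  next
    case 3
    have d: "dim_le 1 (weight_space \<mu>)" using I.wt_dim_le_1[OF 3, of 0] by (simp add: wt)
    obtain B where B: "B \<subseteq> weight_space \<mu>" "independent B" "weight_space \<mu> \<subseteq> span B" "finite B" "card B \<le> 1"
      by (rule dim_le_basis[OF d])
    have "B \<noteq> {}" using B(3) \<mu> subspace_0[OF weight_subspace] by auto
    then have "card B = 1" using B(4,5) by (simp add: le_Suc_eq)
    then show ?thesis using basis_card_eq_dim[OF B(1,3,2)] by simp
  qed
qed

lemma main: "highest_weight_module as_lmod \<or> lowest_weight_module as_lmod \<or> intermediate_series"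
proof (cases "highest_weight_module as_lmod \<or> lowest_weight_module as_lmod")
  case False
  \<comment> \<open>Irreducibility leaves only N = N' = V to exclude, and then N \<inter> N' would
    not be 0.\<close>
  have "indecomposable_module as_lmod"
    using irr unfolding indecomposable_module_def irreducible_module_def by (metis inf.idem)
  moreover have "weight_module" using HC by (simp add: Harish_Chandra_def)
  moreover have "dim (weight_space \<mu>) = 1" if "weight_space \<mu> \<noteq> {0}" for \<mu>
    using weight_trichotomy[OF that] False by blast
  ultimately show ?thesis unfolding intermediate_series_def by blast
qed blast

end

theorem theorem4p5:
  fixes scale :: "complex \<Rightarrow> 'v::ab_group_add \<Rightarrow> 'v"
    and action :: "loop_vir \<Rightarrow> 'v \<Rightarrow> 'v"
  assumes "loop_vir_module scale action"
    and "irreducible_module (loop_vir_module.as_lmod scale action)"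
    and "loop_vir_module.Harish_Chandra scale action"
  shows "highest_weight_module (loop_vir_module.as_lmod scale action) \<or>
         lowest_weight_module (loop_vir_module.as_lmod scale action) \<or>
         loop_vir_module.intermediate_series scale action"
proof -
  interpret irreducible_Harish_Chandra scale action
    by (intro irreducible_Harish_Chandra.intro irreducible_Harish_Chandra_axioms.intro assms)
  show ?thesis by (rule main)
qed

end
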